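(* Let $n \in \mathbb{N}$, $n \geq 3$, let $v \in L^{\infty}(\mathbb{R}^n)$ be a.e. real-valued with $|v(x)| \leq C \langle x \rangle^{-4}$ for a.e. $x \in \mathbb{R}^n$ and some fixed $C \in (0,\infty)$, and let $h = -\Delta + v$ with $\operatorname{dom}(h) = W^{2,2}(\mathbb{R}^n)$ be the associated self-adjoint Schrödinger operator in $L^2(\mathbb{R}^n)$. (i) If $n = 3,4$, there are precisely four possible cases: Case (I): $0$ is regular for $h$. Case (II): $0$ is a (necessarily simple) resonance of $h$. In this case, the resonance function $\psi$ satisfies $$\psi \in L^q(\mathbb{R}^3), \quad q \in (3,\infty) \cup \{\infty\} \quad (\text{if } n=3),$$ $$\psi \in L^q(\mathbb{R}^4), \quad q \in (2,\infty) \cup \{\infty\} \quad (\text{if } n=4),$$ $$\nabla \psi \in \big[L^2(\mathbb{R}^n)\big]^n, \quad \Delta \psi \in L^q(\mathbb{R}^n), \; q \in [2,\infty) \cup \{\infty\}, \; n=3,4,$$ $$\psi \notin L^2(\mathbb{R}^n), \quad n = 3,4.$$ Case (III): $0$ is a (possibly degenerate) eigenvalue of $h$. In this case, the corresponding eigenfunctions $\psi \in \operatorname{dom}(h) = W^{2,2}(\mathbb{R}^n)$ of $h\psi = 0$ also satisfy $$\psi, \Delta\psi \in L^q(\mathbb{R}^n), \quad q \in [2,\infty) \cup \{\infty\}, \; n=3,4,$$ $$\nabla \psi \in \big[L^2(\mathbb{R}^n)\big]^n, \; n = 3,4.$$ Case (IV): A possible mixture of Cases (II) and (III) (i.e.,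 $0$ is both a resonance and an eigenvalue of $h$). (ii) If $n \geq 5$, there are precisely two possible cases: Case (I): $0$ is regular for $h$. Case (II): $0$ is a (possibly degenerate) eigenvalue of $h$. In this case, the corresponding eigenfunctions $\psi \in \operatorname{dom}(h) = W^{2,2}(\mathbb{R}^n)$ of $h \psi = 0$ also satisfy $$\psi, \, \Delta\psi \in L^q(\mathbb{R}^n), \quad q \in \begin{cases} (n/(n-2),\infty) \cup \{\infty\}, & 5 \leq n \leq 7, \\ (2n/(n+4), 2n/(n-4)), & n \geq 8, \end{cases}$$ $$\nabla \psi \in \big[L^q(\mathbb{R}^n)\big]^n, \quad q \in \begin{cases} (5/3,\infty), & n=5, \\ (3/2,\infty), & n = 6, \\ (7/5,14), & n=7, \\ (2n/(n+4), 2n/(n-6)), & n \geq 8. \end{cases}$$ In particular, there are no zero-energy resonances of $h$ in dimension $n \geq 5$. (iii) The point $0$ is regular for $h$ if and only if $$\ker\big(\big[I_{L^2(\mathbb{R}^n)} + \overline{v_2 (h_0 + 0 I_{L^2(\mathbb{R}^n)})^{-1} v_1}\big]\big) = \{0\}.$$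
   Context: Notation: $\langle x \rangle = (1+|x|^2)^{1/2}$; $h_0 = -\Delta$ with $\operatorname{dom}(h_0) = W^{2,2}(\mathbb{R}^n)$ in $L^2(\mathbb{R}^n)$. Factorize $v = v_1 v_2$ with $v_1 = |v|^{1/2}$, $v_2 = u_v |v|^{1/2}$, $u_v = \operatorname{sgn}(v)$, where $\operatorname{sgn}(v(x)) = 1$ if $v(x) \geq 0$ and $-1$ if $v(x) < 0$. For $n \geq 3$, $(h_0 + 0 I_{L^2(\mathbb{R}^n)})^{-1}$ denotes the integral operator with kernel $g_0(0;x,y) = [(n-2)\omega_{n-1}]^{-1} |x-y|^{2-n}$, $x \neq y$, where $\omega_{n-1} = 2\pi^{n/2}/\Gamma(n/2)$ is the area of the unit sphere $S^{n-1}$. $\overline{v_2 (h_0 + 0 I_{L^2(\mathbb{R}^n)})^{-1} v_1}$ denotes the closure, i.e., the bounded operator in $L^2(\mathbb{R}^n)$ with integral kernel $v_2(x) g_0(0;x,y) v_1(y)$. Definitions. (i) The point $0$ is called a (zero-energy) eigenvalue of $h$ if $h\psi = 0$ has a nonzero distributional solution $\psi \in \operatorname{dom}(h) = W^{2,2}(\mathbb{R}^n)$ (equivalently, $\ker(h) \supsetneqq \{0\}$). (ii) The point $0$ is called a zero-energy (or threshold) resonance of $h$ if $\ker\big(\big[I_{L^2(\mathbb{R}^n)} + \overline{v_2 (h_0 + 0 I)^{-1} v_1}\big]\big) \supsetneqq \{0\}$ and if there exists $0 \neq \phi$ in this kernel such that $\psi$ defined by $$\psi(x) = -\big((h_0 +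 0 I)^{-1} v_1 \phi\big)(x) = -[(n-2)\omega_{n-1}]^{-1} \int_{\mathbb{R}^n} d^n y \, |x-y|^{2-n} v_1(y)\phi(y)$$ for a.e. $x \in \mathbb{R}^n$, is a distributional solution of $h\psi = 0$ (i.e., $-\Delta\psi + v\psi = 0$ in the sense of distributions) satisfying $\psi \notin L^2(\mathbb{R}^n)$. Such a $\psi$ is called a resonance function. (iii) $0$ is called regular for $h$ if it is neither a zero-energy eigenvalue nor a zero-energy resonance of $h$. In the case list, Case (II) of (i) means that $0$ is a resonance but not an eigenvalue, and Case (III) of (i) that $0$ is an eigenvalue but not a resonance. "Necessarily simple" means that in Case (II) there is at most one resonance function (up to constant multiples). *)

theory Defs
  imports "HOL-Analysis.Analysis"
begin

text \<open>
  Elements of the Lebesgue and Sobolev spaces are represented by functions on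
  \<open>real ^ 'n\<close>, so \<open>n = CARD('n)\<close>; equality in these spaces is equality almost everywhere.
\<close>

subsection \<open>Lebesgue spaces\<close>

definition L_space :: "ereal \<Rightarrow> (real ^ 'n \<Rightarrow> complex) set" where
  "L_space q = {f \<in> borel_measurable lebesgue.
     if q = \<infinity> then \<exists>B. AE x in lebesgue. norm (f x) \<le> B
     else integrable lebesgue (\<lambda>x. norm (f x) powr real_of_ereal q)}"

text \<open>All representatives of the zero vector of \<open>L\<^sup>2\<close>.\<close>

definition L2_zero :: "(real ^ 'n \<Rightarrow> complex) set" where
  "L2_zero = {f \<in> L_space 2. AE x in lebesgue. f x = 0}"

definition locally_integrable :: "(real ^ 'n \<Rightarrow> complex) \<Rightarrow> bool" where
  "locally_integrable f \<longleftrightarrow> (\<forall>K. compact K \<longrightarrow> set_integrable lebesgue K f)"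


subsection \<open>Test functions and weak derivatives\<close>

definition partial :: "'n::finite \<Rightarrow> (real ^ 'n \<Rightarrow> complex) \<Rightarrow> real ^ 'n \<Rightarrow> complex" where
  "partial i f x = frechet_derivative f (at x) (axis i 1)"

text \<open>A multi-index is given as the list of the coordinate directions of differentiation.\<close>

definition iter_partial :: "'n::finite list \<Rightarrow> (real ^ 'n \<Rightarrow> complex) \<Rightarrow> real ^ 'n \<Rightarrow> complex" where
  "iter_partial is f = foldr partial is f"

text \<open>
  Smoothness: every iterated partial derivative is (Frechet) differentiable, hence exists and
  is continuous.
\<close>

definition test_function :: "(real ^ 'n \<Rightarrow> complex) \<Rightarrow> bool" where
  "test_function \<eta> \<longleftrightarrow>
     (\<forall>is x. iter_partial is \<eta> differentiable (at x)) \<and> compact (closure {x. \<eta> x \<noteq> 0})"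

definition laplacian :: "(real ^ 'n \<Rightarrow> complex) \<Rightarrow> real ^ 'n \<Rightarrow> complex" where
  "laplacian \<eta> x = (\<Sum>i\<in>UNIV. iter_partial [i, i] \<eta> x)"

definition weak_derivative ::
  "'n::finite list \<Rightarrow> (real ^ 'n \<Rightarrow> complex) \<Rightarrow> (real ^ 'n \<Rightarrow> complex) \<Rightarrow> bool" where
  "weak_derivative is \<psi> g \<longleftrightarrow> locally_integrable \<psi> \<and> locally_integrable g \<and>
     (\<forall>\<eta>. test_function \<eta> \<longrightarrow>
        (LINT x|lebesgue. \<psi> x * iter_partial is \<eta> x)
          = (- 1) ^ length is * (LINT x|lebesgue. g x * \<eta> x))"

definition weak_laplacian :: "(real ^ 'n \<Rightarrow> complex) \<Rightarrow> (real ^ 'n \<Rightarrow> complex) \<Rightarrow> bool" where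
  "weak_laplacian \<psi> g \<longleftrightarrow> locally_integrable \<psi> \<and> locally_integrable g \<and>
     (\<forall>\<eta>. test_function \<eta> \<longrightarrow>
        (LINT x|lebesgue. \<psi> x * laplacian \<eta> x) = (LINT x|lebesgue. g x * \<eta> x))"

definition gradient_in_L :: "ereal \<Rightarrow> (real ^ 'n \<Rightarrow> complex) \<Rightarrow> bool" where
  "gradient_in_L q \<psi> \<longleftrightarrow> (\<forall>i. \<exists>g\<in>L_space q. weak_derivative [i] \<psi> g)"

definition laplacian_in_L :: "ereal \<Rightarrow> (real ^ 'n \<Rightarrow> complex) \<Rightarrow> bool" where
  "laplacian_in_L q \<psi> \<longleftrightarrow> (\<exists>g\<in>L_space q. weak_laplacian \<psi> g)"

definition sobolev_space :: "nat \<Rightarrow> ereal \<Rightarrow> (real ^ 'n \<Rightarrow> complex) set" where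
  "sobolev_space k p =
     {\<psi> \<in> L_space p. \<forall>is. length is \<le> k \<longrightarrow> (\<exists>g\<in>L_space p. weak_derivative is \<psi> g)}"


subsection \<open>The potential and the zero-energy integral operators\<close>

definition japanese_bracket :: "real ^ 'n \<Rightarrow> real" where
  "japanese_bracket x = sqrt (1 + (norm x)\<^sup>2)"

text \<open>
  The potential is complex-valued as a function and real only almost everywhere; the value chosen
  for the sign at the null set of points where it is not real is immaterial.
\<close>

definition sgn_pot :: "(real ^ 'n \<Rightarrow> complex) \<Rightarrow> real ^ 'n \<Rightarrow> complex" where
  "sgn_pot v x = (if v x \<in> \<real>\<^sub>\<ge>\<^sub>0 then 1 else - 1)"

definition factor1 :: "(real ^ 'n \<Rightarrow> complex) \<Rightarrow> real ^ 'n \<Rightarrow> complex" where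
  "factor1 v x = complex_of_real (sqrt (norm (v x)))"

definition factor2 :: "(real ^ 'n \<Rightarrow> complex) \<Rightarrow> real ^ 'n \<Rightarrow> complex" where
  "factor2 v x = sgn_pot v x * complex_of_real (sqrt (norm (v x)))"

text \<open>The area of the unit sphere \<open>S\<^bsup>n-1\<^esup>\<close> in \<open>\<real>\<^sup>n\<close> (with \<open>n\<close>, not \<open>n - 1\<close>, as argument).\<close>

definition unit_sphere_area :: "nat \<Rightarrow> real" where
  "unit_sphere_area n = 2 * pi powr (real n / 2) / Gamma (real n / 2)"

definition green0 :: "real ^ 'n \<Rightarrow> real ^ 'n \<Rightarrow> real" where
  "green0 x y = norm (x - y) powr (2 - real CARD('n))
     / ((real CARD('n) - 2) * unit_sphere_area CARD('n))"

definition zero_resolvent :: "(real ^ 'n \<Rightarrow> complex) \<Rightarrow> real ^ 'n \<Rightarrow> complex" where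
  "zero_resolvent f x = (LINT y|lebesgue. complex_of_real (green0 x y) * f y)"

text \<open>
  The bounded integral operator with kernel \<open>v\<^sub>2(x) g\<^sub>0(0;x,y) v\<^sub>1(y)\<close>.  If
  \<open>v\<close> decays like \<open>\<langle>x\<rangle>\<^bsup>-4\<^esup>\<close> and \<open>\<phi>\<close> is in \<open>L\<^sup>2\<close>, then the integral
  converges absolutely for almost every \<open>x\<close>.
\<close>

definition sandwiched_resolvent ::
  "(real ^ 'n \<Rightarrow> complex) \<Rightarrow> (real ^ 'n \<Rightarrow> complex) \<Rightarrow> real ^ 'n \<Rightarrow> complex" where
  "sandwiched_resolvent v \<phi> x = factor2 v x * zero_resolvent (\<lambda>y. factor1 v y * \<phi> y) x"

definition ker_sandwiched :: "(real ^ 'n \<Rightarrow> complex) \<Rightarrow> (real ^ 'n \<Rightarrow> complex) set" where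
  "ker_sandwiched v =
     {\<phi> \<in> L_space 2. AE x in lebesgue. \<phi> x + sandwiched_resolvent v \<phi> x = 0}"


subsection \<open>Threshold behaviour of the Schroedinger operator\<close>

definition distributional_solution ::
  "(real ^ 'n \<Rightarrow> complex) \<Rightarrow> (real ^ 'n \<Rightarrow> complex) \<Rightarrow> bool" where
  "distributional_solution v \<psi> \<longleftrightarrow>
     locally_integrable \<psi> \<and> locally_integrable (\<lambda>x. v x * \<psi> x) \<and>
     (\<forall>\<eta>. test_function \<eta> \<longrightarrow>
        - (LINT x|lebesgue. \<psi> x * laplacian \<eta> x) + (LINT x|lebesgue. v x * \<psi> x * \<eta> x) = 0)"

definition schroedinger_domain :: "(real ^ 'n \<Rightarrow> complex) set" where
  "schroedinger_domain = sobolev_space 2 2"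

definition zero_eigenfunction ::
  "(real ^ 'n \<Rightarrow> complex) \<Rightarrow> (real ^ 'n \<Rightarrow> complex) \<Rightarrow> bool" where
  "zero_eigenfunction v \<psi> \<longleftrightarrow> \<psi> \<in> schroedinger_domain \<and> \<not> (AE x in lebesgue. \<psi> x = 0) \<and>
     distributional_solution v \<psi>"

definition zero_eigenvalue :: "(real ^ 'n \<Rightarrow> complex) \<Rightarrow> bool" where
  "zero_eigenvalue v \<longleftrightarrow> (\<exists>\<psi>. zero_eigenfunction v \<psi>)"

definition resonance_function ::
  "(real ^ 'n \<Rightarrow> complex) \<Rightarrow> (real ^ 'n \<Rightarrow> complex) \<Rightarrow> bool" where
  "resonance_function v \<psi> \<longleftrightarrow>
     (\<exists>\<phi> \<in> ker_sandwiched v - L2_zero.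
        AE x in lebesgue. \<psi> x = - zero_resolvent (\<lambda>y. factor1 v y * \<phi> y) x) \<and>
     distributional_solution v \<psi> \<and> \<psi> \<notin> L_space 2"

definition zero_resonance :: "(real ^ 'n \<Rightarrow> complex) \<Rightarrow> bool" where
  "zero_resonance v \<longleftrightarrow> L2_zero \<subset> ker_sandwiched v \<and> (\<exists>\<psi>. resonance_function v \<psi>)"

definition zero_regular :: "(real ^ 'n \<Rightarrow> complex) \<Rightarrow> bool" where
  "zero_regular v \<longleftrightarrow> \<not> zero_eigenvalue v \<and> \<not> zero_resonance v"

definition exactly_one :: "bool list \<Rightarrow> bool" where
  "exactly_one Ps \<longleftrightarrow> length (filter (\<lambda>P. P) Ps) = 1"

end

theory Submission
  imports Defs
begin

text \<open>
  Both eigenfunctions and resonance functions at zero energy turn out to be exactly the solutions of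
  \<open>\<psi> = - G (v \<psi>)\<close> with \<open>\<bar>v\<bar>\<^bsup>1/2\<^esup> \<psi> \<in> L\<^sup>2\<close>, where \<open>G\<close> is the Newtonian potential operator. For an
  \<open>L\<^sup>2\<close> eigenfunction this follows by testing the equation with cut-off Newtonian potentials of test functions.
  A contraction argument near the diagonal of the kernel makes \<open>\<psi>\<close> bounded, and since \<open>v\<close> decays like
  \<open>\<langle>x\<rangle>\<^bsup>-4\<^esup>\<close>, iterating the equation gives \<open>\<psi> = O(\<langle>x\<rangle>\<^bsup>2-n\<^esup>)\<close> and \<open>\<nabla> \<psi> = O(\<langle>x\<rangle>\<^bsup>1-n\<^esup>)\<close>; all
  integrability claims are read off from these two bounds. In particular \<open>\<psi> \<in> L\<^sup>2\<close> if \<open>n \<ge> 5\<close>, and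
  for \<open>n = 3, 4\<close> it is in \<open>L\<^sup>2\<close> as soon as \<open>\<integral> v \<psi> = 0\<close>, a single linear condition, whence the simplicity of
  a resonance. Solutions in \<open>L\<^sup>2\<close> lie in \<open>W\<^bsup>2,2\<^esup>\<close> by the energy identity for the Hessian of a Newtonian potential.
\<close>

subsection \<open>Radial integrals and weights\<close>

text \<open>A priori only |v|^(1/2) psi in L^2 is known, and for n >= 4 the kernel |z|^(2-n) is not
  locally square integrable, so the Cauchy-Schwarz inequality alone cannot give boundedness; hence
  the part of the kernel near the diagonal is treated separately, by truncation and absorption.
  Decay is measured in natural powers of \<open>wt x\<close> = 1/<x>: exponents add under products,
  larger ones are stronger, and a strict inequality between them leaves a whole unit of room. One
  pass through the equation improves the exponent of psi by one: v contributes four powers, G costs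
  two, and one is given up to the strictness of the convergence condition. The second obstacle is
  that the definitions speak of functions modulo null sets of \<open>lebesgue\<close>, whereas
  translations, scalings and Fubini are used for \<open>lborel\<close>. Every function is therefore
  replaced by a Borel one, and every solution by the right-hand side of its own integral equation,
  which then holds at each point.\<close>

lemma nn_integral_lborel_reflect:
  fixes h :: "'a::euclidean_space \<Rightarrow> ennreal"
  assumes [measurable]: "h \<in> borel_measurable borel"
  shows "(\<integral>\<^sup>+y. h (x - y) \<partial>lborel) = (\<integral>\<^sup>+z. h z \<partial>lborel)"
proof -
  have "(\<integral>\<^sup>+z. h z \<partial>lborel)
      = (\<integral>\<^sup>+z. h z \<partial>density (distr lborel borel (\<lambda>y. x + (-1) *\<^sub>R y)) (\<lambda>_. ennreal (\<bar>-1\<bar> ^ DIM('a))))"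
    by (subst lborel_affine[of "-1" x]) simp_all
  also have "\<dots> = (\<integral>\<^sup>+z. h z \<partial>distr lborel borel (\<lambda>y. x + (-1) *\<^sub>R y))"
    by (subst nn_integral_density) simp_all
  also have "\<dots> = (\<integral>\<^sup>+y. h (x + (-1) *\<^sub>R y) \<partial>lborel)"
    by (subst nn_integral_distr) simp_all
  finally show ?thesis by simp
qed

lemma lebesgue_integral_lborel_affine:
  fixes h :: "'a::euclidean_space \<Rightarrow> 'b::{banach, second_countable_topology}"
  assumes [measurable]: "h \<in> borel_measurable borel" and "c \<noteq> 0"
  shows "(LINT z|lborel. h z) = \<bar>c\<bar> ^ DIM('a) *\<^sub>R (LINT y|lborel. h (x + c *\<^sub>R y))"
proof -
  have "(LINT z|lborel. h z)
      = (LINT z|density (distr lborel borel (\<lambda>y. x + c *\<^sub>R y)) (\<lambda>_. ennreal (\<bar>c\<bar> ^ DIM('a))). h z)"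
    by (subst lborel_affine[OF \<open>c \<noteq> 0\<close>, of x]) simp_all
  also have "\<dots> = (LINT z|distr lborel borel (\<lambda>y. x + c *\<^sub>R y). \<bar>c\<bar> ^ DIM('a) *\<^sub>R h z)"
    by (subst integral_density) simp_all
  also have "\<dots> = (LINT y|lborel. \<bar>c\<bar> ^ DIM('a) *\<^sub>R h (x + c *\<^sub>R y))"
    by (subst integral_distr) simp_all
  finally show ?thesis by simp
qed

lemma lebesgue_integral_lborel_shift:
  fixes h :: "'a::euclidean_space \<Rightarrow> 'b::{banach, second_countable_topology}"
  assumes [measurable]: "h \<in> borel_measurable borel"
  shows "(LINT y|lborel. h (x + y)) = (LINT z|lborel. h z)"
  using lebesgue_integral_lborel_affine[OF assms, of 1 x] by simp

lemma integrable_lborel_shift: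
  fixes h :: "'a::euclidean_space \<Rightarrow> 'b::{banach, second_countable_topology}"
  assumes "integrable lborel h"
  shows "integrable lborel (\<lambda>y. h (x + y))"
proof -
  have [measurable]: "h \<in> borel_measurable borel" using assms by auto
  have "integrable (distr lborel borel (\<lambda>y. x + y)) h"
    using assms by (simp add: lborel_distr_plus)
  then show ?thesis by (subst (asm) integrable_distr_eq) simp_all
qed

text \<open>Polar coordinates without a surface measure: the image of Lebesgue measure under the
  norm gives {..a} the volume of a ball, and the density on the right is the derivative of V r^n.
  Agreement on these half-lines, an intersection-stable generator, is enough.\<close>

lemma nn_integral_radial:
  fixes h :: "real \<Rightarrow> ennreal"
  assumes [measurable]: "h \<in> borel_measurable borel"
  shows "(\<integral>\<^sup>+x. h (norm (x::'a::euclidean_space)) \<partial>lborel)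
    = (\<integral>\<^sup>+r. ennreal (DIM('a) * unit_ball_vol DIM('a) * r ^ (DIM('a) - 1)) * indicator {0..} r * h r \<partial>lborel)"
proof -
  let ?n = "DIM('a)" let ?V = "unit_ball_vol ?n"
  let ?d = "\<lambda>r. ennreal (?n * ?V * r ^ (?n - 1)) * indicator {0..} r"
  have "distr lborel borel (norm :: 'a \<Rightarrow> real) = density lborel ?d"
  proof (rule measure_eqI_generator_eq[where E="range atMost" and \<Omega>=UNIV and A="\<lambda>i. {..real i}"])
    show "Int_stable (range (atMost :: real \<Rightarrow> _))"
      by (auto simp: Int_stable_def intro!: image_eqI[of _ _ "min _ _"])
    show "sets (distr lborel borel (norm :: 'a \<Rightarrow> real)) = sigma_sets UNIV (range atMost)"
      by (simp add: borel_eq_atMost)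
    show "sets (density lborel ?d) = sigma_sets UNIV (range atMost)"
      by (simp add: borel_eq_atMost)
    have L: "emeasure (distr lborel borel (norm :: 'a \<Rightarrow> real)) {..a} = ennreal (if a \<ge> 0 then ?V * a ^ ?n else 0)" for a
    proof -
      have "emeasure (distr lborel borel (norm :: 'a \<Rightarrow> real)) {..a} = emeasure lborel (cball (0::'a) a)"
        by (subst emeasure_distr) (auto intro!: arg_cong[of _ _ "emeasure _"])
      then show ?thesis by (auto simp: emeasure_cball not_le)
    qed
    show "emeasure (distr lborel borel (norm :: 'a \<Rightarrow> real)) X = emeasure (density lborel ?d) X" if "X \<in> range atMost" for X
    proof -
      from that obtain a where X: "X = {..a}" by auto
      have "emeasure (density lborel ?d) X = (\<integral>\<^sup>+r. ?d r * indicator {..a} r \<partial>lborel)"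
        unfolding X by (subst emeasure_density) auto
      also have "\<dots> = (\<integral>\<^sup>+r. ennreal (?n * ?V * r ^ (?n - 1)) * indicator {0..a} r \<partial>lborel)"
        by (intro nn_integral_cong) (auto split: split_indicator)
      also have "\<dots> = ennreal (if a \<ge> 0 then ?V * a ^ ?n else 0)"
      proof (cases "a \<ge> 0")
        case True
        have "(\<integral>\<^sup>+r. ennreal (?n * ?V * r ^ (?n - 1)) * indicator {0..a} r \<partial>lborel) = ennreal (?V * a ^ ?n - ?V * 0 ^ ?n)"
          using True by (intro nn_integral_FTC_Icc) (auto intro!: derivative_eq_intros)
        then show ?thesis using True by simp
      next
        case False
        then have "{0..a} = {}" by auto
        with False show ?thesis by simp
      qed
      finally show ?thesis unfolding X L by (rule sym)
    qed
    show "range (\<lambda>i. {..real i}) \<subseteq> range atMost" by auto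
    show "(\<Union>i. {..real i}) = UNIV" by (auto intro: real_arch_simple)
    show "emeasure (distr lborel borel (norm :: 'a \<Rightarrow> real)) {..real i} \<noteq> \<infinity>" for i
      unfolding L by simp
  qed simp
  then have "(\<integral>\<^sup>+r. h r \<partial>distr lborel borel (norm :: 'a \<Rightarrow> real)) = (\<integral>\<^sup>+r. h r \<partial>density lborel ?d)"
    by simp
  then show ?thesis
    by (subst (asm) nn_integral_distr, simp, simp, subst (asm) nn_integral_density, simp, simp, simp)
qed

section \<open>The weight 1/<x>, the singularity 1/|z|, and integrals of their products\<close>

definition wt :: "real ^ 'n \<Rightarrow> real" where
  "wt x = 1 / japanese_bracket x"

text \<open>On the diagonal both \<open>inv_norm\<close> (division by zero) and the \<open>powr\<close> in \<open>green0\<close> give \<open>0\<close>.\<close>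

definition inv_norm :: "real ^ 'n \<Rightarrow> real" where
  "inv_norm z = 1 / norm z"

lemma japanese_bracket_ge_1: "1 \<le> japanese_bracket x"
  by (simp add: japanese_bracket_def)

lemma norm_le_japanese_bracket: "norm x \<le> japanese_bracket x"
  by (simp add: japanese_bracket_def real_le_rsqrt)

lemma japanese_bracket_le: "japanese_bracket x \<le> 1 + norm x"
  unfolding japanese_bracket_def by (rule real_le_lsqrt) (auto simp: power2_eq_square algebra_simps)

lemma wt_pos [simp]: "0 < wt x"
  using japanese_bracket_ge_1[of x] by (simp add: wt_def)

lemma wt_nonneg [simp]: "0 \<le> wt x" and wt_neq_0 [simp]: "wt x \<noteq> 0"
  using wt_pos[of x] by linarith+

lemma wt_le_1 [simp]: "wt x \<le> 1"
  using japanese_bracket_ge_1[of x] by (simp add: wt_def)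

lemma inv_norm_nonneg [simp]: "0 \<le> inv_norm x"
  by (simp add: inv_norm_def)

lemma continuous_on_wt [continuous_intros]: "continuous_on S wt"
  unfolding wt_def japanese_bracket_def
  by (intro continuous_intros) (auto simp: add_nonneg_eq_0_iff)

lemma borel_measurable_wt [measurable]: "wt \<in> borel_measurable borel"
  by (intro borel_measurable_continuous_onI continuous_intros)

lemma borel_measurable_inv_norm [measurable]: "inv_norm \<in> borel_measurable borel"
  unfolding inv_norm_def by measurable

lemma inv_norm_commute: "inv_norm (x - y) = inv_norm (y - x)"
  by (simp add: inv_norm_def norm_minus_commute)

lemma japanese_bracket_triangle: "japanese_bracket (x + z) \<le> japanese_bracket x + norm z"
proof -
  have "(1 + norm z ^ 2 + norm x ^ 2 + 2 * norm x * norm z) \<le> (japanese_bracket x + norm z)\<^sup>2"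
    using mult_right_mono[OF norm_le_japanese_bracket[of x], of "norm z"]
    by (simp add: power2_sum japanese_bracket_def add_nonneg_nonneg)
  moreover have "norm (x + z) ^ 2 \<le> (norm x + norm z) ^ 2"
    by (intro power_mono norm_triangle_ineq) auto
  ultimately show ?thesis
    using japanese_bracket_ge_1[of x]
    by (subst japanese_bracket_def, intro real_le_lsqrt) (auto simp: power2_sum)
qed

text \<open>A Peetre-type inequality: weighted bounds survive bounded translations. It is used at
  the intermediate points that mean value arguments produce.\<close>

lemma wt_shift: "wt (x + z) \<le> (1 + norm z) * wt x"
proof -
  have "japanese_bracket x \<le> japanese_bracket (x + z) + norm z"
    using japanese_bracket_triangle[of "x + z" "- z"] by simp
  also have "\<dots> \<le> (1 + norm z) * japanese_bracket (x + z)"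
    using mult_left_mono[OF japanese_bracket_ge_1[of "x + z"], of "norm z"]
    by (simp add: algebra_simps)
  finally show ?thesis
    using japanese_bracket_ge_1[of x] japanese_bracket_ge_1[of "x + z"]
    by (simp add: wt_def field_simps)
qed

lemma wt_power_antimono: "j \<le> k \<Longrightarrow> wt x ^ k \<le> wt x ^ j"
  by (simp add: power_decreasing)

text \<open>In polar coordinates the integrand is compared with (1 + r)^(-1-\<delta>), \<delta> = s
  - n, which has an explicit antiderivative. The factor 2^s in the constant comes from sqrt (1 +
  r^2) >= (1 + r) / 2.\<close>

lemma wt_powr_integrable:
  fixes s :: real
  assumes s: "s > CARD('n)"
  shows "integrable lborel (\<lambda>x::real^'n. wt x powr s)"
proof (rule integrableI_bounded)
  let ?n = "CARD('n)" let ?V = "unit_ball_vol ?n"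
  define \<delta> where "\<delta> = s - ?n"
  have \<delta>: "\<delta> > 0" and n: "?n \<ge> 1" using s by (auto simp: \<delta>_def Suc_le_eq)
  define c where "c = ?n * ?V * 2 powr s"
  have c0: "c \<ge> 0" by (auto simp: c_def intro!: mult_nonneg_nonneg)
  have pt: "?n * ?V * r ^ (?n - 1) * (1 / sqrt (1 + r\<^sup>2)) powr s \<le> c * (1 + r) powr (- \<delta> - 1)" if "r \<ge> 0" for r
  proof -
    have a: "(1 + r) / 2 \<le> sqrt (1 + r\<^sup>2)"
      using that by (intro real_le_rsqrt) (auto simp: power2_eq_square field_simps, sos)
    have "1 / sqrt (1 + r\<^sup>2) \<le> 1 / ((1 + r) / 2)"
      using that a by (intro divide_left_mono) (auto intro!: mult_pos_pos add_pos_nonneg)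
    then have "(1 / sqrt (1 + r\<^sup>2)) powr s \<le> (2 * (1 / (1 + r))) powr s"
      using s by (intro powr_mono2) auto
    also have "\<dots> = 2 powr s * (1 + r) powr (- s)"
      using that by (simp add: powr_mult powr_minus powr_divide inverse_eq_divide)
    finally have b: "(1 / sqrt (1 + r\<^sup>2)) powr s \<le> 2 powr s * (1 + r) powr (- s)" .
    have "r ^ (?n - 1) \<le> (1 + r) ^ (?n - 1)" using that by (intro power_mono) auto
    also have "\<dots> = (1 + r) powr real (?n - 1)" using that by (intro powr_realpow[symmetric]) auto
    finally have "r ^ (?n - 1) * (1 / sqrt (1 + r\<^sup>2)) powr s \<le> (1 + r) powr real (?n - 1) * (2 powr s * (1 + r) powr (- s))"
      using that by (intro mult_mono b) auto
    also have "\<dots> = 2 powr s * (1 + r) powr (- \<delta> - 1)"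
      using n by (simp add: powr_add[symmetric] \<delta>_def of_nat_diff algebra_simps)
    finally show ?thesis by (simp add: c_def mult.assoc mult_left_mono)
  qed
  have "(\<integral>\<^sup>+x. ennreal (norm (wt (x::real^'n) powr s)) \<partial>lborel)
      = (\<integral>\<^sup>+x. (\<lambda>r. ennreal ((1 / sqrt (1 + r\<^sup>2)) powr s)) (norm (x::real^'n)) \<partial>lborel)"
    by (simp add: wt_def japanese_bracket_def)
  also have "\<dots> = (\<integral>\<^sup>+r. ennreal (?n * ?V * r ^ (?n - 1)) * indicator {0..} r * ennreal ((1 / sqrt (1 + r\<^sup>2)) powr s) \<partial>lborel)"
    by (subst nn_integral_radial) simp_all
  also have "\<dots> \<le> (\<integral>\<^sup>+r. ennreal (c * (1 + r) powr (- \<delta> - 1)) * indicator {0..} r \<partial>lborel)"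
    using pt by (intro nn_integral_mono) (auto split: split_indicator simp: ennreal_mult'[symmetric] intro!: ennreal_leI)
  also have "\<dots> = ennreal (0 - - (c / \<delta>) * (1 + 0) powr (- \<delta>))"
  proof (rule nn_integral_FTC_atLeast)
    show "((\<lambda>r. - (c / \<delta>) * (1 + r) powr (- \<delta>)) has_real_derivative c * (1 + r) powr (- \<delta> - 1)) (at r)"
      if "0 \<le> r" for r using that \<delta> by (auto intro!: derivative_eq_intros simp: field_simps)
    have "((\<lambda>r. (1 + r) powr (- \<delta>)) \<longlongrightarrow> 0) at_top"
      using \<delta> by (intro tendsto_neg_powr filterlim_tendsto_add_at_top[of _ 1] filterlim_ident tendsto_const) auto
    then show "((\<lambda>r. - (c / \<delta>) * (1 + r) powr (- \<delta>)) \<longlongrightarrow> 0) at_top"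
      by (rule tendsto_mult_right_zero)
  qed (use c0 in auto)
  finally show "(\<integral>\<^sup>+x. ennreal (norm (wt (x::real^'n) powr s)) \<partial>lborel) < \<infinity>"
    by (simp add: top.not_eq_extremum le_less_trans)
qed measurable

lemma wt_power_integrable:
  assumes "k > CARD('n)"
  shows "integrable lborel (\<lambda>x::real^'n. wt x ^ k)"
  using wt_powr_integrable[of "real k", where 'n='n] assms by (simp add: powr_realpow)

text \<open>The Jacobian r^(n-1) absorbs the singularity r^(-a) completely, because a \<le> n - 1
  for natural numbers; the radial integrand is bounded.\<close>

lemma inv_norm_power_locally_integrable:
  assumes a: "a < CARD('n)"
  shows "(\<integral>\<^sup>+(z::real^'n). ennreal (inv_norm z ^ a) * indicator (ball 0 1) z \<partial>lborel) < \<infinity>"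
proof -
  let ?n = "CARD('n)" let ?V = "unit_ball_vol ?n"
  have pt: "r ^ (?n - 1) * (1 / r) ^ a \<le> 1" if "0 \<le> r" "r < 1" for r :: real
  proof (cases "r = 0")
    case True then show ?thesis by (auto simp: power_0_left)
  next
    case False
    have "r ^ (?n - 1) \<le> r ^ a" using that a by (intro power_decreasing) auto
    then show ?thesis using False that by (simp add: power_one_over field_simps)
  qed
  have "(\<integral>\<^sup>+(z::real^'n). ennreal (inv_norm z ^ a) * indicator (ball 0 1) z \<partial>lborel)
    = (\<integral>\<^sup>+z. (\<lambda>r. ennreal ((1 / r) ^ a) * indicator {..<1} r) (norm (z::real^'n)) \<partial>lborel)"
    by (intro nn_integral_cong) (auto simp: inv_norm_def split: split_indicator)
  also have "\<dots> = (\<integral>\<^sup>+r. ennreal (?n * ?V * r ^ (?n - 1)) * indicator {0..} r * (ennreal ((1 / r) ^ a) * indicator {..<1} r) \<partial>lborel)"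
    by (subst nn_integral_radial) simp_all
  also have "\<dots> \<le> (\<integral>\<^sup>+r. ennreal (?n * ?V) * indicator {0..1::real} r \<partial>lborel)"
  proof (rule nn_integral_mono)
    fix r :: real
    have "?n * ?V * r ^ (?n - 1) * (1 / r) ^ a \<le> ?n * ?V" if "0 \<le> r" "r < 1"
      using mult_left_mono[OF pt[OF that], of "?n * ?V"] by (simp add: mult.assoc)
    then show "ennreal (?n * ?V * r ^ (?n - 1)) * indicator {0..} r * (ennreal ((1 / r) ^ a) * indicator {..<1} r)
      \<le> ennreal (?n * ?V) * indicator {0..1} r"
      by (auto split: split_indicator simp: ennreal_mult'[symmetric] intro!: ennreal_leI)
  qed
  also have "\<dots> < \<infinity>" by (simp add: nn_integral_cmult ennreal_mult_less_top)
  finally show ?thesis .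
qed

lemma inv_norm_le_wt:
  assumes "1 \<le> norm z" shows "inv_norm z \<le> 2 * wt z"
proof -
  have "japanese_bracket z \<le> 2 * norm z" using japanese_bracket_le[of z] assms by simp
  moreover have "0 < norm z" using assms by linarith
  ultimately show ?thesis using assms japanese_bracket_ge_1[of z] by (simp add: inv_norm_def wt_def field_simps)
qed

text \<open>Inside the unit ball about x the weight is at most 1 and the singularity is integrable.
  Outside, s = 1/|x - y| and t = \<open>wt y\<close> are both at most 1, so s^a t^b \<le> max(s,
  t)^(a+b) \<le> s^(n+1) + t^(n+1), as a + b is at least n + 1. Neither integral depends on
  x.\<close>

lemma inv_norm_wt_bound:
  assumes a: "a < CARD('n)" and ab: "CARD('n) < a + b"
  shows "\<exists>C>0. \<forall>x::real^'n. (\<integral>\<^sup>+y. ennreal (inv_norm (x - y) ^ a * wt y ^ b) \<partial>lborel) \<le> ennreal C"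
proof -
  let ?k = "Suc CARD('n)"
  define A where "A = (\<integral>\<^sup>+(z::real^'n). ennreal (inv_norm z ^ a) * indicator (ball 0 1) z \<partial>lborel)"
  define W where "W = (\<integral>\<^sup>+(z::real^'n). ennreal (wt z ^ ?k) \<partial>lborel)"
  have "W < \<infinity>"
    using wt_power_integrable[of ?k, where 'n='n]
    by (auto simp: integrable_iff_bounded W_def)
  moreover have "A < \<infinity>" unfolding A_def by (rule inv_norm_power_locally_integrable[OF a])
  ultimately have fin: "A + (ennreal (2 ^ ?k) * W + W) < \<infinity>" by (simp add: ennreal_mult_less_top)
  define h where "h z = ennreal (inv_norm z ^ a) * indicator (ball 0 1) z" for z :: "real^'n"
  have h [measurable]: "h \<in> borel_measurable borel" unfolding h_def
    by (intro borel_measurable_times_ennreal borel_measurable_indicator) (auto intro: borel_open)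
  define w where "w z = ennreal (wt z ^ ?k)" for z :: "real^'n"
  have w [measurable]: "w \<in> borel_measurable borel" unfolding w_def by measurable
  have bound: "(\<integral>\<^sup>+y. ennreal (inv_norm (x - y) ^ a * wt y ^ b) \<partial>lborel) \<le> A + (ennreal (2 ^ ?k) * W + W)" for x :: "real^'n"
  proof -
    have pt: "ennreal (inv_norm (x - y) ^ a * wt y ^ b)
       \<le> ennreal (inv_norm (x - y) ^ a) * indicator (ball 0 1) (x - y)
         + (ennreal (2 ^ ?k) * ennreal (wt (x - y) ^ ?k) + ennreal (wt y ^ ?k))" for y
    proof (cases "norm (x - y) < 1")
      case True
      have "inv_norm (x - y) ^ a * wt y ^ b \<le> inv_norm (x - y) ^ a"
        by (intro mult_left_le) (auto simp: power_le_one)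
      then have "ennreal (inv_norm (x - y) ^ a * wt y ^ b) \<le> ennreal (inv_norm (x - y) ^ a) * indicator (ball 0 1) (x - y)"
        using True by (simp add: ennreal_leI)
      then show ?thesis by (rule add_increasing2[rotated]) simp
    next
      case False
      define s where "s = inv_norm (x - y)" define t where "t = wt y"
      have s: "0 \<le> s" "s \<le> 1" "s \<le> 2 * wt (x - y)" and t: "0 \<le> t" "t \<le> 1"
        using False inv_norm_le_wt[of "x - y"] by (auto simp: s_def t_def inv_norm_def divide_le_eq_1)
      have "s ^ a * t ^ b \<le> max s t ^ a * max s t ^ b"
        using s t by (intro mult_mono power_mono) auto
      also have "\<dots> = max s t ^ (a + b)" by (simp add: power_add)
      also have "\<dots> \<le> max s t ^ ?k" using s t ab by (intro power_decreasing) auto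
      also have "\<dots> \<le> s ^ ?k + t ^ ?k" using s t by (auto simp: max_def)
      also have "s ^ ?k \<le> (2 * wt (x - y)) ^ ?k" using s by (intro power_mono) auto
      also have "\<dots> = 2 ^ ?k * wt (x - y) ^ ?k" by (rule power_mult_distrib)
      finally have "ennreal (s ^ a * t ^ b) \<le> ennreal (2 ^ ?k * wt (x - y) ^ ?k + t ^ ?k)"
        by (intro ennreal_leI) simp
      also have "\<dots> = ennreal (2 ^ ?k) * ennreal (wt (x - y) ^ ?k) + ennreal (t ^ ?k)"
        using t by (subst ennreal_plus) (auto simp: ennreal_mult)
      finally show ?thesis unfolding s_def t_def by (rule add_increasing[rotated]) simp
    qed
    have "(\<integral>\<^sup>+y. ennreal (inv_norm (x - y) ^ a * wt y ^ b) \<partial>lborel)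
       \<le> (\<integral>\<^sup>+y. h (x - y) + (ennreal (2 ^ ?k) * w (x - y) + w y) \<partial>lborel)"
      unfolding h_def w_def by (intro nn_integral_mono pt)
    also have "\<dots> = (\<integral>\<^sup>+y. h (x - y) \<partial>lborel) + (ennreal (2 ^ ?k) * (\<integral>\<^sup>+y. w (x - y) \<partial>lborel) + (\<integral>\<^sup>+y. w y \<partial>lborel))"
      by (simp add: nn_integral_add nn_integral_cmult del: power_Suc)
    also have "\<dots> = (\<integral>\<^sup>+y. h y \<partial>lborel) + (ennreal (2 ^ ?k) * (\<integral>\<^sup>+y. w y \<partial>lborel) + (\<integral>\<^sup>+y. w y \<partial>lborel))"
      by (simp only: nn_integral_lborel_reflect[OF h] nn_integral_lborel_reflect[OF w])
    finally show ?thesis unfolding A_def W_def h_def w_def .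
  qed
  obtain C0 where C0: "C0 \<ge> 0" "A + (ennreal (2 ^ ?k) * W + W) = ennreal C0"
    using fin by (cases "A + (ennreal (2 ^ ?k) * W + W)") auto
  have "(\<integral>\<^sup>+y. ennreal (inv_norm (x - y) ^ a * wt y ^ b) \<partial>lborel) \<le> ennreal (C0 + 1)" for x :: "real^'n"
    using bound[of x] unfolding C0(2) by (rule order_trans) (simp add: ennreal_leI)
  then show ?thesis using C0(1) by (intro exI[of _ "C0 + 1"]) simp
qed

text \<open>One of <y> and |x - y| is at least half of <x>, so the smaller of the two inverses is at
  most \<open>2 * wt x\<close> and the larger one is left over; the sum on the right replaces this
  maximum.\<close>

lemma wt_split:
  "wt y ^ g * inv_norm (x - y) ^ g \<le> 2 ^ g * wt x ^ g * (wt y ^ g + inv_norm (x - y) ^ g)"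
proof (cases "x = y")
  case True
  then show ?thesis by (cases g) (auto simp: inv_norm_def)
next
  case False
  have "japanese_bracket x \<le> japanese_bracket y + norm (x - y)"
    using japanese_bracket_triangle[of y "x - y"] by simp
  have 1: "wt y * inv_norm (x - y) \<le> 2 * wt x * max (wt y) (inv_norm (x - y))"
  proof -
    have p: "japanese_bracket x > 0" "japanese_bracket y > 0" "norm (x - y) > 0"
      using japanese_bracket_ge_1[of x] japanese_bracket_ge_1[of y] False by auto
    show ?thesis
    proof (cases "japanese_bracket y \<le> norm (x - y)")
      case True
      then have "japanese_bracket x \<le> 2 * norm (x - y)"
        using \<open>japanese_bracket x \<le> japanese_bracket y + norm (x - y)\<close> by simp
      then have "inv_norm (x - y) \<le> 2 * wt x" using p by (simp add: inv_norm_def wt_def field_simps)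
      then have "wt y * inv_norm (x - y) \<le> wt y * (2 * wt x)" by (intro mult_left_mono) auto
      also have "\<dots> \<le> 2 * wt x * max (wt y) (inv_norm (x - y))" by (simp add: mult.commute mult_left_mono)
      finally show ?thesis .
    next
      case False
      then have "japanese_bracket x \<le> 2 * japanese_bracket y"
        using \<open>japanese_bracket x \<le> japanese_bracket y + norm (x - y)\<close> by simp
      then have "wt y \<le> 2 * wt x" using p by (simp add: inv_norm_def wt_def field_simps)
      then have "wt y * inv_norm (x - y) \<le> 2 * wt x * inv_norm (x - y)" by (intro mult_right_mono) auto
      also have "\<dots> \<le> 2 * wt x * max (wt y) (inv_norm (x - y))" by (simp add: mult_left_mono)
      finally show ?thesis .
    qed
  qed
  have "wt y ^ g * inv_norm (x - y) ^ g \<le> (2 * wt x * max (wt y) (inv_norm (x - y))) ^ g"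
    unfolding power_mult_distrib[symmetric] by (intro power_mono 1) auto
  also have "\<dots> = 2 ^ g * wt x ^ g * max (wt y) (inv_norm (x - y)) ^ g"
    by (simp add: power_mult_distrib)
  also have "\<dots> \<le> 2 ^ g * wt x ^ g * (wt y ^ g + inv_norm (x - y) ^ g)"
    by (intro mult_left_mono) (auto simp: max_def)
  finally show ?thesis .
qed

text \<open>The weight is transferred to \<open>x\<close> by \<open>\<langle>x\<rangle> \<le> \<langle>y\<rangle> + \<bar>x - y\<bar>\<close>, at the expense of
  either the kernel or the density.\<close>

lemma inv_norm_wt_decay:
  assumes a: "a < CARD('n)" and g: "g \<le> a" "g \<le> b" and ab: "CARD('n) + g < a + b"
  shows "\<exists>C>0. \<forall>x::real^'n. (\<integral>\<^sup>+y. ennreal (inv_norm (x - y) ^ a * wt y ^ b) \<partial>lborel) \<le> ennreal (C * wt x ^ g)"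
proof -
  have ab1: "CARD('n) < a + (b - g)" and a2: "a - g < CARD('n)" and ab2: "CARD('n) < (a - g) + b"
    using a g ab by arith+
  obtain C1 where C1: "C1 > 0" "\<And>x::real^'n. (\<integral>\<^sup>+y. ennreal (inv_norm (x - y) ^ a * wt y ^ (b - g)) \<partial>lborel) \<le> ennreal C1"
    using inv_norm_wt_bound[OF a, of "b - g"] ab1 by auto
  obtain C2 where C2: "C2 > 0" "\<And>x::real^'n. (\<integral>\<^sup>+y. ennreal (inv_norm (x - y) ^ (a - g) * wt y ^ b) \<partial>lborel) \<le> ennreal C2"
    using inv_norm_wt_bound[OF a2 ab2] by auto
  have "(\<integral>\<^sup>+y. ennreal (inv_norm (x - y) ^ a * wt y ^ b) \<partial>lborel) \<le> ennreal (2 ^ g * (C1 + C2) * wt x ^ g)" for x :: "real^'n"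
  proof -
    have pt: "inv_norm (x - y) ^ a * wt y ^ b \<le> 2 ^ g * wt x ^ g * (inv_norm (x - y) ^ a * wt y ^ (b - g) + inv_norm (x - y) ^ (a - g) * wt y ^ b)" for y
    proof -
      have ea: "inv_norm (x - y) ^ a = inv_norm (x - y) ^ (a - g) * inv_norm (x - y) ^ g"
        and eb: "wt y ^ b = wt y ^ (b - g) * wt y ^ g"
        using g by (simp_all add: power_add[symmetric])
      have "inv_norm (x - y) ^ a * wt y ^ b = inv_norm (x - y) ^ (a - g) * wt y ^ (b - g) * (wt y ^ g * inv_norm (x - y) ^ g)"
        by (simp add: ea eb)
      also have "\<dots> \<le> inv_norm (x - y) ^ (a - g) * wt y ^ (b - g) * (2 ^ g * wt x ^ g * (wt y ^ g + inv_norm (x - y) ^ g))"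
        by (intro mult_left_mono wt_split) auto
      finally show ?thesis by (simp add: ea eb algebra_simps)
    qed
    have "(\<integral>\<^sup>+y. ennreal (inv_norm (x - y) ^ a * wt y ^ b) \<partial>lborel)
      \<le> (\<integral>\<^sup>+y. ennreal (2 ^ g * wt x ^ g) * (ennreal (inv_norm (x - y) ^ a * wt y ^ (b - g)) + ennreal (inv_norm (x - y) ^ (a - g) * wt y ^ b)) \<partial>lborel)"
    proof (rule nn_integral_mono)
      fix y
      show "ennreal (inv_norm (x - y) ^ a * wt y ^ b) \<le> ennreal (2 ^ g * wt x ^ g) *
          (ennreal (inv_norm (x - y) ^ a * wt y ^ (b - g)) + ennreal (inv_norm (x - y) ^ (a - g) * wt y ^ b))"
        using ennreal_leI[OF pt[of y]] by (simp add: ennreal_mult' ennreal_plus)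
    qed
    also have "\<dots> = ennreal (2 ^ g * wt x ^ g) * ((\<integral>\<^sup>+y. ennreal (inv_norm (x - y) ^ a * wt y ^ (b - g)) \<partial>lborel) + (\<integral>\<^sup>+y. ennreal (inv_norm (x - y) ^ (a - g) * wt y ^ b) \<partial>lborel))"
      by (simp add: nn_integral_add nn_integral_cmult)
    also have "\<dots> \<le> ennreal (2 ^ g * wt x ^ g) * (ennreal C1 + ennreal C2)"
      by (intro mult_left_mono add_mono C1 C2) auto
    also have "\<dots> = ennreal (2 ^ g * (C1 + C2) * wt x ^ g)"
      using C1(1) C2(1) by (simp add: ennreal_mult' ennreal_plus mult_ac)
    finally show ?thesis .
  qed
  moreover have "2 ^ g * (C1 + C2) > 0" using C1(1) C2(1) by simp
  ultimately show ?thesis by blast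
qed

text \<open>The antiderivative of the radial density is \<open>V (r / \<surd>(1 + r\<^sup>2))\<^sup>n\<close>.\<close>

lemma integral_wt_power_plus_2:
  "(LINT x|lborel. wt (x::real^'n) ^ (CARD('n) + 2)) = unit_ball_vol CARD('n)"
proof -
  let ?n = "CARD('n)" let ?V = "unit_ball_vol ?n"
  have n: "?n \<ge> 1" by (simp add: Suc_le_eq)
  have "(\<integral>\<^sup>+x. ennreal (wt (x::real^'n) ^ (?n + 2)) \<partial>lborel)
      = (\<integral>\<^sup>+x. (\<lambda>r. ennreal ((1 / sqrt (1 + r\<^sup>2)) ^ (?n + 2))) (norm (x::real^'n)) \<partial>lborel)"
    by (simp add: wt_def japanese_bracket_def)
  also have "\<dots> = (\<integral>\<^sup>+r. ennreal (?n * ?V * r ^ (?n - 1)) * indicator {0..} r * ennreal ((1 / sqrt (1 + r\<^sup>2)) ^ (?n + 2)) \<partial>lborel)"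
    by (subst nn_integral_radial) simp_all
  also have "\<dots> = (\<integral>\<^sup>+r. ennreal (?n * ?V * r ^ (?n - 1) * (1 / sqrt (1 + r\<^sup>2)) ^ (?n + 2)) * indicator {0..} r \<partial>lborel)"
    by (intro nn_integral_cong) (auto split: split_indicator simp: ennreal_mult'[symmetric])
  also have "\<dots> = ennreal (?V * 1 ^ ?n - ?V * (0 / sqrt (1 + 0\<^sup>2)) ^ ?n)"
  proof (rule nn_integral_FTC_atLeast)
    show "((\<lambda>r. ?V * (r / sqrt (1 + r\<^sup>2)) ^ ?n) has_real_derivative ?n * ?V * r ^ (?n - 1) * (1 / sqrt (1 + r\<^sup>2)) ^ (?n + 2)) (at r)"
      if "0 \<le> r" for r
    proof -
      have p: "1 + r\<^sup>2 > 0" by (simp add: add_pos_nonneg)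
      have sq: "sqrt (1 + r\<^sup>2) * sqrt (1 + r\<^sup>2) = 1 + r\<^sup>2" using p by simp
      have "((\<lambda>r. r / sqrt (1 + r\<^sup>2)) has_real_derivative (1 / sqrt (1 + r\<^sup>2)) ^ 3) (at r)"
        using p
        by (auto intro!: derivative_eq_intros simp: field_simps power3_eq_cube power2_eq_square)
      from DERIV_power[OF this, of ?n, THEN DERIV_cmult, of ?V] show ?thesis
      proof (rule DERIV_cong)
        have "(1 / sqrt (1 + r\<^sup>2)) ^ (?n + 2) = (1 / sqrt (1 + r\<^sup>2)) ^ (?n - 1) * (1 / sqrt (1 + r\<^sup>2)) ^ 3"
          using n by (simp only: power_add[symmetric]) (simp add: numeral_eq_Suc)
        moreover have "(r / sqrt (1 + r\<^sup>2)) ^ (?n - 1) = r ^ (?n - 1) * (1 / sqrt (1 + r\<^sup>2)) ^ (?n - 1)"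
          by (simp add: power_mult_distrib[symmetric])
        ultimately show "?V * (real ?n * ((1 / sqrt (1 + r\<^sup>2)) ^ 3 * (r / sqrt (1 + r\<^sup>2)) ^ (?n - Suc 0))) = ?n * ?V * r ^ (?n - 1) * (1 / sqrt (1 + r\<^sup>2)) ^ (?n + 2)"
          by simp
      qed
    qed
    have "((\<lambda>r::real. r / sqrt (1 + r\<^sup>2)) \<longlongrightarrow> 1) at_top"
    proof (rule Lim_transform_eventually)
      have "((\<lambda>r::real. sqrt (1 / (inverse r ^ 2 + 1))) \<longlongrightarrow> sqrt (1 / (0 ^ 2 + 1))) at_top"
        by (intro tendsto_intros tendsto_inverse_0_at_top filterlim_ident) auto
      then show "((\<lambda>r::real. sqrt (1 / (inverse r ^ 2 + 1))) \<longlongrightarrow> 1) at_top" by simp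
      show "\<forall>\<^sub>F r::real in at_top. sqrt (1 / (inverse r ^ 2 + 1)) = r / sqrt (1 + r\<^sup>2)"
        using eventually_gt_at_top[of 0]
      proof eventually_elim
        case (elim r)
        have "1 / (inverse r ^ 2 + 1) = r\<^sup>2 / (1 + r\<^sup>2)" using elim by (simp add: field_simps)
        then show ?case using elim by (simp add: real_sqrt_divide)
      qed
    qed
    then show "((\<lambda>r. ?V * (r / sqrt (1 + r\<^sup>2)) ^ ?n) \<longlongrightarrow> ?V * 1 ^ ?n) at_top"
      by (intro tendsto_intros)
  qed auto
  also have "\<dots> = ennreal ?V" by (simp add: power_0_left)
  finally show ?thesis
    by (intro integral_eq_nn_integral[THEN trans]) (auto simp: measurable_completion)
qed

subsection \<open>Calculus of smooth functions\<close>

text \<open>The first half of \<open>test_function\<close>, split off because Newtonian potentials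
  of test functions are smooth but do not have compact support.\<close>

definition smooth :: "(real ^ 'n \<Rightarrow> complex) \<Rightarrow> bool" where
  "smooth f \<longleftrightarrow> (\<forall>is x. iter_partial is f differentiable (at x))"

lemma iter_partial_simps [simp]:
  "iter_partial [] f = f" "iter_partial (i # is) f = partial i (iter_partial is f)"
  by (simp_all add: iter_partial_def)

lemma iter_partial_append: "iter_partial (is @ js) f = iter_partial is (iter_partial js f)"
  by (simp add: iter_partial_def)

lemma smooth_differentiable: "smooth f \<Longrightarrow> f differentiable (at x)"
  unfolding smooth_def by (metis iter_partial_simps(1))

lemma smooth_partial: "smooth f \<Longrightarrow> smooth (partial i f)"
  unfolding smooth_def by (metis iter_partial_append iter_partial_simps)

lemma partial_eqI: "(f has_derivative D) (at x) \<Longrightarrow> partial i f x = D (axis i 1)"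
  unfolding partial_def by (metis frechet_derivative_at)

lemma linear_axis_expand:
  fixes D :: "real ^ 'n \<Rightarrow> 'b::real_vector"
  assumes "linear D" shows "D h = (\<Sum>i\<in>UNIV. h $ i *\<^sub>R D (axis i 1))"
proof -
  have "D h = D (\<Sum>i\<in>UNIV. h $ i *\<^sub>R axis i 1)"
    using basis_expansion[of h] by (simp add: scalar_mult_eq_scaleR)
  also have "\<dots> = (\<Sum>i\<in>UNIV. h $ i *\<^sub>R D (axis i 1))"
    using assms by (simp add: linear_sum linear_scale)
  finally show ?thesis .
qed

lemma has_derivative_partial:
  assumes "f differentiable (at x)"
  shows "(f has_derivative (\<lambda>h. \<Sum>i\<in>UNIV. h $ i *\<^sub>R partial i f x)) (at x)"
proof -
  have d: "(f has_derivative frechet_derivative f (at x)) (at x)"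
    using assms by (simp add: frechet_derivative_works)
  then have "frechet_derivative f (at x) h = (\<Sum>i\<in>UNIV. h $ i *\<^sub>R partial i f x)" for h
    unfolding partial_def by (intro linear_axis_expand) (rule has_derivative_linear)
  then have "frechet_derivative f (at x) = (\<lambda>h. \<Sum>i\<in>UNIV. h $ i *\<^sub>R partial i f x)" by blast
  then show ?thesis using d by simp
qed

lemma sum_axis_scaleR:
  fixes g :: "'n::finite \<Rightarrow> 'b::real_vector"
  shows "(\<Sum>j\<in>UNIV. (axis i (1::real)) $ j *\<^sub>R g j) = g i"
proof -
  have "(\<Sum>j\<in>UNIV. (axis i (1::real)) $ j *\<^sub>R g j) = (\<Sum>j\<in>UNIV. if j = i then g j else 0)"
    by (intro sum.cong) (auto simp: axis_def)
  then show ?thesis by simp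
qed

lemma differentiable_sum_list:
  fixes gs :: "('a::real_normed_vector \<Rightarrow> 'b::real_normed_vector) list"
  assumes "\<And>g. g \<in> set gs \<Longrightarrow> g differentiable (at x)"
  shows "(\<lambda>x. \<Sum>g\<leftarrow>gs. g x) differentiable (at x)"
  using assms by (induction gs) (auto intro: differentiable_add)

lemma partial_add:
  assumes "f differentiable (at x)" "g differentiable (at x)"
  shows "partial i (\<lambda>x. f x + g x) x = partial i f x + partial i g x"
  using partial_eqI[OF has_derivative_add[OF has_derivative_partial[OF assms(1)] has_derivative_partial[OF assms(2)]], of i]
  by (simp add: sum_axis_scaleR)

lemma partial_const [simp]: "partial i (\<lambda>x. c) x = 0"
  by (rule partial_eqI[of _ "\<lambda>_. 0", simplified]) (rule has_derivative_const)

lemma partial_mult: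
  assumes "f differentiable (at x)" "g differentiable (at x)"
  shows "partial i (\<lambda>x. f x * g x) x = f x * partial i g x + partial i f x * g x"
  using partial_eqI[OF has_derivative_mult[OF has_derivative_partial[OF assms(1)] has_derivative_partial[OF assms(2)]], of i]
  by (simp add: sum_axis_scaleR)

lemma partial_cmult:
  assumes "f differentiable (at x)"
  shows "partial i (\<lambda>x. c * f x) x = c * partial i f x"
  using partial_mult[OF differentiable_const assms] by simp

lemma partial_cnj:
  assumes "f differentiable (at x)"
  shows "partial i (\<lambda>x. cnj (f x)) x = cnj (partial i f x)"
  using partial_eqI[OF bounded_linear.has_derivative[OF bounded_linear_cnj has_derivative_partial[OF assms]], of i]
  by (simp add: sum_axis_scaleR)

lemma partial_sum_list:
  assumes "\<And>g. g \<in> set gs \<Longrightarrow> g differentiable (at x)"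
  shows "partial i (\<lambda>x. \<Sum>g\<leftarrow>gs. g x) x = (\<Sum>g\<leftarrow>gs. partial i g x)"
  using assms
proof (induction gs)
  case (Cons g gs)
  have "partial i (\<lambda>x. g x + (\<Sum>g\<leftarrow>gs. g x)) x = partial i g x + partial i (\<lambda>x. \<Sum>g\<leftarrow>gs. g x) x"
    using Cons.prems by (intro partial_add differentiable_sum_list) auto
  then show ?case using Cons by simp
qed simp

text \<open>Spares all formulas for higher derivatives: only a class of differentiable functions
  that is stable under every \<open>partial i\<close> has to be exhibited.\<close>

lemma smooth_coinduct:
  assumes "f \<in> S" and "\<And>g x. g \<in> S \<Longrightarrow> g differentiable (at x)"
    and "\<And>g i. g \<in> S \<Longrightarrow> partial i g \<in> S"
  shows "smooth f"
proof -
  have "iter_partial is f \<in> S" for "is"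
    by (induction "is") (auto intro: assms)
  then show ?thesis unfolding smooth_def using assms(2) by blast
qed

text \<open>The Leibniz and chain rules turn a member of the class into several; closing the class
  under sums over lists reduces this to \<open>smooth_coinduct\<close>.\<close>

lemma smooth_coinduct_sum:
  assumes f: "f \<in> S" and diff: "\<And>g x. g \<in> S \<Longrightarrow> g differentiable (at x)"
    and part: "\<And>g i. g \<in> S \<Longrightarrow> \<exists>gs. set gs \<subseteq> S \<and> (\<forall>x. partial i g x = (\<Sum>h\<leftarrow>gs. h x))"
  shows "smooth f"
proof (rule smooth_coinduct[where S="{\<lambda>x. \<Sum>h\<leftarrow>gs. h x | gs. set gs \<subseteq> S}"])
  show "f \<in> {\<lambda>x. \<Sum>h\<leftarrow>gs. h x | gs. set gs \<subseteq> S}"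
    using f by (intro CollectI exI[of _ "[f]"]) auto
next
  fix g x assume "g \<in> {\<lambda>x. \<Sum>h\<leftarrow>gs. h x | gs. set gs \<subseteq> S}"
  then obtain gs where gs: "set gs \<subseteq> S" "g = (\<lambda>x. \<Sum>h\<leftarrow>gs. h x)" by auto
  show "g differentiable (at x)" unfolding gs(2) using gs(1) diff by (intro differentiable_sum_list) blast
next
  fix g i assume "g \<in> {\<lambda>x. \<Sum>h\<leftarrow>gs. h x | gs. set gs \<subseteq> S}"
  then obtain gs where gs: "set gs \<subseteq> S" "g = (\<lambda>x. \<Sum>h\<leftarrow>gs. h x)" by auto
  obtain F where F: "\<And>h. h \<in> S \<Longrightarrow> set (F h) \<subseteq> S \<and> (\<forall>x. partial i h x = (\<Sum>h'\<leftarrow>F h. h' x))"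
    using part[of _ i] by metis
  have "partial i g = (\<lambda>x. \<Sum>h\<leftarrow>concat (map F gs). h x)"
  proof
    fix x
    have "partial i g x = (\<Sum>h\<leftarrow>gs. partial i h x)"
      unfolding gs(2) using gs(1) diff by (intro partial_sum_list) auto
    also have "\<dots> = (\<Sum>h\<leftarrow>concat (map F gs). h x)"
      using gs(1) F by (induction gs) auto
    finally show "partial i g x = (\<Sum>h\<leftarrow>concat (map F gs). h x)" .
  qed
  moreover have "set (concat (map F gs)) \<subseteq> S" using gs(1) F by auto
  ultimately show "partial i g \<in> {\<lambda>x. \<Sum>h\<leftarrow>gs. h x | gs. set gs \<subseteq> S}" by blast
qed

section \<open>Algebraic closure properties of smooth functions, up to polynomials and affine
  substitutions\<close>

lemma smooth_add:
  assumes "smooth f" "smooth g" shows "smooth (\<lambda>x. f x + g x)"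
proof (rule smooth_coinduct[where S="{\<lambda>x. f x + g x | f g. smooth f \<and> smooth g}"])
  fix h i assume "h \<in> {\<lambda>x. f x + g x | f g. smooth f \<and> smooth g}"
  then obtain f g where h: "h = (\<lambda>x. f x + g x)" "smooth f" "smooth g" by auto
  then have "partial i h = (\<lambda>x. partial i f x + partial i g x)"
    by (auto intro!: partial_add smooth_differentiable)
  then show "partial i h \<in> {\<lambda>x. f x + g x | f g. smooth f \<and> smooth g}"
    using h smooth_partial by blast
next
  fix h x assume "h \<in> {\<lambda>x. f x + g x | f g. smooth f \<and> smooth g}"
  then show "h differentiable (at x)" by (auto intro: differentiable_add smooth_differentiable)
qed (use assms in blast)

lemma smooth_mult:
  assumes "smooth f" "smooth g" shows "smooth (\<lambda>x. f x * g x)"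
proof (rule smooth_coinduct_sum[where S="{\<lambda>x. f x * g x | f g. smooth f \<and> smooth g}"])
  fix h i assume "h \<in> {\<lambda>x. f x * g x | f g. smooth f \<and> smooth g}"
  then obtain f g where h: "h = (\<lambda>x. f x * g x)" "smooth f" "smooth g" by auto
  have "partial i h x = (\<Sum>k\<leftarrow>[\<lambda>x. f x * partial i g x, \<lambda>x. partial i f x * g x]. k x)" for x
    unfolding h(1) using h(2,3) by (simp add: partial_mult smooth_differentiable)
  then show "\<exists>gs. set gs \<subseteq> {\<lambda>x. f x * g x | f g. smooth f \<and> smooth g} \<and> (\<forall>x. partial i h x = (\<Sum>h\<leftarrow>gs. h x))"
    using h(2,3) by (intro exI[of _ "[\<lambda>x. f x * partial i g x, \<lambda>x. partial i f x * g x]"]) (simp, blast intro: smooth_partial)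
next
  fix h x assume "h \<in> {\<lambda>x. f x * g x | f g. smooth f \<and> smooth g}"
  then show "h differentiable (at x)" by (auto intro: differentiable_mult smooth_differentiable)
qed (use assms in blast)

lemma smooth_const: "smooth (\<lambda>x. c)"
proof (rule smooth_coinduct[where S="{\<lambda>x. c | c. True}"])
  fix h :: "real ^ 'n \<Rightarrow> complex" and i assume "h \<in> {\<lambda>x. c | c. True}"
  then obtain c where "h = (\<lambda>x. c)" by blast
  then have "partial i h = (\<lambda>x. 0)" by (intro ext) (simp only: partial_const)
  then show "partial i h \<in> {\<lambda>x. c | c. True}" by blast
qed auto

lemma smooth_coord: "smooth (\<lambda>x::real ^ 'n. complex_of_real (x $ i))"
proof (rule smooth_coinduct[where S="insert (\<lambda>x. complex_of_real (x $ i)) {\<lambda>x. c | c. True}"])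
  have d: "((\<lambda>x. complex_of_real (x $ i)) has_derivative (\<lambda>h. complex_of_real (h $ i))) (at x)" for x :: "real ^ 'n"
    by (intro bounded_linear_imp_has_derivative bounded_linear_compose[OF bounded_linear_of_real bounded_linear_vec_nth])
  show "g differentiable (at x)" if "g \<in> insert (\<lambda>x. complex_of_real (x $ i)) {\<lambda>x. c | c. True}" for g x
    using that differentiableI[OF d] by (auto intro: differentiable_const)
  show "partial j g \<in> insert (\<lambda>x. complex_of_real (x $ i)) {\<lambda>x. c | c. True}"
    if "g \<in> insert (\<lambda>x. complex_of_real (x $ i)) {\<lambda>x. c | c. True}" for g j
  proof -
    have "partial j (\<lambda>x. complex_of_real (x $ i)) = (\<lambda>x. complex_of_real (axis j 1 $ i))"
      using partial_eqI[OF d] by blast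
    moreover have "partial j (\<lambda>x. c) = (\<lambda>x. 0)" for c by (rule ext) simp
    ultimately show ?thesis using that by auto
  qed
qed auto

lemma smooth_sum:
  assumes "finite A" "\<And>i. i \<in> A \<Longrightarrow> smooth (f i)" shows "smooth (\<lambda>x. \<Sum>i\<in>A. f i x)"
  using assms by (induction A) (auto intro: smooth_const smooth_add)

lemma smooth_diff:
  assumes "smooth f" "smooth g" shows "smooth (\<lambda>x. f x - g x)"
  using smooth_add[OF assms(1) smooth_mult[OF smooth_const[of "-1"] assms(2)]] by simp

lemma smooth_real_polynomial:
  fixes p :: "real ^ 'n \<Rightarrow> real"
  shows "real_polynomial_function p \<Longrightarrow> smooth (\<lambda>x. complex_of_real (p x))"
proof (induction rule: real_polynomial_function.induct)
  case (linear f)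
  have "complex_of_real (f x) = (\<Sum>i\<in>UNIV. complex_of_real (x $ i) * complex_of_real (f (axis i 1)))" for x
    using linear_axis_expand[OF bounded_linear.linear[OF linear], of x] by simp
  then have eq: "(\<lambda>x. complex_of_real (f x)) = (\<lambda>x. \<Sum>i\<in>UNIV. complex_of_real (x $ i) * complex_of_real (f (axis i 1)))"
    by (rule ext)
  show ?case by (subst eq) (intro smooth_sum smooth_mult smooth_coord smooth_const finite)
qed (simp_all add: smooth_const smooth_add smooth_mult)

lemma smooth_polynomial:
  fixes p :: "real ^ 'n \<Rightarrow> complex"
  assumes "polynomial_function p" shows "smooth p"
proof -
  have "real_polynomial_function (\<lambda>x. Re (p x))" "real_polynomial_function (\<lambda>x. Im (p x))"
    using assms unfolding polynomial_function_def
    by (auto simp: comp_def dest: spec[of _ Re] spec[of _ Im] intro: bounded_linear_Re bounded_linear_Im)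
  then have "smooth (\<lambda>x. complex_of_real (Re (p x)) + \<i> * complex_of_real (Im (p x)))"
    by (intro smooth_add smooth_mult smooth_const smooth_real_polynomial)
  then show ?thesis by (simp add: complex_eq[symmetric])
qed

lemma partial_affine:
  assumes "f differentiable (at (a + c *\<^sub>R x))"
  shows "((\<lambda>x. f (a + c *\<^sub>R x)) has_derivative (\<lambda>h. \<Sum>i\<in>UNIV. (c * h $ i) *\<^sub>R partial i f (a + c *\<^sub>R x))) (at x)"
    and "partial i (\<lambda>x. f (a + c *\<^sub>R x)) x = c * partial i f (a + c *\<^sub>R x)"
proof -
  have "((\<lambda>x. a + c *\<^sub>R x) has_derivative (\<lambda>h. c *\<^sub>R h)) (at x)"
    by (auto intro!: derivative_eq_intros)
  from has_derivative_compose[OF this has_derivative_partial[OF assms]]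
  show *: "((\<lambda>x. f (a + c *\<^sub>R x)) has_derivative (\<lambda>h. \<Sum>i\<in>UNIV. (c * h $ i) *\<^sub>R partial i f (a + c *\<^sub>R x))) (at x)"
    by simp
  show "partial i (\<lambda>x. f (a + c *\<^sub>R x)) x = c * partial i f (a + c *\<^sub>R x)"
    using partial_eqI[OF *, of i] sum_axis_scaleR[of i "\<lambda>i. c *\<^sub>R partial i f (a + c *\<^sub>R x)"]
    by (simp add: scaleR_conv_of_real mult_ac)
qed

lemma smooth_affine:
  assumes "smooth f" shows "smooth (\<lambda>x. f (a + c *\<^sub>R x))"
proof (rule smooth_coinduct[where S="{\<lambda>x. d * f (a + c *\<^sub>R x) | d f. smooth f}"])
  show "(\<lambda>x. f (a + c *\<^sub>R x)) \<in> {\<lambda>x. d * f (a + c *\<^sub>R x) | d f. smooth f}"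
    using assms by (intro CollectI exI[of _ 1] exI[of _ f]) auto
next
  fix g x assume "g \<in> {\<lambda>x. d * f (a + c *\<^sub>R x) | d f. smooth f}"
  then obtain d f where g: "g = (\<lambda>x. d * f (a + c *\<^sub>R x))" "smooth f" by auto
  have "(\<lambda>x. f (a + c *\<^sub>R x)) differentiable (at x)"
    using partial_affine(1)[OF smooth_differentiable[OF g(2)], of a c x] by (auto simp: differentiable_def)
  then show "g differentiable (at x)" unfolding g(1) by (intro differentiable_mult differentiable_const)
next
  fix g i assume "g \<in> {\<lambda>x. d * f (a + c *\<^sub>R x) | d f. smooth f}"
  then obtain d f where g: "g = (\<lambda>x. d * f (a + c *\<^sub>R x))" "smooth f" by auto
  have "partial i g x = (d * c) * partial i f (a + c *\<^sub>R x)" for x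
  proof -
    have "(\<lambda>x. f (a + c *\<^sub>R x)) differentiable (at x)"
      using partial_affine(1)[OF smooth_differentiable[OF g(2)], of a c x] by (auto simp: differentiable_def)
    then show ?thesis unfolding g(1)
      by (simp add: partial_cmult partial_affine(2) smooth_differentiable g(2))
  qed
  then have "partial i g = (\<lambda>x. (d * c) * partial i f (a + c *\<^sub>R x))" by blast
  then show "partial i g \<in> {\<lambda>x. d * f (a + c *\<^sub>R x) | d f. smooth f}"
    using smooth_partial[OF g(2)] by blast
qed

section \<open>The flat exponential function and smooth bumps\<close>

definition flat_exp :: "nat \<Rightarrow> real \<Rightarrow> real" where
  "flat_exp k t = (if t > 0 then exp (- 1 / t) / t ^ k else 0)"

text \<open>The factors 1/t^k are carried along because differentiation of exp(-1/t) creates them;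
  thus the family over k is closed under derivatives up to linear combinations. The case t = 0 is
  the substantial one: there the difference quotient is a power of 1/t divided by exp(1/t).\<close>

lemma flat_exp_has_derivative:
  "(flat_exp k has_real_derivative flat_exp (k + 2) t - k * flat_exp (k + 1) t) (at t)"
proof -
  consider "t > 0" | "t < 0" | "t = 0" by linarith
  then show ?thesis
  proof cases
    case 1
    have "((\<lambda>t. exp (- 1 / t) / t ^ k) has_real_derivative flat_exp (k + 2) t - k * flat_exp (k + 1) t) (at t)"
    proof -
      have "((\<lambda>t. exp (- 1 / t) / t ^ k) has_real_derivative
          (exp (- 1 / t) * (1 / t\<^sup>2) * t ^ k - exp (- 1 / t) * (k * t ^ (k - 1))) / (t ^ k * t ^ k)) (at t)"
        using 1 by (auto intro!: derivative_eq_intros simp: power2_eq_square)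
      moreover have "(exp (- 1 / t) * (1 / t\<^sup>2) * t ^ k - exp (- 1 / t) * (k * t ^ (k - 1))) / (t ^ k * t ^ k)
          = flat_exp (k + 2) t - k * flat_exp (k + 1) t"
        using 1 by (cases k) (simp_all add: flat_exp_def field_simps power2_eq_square)
      ultimately show ?thesis by simp
    qed
    then show ?thesis
      by (rule DERIV_cong_ev[THEN iffD1, rotated -1, OF _ refl _ refl])
         (use eventually_nhds_in_open[of "{0<..}" t] 1 in \<open>auto simp: flat_exp_def elim!: eventually_mono\<close>)
  next
    case 2
    have "((\<lambda>t. 0) has_real_derivative flat_exp (k + 2) t - k * flat_exp (k + 1) t) (at t)"
      using 2 by (simp add: flat_exp_def)
    then show ?thesis
      by (rule DERIV_cong_ev[THEN iffD1, rotated -1, OF _ refl _ refl])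
         (use eventually_nhds_in_open[of "{..<0}" t] 2 in \<open>auto simp: flat_exp_def elim!: eventually_mono\<close>)
  next
    case 3
    have "((\<lambda>y. flat_exp k y / y) \<longlongrightarrow> 0) (at_right 0)"
    proof (rule Lim_transform_eventually)
      show "((\<lambda>y::real. inverse y ^ (k + 1) / exp (inverse y)) \<longlongrightarrow> 0) (at_right 0)"
        using filterlim_compose[OF tendsto_power_div_exp_0 filterlim_inverse_at_top_right] .
      show "\<forall>\<^sub>F y in at_right 0. inverse y ^ (k + 1) / exp (inverse y) = flat_exp k y / y"
        using eventually_at_right_less[of "0::real"]
        by eventually_elim (simp add: flat_exp_def exp_minus divide_simps)
    qed
    moreover have "((\<lambda>y. flat_exp k y / y) \<longlongrightarrow> 0) (at_left 0)"
    proof (rule Lim_transform_eventually)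
      show "\<forall>\<^sub>F y in at_left 0. 0 = flat_exp k y / y"
        by (auto simp: eventually_at_left_field flat_exp_def intro!: exI[of _ "-1"])
    qed simp
    ultimately have "((\<lambda>y. flat_exp k y / y) \<longlongrightarrow> 0) (at 0)" by (simp add: filterlim_split_at)
    then show ?thesis unfolding 3 by (simp add: has_field_derivative_iff flat_exp_def)
  qed
qed

lemma smooth_flat_exp:
  fixes r :: "real ^ 'n \<Rightarrow> real"
  assumes r: "smooth (\<lambda>x. complex_of_real (r x))"
  shows "smooth (\<lambda>x. complex_of_real (flat_exp k (r x)))"
proof -
  let ?S = "{\<lambda>x. h x * complex_of_real (flat_exp k (r x)) | h k. smooth h}"
  let ?r = "\<lambda>x. complex_of_real (r x)"
  have d: "((\<lambda>x. complex_of_real (flat_exp k (r x))) has_derivative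
     (\<lambda>h. complex_of_real (flat_exp (k + 2) (r x) - k * flat_exp (k + 1) (r x)) * (\<Sum>i\<in>UNIV. h $ i *\<^sub>R partial i ?r x))) (at x)" for k x
  proof -
    let ?D = "\<lambda>h. \<Sum>i\<in>UNIV. h $ i *\<^sub>R partial i ?r x"
    have D: "(?r has_derivative ?D) (at x)"
      by (rule has_derivative_partial[OF smooth_differentiable[OF r]])
    have rR: "((\<lambda>x. Re (?r x)) has_derivative (\<lambda>h. Re (?D h))) (at x)"
      by (rule bounded_linear.has_derivative[OF bounded_linear_Re D])
    have Im0: "((\<lambda>x. Im (?r x)) has_derivative (\<lambda>h. Im (?D h))) (at x)"
      by (rule bounded_linear.has_derivative[OF bounded_linear_Im D])
    \<comment> \<open>The derivative of the real function r is only available through the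
      complex-valued \<open>partial\<close>. Comparison with the zero function shows that its
      imaginary part vanishes, so that the real chain rule applies.\<close>
    have "((\<lambda>x. 0) has_derivative (\<lambda>h. Im (?D h))) (at x)" using Im0 by simp
    from has_derivative_unique[OF this has_derivative_const] have "Im (?D h) = 0" for h by meson
    then have Dr: "complex_of_real (Re (?D h)) = ?D h" for h by (simp add: complex_eq_iff)
    have "(r has_derivative (\<lambda>h. Re (?D h))) (at x)" using rR by simp
    from has_derivative_compose[OF this flat_exp_has_derivative[of k "r x", unfolded has_field_derivative_def]]
    have "((\<lambda>x. flat_exp k (r x)) has_derivative
      (\<lambda>h. (flat_exp (k + 2) (r x) - k * flat_exp (k + 1) (r x)) * Re (?D h))) (at x)" by simp
    from bounded_linear.has_derivative[OF bounded_linear_of_real[where 'a=complex] this]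
    show ?thesis unfolding of_real_mult Dr .
  qed
  have diff: "(\<lambda>x. complex_of_real (flat_exp k (r x))) differentiable (at x)" for k x
    using d by (auto simp: differentiable_def)
  have part: "partial i (\<lambda>x. complex_of_real (flat_exp k (r x))) x
     = complex_of_real (flat_exp (k + 2) (r x) - k * flat_exp (k + 1) (r x)) * partial i ?r x" for k i x
    using partial_eqI[OF d, of i k x] by (simp only: sum_axis_scaleR)
  show ?thesis
  proof (rule smooth_coinduct_sum[where S="?S"])
    show "(\<lambda>x. complex_of_real (flat_exp k (r x))) \<in> ?S"
      using smooth_const[of 1] by (intro CollectI exI[of _ "\<lambda>_. 1"] exI[of _ k]) auto
    show "g differentiable (at x)" if "g \<in> ?S" for g x
      using that diff by (auto intro: differentiable_mult smooth_differentiable)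
    show "\<exists>gs. set gs \<subseteq> ?S \<and> (\<forall>x. partial i g x = (\<Sum>h\<leftarrow>gs. h x))" if "g \<in> ?S" for g i
    proof -
      from that obtain h k where h: "g = (\<lambda>x. h x * complex_of_real (flat_exp k (r x)))" "smooth h" by auto
      let ?gs = "[\<lambda>x. (h x * partial i ?r x) * complex_of_real (flat_exp (k + 2) (r x)),
         \<lambda>x. (complex_of_real (- real k) * (h x * partial i ?r x)) * complex_of_real (flat_exp (k + 1) (r x)),
         \<lambda>x. partial i h x * complex_of_real (flat_exp k (r x))]"
      have "partial i g x = (\<Sum>h\<leftarrow>?gs. h x)" for x
        unfolding h(1) using partial_mult[OF smooth_differentiable[OF h(2)] diff, of i k x]
        by (simp add: part algebra_simps)
      moreover have "set ?gs \<subseteq> ?S"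
      proof -
        have s1: "smooth (\<lambda>x. h x * partial i ?r x)"
          and s2: "smooth (\<lambda>x. complex_of_real (- real k) * (h x * partial i ?r x))"
          and s3: "smooth (partial i h)"
          using h(2) r by (intro smooth_mult smooth_partial smooth_const; simp)+
        have "(\<lambda>x. u x * complex_of_real (flat_exp m (r x))) \<in> ?S" if "smooth u" for u m
          using that by blast
        from this[OF s1] this[OF s2] this[OF s3] show ?thesis
          by (simp only: list.set insert_subset empty_subsetI)
      qed
      ultimately show ?thesis by blast
    qed
  qed
qed

lemma flat_exp_nonneg: "0 \<le> flat_exp k t" and flat_exp_0_le_1: "flat_exp 0 t \<le> 1"
  by (auto simp: flat_exp_def)

lemma norm_vec_square: "(norm (x :: real ^ 'n))\<^sup>2 = (\<Sum>i\<in>UNIV. (x $ i)\<^sup>2)"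
  unfolding power2_norm_eq_inner inner_vec_def by (simp add: power2_eq_square)

text \<open>The factor k controls the steepness: for k = R tending to infinity the values tend to 1
  everywhere. There is no normalization; \<open>bump 1 1 0\<close> is exp(-1), so cutoffs made from
  it converge to this nonzero constant instead of 1.\<close>

definition bump :: "real \<Rightarrow> real \<Rightarrow> real ^ 'n \<Rightarrow> complex" where
  "bump k R x = complex_of_real (flat_exp 0 (k * (R\<^sup>2 - (norm x)\<^sup>2)))"

lemma smooth_bump: "smooth (bump k R)"
proof -
  have "smooth (\<lambda>x::real^'n. complex_of_real (k * R\<^sup>2) - complex_of_real k * (\<Sum>i\<in>UNIV. complex_of_real (x $ i) * complex_of_real (x $ i)))"
    by (intro smooth_diff smooth_const smooth_mult smooth_sum smooth_coord) simp
  also have "(\<lambda>x::real^'n. complex_of_real (k * R\<^sup>2) - complex_of_real k * (\<Sum>i\<in>UNIV. complex_of_real (x $ i) * complex_of_real (x $ i)))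
    = (\<lambda>x. complex_of_real (k * (R\<^sup>2 - (norm x)\<^sup>2)))"
    unfolding norm_vec_square by (rule ext) (simp add: power2_eq_square right_diff_distrib)
  finally show ?thesis unfolding bump_def by (rule smooth_flat_exp)
qed

lemma norm_bump_le_1: "norm (bump k R x) \<le> 1"
  by (simp add: bump_def flat_exp_nonneg flat_exp_0_le_1)

lemma bump_eq_0: "0 \<le> k \<Longrightarrow> 0 \<le> R \<Longrightarrow> R \<le> norm x \<Longrightarrow> bump k R x = 0"
  by (auto simp: bump_def flat_exp_def zero_less_mult_iff not_less power_mono)

lemma bump_neq_0: "0 < k \<Longrightarrow> norm x < R \<Longrightarrow> bump k R x \<noteq> 0"
  by (auto simp: bump_def flat_exp_def intro!: mult_pos_pos power_strict_mono)

lemma bump_tendsto: "(\<lambda>n. bump (real n) (real n) x) \<longlonglongrightarrow> 1"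
proof -
  have "filterlim (\<lambda>n. - (norm x)\<^sup>2 + (real n)\<^sup>2) at_top sequentially"
    by (intro filterlim_tendsto_add_at_top[OF tendsto_const] filterlim_pow_at_top filterlim_real_sequentially) simp
  then have "filterlim (\<lambda>n. (real n)\<^sup>2 - (norm x)\<^sup>2) at_top sequentially" by simp
  then have t: "filterlim (\<lambda>n. real n * ((real n)\<^sup>2 - (norm x)\<^sup>2)) at_top sequentially"
    by (intro filterlim_at_top_mult_at_top filterlim_real_sequentially)
  have "((\<lambda>t. exp (- inverse t)) \<longlongrightarrow> exp (- 0)) (at_top :: real filter)"
    by (intro tendsto_intros tendsto_inverse_0_at_top filterlim_ident)
  then have "((\<lambda>t. flat_exp 0 t) \<longlongrightarrow> exp (- 0)) at_top"
    by (rule Lim_transform_eventually) (use eventually_gt_at_top[of 0] in eventually_elim, simp add: flat_exp_def inverse_eq_divide)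
  from filterlim_compose[OF this t] show ?thesis
    unfolding bump_def by (intro tendsto_of_real[where 'a=complex, of _ 1, simplified]) simp
qed

subsection \<open>Test functions\<close>

lemma test_function_iff: "test_function \<eta> \<longleftrightarrow> smooth \<eta> \<and> (\<exists>R>0. \<forall>x. norm x > R \<longrightarrow> \<eta> x = 0)"
proof -
  have "bounded {x. \<eta> x \<noteq> 0} \<longleftrightarrow> (\<exists>R>0. \<forall>x. norm x > R \<longrightarrow> \<eta> x = 0)"
    unfolding bounded_pos by (auto simp: not_le[symmetric])
  then show ?thesis by (simp add: test_function_def smooth_def compact_closure)
qed

lemma test_function_smooth: "test_function \<eta> \<Longrightarrow> smooth \<eta>"
  by (simp add: test_function_iff)

lemma smooth_continuous: "smooth f \<Longrightarrow> continuous_on S f"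
  by (meson continuous_at_imp_continuous_on differentiable_imp_continuous_within smooth_differentiable)

lemma smooth_borel [measurable_dest]: "smooth f \<Longrightarrow> f \<in> borel_measurable borel"
  by (intro borel_measurable_continuous_onI smooth_continuous)

lemma partial_vanish:
  assumes "\<And>x. norm x > R \<Longrightarrow> \<eta> x = 0" and "norm x > R"
  shows "partial i \<eta> x = 0"
proof (rule partial_eqI[of _ "\<lambda>_. 0", simplified])
  have "open {y. norm y > R}" by (intro open_Collect_less continuous_intros)
  then have "\<forall>\<^sub>F y in nhds x. norm y > R"
    using eventually_nhds_in_open[of "{y. norm y > R}" x] assms(2) by simp
  then have "\<forall>\<^sub>F y in nhds x. 0 = \<eta> y"
    by (rule eventually_mono) (simp add: assms(1))
  then show "(\<eta> has_derivative (\<lambda>_. 0)) (at x)"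
    by (intro has_derivative_transform_eventually[OF has_derivative_const[of 0]])
       (auto simp: eventually_at_filter assms elim: eventually_mono)
qed

lemma test_function_partial:
  assumes "test_function \<eta>" shows "test_function (partial i \<eta>)"
  using assms partial_vanish[of _ \<eta> _ i] unfolding test_function_iff by (blast intro: smooth_partial)

lemma test_function_iter_partial: "test_function \<eta> \<Longrightarrow> test_function (iter_partial is \<eta>)"
  by (induction "is") (auto intro: test_function_partial)

lemma test_function_add:
  assumes "test_function \<eta>" "test_function \<zeta>" shows "test_function (\<lambda>x. \<eta> x + \<zeta> x)"
proof -
  obtain R S where "R > 0" "\<And>x. norm x > R \<Longrightarrow> \<eta> x = 0" "\<And>x. norm x > S \<Longrightarrow> \<zeta> x = 0"
    using assms unfolding test_function_iff by blast
  then show ?thesis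
    using assms unfolding test_function_iff by (auto intro!: smooth_add exI[of _ "max R S"])
qed

lemma test_function_sum:
  assumes "finite A" "A \<noteq> {}" "\<And>i. i \<in> A \<Longrightarrow> test_function (f i)"
  shows "test_function (\<lambda>x. \<Sum>i\<in>A. f i x)"
  using assms by (induction A rule: finite_ne_induct) (auto intro: test_function_add)

lemma test_function_mult:
  assumes "test_function \<eta>" "smooth f" shows "test_function (\<lambda>x. \<eta> x * f x)"
  using assms unfolding test_function_iff by (auto intro!: smooth_mult)

lemma test_function_laplacian: "test_function \<eta> \<Longrightarrow> test_function (laplacian \<eta>)"
  unfolding laplacian_def[abs_def] by (intro test_function_sum test_function_iter_partial) auto

lemma test_function_affine:
  assumes "test_function \<eta>" "c \<noteq> 0" shows "test_function (\<lambda>x. \<eta> (a + c *\<^sub>R x))"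
proof -
  obtain R where R: "R > 0" "\<And>x. norm x > R \<Longrightarrow> \<eta> x = 0"
    using assms unfolding test_function_iff by blast
  have "\<eta> (a + c *\<^sub>R x) = 0" if "norm x > (R + norm a) / \<bar>c\<bar>" for x
  proof (rule R(2))
    have "R + norm a < \<bar>c\<bar> * norm x" using that assms(2) by (simp add: field_simps)
    also have "\<bar>c\<bar> * norm x \<le> norm (a + c *\<^sub>R x) + norm a"
      using norm_triangle_ineq4[of "a + c *\<^sub>R x" a] by simp
    finally show "norm (a + c *\<^sub>R x) > R" by simp
  qed
  moreover have "(R + norm a) / \<bar>c\<bar> > 0" using R assms(2) by (intro divide_pos_pos add_pos_nonneg) auto
  ultimately show ?thesis
    using assms(1) unfolding test_function_iff by (blast intro: smooth_affine)
qed

lemma test_function_bump: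
  assumes "k \<ge> 0" "R > 0" shows "test_function (bump k R)"
  unfolding test_function_iff using assms by (auto intro!: smooth_bump exI[of _ R] bump_eq_0)

text \<open>Lets test functions enter all decay estimates with an exponent of choice. On the ball of
  radius R that carries the function, (1 + R) \<open>wt x\<close> is at least 1.\<close>

lemma test_function_bound:
  fixes \<eta> :: "real ^ 'n \<Rightarrow> complex"
  assumes "test_function \<eta>" shows "\<exists>C>0. \<forall>x. norm (\<eta> x) \<le> C * wt x ^ k"
proof -
  obtain R where R: "R > 0" "\<And>x. norm x > R \<Longrightarrow> \<eta> x = 0"
    using assms unfolding test_function_iff by blast
  have "compact (\<eta> ` cball 0 R)"
    using assms by (intro compact_continuous_image smooth_continuous test_function_smooth) auto
  then obtain B where B: "B > 0" "\<And>x. norm x \<le> R \<Longrightarrow> norm (\<eta> x) \<le> B"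
    using compact_imp_bounded bounded_pos by (metis image_eqI mem_cball_0)
  have "norm (\<eta> x) \<le> B * (1 + R) ^ k * wt x ^ k" for x
  proof (cases "norm x \<le> R")
    case True
    have "1 \<le> (1 + R) * wt x"
      using japanese_bracket_le[of x] japanese_bracket_ge_1[of x] True by (simp add: wt_def field_simps)
    then have "1 \<le> ((1 + R) * wt x) ^ k" by simp
    then have "B * 1 \<le> B * ((1 + R) * wt x) ^ k" using B(1) by (intro mult_left_mono) auto
    then show ?thesis using B(2)[OF True] by (simp add: power_mult_distrib mult.assoc)
  qed (use R B in auto)
  moreover have "B * (1 + R) ^ k > 0" using B R by simp
  ultimately show ?thesis by blast
qed

lemma integrable_wt_bound:
  fixes f :: "real ^ 'n \<Rightarrow> complex"
  assumes [measurable]: "f \<in> borel_measurable borel" and "\<And>x. norm (f x) \<le> C * wt x ^ k" and "k > CARD('n)"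
  shows "integrable lborel f"
  by (rule Bochner_Integration.integrable_bound[OF integrable_mult_right[OF wt_power_integrable[OF assms(3)], of C]])
     (use assms(2) in \<open>auto intro!: AE_I2 intro: order_trans[OF _ abs_ge_self]\<close>)

lemma test_function_integrable:
  fixes \<eta> :: "real ^ 'n \<Rightarrow> complex"
  assumes "test_function \<eta>" shows "integrable lborel \<eta>"
  using test_function_bound[OF assms, of "Suc CARD('n)"] assms
  by (auto intro!: integrable_wt_bound[where k="Suc CARD('n)"] smooth_borel test_function_smooth)

subsection \<open>Density of test functions\<close>

text \<open>A measurable function is an almost everywhere limit of continuous ones. These are
  truncated to size h, replaced by polynomials on growing balls and multiplied by bumps. The bound 2
  h is the point of the construction: it serves as the majorant for dominated convergence.\<close>

lemma test_function_approximation: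
  fixes f :: "real ^ 'n \<Rightarrow> complex"
  assumes f: "f \<in> borel_measurable lebesgue" and h: "continuous_on UNIV h" "\<And>x. 0 < h x"
    and fh: "\<And>x. norm (f x) \<le> h x"
  shows "\<exists>\<eta>. (\<forall>k. test_function (\<eta> k)) \<and> (\<forall>k x. norm (\<eta> k x) \<le> 2 * h x) \<and>
    (AE x in lborel. (\<lambda>k. \<eta> k x) \<longlonglongrightarrow> f x)"
proof -
  have "f measurable_on UNIV" by (rule lebesgue_measurable_imp_measurable_on[OF f]) simp
  then obtain N g where N: "negligible N" and g: "\<And>k. continuous_on UNIV (g k)"
    and lim: "\<And>x. x \<notin> N \<Longrightarrow> (\<lambda>k. g k x) \<longlonglongrightarrow> f x"
    unfolding measurable_on_def by auto
  \<comment> \<open>Radial truncation to the disc of radius h x. Written with a maximum it is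
    visibly continuous and leaves values of norm at most h x unchanged.\<close>
  define c where "c k x = (h x / max (h x) (norm (g k x))) *\<^sub>R g k x" for k :: nat and x
  have mpos: "0 < max (h x) (norm (g k x))" for k x using h(2)[of x] by (simp add: less_max_iff_disj)
  have c_cont: "continuous_on S (c k)" for k S
    unfolding c_def using continuous_on_subset[OF h(1)] continuous_on_subset[OF g] mpos
    by (intro continuous_intros) (auto simp: less_imp_neq[symmetric])
  have c_le: "norm (c k x) \<le> h x" for k x
  proof -
    have "norm (c k x) = h x * (norm (g k x) / max (h x) (norm (g k x)))"
      using h(2)[of x] mpos[of x k] by (simp add: c_def)
    also have "\<dots> \<le> h x * 1"
      using h(2)[of x] mpos[of x k] by (intro mult_left_mono) (auto simp: divide_le_eq)
    finally show ?thesis by simp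
  qed
  \<comment> \<open>A positive lower bound of h on the ball; a polynomial error below it costs at
    most another h x, whence the factor 2.\<close>
  have "\<exists>e>0. \<forall>x\<in>cball 0 (real k). e \<le> h x" for k :: nat
  proof -
    obtain y where "y \<in> cball 0 (real k)" "\<And>x. x \<in> cball 0 (real k) \<Longrightarrow> h y \<le> h x"
      using continuous_attains_inf[of "cball 0 (real k)" h] continuous_on_subset[OF h(1)] by (auto simp: not_less)
    then show ?thesis using h(2) by blast
  qed
  then obtain e where e: "\<And>k::nat. e k > 0" "\<And>k x. norm x \<le> real k \<Longrightarrow> e k \<le> h x"
    by (metis mem_cball_0)
  have "\<exists>p. polynomial_function p \<and> (\<forall>x\<in>cball 0 (real k). norm (c k x - p x) < min (e k) (1 / real (Suc k)))" for k
    using e(1)[of k] by (intro Stone_Weierstrass_polynomial_function c_cont) auto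
  then obtain p where p: "\<And>k. polynomial_function (p k)"
    "\<And>k x. norm x \<le> real k \<Longrightarrow> norm (c k x - p k x) < min (e k) (1 / real (Suc k))"
    by (metis mem_cball_0)
  define \<eta> where "\<eta> k x = bump (real k) (real k) x * p k x" for k x
  \<comment> \<open>For k = 0 the bump has radius 0 and vanishes identically, outside the scope of
    \<open>test_function_bump\<close>.\<close>
  have "test_function (\<eta> k)" for k
  proof (cases "k = 0")
    case True
    then have "\<eta> k = (\<lambda>x. 0)" by (auto simp: \<eta>_def bump_eq_0)
    then show ?thesis by (auto simp: test_function_iff smooth_const intro: exI[of _ 1])
  next
    case False
    then show ?thesis unfolding \<eta>_def
      by (intro test_function_mult test_function_bump smooth_polynomial p) auto
  qed
  moreover have "norm (\<eta> k x) \<le> 2 * h x" for k x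
  proof (cases "norm x \<le> real k")
    case True
    have "norm (p k x) \<le> norm (c k x) + norm (c k x - p k x)"
      by (metis norm_minus_commute norm_triangle_sub)
    also have "\<dots> \<le> h x + h x"
      using p(2)[OF True] e(2)[OF True] c_le[of k x] by simp
    finally have "norm (p k x) \<le> 2 * h x" by simp
    then show ?thesis unfolding \<eta>_def norm_mult
      by (rule order_trans[OF mult_left_le_one_le[OF norm_ge_zero norm_ge_zero norm_bump_le_1]])
  next
    case False
    then have "\<eta> k x = 0" by (simp add: \<eta>_def bump_eq_0)
    then show ?thesis using h(2)[of x] by simp
  qed
  moreover have "AE x in lborel. (\<lambda>k. \<eta> k x) \<longlonglongrightarrow> f x"
  proof -
    have "(\<lambda>k. \<eta> k x) \<longlonglongrightarrow> f x" if "x \<notin> N" for x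
    proof -
      have "(\<lambda>k. c k x) \<longlonglongrightarrow> (h x / max (h x) (norm (f x))) *\<^sub>R f x"
        unfolding c_def using lim[OF that] h(2)[of x] by (intro tendsto_intros) (auto simp: less_max_iff_disj max_def)
      moreover have "max (h x) (norm (f x)) = h x" using fh[of x] by (simp add: max_def)
      ultimately have c: "(\<lambda>k. c k x) \<longlonglongrightarrow> f x" using h(2)[of x] by simp
      have "(\<lambda>k. c k x - p k x) \<longlonglongrightarrow> 0"
      proof (rule Lim_null_comparison)
        show "\<forall>\<^sub>F k in sequentially. norm (c k x - p k x) \<le> 1 / real (Suc k)"
          using eventually_ge_at_top[of "nat \<lceil>norm x\<rceil>"]
          by eventually_elim (use p(2) in \<open>force simp: nat_le_iff ceiling_le_iff intro: less_imp_le\<close>)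
        show "(\<lambda>k. 1 / real (Suc k)) \<longlonglongrightarrow> 0" by (rule LIMSEQ_Suc) (rule lim_1_over_n)
      qed
      from tendsto_diff[OF c this] have "(\<lambda>k. p k x) \<longlonglongrightarrow> f x" by simp
      from tendsto_mult[OF bump_tendsto[of x] this] show ?thesis unfolding \<eta>_def by simp
    qed
    moreover have "AE x in lborel. x \<notin> N"
    proof -
      have "N \<in> null_sets lebesgue" using N by (simp add: negligible_iff_null_sets)
      then have "AE x in lebesgue. x \<notin> N" by (rule AE_not_in)
      then show ?thesis by (simp add: AE_completion_iff)
    qed
    ultimately show ?thesis by (auto elim: eventually_mono)
  qed
  ultimately show ?thesis by blast
qed

text \<open>The fundamental lemma of the calculus of variations. After localization by a bump, w' is
  integrable and may be tested with bounded approximations of the conjugate of its sign; in the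
  limit the integral of |w'| is zero. The bump has no zeros inside its ball, so w vanishes there
  too.\<close>

lemma AE_eq_0_if_test_integrals_eq_0:
  fixes w :: "real ^ 'n \<Rightarrow> complex"
  assumes [measurable]: "w \<in> borel_measurable borel"
    and loc: "\<And>K. compact K \<Longrightarrow> set_integrable lborel K w"
    and zero: "\<And>\<eta>. test_function \<eta> \<Longrightarrow> (LINT x|lborel. w x * \<eta> x) = 0"
  shows "AE x in lborel. w x = 0"
proof -
  have "AE x in lborel. norm x < real (Suc R) \<longrightarrow> w x = 0" for R
  proof -
    let ?b = "bump 1 (real (Suc R)) :: real ^ 'n \<Rightarrow> complex"
    define w' where "w' x = w x * ?b x" for x
    have [measurable]: "?b \<in> borel_measurable borel" by (intro smooth_borel smooth_bump)
    have [measurable]: "w' \<in> borel_measurable borel" unfolding w'_def by measurable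
    have b0: "?b x = 0" if "norm x \<ge> real (Suc R)" for x using that by (intro bump_eq_0) auto
    have int: "integrable lborel w'"
    proof (rule Bochner_Integration.integrable_bound)
      show "integrable lborel (\<lambda>x. indicator (cball 0 (real (Suc R))) x *\<^sub>R w x)"
        using loc[of "cball 0 (real (Suc R))"] by (simp add: set_integrable_def)
      show "AE x in lborel. norm (w' x) \<le> norm (indicator (cball 0 (real (Suc R))) x *\<^sub>R w x)"
        using norm_bump_le_1[of 1 "real (Suc R)"] b0
        by (intro AE_I2) (auto simp: w'_def norm_mult indicator_def intro!: mult_left_le)
    qed measurable
    define f where "f x = cnj (sgn (w' x))" for x
    have [measurable]: "f \<in> borel_measurable borel"
    proof -
      have [measurable]: "cnj \<in> borel_measurable borel" by (intro borel_measurable_continuous_onI continuous_intros)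
      show ?thesis unfolding f_def sgn_eq by measurable
    qed
    have "f \<in> borel_measurable lebesgue" by (intro measurable_completion) simp
    moreover have "norm (f x) \<le> 1" for x by (simp add: f_def norm_sgn)
    ultimately
    obtain \<eta> where \<eta>: "\<And>k. test_function (\<eta> k)" "\<And>k x. norm (\<eta> k x) \<le> 2" "AE x in lborel. (\<lambda>k. \<eta> k x) \<longlonglongrightarrow> f x"
      using test_function_approximation[of f "\<lambda>_. 1"] by auto
    have [measurable]: "\<eta> k \<in> borel_measurable borel" for k
      by (intro smooth_borel test_function_smooth \<eta>)
    have "(\<lambda>k. LINT x|lborel. w' x * \<eta> k x) \<longlonglongrightarrow> (LINT x|lborel. w' x * f x)"
    proof (rule integral_dominated_convergence[where w="\<lambda>x. 2 * norm (w' x)"])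
      show "integrable lborel (\<lambda>x. 2 * norm (w' x))" using int by simp
      show "AE x in lborel. (\<lambda>k. w' x * \<eta> k x) \<longlonglongrightarrow> w' x * f x"
        using \<eta>(3) by eventually_elim (intro tendsto_intros)
      show "AE x in lborel. norm (w' x * \<eta> k x) \<le> 2 * norm (w' x)" for k
        by (intro AE_I2) (simp add: norm_mult mult.commute[of 2] mult_left_mono[OF \<eta>(2)])
    qed measurable
    moreover have "(LINT x|lborel. w' x * \<eta> k x) = 0" for k
      using zero[OF test_function_mult[OF \<eta>(1) smooth_bump], of k 1 "real (Suc R)"]
      by (simp add: w'_def mult_ac)
    ultimately have "(LINT x|lborel. w' x * f x) = 0" by (simp add: LIMSEQ_const_iff)
    moreover have "w' x * f x = complex_of_real (norm (w' x))" for x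
      by (cases "w' x = 0") (simp_all add: f_def sgn_eq complex_norm_square[symmetric] power2_eq_square)
    ultimately have "(LINT x|lborel. norm (w' x)) = 0" by (simp add: integral_complex_of_real)
    then have "AE x in lborel. w' x = 0" using int by (subst (asm) integral_nonneg_eq_0_iff_AE) auto
    then show ?thesis
      by eventually_elim (auto simp: w'_def bump_neq_0)
  qed
  then have "AE x in lborel. \<forall>R. norm x < real (Suc R) \<longrightarrow> w x = 0"
    by (rule AE_all_countable[THEN iffD2, rule_format])
  then show ?thesis
    by eventually_elim (metis reals_Archimedean2 less_trans of_nat_less_iff lessI)
qed

subsection \<open>Integration by parts\<close>

lemma directional_difference_quotient:
  fixes F :: "real ^ 'n \<Rightarrow> complex"
  assumes "F differentiable (at x)"
  shows "(\<lambda>k. real (Suc k) *\<^sub>R (F (x + axis i (1 / real (Suc k))) - F x)) \<longlonglongrightarrow> partial i F x"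
proof -
  let ?D = "\<lambda>h. \<Sum>i\<in>UNIV. h $ i *\<^sub>R partial i F x"
  let ?h = "\<lambda>k. axis i (1 / real (Suc k)) :: real ^ 'n"
  have ax: "?h k = (1 / real (Suc k)) *\<^sub>R axis i 1" for k by (simp add: vec_eq_iff axis_def)
  have n: "norm (?h k) = 1 / real (Suc k)" for k unfolding ax by simp
  have Dh: "?D (?h k) = (1 / real (Suc k)) *\<^sub>R partial i F x" for k
    unfolding ax using sum_axis_scaleR[of i "\<lambda>j. (1 / real (Suc k)) *\<^sub>R partial j F x"] by (simp add: mult.commute)
  have "(\<lambda>h. norm (F (x + h) - F x - ?D h) / norm h) \<midarrow>0\<rightarrow> 0"
    using has_derivative_partial[OF assms] by (simp add: has_derivative_at)
  moreover have "filterlim ?h (at 0) sequentially"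
  proof (rule filterlim_atI)
    have "(\<lambda>k. (1 / real (Suc k)) *\<^sub>R axis i (1::real) :: real ^ 'n) \<longlonglongrightarrow> 0 *\<^sub>R axis i 1"
      by (intro tendsto_intros LIMSEQ_Suc lim_1_over_n)
    then show "?h \<longlonglongrightarrow> 0" unfolding ax by simp
    show "\<forall>\<^sub>F k in sequentially. ?h k \<noteq> 0" by (simp add: axis_eq_0_iff)
  qed
  ultimately have "(\<lambda>k. norm (F (x + ?h k) - F x - ?D (?h k)) / norm (?h k)) \<longlonglongrightarrow> 0"
    by (rule filterlim_compose)
  moreover have "norm (F (x + ?h k) - F x - ?D (?h k)) / norm (?h k)
     = norm (real (Suc k) *\<^sub>R (F (x + ?h k) - F x) - partial i F x)" for k
  proof -
    have "real (Suc k) *\<^sub>R (F (x + ?h k) - F x) - partial i F x = real (Suc k) *\<^sub>R (F (x + ?h k) - F x - ?D (?h k))"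
      unfolding Dh by (simp add: scaleR_diff_right del: of_nat_Suc)
    then show ?thesis unfolding n by (simp del: of_nat_Suc)
  qed
  ultimately show ?thesis
    by (subst LIM_zero_iff[symmetric], subst tendsto_norm_zero_iff[symmetric]) simp
qed

text \<open>A derivative that exists everywhere need not be continuous, but it is a pointwise limit
  of difference quotients.\<close>

lemma borel_measurable_partial:
  fixes F :: "real ^ 'n \<Rightarrow> complex"
  assumes "\<And>x. F differentiable (at x)"
  shows "partial i F \<in> borel_measurable borel"
proof (rule borel_measurable_LIMSEQ_metric)
  have [measurable]: "F \<in> borel_measurable borel"
    using assms by (intro borel_measurable_continuous_onI) (meson continuous_at_imp_continuous_on differentiable_imp_continuous_within)
  show "(\<lambda>x. real (Suc k) *\<^sub>R (F (x + axis i (1 / real (Suc k))) - F x)) \<in> borel_measurable borel" for k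
    by measurable
  show "(\<lambda>k. real (Suc k) *\<^sub>R (F (x + axis i (1 / real (Suc k))) - F x)) \<longlonglongrightarrow> partial i F x" for x
    by (rule directional_difference_quotient[OF assms])
qed

text \<open>By translation invariance the difference quotients have integral zero.\<close>

lemma integral_partial_eq_0:
  fixes F :: "real ^ 'n \<Rightarrow> complex"
  assumes diff: "\<And>x. F differentiable (at x)" and int: "integrable lborel F"
    and bound: "\<And>x. norm (partial i F x) \<le> C * wt x ^ k" and k: "k > CARD('n)"
  shows "(LINT x|lborel. partial i F x) = 0"
proof -
  let ?d = "\<lambda>m x. real (Suc m) *\<^sub>R (F (x + axis i (1 / real (Suc m))) - F x)"
  have [measurable]: "F \<in> borel_measurable borel" using int by auto
  have [measurable]: "partial i F \<in> borel_measurable borel" by (rule borel_measurable_partial[OF diff])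
  have C0: "C \<ge> 0" using order_trans[OF norm_ge_zero bound[of 0]] zero_less_power[OF wt_pos[of "0 :: real ^ 'n"], of k]
    by (simp add: zero_le_mult_iff)
  have "(\<lambda>m. LINT x|lborel. ?d m x) \<longlonglongrightarrow> (LINT x|lborel. partial i F x)"
  proof (rule integral_dominated_convergence[where w="\<lambda>x. (C * 2 ^ k) * wt x ^ k"])
    show "integrable lborel (\<lambda>x::real^'n. C * 2 ^ k * wt x ^ k)"
      by (intro integrable_mult_right wt_power_integrable k)
    show "AE x in lborel. (\<lambda>m. ?d m x) \<longlonglongrightarrow> partial i F x"
      by (intro AE_I2 directional_difference_quotient diff)
    show "AE x in lborel. norm (?d m x) \<le> C * 2 ^ k * wt x ^ k" for m
    proof (intro AE_I2)
      fix x
      let ?t = "1 / real (Suc m)"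
      have der: "((\<lambda>s. F (x + s *\<^sub>R axis i 1)) has_derivative (\<lambda>h. h *\<^sub>R partial i F (x + s *\<^sub>R axis i 1))) (at s)" for s
      proof -
        have "((\<lambda>s. x + s *\<^sub>R axis i 1) has_derivative (\<lambda>h. h *\<^sub>R axis i 1)) (at s)"
          by (auto intro!: derivative_eq_intros)
        from has_derivative_compose[OF this has_derivative_partial[OF diff]]
        show ?thesis
          using sum_axis_scaleR[of i "\<lambda>j. h *\<^sub>R partial j F (x + s *\<^sub>R axis i 1)" for h] by (simp add: mult.commute)
      qed
      \<comment> \<open>By the mean value inequality the quotient is bounded by the derivative at a
        point at distance less than 1 from x, where the weight is at most twice as large; this gives
        a majorant independent of m.\<close>
      have "\<exists>s\<in>{0<..<?t}. norm (F (x + ?t *\<^sub>R axis i 1) - F (x + 0 *\<^sub>R axis i 1)) \<le> norm ((?t - 0) *\<^sub>R partial i F (x + s *\<^sub>R axis i 1))"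
        by (rule mvt_general) (auto intro!: der continuous_at_imp_continuous_on has_derivative_continuous[OF der])
      then obtain s where s: "0 < s" "s < ?t"
        and le: "norm (F (x + ?t *\<^sub>R axis i 1) - F x) \<le> ?t * norm (partial i F (x + s *\<^sub>R axis i 1))"
        by auto
      have "?t \<le> 1" by simp
      then have "s < 1" using s(2) by linarith
      have "wt (x + s *\<^sub>R axis i 1) \<le> (1 + s) * wt x"
        using wt_shift[of x "s *\<^sub>R axis i 1"] s(1) by simp
      also have "\<dots> \<le> 2 * wt x" using \<open>s < 1\<close> by (intro mult_right_mono) auto
      finally have "wt (x + s *\<^sub>R axis i 1) \<le> 2 * wt x" .
      then have "wt (x + s *\<^sub>R axis i 1) ^ k \<le> (2 * wt x) ^ k" by (intro power_mono) auto
      then have "norm (partial i F (x + s *\<^sub>R axis i 1)) \<le> C * (2 * wt x) ^ k"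
        using bound[of "x + s *\<^sub>R axis i 1"] C0 by (meson mult_left_mono order_trans)
      then have "?t * norm (partial i F (x + s *\<^sub>R axis i 1)) \<le> ?t * (C * (2 * wt x) ^ k)"
        by (intro mult_left_mono) auto
      with le have "norm (F (x + ?t *\<^sub>R axis i 1) - F x) \<le> ?t * (C * (2 * wt x) ^ k)" by linarith
      moreover have "axis i ?t = (?t *\<^sub>R axis i 1 :: real ^ 'n)" by (simp add: vec_eq_iff axis_def)
      ultimately have "real (Suc m) * norm (F (x + axis i ?t) - F x) \<le> real (Suc m) * (?t * (C * (2 * wt x) ^ k))"
        by (intro mult_left_mono) auto
      then show "norm (?d m x) \<le> C * 2 ^ k * wt x ^ k"
        by (simp add: power_mult_distrib mult.assoc del: of_nat_Suc)
    qed
  qed measurable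
  moreover have "(LINT x|lborel. ?d m x) = 0" for m
  proof -
    have "(LINT x|lborel. F (x + axis i (1 / real (Suc m)))) = (LINT x|lborel. F x)"
      using lebesgue_integral_lborel_shift[of F "axis i (1 / real (Suc m))"] by (simp add: add.commute)
    moreover have "integrable lborel (\<lambda>x. F (x + axis i (1 / real (Suc m))))"
      using integrable_lborel_shift[OF int, of "axis i (1 / real (Suc m))"] by (simp add: add.commute)
    ultimately show ?thesis using int by simp
  qed
  ultimately show ?thesis by (simp add: LIMSEQ_const_iff)
qed

lemma integral_by_parts:
  fixes F G :: "real ^ 'n \<Rightarrow> complex"
  assumes F: "\<And>x. F differentiable (at x)" and G: "\<And>x. G differentiable (at x)"
    and FG: "\<And>x. norm (F x * G x) \<le> A * wt x ^ k"
    and FG': "\<And>x. norm (F x * partial i G x) \<le> A * wt x ^ k"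
    and F'G: "\<And>x. norm (partial i F x * G x) \<le> A * wt x ^ k"
    and k: "k > CARD('n)"
  shows "(LINT x|lborel. F x * partial i G x) = - (LINT x|lborel. partial i F x * G x)"
proof -
  have cont: "f \<in> borel_measurable borel" if "\<And>x. f differentiable (at x)" for f :: "real ^ 'n \<Rightarrow> complex"
    using that by (intro borel_measurable_continuous_onI) (meson continuous_at_imp_continuous_on differentiable_imp_continuous_within)
  note [measurable] = cont[OF F] cont[OF G] borel_measurable_partial[OF F] borel_measurable_partial[OF G]
  have p: "partial i (\<lambda>x. F x * G x) x = F x * partial i G x + partial i F x * G x" for x
    by (intro partial_mult F G)
  have "norm (partial i (\<lambda>x. F x * G x) x) \<le> (2 * A) * wt x ^ k" for x
    unfolding p using norm_triangle_ineq[of "F x * partial i G x" "partial i F x * G x"] FG'[of x] F'G[of x] by simp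
  moreover have "integrable lborel (\<lambda>x. F x * G x)" by (rule integrable_wt_bound[OF _ FG k]) measurable
  ultimately have "(LINT x|lborel. partial i (\<lambda>x. F x * G x) x) = 0"
    by (intro integral_partial_eq_0[OF differentiable_mult[OF F G] _ _ k])
  moreover have "integrable lborel (\<lambda>x. F x * partial i G x)" "integrable lborel (\<lambda>x. partial i F x * G x)"
    by (rule integrable_wt_bound[OF _ FG' k] integrable_wt_bound[OF _ F'G k]; measurable)+
  ultimately show ?thesis unfolding p by (simp add: add_eq_0_iff2)
qed

text \<open>The test function supplies all the decay, so that boundedness of F and of its derivative
  is enough for the weighted version.\<close>

lemma integral_by_parts_test:
  fixes F \<eta> :: "real ^ 'n \<Rightarrow> complex"
  assumes F: "\<And>x. F differentiable (at x)" and B: "\<And>x. norm (F x) \<le> B" "\<And>x. norm (partial i F x) \<le> B"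
    and \<eta>: "test_function \<eta>"
  shows "(LINT x|lborel. F x * partial i \<eta> x) = - (LINT x|lborel. partial i F x * \<eta> x)"
proof -
  let ?k = "Suc CARD('n)"
  obtain C where C: "C > 0" "\<And>x. norm (\<eta> x) \<le> C * wt x ^ ?k"
    using test_function_bound[OF \<eta>, of ?k] by blast
  obtain D where D: "D > 0" "\<And>x. norm (partial i \<eta> x) \<le> D * wt x ^ ?k"
    using test_function_bound[OF test_function_partial[OF \<eta>], where k="?k"] by blast
  have B0: "B \<ge> 0" using order_trans[OF norm_ge_zero B(1)] .
  have CD: "a * (c * w) \<le> B * max C D * w" if "a \<le> B" "0 \<le> a" "c \<le> max C D" "0 \<le> c" "w \<ge> 0" for a c w
    using that B0 by (simp add: mult.assoc mult_mono)
  have m: "C \<le> max C D" "D \<le> max C D" by auto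
  show ?thesis
  proof (rule integral_by_parts[where A="B * max C D" and k="?k"])
    show "norm (F x * \<eta> x) \<le> B * max C D * wt x ^ ?k" for x
      unfolding norm_mult using C(1) by (intro order_trans[OF mult_left_mono[OF C(2)] CD]) (auto simp: B)
    show "norm (F x * partial i \<eta> x) \<le> B * max C D * wt x ^ ?k" for x
      unfolding norm_mult using D(1) by (intro order_trans[OF mult_left_mono[OF D(2)] CD]) (auto simp: B)
    show "norm (partial i F x * \<eta> x) \<le> B * max C D * wt x ^ ?k" for x
      unfolding norm_mult using C(1) by (intro order_trans[OF mult_left_mono[OF C(2)] CD]) (auto simp: B)
  qed (use F \<eta> in \<open>auto intro: smooth_differentiable test_function_smooth\<close>)
qed

subsection \<open>The Newtonian kernel\<close>

text \<open>The fundamental solution without its normalizing factor, which is collected in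
  \<open>newton_const\<close>.\<close>

definition newton_kernel :: "real ^ 'n \<Rightarrow> complex" where
  "newton_kernel z = complex_of_real (inv_norm z ^ (CARD('n) - 2))"

text \<open>The classical partial derivative of |z|^(2-n) away from the origin. That it is also the
  weak derivative, without a contribution of the origin, is
  \<open>newton_kernel_weak_gradient\<close>.\<close>

definition newton_gradient :: "'n::finite \<Rightarrow> real ^ 'n \<Rightarrow> complex" where
  "newton_gradient i z = complex_of_real (- (real CARD('n) - 2) * z $ i * inv_norm z ^ CARD('n))"

text \<open>A smooth replacement of 1/|z| that lies below it, tends to it off the origin as
  \<epsilon> \<rightarrow> 0, and has powers with closed-form derivatives.\<close>

definition inv_norm_reg :: "real \<Rightarrow> real ^ 'n \<Rightarrow> real" where
  "inv_norm_reg \<epsilon> z = 1 / sqrt ((norm z)\<^sup>2 + \<epsilon>\<^sup>2)"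

lemma inv_norm_reg_nonneg [simp]: "0 \<le> inv_norm_reg \<epsilon> z"
  by (simp add: inv_norm_reg_def)

lemma inv_norm_reg_pos:
  assumes "\<epsilon> > 0" shows "0 < inv_norm_reg \<epsilon> z"
proof -
  have "0 < (norm z)\<^sup>2 + \<epsilon>\<^sup>2" using assms by (intro add_nonneg_pos) auto
  then show ?thesis by (simp add: inv_norm_reg_def)
qed

lemma inv_norm_reg_square:
  assumes "\<epsilon> > 0" shows "inv_norm_reg \<epsilon> z ^ 2 * ((norm z)\<^sup>2 + \<epsilon>\<^sup>2) = 1"
proof -
  have "0 < (norm z)\<^sup>2 + \<epsilon>\<^sup>2" using assms by (intro add_nonneg_pos) auto
  then show ?thesis using assms by (auto simp: inv_norm_reg_def power_divide)
qed

lemma inv_norm_reg_le_inv_norm: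
  assumes "\<epsilon> > 0" "z \<noteq> 0" shows "inv_norm_reg \<epsilon> z \<le> inv_norm z"
proof -
  have "norm z \<le> sqrt ((norm z)\<^sup>2 + \<epsilon>\<^sup>2)" by (simp add: real_le_rsqrt)
  then show ?thesis using assms unfolding inv_norm_reg_def inv_norm_def by (intro divide_left_mono) (auto intro!: mult_pos_pos add_nonneg_pos)
qed

lemma inv_norm_reg_le:
  assumes "\<epsilon> > 0" shows "inv_norm_reg \<epsilon> z \<le> 1 / \<epsilon>"
proof -
  have "\<epsilon> \<le> sqrt ((norm z)\<^sup>2 + \<epsilon>\<^sup>2)" by (simp add: real_le_rsqrt)
  then show ?thesis using assms unfolding inv_norm_reg_def by (intro divide_left_mono) (auto intro!: mult_pos_pos add_nonneg_pos)
qed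

lemma norm_mult_inv_norm_reg_le:
  assumes "\<epsilon> > 0" shows "\<bar>z $ i\<bar> * inv_norm_reg \<epsilon> z \<le> 1"
proof -
  have "\<bar>z $ i\<bar> \<le> norm z" by (rule component_le_norm_cart)
  also have "norm z \<le> sqrt ((norm z)\<^sup>2 + \<epsilon>\<^sup>2)" by (simp add: real_le_rsqrt)
  finally show ?thesis
    using inv_norm_reg_pos[OF assms, of z] unfolding inv_norm_reg_def by (simp add: divide_le_eq_1)
qed

lemma inv_norm_reg_tendsto:
  assumes "z \<noteq> 0"
  shows "(\<lambda>k. inv_norm_reg (1 / real (Suc k)) z) \<longlonglongrightarrow> inv_norm z"
proof -
  have "(\<lambda>k. inv_norm_reg (1 / real (Suc k)) z) \<longlonglongrightarrow> 1 / sqrt ((norm z)\<^sup>2 + 0\<^sup>2)"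
    unfolding inv_norm_reg_def by (intro tendsto_intros LIMSEQ_Suc lim_1_over_n) (use assms in auto)
  then show ?thesis by (simp add: inv_norm_def)
qed

lemma inv_norm_reg_power_has_derivative:
  assumes "\<epsilon> > 0"
  shows "((\<lambda>z. complex_of_real (inv_norm_reg \<epsilon> z ^ m)) has_derivative
     (\<lambda>h. complex_of_real (- real m * inv_norm_reg \<epsilon> z ^ (m + 2) * (z \<bullet> h)))) (at z)"
proof -
  have p: "0 < z \<bullet> z + \<epsilon>\<^sup>2" for z :: "real ^ 'n" using assms by (intro add_nonneg_pos) auto
  have e: "inv_norm_reg \<epsilon> z = inverse (sqrt (z \<bullet> z + \<epsilon>\<^sup>2))" for z :: "real ^ 'n"
    by (simp add: inv_norm_reg_def power2_norm_eq_inner inverse_eq_divide)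
  have "((\<lambda>z. z \<bullet> z + \<epsilon>\<^sup>2) has_derivative (\<lambda>h. 2 * (z \<bullet> h))) (at z)"
    by (auto intro!: derivative_eq_intros simp: inner_commute)
  moreover have "((\<lambda>r. inverse (sqrt r) ^ m) has_real_derivative
      - real m * inverse (sqrt (z \<bullet> z + \<epsilon>\<^sup>2)) ^ (m + 2) / 2) (at (z \<bullet> z + \<epsilon>\<^sup>2))"
  proof -
    define r where "r = z \<bullet> z + \<epsilon>\<^sup>2"
    have r: "r > 0" using p by (simp add: r_def)
    have "((\<lambda>r. inverse (sqrt r)) has_real_derivative - (inverse (sqrt r) ^ 3 / 2)) (at r)"
      using r by (auto intro!: derivative_eq_intros simp: power3_eq_cube field_simps)
    from DERIV_power[OF this, of m]
    have "((\<lambda>r. inverse (sqrt r) ^ m) has_real_derivative real m * (- (inverse (sqrt r) ^ 3 / 2) * inverse (sqrt r) ^ (m - Suc 0))) (at r)" .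
    moreover have "real m * (- (inverse (sqrt r) ^ 3 / 2) * inverse (sqrt r) ^ (m - Suc 0)) = - real m * inverse (sqrt r) ^ (m + 2) / 2"
      by (cases m) (simp_all add: power3_eq_cube power2_eq_square algebra_simps)
    ultimately show ?thesis unfolding r_def by metis
  qed
  ultimately have "((\<lambda>z. inverse (sqrt (z \<bullet> z + \<epsilon>\<^sup>2)) ^ m) has_derivative
     (\<lambda>h. - real m * inverse (sqrt (z \<bullet> z + \<epsilon>\<^sup>2)) ^ (m + 2) / 2 * (2 * (z \<bullet> h)))) (at z)"
    unfolding has_field_derivative_def by (rule has_derivative_compose)
  from bounded_linear.has_derivative[OF bounded_linear_of_real[where 'a=complex] this]
  show ?thesis unfolding e by (simp add: mult_ac)
qed

lemma partial_inv_norm_reg_power: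
  assumes "\<epsilon> > 0"
  shows "partial i (\<lambda>z. complex_of_real (inv_norm_reg \<epsilon> z ^ m)) z
    = complex_of_real (- real m * z $ i * inv_norm_reg \<epsilon> z ^ (m + 2))"
  using partial_eqI[OF inv_norm_reg_power_has_derivative[OF assms], of i m z]
  by (simp add: inner_axis mult_ac)

lemma partial_coord: "partial i (\<lambda>z. complex_of_real (z $ j)) z = (if i = j then 1 else 0)"
proof -
  have "((\<lambda>x. complex_of_real (x $ j)) has_derivative (\<lambda>h. complex_of_real (h $ j))) (at z)"
    by (intro bounded_linear_imp_has_derivative bounded_linear_compose[OF bounded_linear_of_real bounded_linear_vec_nth])
  from partial_eqI[OF this, of i] show ?thesis by (simp add: axis_def)
qed

lemma borel_measurable_inv_norm_reg [measurable]: "inv_norm_reg \<epsilon> \<in> borel_measurable borel"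
  unfolding inv_norm_reg_def by measurable

lemma borel_measurable_newton [measurable]:
  "newton_kernel \<in> borel_measurable borel" "newton_gradient i \<in> borel_measurable borel"
  unfolding newton_kernel_def newton_gradient_def by measurable

lemma norm_newton_kernel: "norm (newton_kernel z) = inv_norm (z :: real ^ 'n) ^ (CARD('n) - 2)"
  by (simp add: newton_kernel_def norm_power)

lemma norm_newton_gradient:
  assumes "CARD('n) \<ge> 2"
  shows "norm (newton_gradient i z) \<le> CARD('n) * inv_norm (z :: real ^ 'n) ^ (CARD('n) - 1)"
proof -
  let ?n = "CARD('n)"
  have "\<bar>z $ i\<bar> * inv_norm z \<le> 1"
    using component_le_norm_cart[of z i] by (auto simp: inv_norm_def divide_le_eq_1)
  then have "\<bar>z $ i\<bar> * inv_norm z * inv_norm z ^ (?n - 1) \<le> 1 * inv_norm z ^ (?n - 1)"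
    by (intro mult_right_mono) auto
  moreover have "inv_norm z * inv_norm z ^ (?n - 1) = inv_norm z ^ ?n" using assms by (cases ?n) auto
  ultimately have "\<bar>z $ i\<bar> * inv_norm z ^ ?n \<le> inv_norm z ^ (?n - 1)" by (simp add: mult.assoc)
  then have "(real ?n - 2) * (\<bar>z $ i\<bar> * inv_norm z ^ ?n) \<le> ?n * inv_norm z ^ (?n - 1)"
    using assms by (intro mult_mono) auto
  then show ?thesis using assms
    by (simp only: newton_gradient_def norm_of_real abs_mult abs_minus_cancel) (simp add: mult.assoc)
qed

lemma inv_norm_power_test_integrable:
  fixes \<eta> :: "real ^ 'n \<Rightarrow> complex"
  assumes a: "a < CARD('n)" and [measurable]: "\<eta> \<in> borel_measurable borel"
    and \<eta>: "\<And>x. norm (\<eta> x) \<le> C * wt x ^ Suc CARD('n)"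
  shows "integrable lborel (\<lambda>z. inv_norm z ^ a * norm (\<eta> z))"
proof (rule integrableI_bounded)
  obtain B where B: "\<And>x::real^'n. (\<integral>\<^sup>+y. ennreal (inv_norm (x - y) ^ a * wt y ^ Suc CARD('n)) \<partial>lborel) \<le> ennreal B"
    using inv_norm_wt_bound[OF a, of "Suc CARD('n)"] by auto
  have C0: "C \<ge> 0" using order_trans[OF norm_ge_zero \<eta>[of 0]] zero_less_power[OF wt_pos[of "0::real^'n"], of "Suc CARD('n)"]
    by (simp add: zero_le_mult_iff del: power_Suc)
  have "(\<integral>\<^sup>+z. ennreal (norm (inv_norm z ^ a * norm (\<eta> z))) \<partial>lborel) \<le> (\<integral>\<^sup>+y. ennreal C * ennreal (inv_norm (0 - y :: real ^ 'n) ^ a * wt y ^ Suc CARD('n)) \<partial>lborel)"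
  proof (rule nn_integral_mono)
    fix z :: "real ^ 'n"
    have "inv_norm z ^ a * norm (\<eta> z) \<le> C * (inv_norm z ^ a * wt z ^ Suc CARD('n))"
      using mult_left_mono[OF \<eta>[of z], of "inv_norm z ^ a"] by (simp add: mult_ac)
    then show "ennreal (norm (inv_norm z ^ a * norm (\<eta> z))) \<le> ennreal C * ennreal (inv_norm (0 - z) ^ a * wt z ^ Suc CARD('n))"
      using C0 by (subst ennreal_mult'[symmetric]) (auto intro!: ennreal_leI simp: inv_norm_def)
  qed
  also have "\<dots> = ennreal C * (\<integral>\<^sup>+y. ennreal (inv_norm (0 - y :: real ^ 'n) ^ a * wt y ^ Suc CARD('n)) \<partial>lborel)"
    by (intro nn_integral_cmult) measurable
  also have "\<dots> \<le> ennreal C * ennreal B" by (intro mult_left_mono B) auto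
  also have "\<dots> < \<infinity>" by (simp add: ennreal_mult_less_top)
  finally show "(\<integral>\<^sup>+z. ennreal (norm (inv_norm z ^ a * norm (\<eta> z))) \<partial>lborel) < \<infinity>" .
qed measurable

lemma AE_lborel_neq: "AE x in lborel. x \<noteq> (c :: 'a::euclidean_space)"
  by (rule AE_I'[of "{c}"]) (auto simp: null_sets_def)

text \<open>Removes the regularization: off the origin, a null set, the regularized functions are
  dominated by |z|^(-a), which is integrable against a test function for a < n.\<close>

lemma inv_norm_reg_integral_tendsto:
  fixes \<eta> :: "real ^ 'n \<Rightarrow> complex"
  assumes a: "a < CARD('n)" and \<eta>: "test_function \<eta>"
    and [measurable]: "\<And>k. u k \<in> borel_measurable borel"
    and u: "\<And>k z. norm (u k z) \<le> D * inv_norm_reg (1 / real (Suc k)) z ^ a" and D: "D \<ge> 0"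
    and lim: "\<And>z. z \<noteq> 0 \<Longrightarrow> (\<lambda>k. u k z) \<longlonglongrightarrow> U z" and [measurable]: "U \<in> borel_measurable borel"
  shows "(\<lambda>k. LINT z|lborel. u k z * \<eta> z) \<longlonglongrightarrow> (LINT z|lborel. U z * \<eta> z)"
proof (rule integral_dominated_convergence[where w="\<lambda>z. D * (inv_norm z ^ a * norm (\<eta> z))"])
  have [measurable]: "\<eta> \<in> borel_measurable borel" by (intro smooth_borel test_function_smooth \<eta>)
  show "(\<lambda>z. U z * \<eta> z) \<in> borel_measurable lborel" "(\<lambda>z. u k z * \<eta> z) \<in> borel_measurable lborel" for k
    by measurable
  obtain C where "\<And>x. norm (\<eta> x) \<le> C * wt x ^ Suc CARD('n)" using test_function_bound[OF \<eta>] by blast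
  then show "integrable lborel (\<lambda>z. D * (inv_norm z ^ a * norm (\<eta> z)))"
    by (intro integrable_mult_right inv_norm_power_test_integrable a) auto
  show "AE z in lborel. (\<lambda>k. u k z * \<eta> z) \<longlonglongrightarrow> U z * \<eta> z"
    using AE_lborel_neq[of 0] by eventually_elim (intro tendsto_intros lim)
  show "AE z in lborel. norm (u k z * \<eta> z) \<le> D * (inv_norm z ^ a * norm (\<eta> z))" for k
    using AE_lborel_neq[of 0]
  proof eventually_elim
    case (elim z)
    have "inv_norm_reg (1 / real (Suc k)) z ^ a \<le> inv_norm z ^ a"
      using elim by (intro power_mono inv_norm_reg_le_inv_norm) auto
    then have "norm (u k z) \<le> D * inv_norm z ^ a" using u[of k z] D by (meson mult_left_mono order_trans)
    then show ?case by (simp add: norm_mult mult_right_mono mult.assoc[symmetric])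
  qed
qed

text \<open>For the regularized kernels this is ordinary integration by parts. Both sides converge,
  since the singularities of the kernel and of its gradient have the orders n - 2 and n - 1, both
  below n.\<close>

lemma newton_kernel_weak_gradient:
  fixes \<eta> :: "real ^ 'n \<Rightarrow> complex"
  assumes n: "CARD('n) \<ge> 3" and \<eta>: "test_function \<eta>"
  shows "(LINT z|lborel. newton_kernel z * partial i \<eta> z) = - (LINT z|lborel. newton_gradient i z * \<eta> z)"
proof -
  let ?n = "CARD('n)"
  define \<epsilon> where "\<epsilon> k = 1 / real (Suc k)" for k
  have \<epsilon>: "\<epsilon> k > 0" for k by (simp add: \<epsilon>_def)
  define u where "u k z = complex_of_real (inv_norm_reg (\<epsilon> k) z ^ (?n - 2))" for k and z :: "real ^ 'n"
  have n2: "?n - 2 + 2 = ?n" using n by simp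
  have pu: "partial i (u k) z = complex_of_real (- (real ?n - 2) * z $ i * inv_norm_reg (\<epsilon> k) z ^ ?n)" for k z
    unfolding u_def partial_inv_norm_reg_power[OF \<epsilon>] n2 using n by (simp add: of_nat_diff)
  have du: "u k differentiable (at z)" for k z
    unfolding u_def by (rule differentiableI[OF inv_norm_reg_power_has_derivative[OF \<epsilon>]])
  have [measurable]: "u k \<in> borel_measurable borel" "partial i (u k) \<in> borel_measurable borel" for k
    by (unfold u_def, measurable) (fold u_def, rule borel_measurable_partial[OF du])
  have bu: "norm (u k z) \<le> 1 * inv_norm_reg (1 / real (Suc k)) z ^ (?n - 2)" for k z
    by (simp add: u_def \<epsilon>_def norm_power)
  have bpu: "norm (partial i (u k) z) \<le> real ?n * inv_norm_reg (1 / real (Suc k)) z ^ (?n - 1)" for k z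
  proof -
    let ?s = "inv_norm_reg (\<epsilon> k) z"
    have s: "?s ^ ?n = ?s * ?s ^ (?n - 1)" using n by (cases ?n) auto
    have "\<bar>z $ i\<bar> * ?s * ?s ^ (?n - 1) \<le> 1 * ?s ^ (?n - 1)"
      by (intro mult_right_mono norm_mult_inv_norm_reg_le \<epsilon>) auto
    then have "\<bar>z $ i\<bar> * ?s ^ ?n \<le> ?s ^ (?n - 1)" by (simp add: s mult.assoc)
    then have "(real ?n - 2) * (\<bar>z $ i\<bar> * ?s ^ ?n) \<le> real ?n * ?s ^ (?n - 1)"
      using n by (intro mult_mono) auto
    then show ?thesis
      unfolding pu using n by (simp only: norm_of_real abs_mult abs_minus_cancel) (simp add: mult.assoc \<epsilon>_def)
  qed
  have L: "(\<lambda>k. LINT z|lborel. u k z * partial i \<eta> z) \<longlonglongrightarrow> (LINT z|lborel. newton_kernel z * partial i \<eta> z)"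
  proof (rule inv_norm_reg_integral_tendsto[OF _ test_function_partial[OF \<eta>] _ bu])
    show "(\<lambda>k. u k z) \<longlonglongrightarrow> newton_kernel z" if "z \<noteq> 0" for z
      unfolding u_def newton_kernel_def \<epsilon>_def by (intro tendsto_intros inv_norm_reg_tendsto that)
  qed (use n in auto)
  have R: "(\<lambda>k. LINT z|lborel. partial i (u k) z * \<eta> z) \<longlonglongrightarrow> (LINT z|lborel. newton_gradient i z * \<eta> z)"
  proof (rule inv_norm_reg_integral_tendsto[OF _ \<eta> _ bpu])
    show "(\<lambda>k. partial i (u k) z) \<longlonglongrightarrow> newton_gradient i z" if "z \<noteq> 0" for z
      unfolding pu newton_gradient_def \<epsilon>_def by (intro tendsto_intros inv_norm_reg_tendsto that)
  qed (use n in auto)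
  have "(LINT z|lborel. u k z * partial i \<eta> z) = - (LINT z|lborel. partial i (u k) z * \<eta> z)" for k
  proof (rule integral_by_parts_test[OF du _ _ \<eta>])
    let ?B = "max (1 * (1 / \<epsilon> k) ^ (?n - 2)) (real ?n * (1 / \<epsilon> k) ^ (?n - 1))"
    have m: "c * inv_norm_reg (1 / real (Suc k)) z ^ a \<le> c * (1 / \<epsilon> k) ^ a" if "c \<ge> 0" for a c and z :: "real ^ 'n"
      using inv_norm_reg_le[OF \<epsilon>, of k z] that unfolding \<epsilon>_def by (intro mult_left_mono power_mono) auto
    show "norm (u k z) \<le> ?B" for z by (rule order_trans[OF bu order_trans[OF m]]) auto
    show "norm (partial i (u k) z) \<le> ?B" for z by (rule order_trans[OF bpu order_trans[OF m]]) auto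
  qed
  then have "(\<lambda>k. LINT z|lborel. u k z * partial i \<eta> z) \<longlonglongrightarrow> - (LINT z|lborel. newton_gradient i z * \<eta> z)"
    using tendsto_minus[OF R] by simp
  with L show ?thesis by (rule LIMSEQ_unique)
qed

lemma inv_norm_reg_scale:
  assumes "\<epsilon> > 0" shows "inv_norm_reg \<epsilon> (\<epsilon> *\<^sub>R w) = wt w / \<epsilon>"
proof -
  have "(norm (\<epsilon> *\<^sub>R w))\<^sup>2 + \<epsilon>\<^sup>2 = \<epsilon>\<^sup>2 * (1 + (norm w)\<^sup>2)" by (simp add: power_mult_distrib algebra_simps)
  then show ?thesis using assms by (simp add: inv_norm_reg_def wt_def japanese_bracket_def real_sqrt_mult)
qed

text \<open>The Laplacian of \<open>(\<bar>z\<bar>\<^sup>2 + \<epsilon>\<^sup>2)\<^bsup>(2-n)/2\<^esup>\<close> is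
  \<open>- n (n - 2) \<epsilon>\<^sup>2 (\<bar>z\<bar>\<^sup>2 + \<epsilon>\<^sup>2)\<^bsup>-(n+2)/2\<^esup>\<close>, an approximate identity.\<close>

lemma newton_kernel_fundamental_solution:
  fixes \<eta> :: "real ^ 'n \<Rightarrow> complex"
  assumes n: "CARD('n) \<ge> 3" and \<eta>: "test_function \<eta>"
  shows "(LINT z|lborel. newton_kernel z * laplacian \<eta> z)
    = - complex_of_real (real CARD('n) * (real CARD('n) - 2) * unit_ball_vol CARD('n)) * \<eta> 0"
proof -
  let ?n = "CARD('n)" let ?V = "unit_ball_vol ?n"
  define \<epsilon> where "\<epsilon> k = 1 / real (Suc k)" for k
  have \<epsilon>: "\<epsilon> k > 0" for k by (simp add: \<epsilon>_def)
  define s where "s k z = inv_norm_reg (\<epsilon> k) z" for k and z :: "real ^ 'n"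
  have s0: "s k z \<ge> 0" and s1: "s k z \<le> 1 / \<epsilon> k" and zs: "\<bar>z $ i\<bar> * s k z \<le> 1" for k z i
    unfolding s_def using inv_norm_reg_le[OF \<epsilon>] norm_mult_inv_norm_reg_le[OF \<epsilon>] by auto
  have [measurable]: "s k \<in> borel_measurable borel" for k unfolding s_def by measurable
  define u where "u k z = complex_of_real (s k z ^ (?n - 2))" for k and z :: "real ^ 'n"
  define g where "g i k z = complex_of_real (- (real ?n - 2)) * complex_of_real (z $ i) * complex_of_real (s k z ^ ?n)" for i k and z :: "real ^ 'n"
  have n2: "?n - 2 + 2 = ?n" using n by simp
  have pu: "partial i (u k) = g i k" for i k
    unfolding u_def s_def g_def using n
    by (intro ext, subst partial_inv_norm_reg_power[OF \<epsilon>], unfold n2) (simp add: of_nat_diff mult_ac)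
  have du: "u k differentiable (at z)" for k z
    unfolding u_def s_def by (rule differentiableI[OF inv_norm_reg_power_has_derivative[OF \<epsilon>]])
  have ds: "(\<lambda>z. complex_of_real (s k z ^ m)) differentiable (at z)" for k z m
    unfolding s_def by (rule differentiableI[OF inv_norm_reg_power_has_derivative[OF \<epsilon>]])
  have dz: "(\<lambda>z. complex_of_real (z $ i)) differentiable (at z)" for i and z :: "real ^ 'n"
    by (rule smooth_differentiable[OF smooth_coord])
  have dg: "g i k differentiable (at z)" for i k z
    unfolding g_def by (intro differentiable_mult ds dz differentiable_const)
  have pg: "partial i (g i k) z = complex_of_real (- (real ?n - 2) * (s k z ^ ?n - ?n * (z $ i)\<^sup>2 * s k z ^ (?n + 2)))" for i k z
  proof -
    have "partial i (g i k) z = complex_of_real (- (real ?n - 2)) * partial i (\<lambda>z. complex_of_real (z $ i) * complex_of_real (s k z ^ ?n)) z"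
      unfolding g_def mult.assoc by (intro partial_cmult differentiable_mult ds dz)
    also have "partial i (\<lambda>z. complex_of_real (z $ i) * complex_of_real (s k z ^ ?n)) z
        = complex_of_real (z $ i) * complex_of_real (- real ?n * z $ i * s k z ^ (?n + 2)) + 1 * complex_of_real (s k z ^ ?n)"
      unfolding partial_mult[OF dz ds] unfolding s_def partial_inv_norm_reg_power[OF \<epsilon>] partial_coord by simp
    finally show ?thesis by (simp add: algebra_simps power2_eq_square)
  qed
  have lap: "(\<Sum>i\<in>UNIV. partial i (g i k) z) = complex_of_real (- real ?n * (real ?n - 2) * ((\<epsilon> k)\<^sup>2 * s k z ^ (?n + 2)))" for k z
  proof -
    have "(\<Sum>i\<in>UNIV. s k z ^ ?n - ?n * (z $ i)\<^sup>2 * s k z ^ (?n + 2)) = ?n * s k z ^ ?n - ?n * (norm z)\<^sup>2 * s k z ^ (?n + 2)"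
      by (simp add: sum_subtractf norm_vec_square sum_distrib_left sum_distrib_right)
    also have "\<dots> = ?n * ((\<epsilon> k)\<^sup>2 * s k z ^ (?n + 2))"
    proof -
      \<comment> \<open>Inserting 1 = s^2 (|z|^2 + \<epsilon>^2) writes s^n as two terms of exponent
        n + 2. The one with |z|^2 cancels and only the one with \<epsilon>^2 survives.\<close>
      have "s k z ^ ?n = s k z ^ ?n * (s k z ^ 2 * ((norm z)\<^sup>2 + (\<epsilon> k)\<^sup>2))"
        unfolding s_def inv_norm_reg_square[OF \<epsilon>] by simp
      also have "\<dots> = (norm z)\<^sup>2 * s k z ^ (?n + 2) + (\<epsilon> k)\<^sup>2 * s k z ^ (?n + 2)"
        by (simp add: power_add power2_eq_square algebra_simps)
      finally have "?n * s k z ^ ?n = ?n * ((norm z)\<^sup>2 * s k z ^ (?n + 2) + (\<epsilon> k)\<^sup>2 * s k z ^ (?n + 2))"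
        by (rule arg_cong)
      then show ?thesis by (simp add: algebra_simps)
    qed
    finally have *: "(\<Sum>i\<in>UNIV. s k z ^ ?n - ?n * (z $ i)\<^sup>2 * s k z ^ (?n + 2)) = ?n * ((\<epsilon> k)\<^sup>2 * s k z ^ (?n + 2))" .
    have "(\<Sum>i\<in>UNIV. partial i (g i k) z) = complex_of_real (- (real ?n - 2) * (\<Sum>i\<in>UNIV. s k z ^ ?n - ?n * (z $ i)\<^sup>2 * s k z ^ (?n + 2)))"
      unfolding pg sum_distrib_left of_real_sum ..
    then show ?thesis unfolding * by (simp only: mult_minus_left mult.assoc mult.left_commute[of "real ?n - 2"])
  qed
  have [measurable]: "u k \<in> borel_measurable borel" for k unfolding u_def by measurable
  have bu: "norm (u k z) \<le> 1 * inv_norm_reg (1 / real (Suc k)) z ^ (?n - 2)" for k z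
    by (simp add: u_def s_def \<epsilon>_def norm_power)
  have L: "(\<lambda>k. LINT z|lborel. u k z * laplacian \<eta> z) \<longlonglongrightarrow> (LINT z|lborel. newton_kernel z * laplacian \<eta> z)"
  proof (rule inv_norm_reg_integral_tendsto[OF _ test_function_laplacian[OF \<eta>] _ bu])
    show "(\<lambda>k. u k z) \<longlonglongrightarrow> newton_kernel z" if "z \<noteq> 0" for z
      unfolding u_def s_def newton_kernel_def \<epsilon>_def by (intro tendsto_intros inv_norm_reg_tendsto that)
  qed (use n in auto)
  have s_pow: "s k z ^ m \<le> (1 / \<epsilon> k) ^ m" for k z m by (intro power_mono s0 s1)
  have g_bd: "norm (g i k z) \<le> real ?n * (1 / \<epsilon> k) ^ (?n - 1)" for i k z
  proof -
    have e: "s k z ^ ?n = s k z * s k z ^ (?n - 1)" using n by (cases ?n) auto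
    have "\<bar>z $ i\<bar> * s k z * s k z ^ (?n - 1) \<le> 1 * (1 / \<epsilon> k) ^ (?n - 1)"
      by (intro mult_mono zs s_pow) (auto simp: s0)
    then have "(real ?n - 2) * (\<bar>z $ i\<bar> * s k z ^ ?n) \<le> real ?n * (1 / \<epsilon> k) ^ (?n - 1)"
      unfolding e using n s0 by (intro mult_mono) (auto simp: mult.assoc)
    then show ?thesis unfolding g_def norm_mult norm_of_real using n s0[of k z]
      by (simp add: mult.assoc abs_mult)
  qed
  have pg_bd: "norm (partial i (g i k) z) \<le> real ?n * ((1 / \<epsilon> k) ^ ?n + ?n * (1 / \<epsilon> k) ^ ?n)" for i k z
  proof -
    have "(z $ i)\<^sup>2 * s k z ^ (?n + 2) = (\<bar>z $ i\<bar> * s k z)\<^sup>2 * s k z ^ ?n"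
      by (simp add: power_mult_distrib power_add power2_eq_square)
    also have "\<dots> \<le> 1 * (1 / \<epsilon> k) ^ ?n"
      using zs[of z i k] s0[of k z] by (intro mult_mono s_pow) (auto intro!: power_le_one)
    finally have a: "(z $ i)\<^sup>2 * s k z ^ (?n + 2) \<le> (1 / \<epsilon> k) ^ ?n" by simp
    have "\<bar>s k z ^ ?n - ?n * (z $ i)\<^sup>2 * s k z ^ (?n + 2)\<bar> \<le> s k z ^ ?n + ?n * ((z $ i)\<^sup>2 * s k z ^ (?n + 2))"
      using s0[of k z] by (intro order_trans[OF abs_triangle_ineq4]) (simp add: abs_mult)
    also have "\<dots> \<le> (1 / \<epsilon> k) ^ ?n + ?n * (1 / \<epsilon> k) ^ ?n"
      by (intro add_mono s_pow mult_left_mono a) auto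
    finally have "(real ?n - 2) * \<bar>s k z ^ ?n - ?n * (z $ i)\<^sup>2 * s k z ^ (?n + 2)\<bar> \<le> real ?n * ((1 / \<epsilon> k) ^ ?n + ?n * (1 / \<epsilon> k) ^ ?n)"
      using n by (intro mult_mono) auto
    then show ?thesis unfolding pg norm_of_real abs_mult abs_minus_cancel using n by simp
  qed
  have ibp: "(LINT z|lborel. u k z * partial i (partial i \<eta>) z) = (LINT z|lborel. partial i (g i k) z * \<eta> z)" for i k
  proof -
    have "(LINT z|lborel. u k z * partial i (partial i \<eta>) z) = - (LINT z|lborel. partial i (u k) z * partial i \<eta> z)"
    proof (rule integral_by_parts_test[OF du _ _ test_function_partial[OF \<eta>]])
      let ?B = "max ((1 / \<epsilon> k) ^ (?n - 2)) (real ?n * (1 / \<epsilon> k) ^ (?n - 1))"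
      show "norm (u k z) \<le> ?B" for z
        using s_pow[of k z "?n - 2"] s0[of k z] by (simp add: u_def norm_power)
      show "norm (partial i (u k) z) \<le> ?B" for z
        unfolding pu by (rule order_trans[OF g_bd]) simp
    qed
    also have "(LINT z|lborel. partial i (u k) z * partial i \<eta> z) = - (LINT z|lborel. partial i (g i k) z * \<eta> z)"
      unfolding pu
    proof (rule integral_by_parts_test[OF dg _ _ \<eta>])
      let ?B = "max (real ?n * (1 / \<epsilon> k) ^ (?n - 1)) (real ?n * ((1 / \<epsilon> k) ^ ?n + ?n * (1 / \<epsilon> k) ^ ?n))"
      show "norm (g i k z) \<le> ?B" for z by (rule order_trans[OF g_bd]) simp
      show "norm (partial i (g i k) z) \<le> ?B" for z by (rule order_trans[OF pg_bd]) simp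
    qed
    finally show ?thesis by simp
  qed
  have [measurable]: "\<eta> \<in> borel_measurable borel" by (intro smooth_borel test_function_smooth \<eta>)
  have [measurable]: "partial i (g i k) \<in> borel_measurable borel" for i k by (rule borel_measurable_partial[OF dg])
  have bound_int: "integrable lborel (\<lambda>z. f z * \<zeta> z)"
    if "test_function \<zeta>" "f \<in> borel_measurable borel" "\<And>z. norm (f z) \<le> B" for f \<zeta> :: "real ^ 'n \<Rightarrow> complex" and B
  proof (rule Bochner_Integration.integrable_bound)
    show "integrable lborel (\<lambda>z. B * norm (\<zeta> z))"
      by (intro integrable_mult_right integrable_norm test_function_integrable that)
    show "AE z in lborel. norm (f z * \<zeta> z) \<le> norm (B * norm (\<zeta> z))"
      using that(3) order_trans[OF norm_ge_zero that(3)]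
      by (intro AE_I2) (auto simp: norm_mult intro!: mult_right_mono)
    show "(\<lambda>z. f z * \<zeta> z) \<in> borel_measurable lborel"
      using that(2) smooth_borel[OF test_function_smooth[OF that(1)]] by simp
  qed
  let ?c = "complex_of_real (- real ?n * (real ?n - 2))"
  have main: "(LINT z|lborel. u k z * laplacian \<eta> z) = ?c * (LINT w|lborel. complex_of_real (wt w ^ (?n + 2)) * \<eta> (\<epsilon> k *\<^sub>R w))" for k
  proof -
    have iu: "integrable lborel (\<lambda>z. u k z * partial i (partial i \<eta>) z)" for i
      using s_pow[of k _ "?n - 2"] s0
      by (intro bound_int[where B="(1 / \<epsilon> k) ^ (?n - 2)"] test_function_partial \<eta>) (auto simp: u_def norm_power)
    have ig: "integrable lborel (\<lambda>z. partial i (g i k) z * \<eta> z)" for i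
      by (intro bound_int[OF \<eta> _ pg_bd]) measurable
    have "(LINT z|lborel. u k z * laplacian \<eta> z) = (LINT z|lborel. (\<Sum>i\<in>UNIV. u k z * partial i (partial i \<eta>) z))"
      by (simp add: laplacian_def sum_distrib_left)
    also have "\<dots> = (\<Sum>i\<in>UNIV. (LINT z|lborel. partial i (g i k) z * \<eta> z))"
      by (simp add: Bochner_Integration.integral_sum iu ibp)
    also have "\<dots> = (LINT z|lborel. (\<Sum>i\<in>UNIV. partial i (g i k) z) * \<eta> z)"
      by (simp add: sum_distrib_right Bochner_Integration.integral_sum ig)
    also have "\<dots> = ?c * (LINT z|lborel. complex_of_real ((\<epsilon> k)\<^sup>2 * s k z ^ (?n + 2)) * \<eta> z)"
      unfolding lap of_real_mult[of "- real ?n * (real ?n - 2)"] mult.assoc[of ?c] by simp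
    also have "(LINT z|lborel. complex_of_real ((\<epsilon> k)\<^sup>2 * s k z ^ (?n + 2)) * \<eta> z)
       = \<bar>\<epsilon> k\<bar> ^ DIM(real ^ 'n) *\<^sub>R (LINT w|lborel. complex_of_real ((\<epsilon> k)\<^sup>2 * s k (0 + \<epsilon> k *\<^sub>R w) ^ (?n + 2)) * \<eta> (0 + \<epsilon> k *\<^sub>R w))"
      using \<epsilon>[of k] by (intro lebesgue_integral_lborel_affine) auto
    also have "\<dots> = (LINT w|lborel. complex_of_real (wt w ^ (?n + 2)) * \<eta> (\<epsilon> k *\<^sub>R w))"
    proof -
      \<comment> \<open>The substitution z = \<epsilon> w is exactly balanced: the Jacobian
        \<epsilon>^n and the factor \<epsilon>^2 cancel the \<epsilon>^(-n-2) from the kernel. What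
        remains has total mass V by \<open>integral_wt_power_plus_2\<close>.\<close>
      have "\<bar>\<epsilon> k\<bar> ^ ?n * ((\<epsilon> k)\<^sup>2 * s k (\<epsilon> k *\<^sub>R w) ^ (?n + 2)) = wt w ^ (?n + 2)" for w
        using \<epsilon>[of k] by (simp add: s_def inv_norm_reg_scale power_divide power_add power2_eq_square)
      then show ?thesis
        by (subst integral_scaleR_right[symmetric]) (simp add: scaleR_conv_of_real mult.assoc[symmetric] flip: of_real_mult of_real_power)
    qed
    finally show ?thesis .
  qed
  obtain B where B: "\<And>x. norm (\<eta> x) \<le> B" using test_function_bound[OF \<eta>, of 0] by auto
  have "(\<lambda>k. LINT w|lborel. complex_of_real (wt w ^ (?n + 2)) * \<eta> (\<epsilon> k *\<^sub>R w)) \<longlonglongrightarrow> (LINT w|lborel. complex_of_real (wt (w::real^'n) ^ (?n + 2)) * \<eta> 0)"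
  proof (rule integral_dominated_convergence[where w="\<lambda>w. B * wt w ^ (?n + 2)"])
    show "integrable lborel (\<lambda>w::real^'n. B * wt w ^ (?n + 2))"
      by (intro integrable_mult_right wt_power_integrable) simp
    show "AE w in lborel. (\<lambda>k. complex_of_real (wt w ^ (?n + 2)) * \<eta> (\<epsilon> k *\<^sub>R w)) \<longlonglongrightarrow> complex_of_real (wt w ^ (?n + 2)) * \<eta> 0"
    proof (intro AE_I2 tendsto_intros)
      fix w :: "real ^ 'n"
      have "(\<lambda>k. \<epsilon> k *\<^sub>R w) \<longlonglongrightarrow> 0 *\<^sub>R w" unfolding \<epsilon>_def by (intro tendsto_intros LIMSEQ_Suc lim_1_over_n)
      then have "(\<lambda>k. \<epsilon> k *\<^sub>R w) \<longlonglongrightarrow> 0" by simp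
      moreover have "isCont \<eta> 0" using smooth_continuous[OF test_function_smooth[OF \<eta>], of UNIV] by (simp add: continuous_on_eq_continuous_at)
      ultimately show "(\<lambda>k. \<eta> (\<epsilon> k *\<^sub>R w)) \<longlonglongrightarrow> \<eta> 0" by (rule isCont_tendsto_compose[rotated])
    qed
    show "AE w in lborel. norm (complex_of_real (wt w ^ (?n + 2)) * \<eta> (\<epsilon> k *\<^sub>R w)) \<le> B * wt w ^ (?n + 2)" for k
      using B by (intro AE_I2) (simp add: norm_mult norm_power mult.commute mult_left_mono)
  qed measurable
  also have "(LINT w|lborel. complex_of_real (wt (w::real^'n) ^ (?n + 2)) * \<eta> 0) = complex_of_real ?V * \<eta> 0"
    by (simp only: integral_mult_left_zero integral_complex_of_real integral_wt_power_plus_2)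
  finally have "(\<lambda>k. LINT z|lborel. u k z * laplacian \<eta> z) \<longlonglongrightarrow> ?c * (complex_of_real ?V * \<eta> 0)"
    unfolding main by (intro tendsto_intros)
  from LIMSEQ_unique[OF L this] show ?thesis by (simp add: mult.assoc)
qed

subsection \<open>Potentials\<close>

definition pot :: "(real ^ 'n \<Rightarrow> complex) \<Rightarrow> (real ^ 'n \<Rightarrow> complex) \<Rightarrow> real ^ 'n \<Rightarrow> complex" where
  "pot k f x = (LINT y|lborel. k (x - y) * f y)"

text \<open>The transpose of \<open>pot\<close> (see \<open>pot_duality\<close>). The shift is
  placed on the second argument so that derivatives in y fall on the smooth factor and not on the
  singular kernel.\<close>

definition corr :: "(real ^ 'n \<Rightarrow> complex) \<Rightarrow> (real ^ 'n \<Rightarrow> complex) \<Rightarrow> real ^ 'n \<Rightarrow> complex" where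
  "corr k \<eta> y = (LINT z|lborel. k z * \<eta> (y + z))"

text \<open>One exponent a describes both the singularity at the origin and the decay at infinity; a
  < n makes the kernel locally integrable.\<close>

definition kernel_bound :: "nat \<Rightarrow> (real ^ 'n \<Rightarrow> complex) \<Rightarrow> bool" where
  "kernel_bound a k \<longleftrightarrow> a < CARD('n) \<and> k \<in> borel_measurable borel \<and> (\<exists>c>0. \<forall>z. norm (k z) \<le> c * inv_norm z ^ a)"

lemma kernel_bound_measurable [measurable_dest]: "kernel_bound a k \<Longrightarrow> k \<in> borel_measurable borel"
  by (simp add: kernel_bound_def)

lemma kernel_bound_newton_kernel:
  "CARD('n) \<ge> 3 \<Longrightarrow> kernel_bound (CARD('n) - 2) (newton_kernel :: real ^ 'n \<Rightarrow> complex)"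
  by (auto simp: kernel_bound_def norm_newton_kernel intro!: exI[of _ 1])

lemma kernel_bound_newton_gradient:
  assumes "CARD('n) \<ge> 3"
  shows "kernel_bound (CARD('n) - 1) (newton_gradient i :: real ^ 'n \<Rightarrow> complex)"
  using norm_newton_gradient[of i] assms
  by (auto simp: kernel_bound_def intro!: exI[of _ "real CARD('n)"])

lemma pot_bound:
  fixes k f :: "real ^ 'n \<Rightarrow> complex"
  assumes k: "kernel_bound a k" and [measurable]: "f \<in> borel_measurable borel"
    and f: "AE y in lborel. norm (f y) \<le> C * wt y ^ b"
    and g: "g \<le> a" "g \<le> b" "CARD('n) + g < a + b"
  shows "\<And>x. integrable lborel (\<lambda>y. k (x - y) * f y)"
    and "\<exists>D>0. \<forall>x. norm (pot k f x) \<le> D * wt x ^ g"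
proof -
  note [measurable] = kernel_bound_measurable[OF k]
  obtain c where c: "c > 0" "\<And>z. norm (k z) \<le> c * inv_norm z ^ a" and a: "a < CARD('n)"
    using k by (auto simp: kernel_bound_def)
  obtain D where D: "D > 0" "\<And>x::real^'n. (\<integral>\<^sup>+y. ennreal (inv_norm (x - y) ^ a * wt y ^ b) \<partial>lborel) \<le> ennreal (D * wt x ^ g)"
    using inv_norm_wt_decay[OF a g] by blast
  define C' where "C' = max C 1"
  have C': "C' > 0" "AE y in lborel. norm (f y) \<le> C' * wt y ^ b"
  proof -
    show "C' > 0" by (simp add: C'_def)
    have "C * wt y ^ b \<le> C' * wt y ^ b" for y :: "real ^ 'n" by (intro mult_right_mono) (auto simp: C'_def)
    then show "AE y in lborel. norm (f y) \<le> C' * wt y ^ b" using f by (auto elim!: eventually_mono intro: order_trans)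
  qed
  have nn: "(\<integral>\<^sup>+y. ennreal (norm (k (x - y) * f y)) \<partial>lborel) \<le> ennreal (c * C' * D * wt x ^ g)" for x
  proof -
    have "(\<integral>\<^sup>+y. ennreal (norm (k (x - y) * f y)) \<partial>lborel)
      \<le> (\<integral>\<^sup>+y. ennreal (c * C') * ennreal (inv_norm (x - y) ^ a * wt y ^ b) \<partial>lborel)"
    proof (rule nn_integral_mono_AE, use C'(2) in eventually_elim)
      fix y assume "norm (f y) \<le> C' * wt y ^ b"
      then have "norm (k (x - y)) * norm (f y) \<le> (c * inv_norm (x - y) ^ a) * (C' * wt y ^ b)"
        using c by (intro mult_mono) (auto intro!: mult_nonneg_nonneg)
      then show "ennreal (norm (k (x - y) * f y)) \<le> ennreal (c * C') * ennreal (inv_norm (x - y) ^ a * wt y ^ b)"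
        using c C' by (subst ennreal_mult'[symmetric]) (auto intro!: ennreal_leI simp: norm_mult mult_ac)
    qed
    also have "\<dots> = ennreal (c * C') * (\<integral>\<^sup>+y. ennreal (inv_norm (x - y) ^ a * wt y ^ b) \<partial>lborel)"
      by (intro nn_integral_cmult) measurable
    also have "\<dots> \<le> ennreal (c * C') * ennreal (D * wt x ^ g)" by (intro mult_left_mono D) auto
    also have "\<dots> = ennreal (c * C' * D * wt x ^ g)"
      using c C' by (subst ennreal_mult'[symmetric]) (auto simp: mult_ac)
    finally show ?thesis .
  qed
  show int: "integrable lborel (\<lambda>y. k (x - y) * f y)" for x
    by (rule integrableI_bounded) (measurable, rule le_less_trans[OF nn], simp)
  have "norm (pot k f x) \<le> (c * C' * D) * wt x ^ g" for x
  proof -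
    have "ennreal (norm (pot k f x)) \<le> ennreal (c * C' * D * wt x ^ g)"
      unfolding pot_def by (rule order_trans[OF integral_norm_bound_ennreal[OF int] nn])
    then show ?thesis using c C' D by (subst (asm) ennreal_le_iff) auto
  qed
  then show "\<exists>D>0. \<forall>x. norm (pot k f x) \<le> D * wt x ^ g"
    using c C' D by (intro exI[of _ "c * C' * D"]) auto
qed

lemma corr_eq: 
  assumes [measurable]: "k \<in> borel_measurable borel" "\<eta> \<in> borel_measurable borel"
  shows "corr k \<eta> y = (LINT x|lborel. k (x - y) * \<eta> x)"
  using lebesgue_integral_lborel_shift[of "\<lambda>x. k (x - y) * \<eta> x" y] by (simp add: corr_def)

text \<open>Fubini. Integrating the kernel against \<eta> first gives O(\<open>wt y ^ a\<close>),
  the decay of the kernel, because \<eta> decays like <x>^(-n-1); the assumed weighted integrability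
  of f is precisely what makes the double integral absolutely convergent.\<close>

lemma pot_duality:
  fixes k f \<eta> :: "real ^ 'n \<Rightarrow> complex"
  assumes k: "kernel_bound a k" and [measurable]: "f \<in> borel_measurable borel" "\<eta> \<in> borel_measurable borel"
    and f: "integrable lborel (\<lambda>y. wt y ^ a * norm (f y))"
    and \<eta>: "\<And>x. norm (\<eta> x) \<le> C * wt x ^ Suc CARD('n)"
  shows "integrable lborel (\<lambda>x. pot k f x * \<eta> x)"
    and "(LINT x|lborel. pot k f x * \<eta> x) = (LINT y|lborel. f y * corr k \<eta> y)"
proof -
  note [measurable] = kernel_bound_measurable[OF k]
  let ?n = "CARD('n)"
  obtain c where c: "c > 0" "\<And>z. norm (k z) \<le> c * inv_norm z ^ a" and a: "a < ?n"
    using k by (auto simp: kernel_bound_def)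
  have "C * wt (0::real^'n) ^ Suc ?n \<ge> 0" using order_trans[OF norm_ge_zero \<eta>] .
  then have C0: "C \<ge> 0" using zero_less_power[OF wt_pos[of "0 :: real ^ 'n"], of "Suc ?n"]
    by (simp add: zero_le_mult_iff del: power_Suc)
  obtain D where D: "D > 0" "\<And>x::real^'n. (\<integral>\<^sup>+y. ennreal (inv_norm (x - y) ^ a * wt y ^ Suc ?n) \<partial>lborel) \<le> ennreal (D * wt x ^ a)"
    using inv_norm_wt_decay[OF a, of a "Suc ?n"] a by auto
  let ?h = "\<lambda>x y. k (x - y) * f y * \<eta> x"
  have int: "integrable (lborel \<Otimes>\<^sub>M lborel) (case_prod ?h)"
  proof (rule integrableI_bounded)
    show m: "case_prod ?h \<in> borel_measurable (lborel \<Otimes>\<^sub>M lborel)" by measurable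
    have "(\<integral>\<^sup>+p. ennreal (norm (case_prod ?h p)) \<partial>(lborel \<Otimes>\<^sub>M lborel)) = (\<integral>\<^sup>+y. \<integral>\<^sup>+x. ennreal (norm (?h x y)) \<partial>lborel \<partial>lborel)"
      by (subst lborel_pair.nn_integral_snd[symmetric]) (use m in auto)
    also have "\<dots> \<le> (\<integral>\<^sup>+y. ennreal (c * C * D) * ennreal (wt y ^ a * norm (f y)) \<partial>lborel)"
    proof (rule nn_integral_mono)
      fix y
      have "(\<integral>\<^sup>+x. ennreal (norm (?h x y)) \<partial>lborel) \<le> (\<integral>\<^sup>+x. ennreal (c * C * norm (f y)) * ennreal (inv_norm (y - x) ^ a * wt x ^ Suc ?n) \<partial>lborel)"
      proof (rule nn_integral_mono)
        fix x
        have "norm (k (x - y)) * norm (f y) * norm (\<eta> x) \<le> (c * inv_norm (y - x) ^ a) * norm (f y) * (C * wt x ^ Suc ?n)"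
          using c(2)[of "x - y"] c(1) by (intro mult_mono \<eta>) (auto intro!: mult_nonneg_nonneg simp: inv_norm_commute)
        then show "ennreal (norm (?h x y)) \<le> ennreal (c * C * norm (f y)) * ennreal (inv_norm (y - x) ^ a * wt x ^ Suc ?n)"
          using c C0 by (subst ennreal_mult'[symmetric]) (auto intro!: ennreal_leI simp: norm_mult mult_ac)
      qed
      also have "\<dots> = ennreal (c * C * norm (f y)) * (\<integral>\<^sup>+x. ennreal (inv_norm (y - x) ^ a * wt x ^ Suc ?n) \<partial>lborel)"
        by (intro nn_integral_cmult) measurable
      also have "\<dots> \<le> ennreal (c * C * norm (f y)) * ennreal (D * wt y ^ a)" by (intro mult_left_mono D) auto
      also have "\<dots> = ennreal (c * C * D) * ennreal (wt y ^ a * norm (f y))"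
        using c C0 D by (subst (1 2) ennreal_mult'[symmetric]) (auto simp: mult_ac)
      finally show "(\<integral>\<^sup>+x. ennreal (norm (?h x y)) \<partial>lborel) \<le> ennreal (c * C * D) * ennreal (wt y ^ a * norm (f y))" .
    qed
    also have "\<dots> = ennreal (c * C * D) * (\<integral>\<^sup>+y. ennreal (wt y ^ a * norm (f y)) \<partial>lborel)"
      by (intro nn_integral_cmult) measurable
    also have "\<dots> < \<infinity>" using f by (simp add: integrable_iff_bounded ennreal_mult_less_top abs_mult)
    finally show "(\<integral>\<^sup>+p. ennreal (norm (case_prod ?h p)) \<partial>(lborel \<Otimes>\<^sub>M lborel)) < \<infinity>" .
  qed
  have e: "(LINT y|lborel. ?h x y) = pot k f x * \<eta> x" for x
    by (simp add: pot_def)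
  show "integrable lborel (\<lambda>x. pot k f x * \<eta> x)"
    using lborel_pair.integrable_fst'[OF int] by (simp add: pot_def)
  have "(LINT x|lborel. pot k f x * \<eta> x) = (LINT x|lborel. LINT y|lborel. ?h x y)" by (simp only: e)
  also have "\<dots> = (LINT y|lborel. LINT x|lborel. ?h x y)"
    using lborel_pair.Fubini_integral[OF int] by simp
  also have "(\<lambda>y. LINT x|lborel. ?h x y) = (\<lambda>y. f y * corr k \<eta> y)"
  proof
    fix y
    have "(LINT x|lborel. ?h x y) = (LINT x|lborel. f y * (k (x - y) * \<eta> x))" by (simp add: mult_ac)
    also have "\<dots> = f y * corr k \<eta> y" by (subst corr_eq) simp_all
    finally show "(LINT x|lborel. ?h x y) = f y * corr k \<eta> y" .
  qed
  finally show "(LINT x|lborel. pot k f x * \<eta> x) = (LINT y|lborel. f y * corr k \<eta> y)" .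
qed

lemma pot_measurable [measurable]:
  assumes [measurable]: "k \<in> borel_measurable borel" "f \<in> borel_measurable borel"
  shows "pot k f \<in> borel_measurable borel"
proof -
  have "(\<lambda>x. LINT y|lborel. k (x - y) * f y) \<in> borel_measurable lborel" by measurable
  then show ?thesis unfolding pot_def[abs_def] by simp
qed

text \<open>The duality lemma with \<open>wt x ^ Suc n\<close> in place of a test function: this
  weight is bounded below on a compact set.\<close>

lemma pot_locally_integrable:
  fixes k f :: "real ^ 'n \<Rightarrow> complex"
  assumes k: "kernel_bound a k" and [measurable]: "f \<in> borel_measurable borel"
    and f: "integrable lborel (\<lambda>y. wt y ^ a * norm (f y))" and K: "compact K"
  shows "set_integrable lborel K (pot k f)"
proof -
  note [measurable] = kernel_bound_measurable[OF k]
  let ?m = "Suc CARD('n)"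
  obtain R where R: "R > 0" "\<And>x. x \<in> K \<Longrightarrow> norm x \<le> R"
    using compact_imp_bounded[OF K] by (auto simp: bounded_pos)
  have [measurable]: "K \<in> sets borel" using K by (simp add: borel_compact)
  have int: "integrable lborel (\<lambda>x. pot k f x * complex_of_real (wt x ^ ?m))"
    by (rule pot_duality(1)[OF k _ _ f, of _ 1]) (auto simp: norm_power simp del: power_Suc)
  show ?thesis unfolding set_integrable_def
  proof (rule Bochner_Integration.integrable_bound)
    show "integrable lborel (\<lambda>x. (1 + R) ^ ?m * norm (pot k f x * complex_of_real (wt x ^ ?m)))"
      using int by (intro integrable_mult_right integrable_norm)
    show "AE x in lborel. norm (indicator K x *\<^sub>R pot k f x) \<le> norm ((1 + R) ^ ?m * norm (pot k f x * complex_of_real (wt x ^ ?m)))"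
    proof (intro AE_I2)
      fix x
      show "norm (indicator K x *\<^sub>R pot k f x) \<le> norm ((1 + R) ^ ?m * norm (pot k f x * complex_of_real (wt x ^ ?m)))"
      proof (cases "x \<in> K")
        case True
        have "1 \<le> (1 + R) * wt x"
          using japanese_bracket_le[of x] japanese_bracket_ge_1[of x] R(2)[OF True] by (simp add: wt_def field_simps)
        then have "1 \<le> ((1 + R) * wt x) ^ ?m" by (rule one_le_power)
        then have "1 * norm (pot k f x) \<le> ((1 + R) * wt x) ^ ?m * norm (pot k f x)"
          by (intro mult_right_mono) auto
        then show ?thesis using True R(1)
          by (simp add: norm_mult norm_power power_mult_distrib mult_ac abs_mult del: power_Suc)
      qed simp
    qed
  qed measurable
qed

section \<open>Weighted Taylor bounds and differentiation of correlations\<close>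

lemma test_function_lipschitz:
  fixes \<eta> :: "real ^ 'n \<Rightarrow> complex"
  assumes \<eta>: "test_function \<eta>"
  shows "\<exists>M\<ge>0. \<forall>w h. norm h \<le> 1 \<longrightarrow> norm (\<eta> (w + h) - \<eta> w) \<le> M * norm h * wt w ^ k"
proof -
  have "\<forall>i. \<exists>C>0. \<forall>x. norm (partial i \<eta> x) \<le> C * wt x ^ k"
    by (intro allI test_function_bound test_function_partial \<eta>)
  then obtain C where C: "\<And>i. C i > 0" "\<And>i x. norm (partial i \<eta> x) \<le> C i * wt x ^ k"
    by metis
  define M where "M = (\<Sum>i\<in>UNIV. C i) * 2 ^ k"
  have M: "M \<ge> 0" unfolding M_def using C(1) by (intro mult_nonneg_nonneg sum_nonneg) (simp_all add: less_imp_le)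
  have "norm (\<eta> (w + h) - \<eta> w) \<le> M * norm h * wt w ^ k" if h: "norm h \<le> 1" for w h
  proof -
    have der: "((\<lambda>s. \<eta> (w + s *\<^sub>R h)) has_derivative (\<lambda>t. t *\<^sub>R (\<Sum>i\<in>UNIV. h $ i *\<^sub>R partial i \<eta> (w + s *\<^sub>R h)))) (at s)" for s
    proof -
      have "((\<lambda>s. w + s *\<^sub>R h) has_derivative (\<lambda>t. t *\<^sub>R h)) (at s)" by (auto intro!: derivative_eq_intros)
      from has_derivative_compose[OF this has_derivative_partial[OF smooth_differentiable[OF test_function_smooth[OF \<eta>]]]]
      show ?thesis by (simp add: scaleR_sum_right)
    qed
    have "\<exists>s\<in>{0<..<1}. norm (\<eta> (w + 1 *\<^sub>R h) - \<eta> (w + 0 *\<^sub>R h)) \<le> norm ((1 - 0) *\<^sub>R (\<Sum>i\<in>UNIV. h $ i *\<^sub>R partial i \<eta> (w + s *\<^sub>R h)))"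
      by (rule mvt_general) (auto intro!: der continuous_at_imp_continuous_on has_derivative_continuous[OF der])
    then obtain s where s: "0 < s" "s < 1" and le: "norm (\<eta> (w + h) - \<eta> w) \<le> norm (\<Sum>i\<in>UNIV. h $ i *\<^sub>R partial i \<eta> (w + s *\<^sub>R h))"
      by auto
    have "norm (s *\<^sub>R h) \<le> 1" using s h by (simp add: mult_le_one)
    then have "wt (w + s *\<^sub>R h) \<le> 2 * wt w"
      by (intro order_trans[OF wt_shift]) (intro mult_right_mono; simp)
    then have wk: "wt (w + s *\<^sub>R h) ^ k \<le> 2 ^ k * wt w ^ k"
      unfolding power_mult_distrib[symmetric] by (intro power_mono) auto
    have "norm (\<Sum>i\<in>UNIV. h $ i *\<^sub>R partial i \<eta> (w + s *\<^sub>R h)) \<le> (\<Sum>i\<in>UNIV. norm h * (C i * (2 ^ k * wt w ^ k)))"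
    proof (rule sum_norm_le)
      fix i
      have "norm (partial i \<eta> (w + s *\<^sub>R h)) \<le> C i * (2 ^ k * wt w ^ k)"
        using C(1)[of i] by (intro order_trans[OF C(2)] mult_left_mono wk) auto
      then show "norm (h $ i *\<^sub>R partial i \<eta> (w + s *\<^sub>R h)) \<le> norm h * (C i * (2 ^ k * wt w ^ k))"
        unfolding norm_scaleR using component_le_norm_cart[of h i] by (intro mult_mono) auto
    qed
    also have "\<dots> = M * norm h * wt w ^ k"
      unfolding M_def by (simp add: sum_distrib_left sum_distrib_right mult_ac)
    finally show ?thesis using le by linarith
  qed
  with M show ?thesis by blast
qed

text \<open>The mean value inequality for \<open>\<eta> (w + s *\<^sub>R h)\<close> minus its linear
  part: the derivative in s consists of differences of partial derivatives, each of order |h| by the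
  Lipschitz bound. The weight on the right makes the remainder integrable against a kernel.\<close>

lemma test_function_taylor:
  fixes \<eta> :: "real ^ 'n \<Rightarrow> complex"
  assumes \<eta>: "test_function \<eta>"
  shows "\<exists>M\<ge>0. \<forall>w h. norm h \<le> 1 \<longrightarrow>
    norm (\<eta> (w + h) - \<eta> w - (\<Sum>i\<in>UNIV. h $ i *\<^sub>R partial i \<eta> w)) \<le> M * (norm h)\<^sup>2 * wt w ^ k"
proof -
  have "\<forall>i. \<exists>M\<ge>0. \<forall>w h. norm h \<le> 1 \<longrightarrow> norm (partial i \<eta> (w + h) - partial i \<eta> w) \<le> M * norm h * wt w ^ k"
    by (intro allI test_function_lipschitz test_function_partial \<eta>)
  then obtain C where C: "\<And>i. C i \<ge> 0"
    "\<And>i w h. norm h \<le> 1 \<Longrightarrow> norm (partial i \<eta> (w + h) - partial i \<eta> w) \<le> C i * norm h * wt w ^ k"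
    by metis
  define M where "M = (\<Sum>i\<in>UNIV. C i)"
  have M: "M \<ge> 0" unfolding M_def using C(1) by (auto intro!: sum_nonneg)
  have "norm (\<eta> (w + h) - \<eta> w - (\<Sum>i\<in>UNIV. h $ i *\<^sub>R partial i \<eta> w)) \<le> M * (norm h)\<^sup>2 * wt w ^ k" if h: "norm h \<le> 1" for w h
  proof -
    let ?L = "\<Sum>i\<in>UNIV. h $ i *\<^sub>R partial i \<eta> w"
    have der: "((\<lambda>s. \<eta> (w + s *\<^sub>R h) - s *\<^sub>R ?L) has_derivative (\<lambda>t. t *\<^sub>R (\<Sum>i\<in>UNIV. h $ i *\<^sub>R (partial i \<eta> (w + s *\<^sub>R h) - partial i \<eta> w)))) (at s)" for s
    proof -
      have "((\<lambda>s. w + s *\<^sub>R h) has_derivative (\<lambda>t. t *\<^sub>R h)) (at s)" by (auto intro!: derivative_eq_intros)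
      note d1 = has_derivative_compose[OF this has_derivative_partial[OF smooth_differentiable[OF test_function_smooth[OF \<eta>]]]]
      have d2: "((\<lambda>s. s *\<^sub>R ?L) has_derivative (\<lambda>t. t *\<^sub>R ?L)) (at s)" by (auto intro!: derivative_eq_intros)
      show ?thesis using has_derivative_diff[OF d1 d2]
        by (simp add: scaleR_sum_right scaleR_diff_right sum_subtractf)
    qed
    have "\<exists>s\<in>{0<..<1}. norm ((\<eta> (w + 1 *\<^sub>R h) - 1 *\<^sub>R ?L) - (\<eta> (w + 0 *\<^sub>R h) - 0 *\<^sub>R ?L)) \<le> norm ((1 - 0) *\<^sub>R (\<Sum>i\<in>UNIV. h $ i *\<^sub>R (partial i \<eta> (w + s *\<^sub>R h) - partial i \<eta> w)))"
      by (rule mvt_general) (auto intro!: der continuous_at_imp_continuous_on has_derivative_continuous[OF der])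
    then obtain s where s: "0 < s" "s < 1"
      and le0: "norm (\<eta> (w + h) - ?L - \<eta> w) \<le> norm (\<Sum>i\<in>UNIV. h $ i *\<^sub>R (partial i \<eta> (w + s *\<^sub>R h) - partial i \<eta> w))"
      by auto
    have eq: "\<eta> (w + h) - \<eta> w - ?L = \<eta> (w + h) - ?L - \<eta> w" by simp
    have le: "norm (\<eta> (w + h) - \<eta> w - ?L) \<le> norm (\<Sum>i\<in>UNIV. h $ i *\<^sub>R (partial i \<eta> (w + s *\<^sub>R h) - partial i \<eta> w))"
      unfolding eq by (rule le0)
    have sh: "norm (s *\<^sub>R h) \<le> 1" "norm (s *\<^sub>R h) \<le> norm h" using s h by (auto simp: mult_le_one mult_left_le_one_le)
    have "norm (\<Sum>i\<in>UNIV. h $ i *\<^sub>R (partial i \<eta> (w + s *\<^sub>R h) - partial i \<eta> w)) \<le> (\<Sum>i\<in>UNIV. norm h * (C i * norm h * wt w ^ k))"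
    proof (rule sum_norm_le)
      fix i
      have "norm (partial i \<eta> (w + s *\<^sub>R h) - partial i \<eta> w) \<le> C i * norm (s *\<^sub>R h) * wt w ^ k" by (rule C(2)[OF sh(1)])
      also have "\<dots> \<le> C i * norm h * wt w ^ k"
        using C(1) sh(2) by (intro mult_right_mono mult_left_mono) auto
      finally show "norm (h $ i *\<^sub>R (partial i \<eta> (w + s *\<^sub>R h) - partial i \<eta> w)) \<le> norm h * (C i * norm h * wt w ^ k)"
        unfolding norm_scaleR using component_le_norm_cart[of h i] by (intro mult_mono) auto
    qed
    also have "\<dots> = M * (norm h)\<^sup>2 * wt w ^ k"
      unfolding M_def by (simp add: sum_distrib_left sum_distrib_right mult_ac power2_eq_square)
    finally show ?thesis using le by linarith
  qed
  with M show ?thesis by blast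
qed

lemma corr_integrable:
  fixes k \<eta> :: "real ^ 'n \<Rightarrow> complex"
  assumes k: "kernel_bound a k" and [measurable]: "\<eta> \<in> borel_measurable borel"
    and \<eta>: "\<And>x. norm (\<eta> x) \<le> C * wt x ^ Suc CARD('n)"
  shows "integrable lborel (\<lambda>z. k z * \<eta> (y + z))"
proof -
  note [measurable] = kernel_bound_measurable[OF k]
  have k': "kernel_bound a (\<lambda>z. k (- z))"
    using k by (auto simp: kernel_bound_def inv_norm_def)
      (metis norm_minus_cancel)
  have "integrable lborel (\<lambda>x. k (- (y - x)) * \<eta> x)"
    by (rule pot_bound(1)[OF k' _ AE_I2[OF \<eta>], of 0]) simp_all
  from integrable_lborel_shift[OF this, of y] show ?thesis by simp
qed

lemma corr_bound:
  fixes k \<eta> :: "real ^ 'n \<Rightarrow> complex"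
  assumes k: "kernel_bound a k" and [measurable]: "\<eta> \<in> borel_measurable borel"
    and \<eta>: "\<And>x. norm (\<eta> x) \<le> C * wt x ^ Suc CARD('n)"
  shows "\<exists>D>0. \<forall>y. norm (corr k \<eta> y) \<le> D * wt y ^ a"
proof -
  note [measurable] = kernel_bound_measurable[OF k]
  have k': "kernel_bound a (\<lambda>z. k (- z))"
    using k by (auto simp: kernel_bound_def inv_norm_def) (metis norm_minus_cancel)
  have "corr k \<eta> = pot (\<lambda>z. k (- z)) \<eta>"
    unfolding pot_def[abs_def] by (rule ext, subst corr_eq) simp_all
  moreover have "a \<le> Suc CARD('n)" using k by (auto simp: kernel_bound_def)
  ultimately show ?thesis using pot_bound(2)[OF k' _ AE_I2[OF \<eta>], of a] by simp
qed

text \<open>Integrating the weighted Taylor remainder of \<eta> against the kernel gives an error of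
  order |h|^2, hence Frechet differentiability at once, as \<open>smooth\<close> demands.\<close>

lemma corr_has_derivative:
  fixes k \<eta> :: "real ^ 'n \<Rightarrow> complex"
  assumes k: "kernel_bound a k" and \<eta>: "test_function \<eta>"
  shows "(corr k \<eta> has_derivative (\<lambda>h. \<Sum>i\<in>UNIV. h $ i *\<^sub>R corr k (partial i \<eta>) y)) (at y)"
proof -
  note [measurable] = kernel_bound_measurable[OF k]
  let ?m = "Suc CARD('n)"
  let ?D = "\<lambda>h. \<Sum>i\<in>UNIV. h $ i *\<^sub>R corr k (partial i \<eta>) y"
  have int: "integrable lborel (\<lambda>z. k z * \<zeta> (y + z))" if "test_function \<zeta>" for y \<zeta>
    using test_function_bound[OF that, of ?m] smooth_borel[OF test_function_smooth[OF that]]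
    by (auto intro!: corr_integrable[OF k])
  obtain M where M: "M \<ge> 0" "\<And>w h. norm h \<le> 1 \<Longrightarrow>
      norm (\<eta> (w + h) - \<eta> w - (\<Sum>i\<in>UNIV. h $ i *\<^sub>R partial i \<eta> w)) \<le> M * (norm h)\<^sup>2 * wt w ^ ?m"
    using test_function_taylor[OF \<eta>, of ?m] by blast
  have intw: "integrable lborel (\<lambda>z. norm (k z * complex_of_real (wt (y + z) ^ ?m)))"
    by (intro integrable_norm corr_integrable[OF k, of _ 1]) (auto simp: norm_power simp del: power_Suc)
  define K where "K = M * (LINT z|lborel. norm (k z * complex_of_real (wt (y + z) ^ ?m)))"
  have K: "norm (corr k \<eta> (y + h) - corr k \<eta> y - ?D h) \<le> K * (norm h)\<^sup>2" if h: "norm h \<le> 1" for h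
  proof -
    have i1: "integrable lborel (\<lambda>z. k z * (\<Sum>i\<in>UNIV. h $ i *\<^sub>R partial i \<eta> (y + z)))"
      using int[OF test_function_partial[OF \<eta>]] by (simp add: sum_distrib_left)
    have "?D h = (LINT z|lborel. k z * (\<Sum>i\<in>UNIV. h $ i *\<^sub>R partial i \<eta> (y + z)))"
      using int[OF test_function_partial[OF \<eta>]]
      by (simp add: sum_distrib_left Bochner_Integration.integral_sum corr_def)
    then have "corr k \<eta> (y + h) - corr k \<eta> y - ?D h
       = (LINT z|lborel. k z * (\<eta> ((y + z) + h) - \<eta> (y + z) - (\<Sum>i\<in>UNIV. h $ i *\<^sub>R partial i \<eta> (y + z))))"
      using int[OF \<eta>, of "y + h"] int[OF \<eta>, of y] i1
      by (simp add: corr_def right_diff_distrib add_ac)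
    also have "norm \<dots> \<le> (LINT z|lborel. M * (norm h)\<^sup>2 * norm (k z * complex_of_real (wt (y + z) ^ ?m)))"
    proof (rule order_trans[OF integral_norm_bound integral_mono])
      show "integrable lborel (\<lambda>z. norm (k z * (\<eta> ((y + z) + h) - \<eta> (y + z) - (\<Sum>i\<in>UNIV. h $ i *\<^sub>R partial i \<eta> (y + z)))))"
        using int[OF \<eta>, of "y + h"] int[OF \<eta>, of y] i1 by (intro integrable_norm) (simp add: right_diff_distrib add_ac)
      show "integrable lborel (\<lambda>z. M * (norm h)\<^sup>2 * norm (k z * complex_of_real (wt (y + z) ^ ?m)))"
        by (intro integrable_mult_right intw)
      show "norm (k z * (\<eta> ((y + z) + h) - \<eta> (y + z) - (\<Sum>i\<in>UNIV. h $ i *\<^sub>R partial i \<eta> (y + z))))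
        \<le> M * (norm h)\<^sup>2 * norm (k z * complex_of_real (wt (y + z) ^ ?m))" for z
        using mult_left_mono[OF M(2)[OF h, of "y + z"] norm_ge_zero[of "k z"]]
        by (simp add: norm_mult norm_power mult_ac del: power_Suc)
    qed
    also have "\<dots> = K * (norm h)\<^sup>2" by (simp add: K_def mult_ac del: power_Suc)
    finally show ?thesis .
  qed
  show ?thesis unfolding has_derivative_at
  proof
    show "bounded_linear ?D"
      by (intro bounded_linear_sum bounded_linear_compose[OF bounded_linear_scaleR_left bounded_linear_vec_nth])
    show "(\<lambda>h. norm (corr k \<eta> (y + h) - corr k \<eta> y - ?D h) / norm h) \<midarrow>0\<rightarrow> 0"
    proof (rule Lim_null_comparison)
      have "\<forall>\<^sub>F h in at (0 :: real ^ 'n). dist h 0 < 1" by (rule eventually_at_ball'[THEN eventually_mono]) (auto simp: dist_commute)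
      then show "\<forall>\<^sub>F h in at 0. norm (norm (corr k \<eta> (y + h) - corr k \<eta> y - ?D h) / norm h) \<le> K * norm h"
      proof eventually_elim
        case (elim h)
        then have h: "norm h \<le> 1" by simp
        show ?case
        proof (cases "h = 0")
          case False
          then show ?thesis using K[OF h] by (simp add: divide_le_eq power2_eq_square mult_ac)
        qed simp
      qed
      have "((\<lambda>h :: real ^ 'n. K * norm h) \<longlongrightarrow> K * norm (0 :: real ^ 'n)) (at 0)" by (intro tendsto_intros)
      then show "((\<lambda>h :: real ^ 'n. K * norm h) \<longlongrightarrow> 0) (at 0)" by simp
    qed
  qed
qed

lemma partial_corr:
  assumes "kernel_bound a k" "test_function \<eta>"
  shows "partial i (corr k \<eta>) = corr k (partial i \<eta>)"
proof
  fix y show "partial i (corr k \<eta>) y = corr k (partial i \<eta>) y"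
    using partial_eqI[OF corr_has_derivative[OF assms], of i y] by (simp add: sum_axis_scaleR)
qed

lemma smooth_corr:
  assumes k: "kernel_bound a k" and \<eta>: "test_function \<eta>"
  shows "smooth (corr k \<eta>)"
proof (rule smooth_coinduct[where S="{corr k \<eta> | \<eta>. test_function \<eta>}"])
  show "corr k \<eta> \<in> {corr k \<eta> | \<eta>. test_function \<eta>}" using \<eta> by blast
  show "g differentiable (at x)" if "g \<in> {corr k \<eta> | \<eta>. test_function \<eta>}" for g x
    using that differentiableI[OF corr_has_derivative[OF k]] by blast
  show "partial i g \<in> {corr k \<eta> | \<eta>. test_function \<eta>}" if "g \<in> {corr k \<eta> | \<eta>. test_function \<eta>}" for g i
    using that partial_corr[OF k] test_function_partial by blast
qed

subsection \<open>The Newtonian potential\<close>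

abbreviation newton :: "(real ^ 'n \<Rightarrow> complex) \<Rightarrow> real ^ 'n \<Rightarrow> complex" where
  "newton \<equiv> pot newton_kernel"

text \<open>Equal to (n - 2) times the area of the unit sphere, so that
  \<open>zero_resolvent\<close> is \<open>newton\<close> divided by this constant; it is minus the
  factor produced by the Laplacian.\<close>

definition newton_const :: "'n::finite itself \<Rightarrow> real" where
  "newton_const _ = real CARD('n) * (real CARD('n) - 2) * unit_ball_vol CARD('n)"

lemma newton_const_pos: "CARD('n) \<ge> 3 \<Longrightarrow> newton_const TYPE('n::finite) > 0"
  by (auto simp: newton_const_def intro!: mult_pos_pos)

lemma corr_shift_test:
  assumes "test_function \<eta>"
  shows "test_function (\<lambda>z. \<eta> (y + z))" "partial i (\<lambda>z. \<eta> (y + z)) z = partial i \<eta> (y + z)"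
    "laplacian (\<lambda>z. \<eta> (y + z)) z = laplacian \<eta> (y + z)"
proof -
  show "test_function (\<lambda>z. \<eta> (y + z))" using test_function_affine[OF assms, of 1 y] by simp
  have p: "partial i (\<lambda>z. \<zeta> (y + z)) = (\<lambda>z. partial i \<zeta> (y + z))" if "smooth \<zeta>" for i and \<zeta> :: "real ^ 'a \<Rightarrow> complex"
    using partial_affine(2)[OF smooth_differentiable[OF that], of i y 1] by (auto simp: fun_eq_iff)
  note s = test_function_smooth[OF assms]
  show "partial i (\<lambda>z. \<eta> (y + z)) z = partial i \<eta> (y + z)" by (simp add: p[OF s])
  show "laplacian (\<lambda>z. \<eta> (y + z)) z = laplacian \<eta> (y + z)"
    by (simp add: laplacian_def p[OF s] p[OF smooth_partial[OF s]])
qed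

lemma corr_newton_partial:
  fixes \<eta> :: "real ^ 'n \<Rightarrow> complex"
  assumes n: "CARD('n) \<ge> 3" and \<eta>: "test_function \<eta>"
  shows "corr newton_kernel (partial i \<eta>) y = - corr (newton_gradient i) \<eta> y"
  using newton_kernel_weak_gradient[OF n corr_shift_test(1)[OF \<eta>, of y], of i]
  by (simp add: corr_def corr_shift_test(2)[OF \<eta>])

lemma corr_newton_laplacian:
  fixes \<eta> :: "real ^ 'n \<Rightarrow> complex"
  assumes n: "CARD('n) \<ge> 3" and \<eta>: "test_function \<eta>"
  shows "corr newton_kernel (laplacian \<eta>) y = - complex_of_real (newton_const TYPE('n)) * \<eta> y"
  using newton_kernel_fundamental_solution[OF n corr_shift_test(1)[OF \<eta>, of y]]
  by (simp add: corr_def corr_shift_test(3)[OF \<eta>] newton_const_def)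

lemma test_function_bound_Suc:
  fixes \<eta> :: "real ^ 'n \<Rightarrow> complex"
  assumes "test_function \<eta>"
  obtains C where "C > 0" "\<And>x. norm (\<eta> x) \<le> C * wt x ^ Suc CARD('n)" "\<eta> \<in> borel_measurable borel"
  using test_function_bound[OF assms] smooth_borel[OF test_function_smooth[OF assms]] by blast

lemma corr_test_bound:
  fixes \<eta> :: "real ^ 'n \<Rightarrow> complex"
  assumes k: "kernel_bound a k" and \<eta>: "test_function \<eta>"
  shows "\<exists>D>0. \<forall>y. norm (corr k \<eta> y) \<le> D * wt y ^ a"
  using test_function_bound_Suc[OF \<eta>] corr_bound[OF k] by metis

text \<open>The derivative gains a power of decay over a general correlation, because it can be
  moved to the kernel, whose gradient decays like |z|^(1-n). In the energy estimate this gain makes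
  the products integrable, as 2 (n - 1) > n.\<close>

lemma corr_newton_partial_bound:
  fixes \<eta> :: "real ^ 'n \<Rightarrow> complex"
  assumes n: "CARD('n) \<ge> 3" and \<eta>: "test_function \<eta>"
  shows "\<exists>D>0. \<forall>y. norm (corr newton_kernel (partial i \<eta>) y) \<le> D * wt y ^ (CARD('n) - 1)"
  using corr_test_bound[OF kernel_bound_newton_gradient[OF n] \<eta>, of i] by (simp add: corr_newton_partial[OF n \<eta>])

lemma laplacian_corr_newton:
  fixes \<eta> :: "real ^ 'n \<Rightarrow> complex"
  assumes n: "CARD('n) \<ge> 3" and \<eta>: "test_function \<eta>"
  shows "laplacian (corr newton_kernel \<eta>) y = - complex_of_real (newton_const TYPE('n)) * \<eta> y"
proof -
  note k = kernel_bound_newton_kernel[OF n]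
  have int: "integrable lborel (\<lambda>z. newton_kernel z * partial i (partial i \<eta>) (y + z))" for i
    using test_function_bound_Suc[OF test_function_partial[OF test_function_partial[OF \<eta>]], of i i]
    by (metis corr_integrable[OF k])
  have "laplacian (corr newton_kernel \<eta>) y = (\<Sum>i\<in>UNIV. corr newton_kernel (partial i (partial i \<eta>)) y)"
    by (simp add: laplacian_def partial_corr[OF k] \<eta> test_function_partial)
  also have "\<dots> = corr newton_kernel (laplacian \<eta>) y"
    using int by (simp add: corr_def laplacian_def sum_distrib_left Bochner_Integration.integral_sum)
  finally show ?thesis by (simp add: corr_newton_laplacian[OF n \<eta>])
qed

lemma newton_distributional_laplacian:
  fixes f \<eta> :: "real ^ 'n \<Rightarrow> complex"
  assumes n: "CARD('n) \<ge> 3" and [measurable]: "f \<in> borel_measurable borel"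
    and f: "integrable lborel (\<lambda>y. wt y ^ (CARD('n) - 2) * norm (f y))" and \<eta>: "test_function \<eta>"
  shows "(LINT x|lborel. newton f x * laplacian \<eta> x) = - complex_of_real (newton_const TYPE('n)) * (LINT x|lborel. f x * \<eta> x)"
proof -
  obtain C where "C > 0" "\<And>x. norm (laplacian \<eta> x) \<le> C * wt x ^ Suc CARD('n)" "laplacian \<eta> \<in> borel_measurable borel"
    using test_function_bound_Suc[OF test_function_laplacian[OF \<eta>]] by metis
  then have "(LINT x|lborel. newton f x * laplacian \<eta> x) = (LINT y|lborel. f y * corr newton_kernel (laplacian \<eta>) y)"
    by (intro pot_duality(2)[OF kernel_bound_newton_kernel[OF n] _ _ f]) auto
  also have "\<dots> = (LINT y|lborel. - complex_of_real (newton_const TYPE('n)) * (f y * \<eta> y))"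
    by (simp add: corr_newton_laplacian[OF n \<eta>] mult_ac)
  finally show ?thesis by simp
qed

lemma newton_weak_gradient:
  fixes f \<eta> :: "real ^ 'n \<Rightarrow> complex"
  assumes n: "CARD('n) \<ge> 3" and [measurable]: "f \<in> borel_measurable borel"
    and f: "integrable lborel (\<lambda>y. wt y ^ (CARD('n) - 2) * norm (f y))" and \<eta>: "test_function \<eta>"
  shows "(LINT x|lborel. newton f x * partial i \<eta> x) = - (LINT x|lborel. pot (newton_gradient i) f x * \<eta> x)"
proof -
  have f': "integrable lborel (\<lambda>y. wt y ^ (CARD('n) - 1) * norm (f y))"
    by (rule Bochner_Integration.integrable_bound[OF f])
       (auto intro!: AE_I2 mult_right_mono wt_power_antimono)
  obtain C where "C > 0" "\<And>x. norm (partial i \<eta> x) \<le> C * wt x ^ Suc CARD('n)" "partial i \<eta> \<in> borel_measurable borel"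
    using test_function_bound_Suc[OF test_function_partial[OF \<eta>]] by metis
  then have "(LINT x|lborel. newton f x * partial i \<eta> x) = (LINT y|lborel. f y * corr newton_kernel (partial i \<eta>) y)"
    by (intro pot_duality(2)[OF kernel_bound_newton_kernel[OF n] _ _ f]) auto
  also have "\<dots> = - (LINT y|lborel. f y * corr (newton_gradient i) \<eta> y)"
    by (simp add: corr_newton_partial[OF n \<eta>])
  also have "(LINT y|lborel. f y * corr (newton_gradient i) \<eta> y) = (LINT x|lborel. pot (newton_gradient i) f x * \<eta> x)"
  proof -
    obtain D where "D > 0" "\<And>x. norm (\<eta> x) \<le> D * wt x ^ Suc CARD('n)" "\<eta> \<in> borel_measurable borel"
      using test_function_bound_Suc[OF \<eta>] by metis
    then show ?thesis
      by (intro pot_duality(2)[OF kernel_bound_newton_gradient[OF n] _ _ f', symmetric]) auto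
  qed
  finally show ?thesis .
qed

lemma laplacian_mult:
  assumes f: "smooth f" and g: "smooth g"
  shows "laplacian (\<lambda>x. f x * g x) x
    = f x * laplacian g x + 2 * (\<Sum>i\<in>UNIV. partial i f x * partial i g x) + laplacian f x * g x"
proof -
  have p: "partial i (\<lambda>x. f x * g x) = (\<lambda>x. f x * partial i g x + partial i f x * g x)" for i
    using f g by (auto simp: partial_mult smooth_differentiable)
  have "partial i (partial i (\<lambda>x. f x * g x)) x
     = f x * partial i (partial i g) x + 2 * (partial i f x * partial i g x) + partial i (partial i f) x * g x" for i
    unfolding p using f g
    by (subst partial_add) (auto simp: partial_mult smooth_differentiable smooth_partial smooth_mult)
  then show ?thesis
    by (simp add: laplacian_def sum.distrib sum_distrib_left sum_distrib_right)
qed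

section \<open>Cutoffs at scale k + 1\<close>

definition cutoff :: "nat \<Rightarrow> real ^ 'n \<Rightarrow> complex" where
  "cutoff k x = bump 1 1 ((1 / real (Suc k)) *\<^sub>R x)"

lemma cutoff_eq: "cutoff k = (\<lambda>x. bump 1 1 (0 + (1 / real (Suc k)) *\<^sub>R x))"
  by (simp add: cutoff_def fun_eq_iff)

lemma test_function_cutoff: "test_function (cutoff k)"
  unfolding cutoff_eq by (intro test_function_affine test_function_bump) auto

lemma partial_cutoff:
  "partial i (cutoff k) x = (1 / real (Suc k)) * partial i (bump 1 1) ((1 / real (Suc k)) *\<^sub>R x)"
  unfolding cutoff_eq by (subst partial_affine(2)) (simp_all add: smooth_differentiable smooth_bump del: of_nat_Suc)

lemma partial2_cutoff:
  "partial i (partial i (cutoff k)) x = (1 / real (Suc k))\<^sup>2 * partial i (partial i (bump 1 1)) ((1 / real (Suc k)) *\<^sub>R x)"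
proof -
  let ?c = "1 / real (Suc k)"
  have s: "smooth (partial i (bump 1 1))" by (intro smooth_partial smooth_bump)
  have "partial i (cutoff k) = (\<lambda>x. complex_of_real ?c * partial i (bump 1 1) (0 + ?c *\<^sub>R x))"
    using partial_cutoff by auto
  then have "partial i (partial i (cutoff k)) x = complex_of_real ?c * partial i (\<lambda>x. partial i (bump 1 1) (0 + ?c *\<^sub>R x)) x"
    using smooth_differentiable[OF smooth_affine[OF s, of 0 ?c], of x] by (simp only: partial_cmult)
  also have "\<dots> = complex_of_real ?c * (?c * partial i (partial i (bump 1 1)) (0 + ?c *\<^sub>R x))"
    by (subst partial_affine(2)) (simp_all add: smooth_differentiable s del: of_nat_Suc)
  finally show ?thesis by (simp add: power2_eq_square)
qed

text \<open>Two bounds are needed for each derivative: one by a power of \<open>wt\<close>, uniform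
  in k, for domination, and one that vanishes with k, for the limit. Differentiation produces
  factors c = 1/(k + 1), and the first bound comes from
  \<open>c * wt (c *\<^sub>R x) \<le> wt x\<close>.\<close>

lemma cutoff_bounds:
  shows "norm (cutoff k (x :: real ^ 'n)) \<le> 1"
    and "\<exists>B>0. \<forall>k (x :: real ^ 'n). norm (partial i (cutoff k) x) \<le> B * wt x \<and> norm (partial i (cutoff k) x) \<le> B * (1 / real (Suc k))"
    and "\<exists>B>0. \<forall>k (x :: real ^ 'n). norm (laplacian (cutoff k) x) \<le> B * wt x ^ 2 \<and> norm (laplacian (cutoff k) x) \<le> B * (1 / real (Suc k)) ^ 2"
proof -
  show "norm (cutoff k (x :: real ^ 'n)) \<le> 1" by (simp add: cutoff_def norm_bump_le_1)
  have b: "test_function (bump 1 1 :: real ^ 'n \<Rightarrow> complex)" by (intro test_function_bump) auto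
  have key: "\<exists>B>0. \<forall>k (x :: real ^ 'n). norm ((1 / real (Suc k)) ^ m *\<^sub>R \<zeta> ((1 / real (Suc k)) *\<^sub>R x)) \<le> B * wt x ^ m
      \<and> norm ((1 / real (Suc k)) ^ m *\<^sub>R \<zeta> ((1 / real (Suc k)) *\<^sub>R x)) \<le> B * (1 / real (Suc k)) ^ m"
    if \<zeta>: "test_function \<zeta>" for m and \<zeta> :: "real ^ 'n \<Rightarrow> complex"
  proof -
    obtain B where B: "B > 0" "\<And>x. norm (\<zeta> x) \<le> B * wt x ^ m"
      using test_function_bound[OF \<zeta>] by blast
    have "norm ((1 / real (Suc k)) ^ m *\<^sub>R \<zeta> ((1 / real (Suc k)) *\<^sub>R x)) \<le> B * wt x ^ m
       \<and> norm ((1 / real (Suc k)) ^ m *\<^sub>R \<zeta> ((1 / real (Suc k)) *\<^sub>R x)) \<le> B * (1 / real (Suc k)) ^ m" for k and x :: "real ^ 'n"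
    proof -
      let ?c = "1 / real (Suc k)"
      have c: "0 < ?c" "?c \<le> 1" by auto
      have "?c * wt (?c *\<^sub>R x) \<le> wt x"
      proof -
        have "?c * sqrt (1 + (norm x)\<^sup>2) = sqrt (?c\<^sup>2 * (1 + (norm x)\<^sup>2))"
          using c by (simp add: real_sqrt_mult del: of_nat_Suc)
        also have "\<dots> \<le> sqrt (1 + (norm (?c *\<^sub>R x))\<^sup>2)"
          using power_le_one[of ?c 2] c by (intro real_sqrt_le_mono) (simp add: power_mult_distrib power_divide distrib_left del: of_nat_Suc)
        finally have "?c * japanese_bracket x \<le> japanese_bracket (?c *\<^sub>R x)" by (simp add: japanese_bracket_def)
        then show ?thesis
          using japanese_bracket_ge_1[of x] japanese_bracket_ge_1[of "?c *\<^sub>R x"] by (simp add: wt_def divide_simps mult_ac del: of_nat_Suc)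
      qed
      then have "(?c * wt (?c *\<^sub>R x)) ^ m \<le> wt x ^ m" using c by (intro power_mono) auto
      then have 1: "B * (?c ^ m * wt (?c *\<^sub>R x) ^ m) \<le> B * wt x ^ m"
        unfolding power_mult_distrib using B by (intro mult_left_mono) auto
      have 2: "?c ^ m * (B * wt (?c *\<^sub>R x) ^ m) \<le> ?c ^ m * (B * 1)"
        using B c by (intro mult_left_mono) (auto simp: power_le_one)
      have "norm (?c ^ m *\<^sub>R \<zeta> (?c *\<^sub>R x)) \<le> ?c ^ m * (B * wt (?c *\<^sub>R x) ^ m)"
        using mult_left_mono[OF B(2)[of "?c *\<^sub>R x"], of "?c ^ m"] c by simp
      with 1 2 show ?thesis by (simp only: mult_ac mult_1_right) linarith
    qed
    with B(1) show ?thesis by blast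
  qed
  show "\<exists>B>0. \<forall>k (x :: real ^ 'n). norm (partial i (cutoff k) x) \<le> B * wt x \<and> norm (partial i (cutoff k) x) \<le> B * (1 / real (Suc k))"
    using key[OF test_function_partial[OF b, of i], of 1] by (simp only: power_one_right partial_cutoff scaleR_conv_of_real)
  have l: "laplacian (cutoff k) x = (1 / real (Suc k)) ^ 2 *\<^sub>R laplacian (bump 1 1) ((1 / real (Suc k)) *\<^sub>R x)" for k and x :: "real ^ 'n"
    by (simp add: laplacian_def partial2_cutoff scaleR_conv_of_real sum_distrib_left)
  show "\<exists>B>0. \<forall>k (x :: real ^ 'n). norm (laplacian (cutoff k) x) \<le> B * wt x ^ 2 \<and> norm (laplacian (cutoff k) x) \<le> B * (1 / real (Suc k)) ^ 2"
    using key[OF test_function_laplacian[OF b], of 2] by (simp only: l)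
qed

lemma cutoff_tendsto:
  fixes x :: "real ^ 'n"
  shows "(\<lambda>k. cutoff k x) \<longlonglongrightarrow> bump 1 1 (0 :: real ^ 'n)"
proof -
  have "(\<lambda>k. (1 / real (Suc k)) *\<^sub>R x) \<longlonglongrightarrow> 0 *\<^sub>R x" by (intro tendsto_intros LIMSEQ_Suc lim_1_over_n)
  then have "(\<lambda>k. (1 / real (Suc k)) *\<^sub>R x) \<longlonglongrightarrow> 0" by simp
  moreover have "isCont (bump 1 1) (0 :: real ^ 'n)"
    using smooth_continuous[OF smooth_bump, of "UNIV :: (real ^ 'n) set" 1 1] by (simp add: continuous_on_eq_continuous_at)
  ultimately show ?thesis unfolding cutoff_def by (rule isCont_tendsto_compose[rotated])
qed

lemma tendsto_0_if_le_inverse_Suc: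
  fixes f :: "nat \<Rightarrow> complex"
  assumes "\<And>k. norm (f k) \<le> B * (1 / real (Suc k))" shows "f \<longlonglongrightarrow> 0"
proof (rule Lim_null_comparison)
  have "(\<lambda>k. B * (1 / real (Suc k))) \<longlonglongrightarrow> B * 0" by (intro tendsto_intros LIMSEQ_Suc lim_1_over_n)
  then show "(\<lambda>k. B * (1 / real (Suc k))) \<longlonglongrightarrow> 0" by simp
qed (use assms in auto)

text \<open>The Cauchy-Schwarz inequality in the additive form a b \<le> a^2 + b^2; the condition on
  k makes the square of the weight integrable.\<close>

lemma wt_L2_integrable:
  fixes \<psi> :: "real ^ 'n \<Rightarrow> complex"
  assumes [measurable]: "\<psi> \<in> borel_measurable borel" and L2: "integrable lborel (\<lambda>x. (norm (\<psi> x))\<^sup>2)"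
    and k: "2 * k > CARD('n)"
  shows "integrable lborel (\<lambda>x. wt x ^ k * norm (\<psi> x))"
proof (rule Bochner_Integration.integrable_bound)
  show "integrable lborel (\<lambda>x::real^'n. wt x ^ (2 * k) + (norm (\<psi> x))\<^sup>2)"
    by (intro Bochner_Integration.integrable_add wt_power_integrable k L2)
  show "AE x in lborel. norm (wt x ^ k * norm (\<psi> x)) \<le> norm (wt x ^ (2 * k) + (norm (\<psi> x))\<^sup>2)"
  proof (intro AE_I2)
    fix x :: "real ^ 'n"
    have "2 * (wt x ^ k * norm (\<psi> x)) \<le> (wt x ^ k)\<^sup>2 + (norm (\<psi> x))\<^sup>2"
      using sum_squares_bound[of "wt x ^ k" "norm (\<psi> x)"] by simp
    moreover have "wt x ^ k * norm (\<psi> x) \<ge> 0" by simp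
    moreover have "(wt x ^ k)\<^sup>2 = wt x ^ (2 * k)" by (simp add: power_mult[symmetric] mult.commute)
    ultimately have "wt x ^ k * norm (\<psi> x) \<le> wt x ^ (2 * k) + (norm (\<psi> x))\<^sup>2" by linarith
    then show "norm (wt x ^ k * norm (\<psi> x)) \<le> norm (wt x ^ (2 * k) + (norm (\<psi> x))\<^sup>2)" by simp
  qed
qed measurable

text \<open>Testing with \<open>\<chi>(x/R) (\<Gamma> \<star> \<eta>)\<close> and letting \<open>R \<rightarrow> \<infinity>\<close>: on the support of the cutoff its derivatives are
  bounded by powers of \<open>1/\<langle>x\<rangle>\<close>, so all error terms are dominated by \<open>\<langle>x\<rangle>\<^bsup>-n\<^esup> \<bar>\<psi>\<bar>\<close>.\<close>

lemma L2_solution_eq_newton: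
  fixes \<psi> f :: "real ^ 'n \<Rightarrow> complex"
  assumes n: "CARD('n) \<ge> 3"
    and [measurable]: "\<psi> \<in> borel_measurable borel" "f \<in> borel_measurable borel"
    and L2: "integrable lborel (\<lambda>x. (norm (\<psi> x))\<^sup>2)"
    and f: "\<And>x. norm (f x) \<le> C * wt x ^ 4 * norm (\<psi> x)"
    and sol: "\<And>\<eta>. test_function \<eta> \<Longrightarrow> (LINT x|lborel. \<psi> x * laplacian \<eta> x) = (LINT x|lborel. f x * \<eta> x)"
  shows "AE x in lborel. complex_of_real (newton_const TYPE('n)) * \<psi> x = - newton f x"
proof -
  let ?n = "CARD('n)" let ?\<kappa> = "complex_of_real (newton_const TYPE('n))"
  note kn = kernel_bound_newton_kernel[OF n]
  \<comment> \<open>The one integrability fact about \<psi> that the limit requires: every error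
    term below is at most a constant times this integrand.\<close>
  have psi_n: "integrable lborel (\<lambda>x. wt x ^ ?n * norm (\<psi> x))"
    using n by (intro wt_L2_integrable L2) auto
  have f': "integrable lborel (\<lambda>x. wt x ^ (?n - 2) * norm (f x))"
  proof (rule Bochner_Integration.integrable_bound)
    show "integrable lborel (\<lambda>x. C * (wt x ^ ?n * norm (\<psi> x)))" using psi_n by simp
    show "AE x in lborel. norm (wt x ^ (?n - 2) * norm (f x)) \<le> norm (C * (wt x ^ ?n * norm (\<psi> x)))"
    proof (intro AE_I2)
      fix x
      have "wt x ^ (?n - 2) * norm (f x) \<le> wt x ^ (?n - 2) * (C * wt x ^ 4 * norm (\<psi> x))" by (intro mult_left_mono f) auto
      also have "\<dots> \<le> \<bar>C\<bar> * (wt x ^ (?n - 2) * wt x ^ 4 * norm (\<psi> x))"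
        by (simp add: mult_ac mult_right_mono)
      also have "wt x ^ (?n - 2) * wt x ^ 4 \<le> wt x ^ ?n"
        unfolding power_add[symmetric] using n by (intro wt_power_antimono) auto
      finally show "norm (wt x ^ (?n - 2) * norm (f x)) \<le> norm (C * (wt x ^ ?n * norm (\<psi> x)))"
        by (simp add: abs_mult mult_right_mono mult_left_mono)
    qed
  qed measurable
  have C1: "norm (f x) * wt x ^ (?n - 2) \<le> \<bar>C\<bar> * (wt x ^ ?n * norm (\<psi> x))" for x
  proof -
    have "wt x ^ (?n - 2) * norm (f x) \<le> wt x ^ (?n - 2) * (\<bar>C\<bar> * wt x ^ 4 * norm (\<psi> x))"
      by (intro mult_left_mono order_trans[OF f] mult_right_mono) auto
    also have "\<dots> = \<bar>C\<bar> * (wt x ^ (?n - 2 + 4) * norm (\<psi> x))" by (simp add: power_add mult_ac)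
    also have "\<dots> \<le> \<bar>C\<bar> * (wt x ^ ?n * norm (\<psi> x))"
      using n by (intro mult_left_mono mult_right_mono wt_power_antimono) auto
    finally show ?thesis by (simp add: mult_ac)
  qed
  have zero: "(LINT x|lborel. (?\<kappa> * \<psi> x + newton f x) * \<eta> x) = 0" if \<eta>: "test_function \<eta>" for \<eta>
  proof -
    define U where "U = corr newton_kernel \<eta>"
    have sU: "smooth U" unfolding U_def by (rule smooth_corr[OF kn \<eta>])
    have [measurable]: "U \<in> borel_measurable borel" "\<eta> \<in> borel_measurable borel"
      by (intro smooth_borel sU test_function_smooth \<eta>)+
    have [measurable]: "partial i U \<in> borel_measurable borel" for i by (intro smooth_borel smooth_partial sU)
    have [measurable]: "cutoff k \<in> borel_measurable borel" "partial i (cutoff k) \<in> borel_measurable borel"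
      "laplacian (cutoff k) \<in> borel_measurable borel" for k and i :: 'n
      by (intro smooth_borel test_function_smooth test_function_cutoff test_function_partial test_function_laplacian)+
    obtain D where D: "D > 0" "\<And>y. norm (U y) \<le> D * wt y ^ (?n - 2)"
      using corr_test_bound[OF kn \<eta>] unfolding U_def by blast
    have "\<forall>i. \<exists>D>0. \<forall>y. norm (partial i U y) \<le> D * wt y ^ (?n - 1)"
      unfolding U_def partial_corr[OF kn \<eta>] by (intro allI corr_newton_partial_bound[OF n \<eta>])
    then obtain D' where D': "\<And>i. D' i > 0" "\<And>i y. norm (partial i U y) \<le> D' i * wt y ^ (?n - 1)" by metis
    have "\<forall>i. \<exists>B>0. \<forall>k (x::real^'n). norm (partial i (cutoff k) x) \<le> B * wt x \<and> norm (partial i (cutoff k) x) \<le> B * (1 / real (Suc k))"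
      by (intro allI cutoff_bounds(2))
    then obtain B where B: "\<And>i. B i > 0" "\<And>i k (x::real^'n). norm (partial i (cutoff k) x) \<le> B i * wt x"
      "\<And>i k (x::real^'n). norm (partial i (cutoff k) x) \<le> B i * (1 / real (Suc k))" by metis
    obtain L where L: "L > 0" "\<And>k (x::real^'n). norm (laplacian (cutoff k) x) \<le> L * wt x ^ 2"
      "\<And>k (x::real^'n). norm (laplacian (cutoff k) x) \<le> L * (1 / real (Suc k)) ^ 2" using cutoff_bounds(3) by metis
    obtain E where E: "E > 0" "\<And>x. norm (\<eta> x) \<le> E * wt x ^ ?n" using test_function_bound[OF \<eta>] by blast
    \<comment> \<open>The three terms of the Laplacian of a product. Each has n powers of the
      weight: n from \<eta>, 1 + (n - 1) from the two gradients, and 2 + (n - 2) from the Laplacian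
      of the cutoff times U.\<close>
    define M where "M = newton_const TYPE('n) * E + 2 * (\<Sum>i\<in>UNIV. B i * D' i) + L * D"
    let ?T = "\<lambda>k x. cutoff k x * U x"
    have T: "test_function (?T k)" for k by (rule test_function_mult[OF test_function_cutoff sU])
    have lapT: "laplacian (?T k) x = cutoff k x * (- ?\<kappa> * \<eta> x) + 2 * (\<Sum>i\<in>UNIV. partial i (cutoff k) x * partial i U x) + laplacian (cutoff k) x * U x" for k x
      by (subst laplacian_mult[OF test_function_smooth[OF test_function_cutoff] sU])
         (simp add: U_def laplacian_corr_newton[OF n \<eta>])
    have \<kappa>0: "newton_const TYPE('n) > 0" by (rule newton_const_pos[OF n])
    have lapT_bound: "norm (laplacian (?T k) x) \<le> M * wt x ^ ?n" for k x
    proof -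
      have 1: "norm (cutoff k x * (- ?\<kappa> * \<eta> x)) \<le> newton_const TYPE('n) * E * wt x ^ ?n"
      proof -
        have "norm (cutoff k x) * (newton_const TYPE('n) * norm (\<eta> x)) \<le> 1 * (newton_const TYPE('n) * (E * wt x ^ ?n))"
          using \<kappa>0 by (intro mult_mono mult_left_mono cutoff_bounds(1) E) auto
        then show ?thesis using \<kappa>0 by (simp add: norm_mult mult.assoc)
      qed
      have 2: "norm (\<Sum>i\<in>UNIV. partial i (cutoff k) x * partial i U x) \<le> (\<Sum>i\<in>UNIV. (B i * D' i) * wt x ^ ?n)"
      proof (rule sum_norm_le)
        fix i
        have "norm (partial i (cutoff k) x) * norm (partial i U x) \<le> (B i * wt x) * (D' i * wt x ^ (?n - 1))"
          using B(1)[of i] D'(1)[of i] by (intro mult_mono B(2) D'(2)) auto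
        also have "\<dots> = (B i * D' i) * wt x ^ ?n" using n by (cases ?n) auto
        finally show "norm (partial i (cutoff k) x * partial i U x) \<le> (B i * D' i) * wt x ^ ?n" by (simp add: norm_mult)
      qed
      have 3: "norm (laplacian (cutoff k) x * U x) \<le> L * D * wt x ^ ?n"
      proof -
        have "norm (laplacian (cutoff k) x) * norm (U x) \<le> (L * wt x ^ 2) * (D * wt x ^ (?n - 2))"
          using L(1) D(1) by (intro mult_mono L(2) D(2)) auto
        also have "\<dots> = L * D * (wt x ^ 2 * wt x ^ (?n - 2))" by (simp add: mult_ac)
        also have "wt x ^ 2 * wt x ^ (?n - 2) = wt x ^ ?n"
        proof -
          have "2 + (?n - 2) = ?n" using n by simp
          then show ?thesis by (simp only: power_add[symmetric])
        qed
        finally show ?thesis by (simp add: norm_mult)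
      qed
      have "norm (laplacian (?T k) x) \<le> norm (cutoff k x * (- ?\<kappa> * \<eta> x)) + norm (2 * (\<Sum>i\<in>UNIV. partial i (cutoff k) x * partial i U x)) + norm (laplacian (cutoff k) x * U x)"
        unfolding lapT by (intro order_trans[OF norm_triangle_ineq] add_right_mono norm_triangle_ineq)
      also have "norm (2 * (\<Sum>i\<in>UNIV. partial i (cutoff k) x * partial i U x)) \<le> 2 * ((\<Sum>i\<in>UNIV. B i * D' i) * wt x ^ ?n)"
        using 2 by (simp add: norm_mult sum_distrib_right)
      finally show ?thesis using 1 3 by (simp add: M_def algebra_simps)
    qed
    have lim: "(\<lambda>k. laplacian (?T k) x) \<longlonglongrightarrow> bump 1 1 (0::real^'n) * (- ?\<kappa> * \<eta> x) + 2 * (\<Sum>i\<in>UNIV. 0 * partial i U x) + 0 * U x" for x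
      unfolding lapT
    proof (intro tendsto_intros cutoff_tendsto)
      show "(\<lambda>k. partial i (cutoff k) x) \<longlonglongrightarrow> 0" for i by (rule tendsto_0_if_le_inverse_Suc[OF B(3)])
      have "(1 / real (Suc k)) ^ 2 \<le> 1 / real (Suc k)" for k by (simp add: power2_eq_square divide_simps)
      then have "norm (laplacian (cutoff k) x) \<le> L * (1 / real (Suc k))" for k
        using L by (meson mult_left_mono less_imp_le order_trans)
      then show "(\<lambda>k. laplacian (cutoff k) x) \<longlonglongrightarrow> 0" by (rule tendsto_0_if_le_inverse_Suc)
    qed
    have [measurable]: "laplacian (?T k) \<in> borel_measurable borel" for k
      by (intro smooth_borel test_function_smooth test_function_laplacian T)
    have "(\<lambda>k. LINT x|lborel. \<psi> x * laplacian (?T k) x) \<longlonglongrightarrow> (LINT x|lborel. \<psi> x * (bump 1 1 (0::real^'n) * (- ?\<kappa> * \<eta> x)))"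
    proof (rule integral_dominated_convergence[where w="\<lambda>x. M * (wt x ^ ?n * norm (\<psi> x))"])
      show "integrable lborel (\<lambda>x. M * (wt x ^ ?n * norm (\<psi> x)))" using psi_n by simp
      show "AE x in lborel. (\<lambda>k. \<psi> x * laplacian (?T k) x) \<longlonglongrightarrow> \<psi> x * (bump 1 1 (0::real^'n) * (- ?\<kappa> * \<eta> x))"
        using lim by (intro AE_I2 tendsto_mult tendsto_const) simp
      show "AE x in lborel. norm (\<psi> x * laplacian (?T k) x) \<le> M * (wt x ^ ?n * norm (\<psi> x))" for k
        using mult_left_mono[OF lapT_bound norm_ge_zero] by (intro AE_I2) (simp add: norm_mult mult_ac)
    qed measurable
    moreover have "(\<lambda>k. LINT x|lborel. f x * ?T k x) \<longlonglongrightarrow> (LINT x|lborel. f x * (bump 1 1 (0::real^'n) * U x))"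
    proof (rule integral_dominated_convergence[where w="\<lambda>x. D * (\<bar>C\<bar> * (wt x ^ ?n * norm (\<psi> x)))"])
      show "integrable lborel (\<lambda>x. D * (\<bar>C\<bar> * (wt x ^ ?n * norm (\<psi> x))))" using psi_n by simp
      show "AE x in lborel. (\<lambda>k. f x * ?T k x) \<longlonglongrightarrow> f x * (bump 1 1 (0::real^'n) * U x)"
        by (intro AE_I2 tendsto_intros cutoff_tendsto)
      show "AE x in lborel. norm (f x * ?T k x) \<le> D * (\<bar>C\<bar> * (wt x ^ ?n * norm (\<psi> x)))" for k
      proof (intro AE_I2)
        fix x
        have "norm (f x * ?T k x) \<le> norm (f x) * (1 * (D * wt x ^ (?n - 2)))"
          unfolding norm_mult by (intro mult_left_mono mult_mono cutoff_bounds(1) D(2)) auto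
        also have "\<dots> = D * (norm (f x) * wt x ^ (?n - 2))" by simp
        also have "\<dots> \<le> D * (\<bar>C\<bar> * (wt x ^ ?n * norm (\<psi> x)))" using D(1) by (intro mult_left_mono C1) auto
        finally show "norm (f x * ?T k x) \<le> D * (\<bar>C\<bar> * (wt x ^ ?n * norm (\<psi> x)))" .
      qed
    qed measurable
    ultimately have e1: "(LINT x|lborel. \<psi> x * (bump 1 1 (0::real^'n) * (- ?\<kappa> * \<eta> x))) = (LINT x|lborel. f x * (bump 1 1 (0::real^'n) * U x))"
      unfolding sol[OF T] by (rule LIMSEQ_unique)
    have e2: "(LINT x|lborel. \<psi> x * (bump 1 1 (0::real^'n) * (- ?\<kappa> * \<eta> x))) = bump 1 1 (0::real^'n) * (- (LINT x|lborel. ?\<kappa> * \<psi> x * \<eta> x))"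
    proof -
      have "(\<lambda>x. \<psi> x * (bump 1 1 (0::real^'n) * (- ?\<kappa> * \<eta> x))) = (\<lambda>x. bump 1 1 (0::real^'n) * (- (?\<kappa> * \<psi> x * \<eta> x)))"
        by (auto simp: mult_ac)
      then show ?thesis by (simp only: integral_mult_right_zero Bochner_Integration.integral_minus)
    qed
    have e3: "(LINT x|lborel. f x * (bump 1 1 (0::real^'n) * U x)) = bump 1 1 (0::real^'n) * (LINT x|lborel. f x * U x)"
    proof -
      have "(\<lambda>x. f x * (bump 1 1 (0::real^'n) * U x)) = (\<lambda>x. bump 1 1 (0::real^'n) * (f x * U x))" by (auto simp: mult_ac)
      then show ?thesis by (simp only: integral_mult_right_zero)
    qed
    \<comment> \<open>The limit of the cutoffs is this constant on both sides, and it
      cancels.\<close>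
    have "bump 1 1 (0::real^'n) \<noteq> 0" by (rule bump_neq_0) auto
    then have e: "- (LINT x|lborel. ?\<kappa> * \<psi> x * \<eta> x) = (LINT x|lborel. f x * U x)"
      by (rule mult_left_cancel[THEN iffD1]) (rule trans[OF trans[OF e2[symmetric] e1] e3])
    obtain E' where E': "\<And>x. norm (\<eta> x) \<le> E' * wt x ^ Suc ?n" using test_function_bound[OF \<eta>] by blast
    have "(LINT x|lborel. f x * U x) = (LINT x|lborel. newton f x * \<eta> x)"
      unfolding U_def by (rule pot_duality(2)[OF kn _ _ f' E', symmetric]) simp_all
    moreover have i1: "integrable lborel (\<lambda>x. newton f x * \<eta> x)"
      by (rule pot_duality(1)[OF kn _ _ f' E']) simp_all
    moreover have i2: "integrable lborel (\<lambda>x. ?\<kappa> * \<psi> x * \<eta> x)"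
    proof (rule Bochner_Integration.integrable_bound)
      show "integrable lborel (\<lambda>x. newton_const TYPE('n) * E * (wt x ^ ?n * norm (\<psi> x)))" using psi_n by simp
      show "AE x in lborel. norm (?\<kappa> * \<psi> x * \<eta> x) \<le> norm (newton_const TYPE('n) * E * (wt x ^ ?n * norm (\<psi> x)))"
      proof (intro AE_I2)
        fix x
        have "newton_const TYPE('n) * norm (\<psi> x) * norm (\<eta> x) \<le> newton_const TYPE('n) * norm (\<psi> x) * (E * wt x ^ ?n)"
          using \<kappa>0 by (intro mult_left_mono E(2)) auto
        then show "norm (?\<kappa> * \<psi> x * \<eta> x) \<le> norm (newton_const TYPE('n) * E * (wt x ^ ?n * norm (\<psi> x)))"
          using \<kappa>0 E(1) by (simp add: norm_mult abs_mult mult_ac)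
      qed
    qed measurable
    ultimately show ?thesis using e by (simp add: distrib_right add_eq_0_iff)
  qed
  have loc: "set_integrable lborel K (\<lambda>x. ?\<kappa> * \<psi> x + newton f x)" if K: "compact K" for K
  proof (rule set_integral_add(1))
    show "set_integrable lborel K (newton f)" by (rule pot_locally_integrable[OF kn _ f' K]) simp
    have [measurable]: "K \<in> sets borel" using K by (simp add: borel_compact)
    have "set_integrable lborel K \<psi>" unfolding set_integrable_def
    proof (rule Bochner_Integration.integrable_bound)
      have "integrable lborel (indicator K :: real ^ 'n \<Rightarrow> real)"
        using emeasure_bounded_finite[OF compact_imp_bounded[OF K]] by (intro integrable_real_indicator) auto
      then show "integrable lborel (\<lambda>x. indicator K x + (norm (\<psi> x))\<^sup>2)" using L2 by simp
      have "norm (\<psi> x) \<le> 1 + (norm (\<psi> x))\<^sup>2" for x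
      proof -
        have "2 * norm (\<psi> x) \<le> 1 + (norm (\<psi> x))\<^sup>2" using sum_squares_bound[of 1 "norm (\<psi> x)"] by simp
        then show ?thesis using norm_ge_zero[of "\<psi> x"] by linarith
      qed
      then show "AE x in lborel. norm (indicator K x *\<^sub>R \<psi> x) \<le> norm (indicator K x + (norm (\<psi> x))\<^sup>2)"
        by (intro AE_I2) (auto split: split_indicator)
    qed measurable
    then show "set_integrable lborel K (\<lambda>x. ?\<kappa> * \<psi> x)" by (rule set_integrable_mult_right)
  qed
  have "AE x in lborel. ?\<kappa> * \<psi> x + newton f x = 0"
    by (rule AE_eq_0_if_test_integrals_eq_0[OF _ loc zero]) measurable
  then show ?thesis by eventually_elim (simp add: eq_neg_iff_add_eq_0)
qed

subsection \<open>Boundedness and decay\<close>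

text \<open>Near the diagonal the kernel has small \<open>L\<^sup>1\<close> norm, away from it the Cauchy-Schwarz inequality gives a
  bound \<open>M\<close>. Hence \<open>u \<le> M + A q \<star> u\<close> with \<open>A \<parallel>q\<parallel>\<^sub>1 \<le> 1/2\<close>, so \<open>w = (u - 2 M)\<^sup>+\<close> satisfies \<open>w \<le> A q \<star> w\<close>
  and \<open>\<parallel>w\<parallel>\<^sub>2\<^sup>2 \<le> \<parallel>w\<parallel>\<^sub>2\<^sup>2 / 2\<close>.\<close>

lemma newton_bootstrap_bounded:
  fixes u :: "real ^ 'n \<Rightarrow> real"
  defines "P \<equiv> (\<lambda>x. \<integral>\<^sup>+y. ennreal (inv_norm (x - y) ^ (CARD('n) - 2) * (wt y ^ 2 * u y)) \<partial>lborel)"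
  assumes n: "CARD('n) \<ge> 3" and [measurable]: "u \<in> borel_measurable borel"
    and u0: "\<And>x. 0 \<le> u x" and u2: "integrable lborel (\<lambda>x. (u x)\<^sup>2)" and A: "A \<ge> 0"
    and le: "AE x in lborel. ennreal (u x) \<le> ennreal A * P x"
  shows "\<exists>B. \<forall>x. P x \<le> ennreal B"
proof -
  let ?n = "CARD('n)"
  obtain L where L: "L \<ge> 0" "(\<integral>\<^sup>+(z::real^'n). ennreal (inv_norm z ^ (?n - 1)) * indicator (ball 0 1) z \<partial>lborel) = ennreal L"
  proof -
    have "(\<integral>\<^sup>+(z::real^'n). ennreal (inv_norm z ^ (?n - 1)) * indicator (ball 0 1) z \<partial>lborel) < \<infinity>"
      using n by (intro inv_norm_power_locally_integrable) auto
    then show ?thesis using that by (cases "(\<integral>\<^sup>+(z::real^'n). ennreal (inv_norm z ^ (?n - 1)) * indicator (ball 0 1) z \<partial>lborel)") auto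
  qed
  \<comment> \<open>L is the mass of the stronger singularity |z|^(1-n) in the unit ball. On the
    ball of radius \<delta> the kernel is at most \<delta> |z|^(1-n), so its mass there is at most
    \<delta> L; this choice gives A \<delta> L \<le> 1/2 as well as \<delta> < 1.\<close>
  define \<delta> where "\<delta> = 1 / (2 * (A * L + 1))"
  have AL: "A * L \<ge> 0" using A L by simp
  have \<delta>: "\<delta> > 0" "\<delta> < 1" "A * (\<delta> * L) \<le> 1 / 2"
    using AL by (simp_all add: \<delta>_def divide_simps)
  define q where "q z = indicator (ball 0 \<delta>) z * inv_norm z ^ (?n - 2)" for z :: "real ^ 'n"
  have q [measurable]: "q \<in> borel_measurable borel" unfolding q_def
    by (intro borel_measurable_times borel_measurable_indicator) (auto intro: borel_open)
  have q0: "q z \<ge> 0" for z by (simp add: q_def)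
  have q_sym: "q (x - y) = q (y - x)" for x y
    by (auto simp: q_def inv_norm_commute norm_minus_commute indicator_def)
  have Iq: "(\<integral>\<^sup>+z. ennreal (q z) \<partial>lborel) \<le> ennreal (\<delta> * L)"
  proof -
    have "(\<integral>\<^sup>+z. ennreal (q z) \<partial>lborel) \<le> (\<integral>\<^sup>+(z::real^'n). ennreal \<delta> * (ennreal (inv_norm z ^ (?n - 1)) * indicator (ball 0 1) z) \<partial>lborel)"
    proof (rule nn_integral_mono)
      fix z :: "real ^ 'n"
      show "ennreal (q z) \<le> ennreal \<delta> * (ennreal (inv_norm z ^ (?n - 1)) * indicator (ball 0 1) z)"
      proof (cases "norm z < \<delta> \<and> z \<noteq> 0")
        case True
        have "Suc (?n - 2) = ?n - 1" using n by simp
        then have e: "inv_norm z ^ (?n - 1) = inv_norm z * inv_norm z ^ (?n - 2)" by (metis power_Suc)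
        have "1 \<le> \<delta> * inv_norm z" using True by (simp add: inv_norm_def)
        then have "1 * inv_norm z ^ (?n - 2) \<le> \<delta> * inv_norm z * inv_norm z ^ (?n - 2)" by (intro mult_right_mono) auto
        then have "inv_norm z ^ (?n - 2) \<le> \<delta> * inv_norm z ^ (?n - 1)" unfolding e by (simp add: mult.assoc)
        then show ?thesis using True \<delta> by (auto simp: q_def ennreal_mult'[symmetric] intro!: ennreal_leI)
      next
        case False
        then have "q z = 0" using n by (auto simp: q_def inv_norm_def)
        then show ?thesis by simp
      qed
    qed
    also have "\<dots> = ennreal \<delta> * ennreal L"
      unfolding L(2)[symmetric]
      by (intro nn_integral_cmult borel_measurable_times_ennreal borel_measurable_indicator) (auto intro: borel_open)
    also have "\<dots> = ennreal (\<delta> * L)" using \<delta> by (simp add: ennreal_mult')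
    finally show ?thesis .
  qed
  have Iq1: "(\<integral>\<^sup>+y. ennreal (q (x - y)) \<partial>lborel) \<le> ennreal (\<delta> * L)" for x
    by (subst nn_integral_lborel_reflect[of "\<lambda>z. ennreal (q z)"]) (use Iq in auto)
  \<comment> \<open>Chosen so that <z> \<le> K |z| whenever |z| >= \<delta>, which holds as \<delta>
    < 1.\<close>
  define K where "K = 2 / \<delta>"
  have K: "K \<ge> 1" using \<delta> by (simp add: K_def)
  define J where "J = (LINT x|lborel. wt (x::real^'n) ^ (2 * ?n))"
  have Jint: "integrable lborel (\<lambda>x::real^'n. wt x ^ (2 * ?n))" using n by (intro wt_power_integrable) auto
  have J0: "J \<ge> 0" unfolding J_def by (intro integral_nonneg_AE AE_I2) auto
  have J: "(\<integral>\<^sup>+x. ennreal (wt (x::real^'n) ^ (2 * ?n)) \<partial>lborel) = ennreal J"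
    unfolding J_def by (intro nn_integral_eq_integral Jint) auto
  define V where "V = (LINT x|lborel. (u x)\<^sup>2)"
  have V0: "V \<ge> 0" unfolding V_def by (intro integral_nonneg_AE AE_I2) auto
  have V: "(\<integral>\<^sup>+x. ennreal ((u x)\<^sup>2) \<partial>lborel) = ennreal V"
    unfolding V_def by (intro nn_integral_eq_integral u2) auto
  \<comment> \<open>Bounds the part away from the diagonal: with s the kernel times
    \<open>wt y ^ 2\<close>, s u \<le> s^2 + u^2, where s^2 integrates to at most K^(2n) (J + J) and
    u^2 to V.\<close>
  define M1 where "M1 = K ^ (2 * ?n) * (J + J) + V"
  have M1: "M1 \<ge> 0" using K J0 V0 by (simp add: M1_def)
  have split: "P x \<le> ennreal M1 + (\<integral>\<^sup>+y. ennreal (q (x - y) * u y) \<partial>lborel)" for x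
  proof -
    have pt: "ennreal (inv_norm (x - y) ^ (?n - 2) * (wt y ^ 2 * u y))
      \<le> (ennreal (K ^ (2 * ?n)) * (ennreal (wt (x - y) ^ (2 * ?n)) + ennreal (wt y ^ (2 * ?n))) + ennreal ((u y)\<^sup>2))
        + ennreal (q (x - y) * u y)" for y
    proof (cases "norm (x - y) < \<delta>")
      case True
      have "wt y ^ 2 * u y \<le> u y" using u0[of y] by (intro mult_left_le_one_le) (auto simp: power_le_one)
      then have "inv_norm (x - y) ^ (?n - 2) * (wt y ^ 2 * u y) \<le> q (x - y) * u y"
        using True by (simp add: q_def mult_left_mono)
      then show ?thesis by (intro add_increasing ennreal_leI) auto
    next
      case False
      define s where "s = inv_norm (x - y) ^ (?n - 2) * wt y ^ 2"
      have s0: "s \<ge> 0" by (simp add: s_def)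
      have "s * u y \<le> s\<^sup>2 + (u y)\<^sup>2"
        using sum_squares_bound[of s "u y"] mult_nonneg_nonneg[OF s0 u0[of y]] by linarith
      moreover have "s\<^sup>2 \<le> K ^ (2 * ?n) * (wt (x - y) ^ (2 * ?n) + wt y ^ (2 * ?n))"
      proof -
        have "japanese_bracket (x - y) \<le> K * norm (x - y)"
        proof -
          have "\<delta> * japanese_bracket (x - y) \<le> \<delta> * (1 + norm (x - y))"
            using \<delta> by (intro mult_left_mono japanese_bracket_le) auto
          also have "\<dots> \<le> 2 * norm (x - y)"
            using False \<delta> mult_right_mono[of \<delta> 1 "norm (x - y)"] by (simp add: distrib_left)
          finally show ?thesis using \<delta> by (simp add: K_def field_simps)
        qed
        moreover have "0 < norm (x - y)" using False \<delta> by linarith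
        ultimately have iK: "inv_norm (x - y) \<le> K * wt (x - y)"
          using japanese_bracket_ge_1[of "x - y"] by (auto simp: inv_norm_def wt_def field_simps)
        define m where "m = max (K * wt (x - y)) (K * wt y)"
        \<comment> \<open>The squared kernel alone has exponent 2 (n - 2), which does not exceed n
          in low dimensions. The four powers from \<open>wt y ^ 2\<close> squared raise it to 2
          n.\<close>
        have "s\<^sup>2 = inv_norm (x - y) ^ (2 * (?n - 2)) * wt y ^ 4"
          by (simp add: s_def power_mult_distrib power_mult[symmetric] mult.commute)
        also have "\<dots> \<le> m ^ (2 * (?n - 2)) * m ^ 4"
        proof (intro mult_mono power_mono)
          show "inv_norm (x - y) \<le> m" using iK by (simp add: m_def)
          have "wt y \<le> K * wt y" using mult_right_mono[OF K, of "wt y"] by simp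
          then show "wt y \<le> m" unfolding m_def le_max_iff_disj by (rule disjI2)
          then show "0 \<le> m ^ (2 * (?n - 2))" by (simp add: order_trans[OF wt_nonneg])
        qed auto
        also have "\<dots> = m ^ (2 * ?n)" unfolding power_add[symmetric] using n by (intro arg_cong[of _ _ "\<lambda>k. m ^ k"]) auto
        also have "\<dots> \<le> (K * wt (x - y)) ^ (2 * ?n) + (K * wt y) ^ (2 * ?n)"
          using K by (auto simp: m_def max_def)
        finally show ?thesis by (simp add: power_mult_distrib distrib_left)
      qed
      ultimately have "inv_norm (x - y) ^ (?n - 2) * (wt y ^ 2 * u y) \<le> K ^ (2 * ?n) * (wt (x - y) ^ (2 * ?n) + wt y ^ (2 * ?n)) + (u y)\<^sup>2"
        by (simp add: s_def mult.assoc)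
      then have "ennreal (inv_norm (x - y) ^ (?n - 2) * (wt y ^ 2 * u y)) \<le> ennreal (K ^ (2 * ?n) * (wt (x - y) ^ (2 * ?n) + wt y ^ (2 * ?n)) + (u y)\<^sup>2)"
        by (rule ennreal_leI)
      also have "\<dots> = ennreal (K ^ (2 * ?n)) * (ennreal (wt (x - y) ^ (2 * ?n)) + ennreal (wt y ^ (2 * ?n))) + ennreal ((u y)\<^sup>2)"
        using K by (simp add: ennreal_plus ennreal_mult')
      finally show ?thesis by (rule order_trans) simp
    qed
    have "P x \<le> (\<integral>\<^sup>+y. (ennreal (K ^ (2 * ?n)) * (ennreal (wt (x - y) ^ (2 * ?n)) + ennreal (wt y ^ (2 * ?n))) + ennreal ((u y)\<^sup>2))
        + ennreal (q (x - y) * u y) \<partial>lborel)"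
      unfolding P_def by (intro nn_integral_mono pt)
    also have "\<dots> = (ennreal (K ^ (2 * ?n)) * ((\<integral>\<^sup>+y. ennreal (wt (x - y) ^ (2 * ?n)) \<partial>lborel) + (\<integral>\<^sup>+(y::real^'n). ennreal (wt y ^ (2 * ?n)) \<partial>lborel)) + (\<integral>\<^sup>+y. ennreal ((u y)\<^sup>2) \<partial>lborel))
        + (\<integral>\<^sup>+y. ennreal (q (x - y) * u y) \<partial>lborel)"
      by (simp add: nn_integral_add nn_integral_cmult)
    also have "(\<integral>\<^sup>+y. ennreal (wt (x - y) ^ (2 * ?n)) \<partial>lborel) = ennreal J"
      unfolding J[symmetric] by (rule nn_integral_lborel_reflect[of "\<lambda>z. ennreal (wt z ^ (2 * ?n))"]) simp
    also have "ennreal (K ^ (2 * ?n)) * (ennreal J + (\<integral>\<^sup>+y. ennreal (wt (y :: real ^ 'n) ^ (2 * ?n)) \<partial>lborel)) + (\<integral>\<^sup>+y. ennreal ((u y)\<^sup>2) \<partial>lborel) = ennreal M1"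
    proof -
      have p: "0 \<le> K ^ (2 * ?n) * (J + J)" "0 \<le> K ^ (2 * ?n)" using K J0 by auto
      show ?thesis unfolding J V M1_def by (simp only: ennreal_plus[OF p(1) V0] ennreal_mult'[OF p(2)] ennreal_plus[OF J0 J0])
    qed
    finally show ?thesis .
  qed
  define M where "M = A * M1"
  \<comment> \<open>At this level the truncation reproduces itself: the near part of the kernel
    applied to the constant c contributes at most A c \<delta> L \<le> c / 2 = M, and together with
    the far part, again M, this is c.\<close>
  define c where "c = 2 * M"
  have M0: "M \<ge> 0" "c \<ge> 0" using A M1 by (auto simp: M_def c_def)
  define w where "w x = max (u x - c) 0" for x
  have [measurable]: "w \<in> borel_measurable borel" unfolding w_def by measurable
  have w0: "w x \<ge> 0" and uw: "u x \<le> w x + c" for x by (auto simp: w_def)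
  define Q where "Q x = (\<integral>\<^sup>+y. ennreal (q (x - y) * w y) \<partial>lborel)" for x
  have Ac: "ennreal A * (ennreal c * ennreal (\<delta> * L)) \<le> ennreal M"
  proof -
    have "A * (c * (\<delta> * L)) = c * (A * (\<delta> * L))" by simp
    also have "\<dots> \<le> c * (1 / 2)" using M0 \<delta>(3) by (intro mult_left_mono) auto
    finally have "A * (c * (\<delta> * L)) \<le> M" by (simp add: c_def)
    then show ?thesis using A M0 \<delta> L by (simp add: ennreal_mult'[symmetric] ennreal_leI)
  qed
  have w_le: "AE x in lborel. ennreal (w x) \<le> ennreal A * Q x"
    using le
  proof eventually_elim
    case (elim x)
    show ?case
    proof (cases "u x \<le> c")
      case True then show ?thesis by (simp add: w_def)
    next
      case False
      have "(\<integral>\<^sup>+y. ennreal (q (x - y) * u y) \<partial>lborel) \<le> (\<integral>\<^sup>+y. ennreal (q (x - y) * w y) + ennreal c * ennreal (q (x - y)) \<partial>lborel)"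
      proof (rule nn_integral_mono)
        fix y
        have "q (x - y) * u y \<le> q (x - y) * w y + c * q (x - y)"
          using mult_left_mono[OF uw[of y] q0[of "x - y"]] by (simp add: algebra_simps)
        then show "ennreal (q (x - y) * u y) \<le> ennreal (q (x - y) * w y) + ennreal c * ennreal (q (x - y))"
          using ennreal_leI[of "q (x - y) * u y"] q0 w0 M0 by (fastforce simp: ennreal_plus ennreal_mult')
      qed
      also have "\<dots> = Q x + ennreal c * (\<integral>\<^sup>+y. ennreal (q (x - y)) \<partial>lborel)"
        by (simp add: Q_def nn_integral_add nn_integral_cmult)
      also have "\<dots> \<le> Q x + ennreal c * ennreal (\<delta> * L)" by (intro add_left_mono mult_left_mono Iq1) auto
      finally have "P x \<le> ennreal M1 + (Q x + ennreal c * ennreal (\<delta> * L))"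
        by (intro order_trans[OF split] add_left_mono)
      then have "ennreal (u x) \<le> ennreal A * (ennreal M1 + (Q x + ennreal c * ennreal (\<delta> * L)))"
        using elim by (meson mult_left_mono order_trans zero_le)
      also have "\<dots> = ennreal M + (ennreal A * Q x + ennreal A * (ennreal c * ennreal (\<delta> * L)))"
        using A M1 by (simp add: distrib_left M_def ennreal_mult')
      also have "\<dots> \<le> ennreal M + (ennreal A * Q x + ennreal M)" by (intro add_left_mono Ac)
      also have "\<dots> = ennreal c + ennreal A * Q x"
      proof -
        have "ennreal c = ennreal M + ennreal M" unfolding c_def mult_2 by (rule ennreal_plus[OF M0(1) M0(1)])
        then show ?thesis by (simp only: add_ac)
      qed
      finally have "ennreal (u x) \<le> ennreal c + ennreal A * Q x" .
      moreover have "u x = c + w x" using False by (simp add: w_def)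
      ultimately have "ennreal c + ennreal (w x) \<le> ennreal c + ennreal A * Q x"
        by (simp only: ennreal_plus[OF M0(2) w0])
      then show ?thesis by (simp add: ennreal_add_left_cancel_le)
    qed
  qed
  define W where "W = (\<integral>\<^sup>+x. ennreal ((w x)\<^sup>2) \<partial>lborel)"
  have "W \<le> (\<integral>\<^sup>+x. ennreal ((u x)\<^sup>2) \<partial>lborel)"
    unfolding W_def using u0 M0 by (intro nn_integral_mono ennreal_leI power_mono) (auto simp: w_def)
  \<comment> \<open>Finiteness, inherited from the square integrability of u, is what turns W \<le>
    W / 2 into W = 0.\<close>
  then have Wfin: "W < \<infinity>" unfolding V by (simp add: le_less_trans)
  \<comment> \<open>A Schur test: multiply by w x and use 2 w(x) w(y) \<le> w(x)^2 + w(y)^2. By the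
    symmetry of q both terms then give the same double integral.\<close>
  have "W \<le> (\<integral>\<^sup>+x. ennreal A * (\<integral>\<^sup>+y. ennreal (1 / 2) * (ennreal (q (x - y)) * ennreal ((w x)\<^sup>2) + ennreal (q (x - y)) * ennreal ((w y)\<^sup>2)) \<partial>lborel) \<partial>lborel)"
    unfolding W_def
  proof (rule nn_integral_mono_AE, use w_le in eventually_elim)
    fix x assume x: "ennreal (w x) \<le> ennreal A * Q x"
    have "ennreal ((w x)\<^sup>2) = ennreal (w x) * ennreal (w x)" by (simp add: power2_eq_square ennreal_mult' w0)
    also have "\<dots> \<le> (ennreal A * Q x) * ennreal (w x)" by (intro mult_right_mono x) auto
    also have "\<dots> = ennreal A * (\<integral>\<^sup>+y. ennreal (q (x - y) * w y) * ennreal (w x) \<partial>lborel)"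
      unfolding Q_def by (simp add: nn_integral_multc mult.assoc)
    also have "\<dots> \<le> ennreal A * (\<integral>\<^sup>+y. ennreal (1 / 2) * (ennreal (q (x - y)) * ennreal ((w x)\<^sup>2) + ennreal (q (x - y)) * ennreal ((w y)\<^sup>2)) \<partial>lborel)"
    proof (intro mult_left_mono nn_integral_mono)
      fix y
      have "q (x - y) * (2 * (w x * w y)) \<le> q (x - y) * ((w x)\<^sup>2 + (w y)\<^sup>2)"
        using sum_squares_bound[of "w x" "w y"] q0 by (intro mult_left_mono) (auto simp: mult.assoc)
      then have "q (x - y) * w y * w x \<le> 1 / 2 * (q (x - y) * (w x)\<^sup>2 + q (x - y) * (w y)\<^sup>2)"
        by (simp add: algebra_simps)
      then have "ennreal (q (x - y) * w y * w x) \<le> ennreal (1 / 2 * (q (x - y) * (w x)\<^sup>2 + q (x - y) * (w y)\<^sup>2))"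
        by (rule ennreal_leI)
      also have "\<dots> = ennreal (1 / 2) * ennreal (q (x - y) * (w x)\<^sup>2 + q (x - y) * (w y)\<^sup>2)"
        by (rule ennreal_mult') simp
      also have "ennreal (q (x - y) * (w x)\<^sup>2 + q (x - y) * (w y)\<^sup>2) = ennreal (q (x - y)) * ennreal ((w x)\<^sup>2) + ennreal (q (x - y)) * ennreal ((w y)\<^sup>2)"
        using q0 by (subst ennreal_plus) (simp_all add: ennreal_mult')
      finally show "ennreal (q (x - y) * w y) * ennreal (w x) \<le> ennreal (1 / 2) * (ennreal (q (x - y)) * ennreal ((w x)\<^sup>2) + ennreal (q (x - y)) * ennreal ((w y)\<^sup>2))"
        using q0 w0 by (simp add: ennreal_mult')
    qed auto
    finally show "ennreal ((w x)\<^sup>2) \<le> ennreal A * (\<integral>\<^sup>+y. ennreal (1 / 2) * (ennreal (q (x - y)) * ennreal ((w x)\<^sup>2) + ennreal (q (x - y)) * ennreal ((w y)\<^sup>2)) \<partial>lborel)" .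
  qed
  also have "\<dots> = ennreal A * (ennreal (1 / 2) * ((\<integral>\<^sup>+x. \<integral>\<^sup>+y. ennreal (q (x - y)) * ennreal ((w x)\<^sup>2) \<partial>lborel \<partial>lborel) + (\<integral>\<^sup>+x. \<integral>\<^sup>+y. ennreal (q (x - y)) * ennreal ((w y)\<^sup>2) \<partial>lborel \<partial>lborel)))"
    by (simp add: nn_integral_add nn_integral_cmult)
  also have "(\<integral>\<^sup>+x. \<integral>\<^sup>+y. ennreal (q (x - y)) * ennreal ((w y)\<^sup>2) \<partial>lborel \<partial>lborel) = (\<integral>\<^sup>+y. \<integral>\<^sup>+x. ennreal (q (x - y)) * ennreal ((w y)\<^sup>2) \<partial>lborel \<partial>lborel)"
    by (rule lborel_pair.Fubini'[symmetric]) measurable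
  also have "(\<lambda>y. \<integral>\<^sup>+x. ennreal (q (x - y)) * ennreal ((w y)\<^sup>2) \<partial>lborel) = (\<lambda>x. \<integral>\<^sup>+y. ennreal (q (x - y)) * ennreal ((w x)\<^sup>2) \<partial>lborel)"
    by (rule ext) (simp add: q_sym)
  also have "ennreal A * (ennreal (1 / 2) * ((\<integral>\<^sup>+x. \<integral>\<^sup>+y. ennreal (q (x - y)) * ennreal ((w x)\<^sup>2) \<partial>lborel \<partial>lborel) + (\<integral>\<^sup>+x. \<integral>\<^sup>+y. ennreal (q (x - y)) * ennreal ((w x)\<^sup>2) \<partial>lborel \<partial>lborel)))
    \<le> ennreal A * (ennreal (1 / 2) * (ennreal (\<delta> * L) * W + ennreal (\<delta> * L) * W))"
  proof -
    have "(\<integral>\<^sup>+x. \<integral>\<^sup>+y. ennreal (q (x - y)) * ennreal ((w x)\<^sup>2) \<partial>lborel \<partial>lborel) \<le> (\<integral>\<^sup>+x. ennreal (\<delta> * L) * ennreal ((w x)\<^sup>2) \<partial>lborel)"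
      by (intro nn_integral_mono) (simp add: nn_integral_multc mult_right_mono Iq1)
    also have "\<dots> = ennreal (\<delta> * L) * W"
      unfolding W_def by (intro nn_integral_cmult) measurable
    finally show ?thesis by (intro mult_left_mono add_mono) auto
  qed
  finally have W1: "W \<le> ennreal A * (ennreal (1 / 2) * (ennreal (\<delta> * L) * W + ennreal (\<delta> * L) * W))" .
  obtain W' where W': "W' \<ge> 0" "W = ennreal W'" using Wfin by (cases W) auto
  have "W' \<le> A * (1 / 2 * (\<delta> * L * W' + \<delta> * L * W'))"
  proof -
    have p: "0 \<le> \<delta> * L" "0 \<le> \<delta> * L * W'" "0 \<le> (1 / 2 :: real)" using \<delta> L W' by auto
    have "ennreal (A * (1 / 2 * (\<delta> * L * W' + \<delta> * L * W'))) = ennreal A * (ennreal (1 / 2) * (ennreal (\<delta> * L) * W + ennreal (\<delta> * L) * W))"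
      unfolding W'(2) by (simp only: ennreal_mult'[OF A] ennreal_mult'[OF p(3)] ennreal_plus[OF p(2) p(2)] ennreal_mult'[OF p(1)])
    with W1 have "ennreal W' \<le> ennreal (A * (1 / 2 * (\<delta> * L * W' + \<delta> * L * W')))" unfolding W'(2) by simp
    moreover have "0 \<le> A * (1 / 2 * (\<delta> * L * W' + \<delta> * L * W'))" using A p \<delta> L W' by (intro mult_nonneg_nonneg add_nonneg_nonneg) auto
    ultimately show ?thesis by (simp only: ennreal_le_iff)
  qed
  also have "\<dots> = A * (\<delta> * L) * W'" by simp
  also have "\<dots> \<le> 1 / 2 * W'" using \<delta>(3) W'(1) by (intro mult_right_mono)
  finally have "W = 0" using W' by simp
  then have "AE x in lborel. ennreal ((w x)\<^sup>2) = 0" unfolding W_def by (subst (asm) nn_integral_0_iff_AE) auto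
  then have uc: "AE x in lborel. u x \<le> c"
    by eventually_elim (auto simp: w_def split: if_splits)
  have "P x \<le> ennreal (M1 + c * (\<delta> * L))" for x
  proof -
    have "(\<integral>\<^sup>+y. ennreal (q (x - y) * u y) \<partial>lborel) \<le> (\<integral>\<^sup>+y. ennreal c * ennreal (q (x - y)) \<partial>lborel)"
    proof (rule nn_integral_mono_AE, use uc in eventually_elim)
      fix y assume "u y \<le> c"
      then have "q (x - y) * u y \<le> c * q (x - y)" using q0 by (subst mult.commute) (rule mult_right_mono)
      then show "ennreal (q (x - y) * u y) \<le> ennreal c * ennreal (q (x - y))"
        using M0 by (simp add: ennreal_mult'[symmetric] ennreal_leI)
    qed
    also have "\<dots> = ennreal c * (\<integral>\<^sup>+y. ennreal (q (x - y)) \<partial>lborel)" by (intro nn_integral_cmult) measurable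
    also have "\<dots> \<le> ennreal c * ennreal (\<delta> * L)" by (intro mult_left_mono Iq1) auto
    finally have "P x \<le> ennreal M1 + ennreal c * ennreal (\<delta> * L)" by (intro order_trans[OF split] add_left_mono)
    also have "\<dots> = ennreal (M1 + c * (\<delta> * L))" using M0 M1 \<delta> L by (simp add: ennreal_plus ennreal_mult')
    finally show ?thesis .
  qed
  then show ?thesis by blast
qed

text \<open>Every round gains one power: if the potential is O(<x>^(-k)), its source is
  O(<x>^(-k-4)), and n + (k + 1) < (n - 2) + (4 + k) is the condition of \<open>pot_bound\<close>
  for the exponent k + 1. The iteration ends at n - 2, the decay of the kernel.\<close>

lemma newton_decay:
  fixes f :: "real ^ 'n \<Rightarrow> complex"
  assumes n: "CARD('n) \<ge> 3" and [measurable]: "f \<in> borel_measurable borel"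
    and b0: "\<And>x. norm (newton f x) \<le> B0" and C: "C \<ge> 0"
    and f: "AE y in lborel. norm (f y) \<le> C * wt y ^ 4 * norm (newton f y)"
  shows "k \<le> CARD('n) - 2 \<Longrightarrow> \<exists>B>0. \<forall>x. norm (newton f x) \<le> B * wt x ^ k"
proof (induction k)
  case 0
  have "norm (newton f x) \<le> max B0 1 * wt x ^ 0" for x using b0[of x] by simp
  then show ?case by (intro exI[of _ "max B0 1"]) auto
next
  case (Suc k)
  then obtain B where B: "B > 0" "\<And>x. norm (newton f x) \<le> B * wt x ^ k" by auto
  have "AE y in lborel. norm (f y) \<le> (C * B) * wt y ^ (4 + k)"
    using f
  proof eventually_elim
    case (elim y)
    also have "C * wt y ^ 4 * norm (newton f y) \<le> C * wt y ^ 4 * (B * wt y ^ k)"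
      using C by (intro mult_left_mono B) auto
    finally show ?case by (simp add: power_add mult_ac)
  qed
  from pot_bound(2)[OF kernel_bound_newton_kernel[OF n] _ this, of "Suc k"] show ?case
    using Suc.prems by auto
qed

text \<open>The mean value bound |s^k - t^k| \<le> k |s - t| m^(k-1), multiplied by m to avoid the
  exponent k - 1 at k = 0.\<close>

lemma abs_power_diff_le:
  fixes s t m :: real
  assumes "0 \<le> s" "0 \<le> t" "s \<le> m" "t \<le> m"
  shows "\<bar>s ^ k - t ^ k\<bar> * m \<le> real k * \<bar>s - t\<bar> * m ^ k"
proof (induction k)
  case (Suc k)
  have m: "m \<ge> 0" using assms by linarith
  have "\<bar>s ^ Suc k - t ^ Suc k\<bar> \<le> s * \<bar>s ^ k - t ^ k\<bar> + \<bar>s - t\<bar> * t ^ k"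
  proof -
    have "s ^ Suc k - t ^ Suc k = s * (s ^ k - t ^ k) + (s - t) * t ^ k" by (simp add: algebra_simps)
    then show ?thesis using assms by (metis abs_mult abs_of_nonneg abs_triangle_ineq zero_le_power)
  qed
  then have "\<bar>s ^ Suc k - t ^ Suc k\<bar> * m \<le> s * (\<bar>s ^ k - t ^ k\<bar> * m) + \<bar>s - t\<bar> * t ^ k * m"
    using mult_right_mono[OF _ m] by (fastforce simp: algebra_simps)
  also have "\<dots> \<le> m * (real k * \<bar>s - t\<bar> * m ^ k) + \<bar>s - t\<bar> * m ^ k * m"
  proof (rule add_mono)
    show "s * (\<bar>s ^ k - t ^ k\<bar> * m) \<le> m * (real k * \<bar>s - t\<bar> * m ^ k)"
      by (rule mult_mono[OF assms(3) Suc.IH]) (use m in auto)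
    show "\<bar>s - t\<bar> * t ^ k * m \<le> \<bar>s - t\<bar> * m ^ k * m"
      using assms m by (intro mult_right_mono mult_left_mono power_mono) auto
  qed
  also have "\<dots> = real (Suc k) * \<bar>s - t\<bar> * m ^ Suc k" by (simp add: algebra_simps)
  finally show ?case .
qed simp

text \<open>Since |x - y| and <x> differ by at most <y>, replacing the kernel by a function of x
  alone gains a power of decay in x at the price of one factor <y> = 1 /
  \<open>wt y\<close>.\<close>

lemma inv_norm_power_minus_wt_power:
  assumes "x \<noteq> y"
  shows "\<bar>inv_norm (x - y) ^ k - wt x ^ k\<bar> \<le> real k * (inv_norm (x - y) ^ Suc k + wt x ^ Suc k) / wt y"
proof -
  define s where "s = inv_norm (x - y)" define t where "t = wt x" define m where "m = max s t"
  have p: "norm (x - y) > 0" "japanese_bracket x > 0" using assms japanese_bracket_ge_1[of x] by auto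
  have st: "s > 0" "t > 0" "s \<le> m" "t \<le> m" "m > 0"
    using assms by (auto simp: s_def t_def m_def inv_norm_def less_max_iff_disj)
  have "\<bar>norm (x - y) - japanese_bracket x\<bar> \<le> japanese_bracket y"
    using japanese_bracket_triangle[of y "x - y"] norm_triangle_ineq4[of x y]
      norm_le_japanese_bracket[of x] norm_le_japanese_bracket[of y] by simp
  then have "\<bar>norm (x - y) - japanese_bracket x\<bar> * (s * t) \<le> japanese_bracket y * (m * m)"
    using st japanese_bracket_ge_1[of y] by (intro mult_mono) auto
  moreover have "\<bar>s - t\<bar> = \<bar>norm (x - y) - japanese_bracket x\<bar> * (s * t)"
  proof -
    have "t - s = (norm (x - y) - japanese_bracket x) * (s * t)"
      using p by (simp add: s_def t_def inv_norm_def wt_def field_simps)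
    then show ?thesis using st by (metis abs_minus_commute abs_mult abs_of_pos mult_pos_pos)
  qed
  ultimately have d: "\<bar>s - t\<bar> \<le> japanese_bracket y * (m * m)" by simp
  have "\<bar>s ^ k - t ^ k\<bar> * m \<le> real k * \<bar>s - t\<bar> * m ^ k" using st by (intro abs_power_diff_le) auto
  also have "\<dots> \<le> real k * (japanese_bracket y * (m * m)) * m ^ k"
    using st d by (intro mult_right_mono mult_left_mono) auto
  also have "\<dots> = (real k * japanese_bracket y * m ^ Suc k) * m" by (simp add: mult_ac)
  finally have "\<bar>s ^ k - t ^ k\<bar> \<le> real k * japanese_bracket y * m ^ Suc k" using st(5) by (simp add: mult_ac)
  also have "\<dots> \<le> real k * japanese_bracket y * (s ^ Suc k + t ^ Suc k)"
    using st japanese_bracket_ge_1[of y] by (intro mult_left_mono) (auto simp: m_def max_def)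
  finally show ?thesis by (simp add: s_def t_def wt_def mult_ac del: power_Suc)
qed

text \<open>If f has integral zero, the function \<open>wt x ^ (n - 2)\<close>, which does not
  depend on y, may be subtracted from the kernel. The difference decays one power faster, and the
  factor <y> it costs leaves the integrable source bound <y>^(-n-1).\<close>

lemma newton_decay_mean_zero:
  fixes f :: "real ^ 'n \<Rightarrow> complex"
  assumes n: "CARD('n) \<ge> 3" and [measurable]: "f \<in> borel_measurable borel"
    and f: "AE y in lborel. norm (f y) \<le> C * wt y ^ (CARD('n) + 2)" and C: "C \<ge> 0"
    and zero: "(LINT y|lborel. f y) = 0"
  shows "\<exists>D>0. \<forall>x. norm (newton f x) \<le> D * wt x ^ (CARD('n) - 1)"
proof -
  let ?n = "CARD('n)"
  let ?m = "real (?n - 2)"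
  obtain D where D: "D > 0" "\<And>x::real^'n. (\<integral>\<^sup>+y. ennreal (inv_norm (x - y) ^ (?n - 1) * wt y ^ (?n + 1)) \<partial>lborel) \<le> ennreal (D * wt x ^ (?n - 1))"
  proof -
    have "?n - 1 < ?n" "?n - 1 \<le> ?n - 1" "?n - 1 \<le> ?n + 1" "?n + (?n - 1) < (?n - 1) + (?n + 1)" using n by arith+
    from inv_norm_wt_decay[OF this] show ?thesis using that by blast
  qed
  define J where "J = (LINT x|lborel. wt (x::real^'n) ^ (?n + 1))"
  have Jint: "integrable lborel (\<lambda>x::real^'n. wt x ^ (?n + 1))" by (intro wt_power_integrable) auto
  have J0: "J \<ge> 0" unfolding J_def by (intro integral_nonneg_AE AE_I2) auto
  have J: "(\<integral>\<^sup>+x. ennreal (wt (x::real^'n) ^ (?n + 1)) \<partial>lborel) = ennreal J"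
    unfolding J_def by (intro nn_integral_eq_integral Jint) auto
  have fint: "integrable lborel f"
  proof (rule Bochner_Integration.integrable_bound)
    show "integrable lborel (\<lambda>y::real^'n. C * wt y ^ (?n + 2))" by (intro integrable_mult_right wt_power_integrable) simp
    show "AE y in lborel. norm (f y) \<le> norm (C * wt y ^ (?n + 2))" using f by eventually_elim (simp add: C)
  qed measurable
  have "norm (newton f x) \<le> ?m * C * (D + J) * wt x ^ (?n - 1)" for x
  proof -
    let ?h = "\<lambda>y. (newton_kernel (x - y) - complex_of_real (wt x ^ (?n - 2))) * f y"
    have i1: "integrable lborel (\<lambda>y. newton_kernel (x - y) * f y)"
      using n by (intro pot_bound(1)[OF kernel_bound_newton_kernel[OF n] _ f, of 0]) auto
    have i2: "integrable lborel (\<lambda>y. complex_of_real (wt x ^ (?n - 2)) * f y)" using fint by simp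
    have hint: "integrable lborel ?h" using i1 i2 by (simp add: left_diff_distrib del: of_real_power)
    have "(LINT y|lborel. ?h y) = newton f x - complex_of_real (wt x ^ (?n - 2)) * (LINT y|lborel. f y)"
      using i1 i2 by (simp add: left_diff_distrib pot_def del: of_real_power)
    then have e: "newton f x = (LINT y|lborel. ?h y)" using zero by simp
    have "ennreal (norm (newton f x)) \<le> (\<integral>\<^sup>+y. ennreal (norm (?h y)) \<partial>lborel)"
      unfolding e by (rule integral_norm_bound_ennreal[OF hint])
    also have "\<dots> \<le> (\<integral>\<^sup>+y. ennreal (?m * C) * (ennreal (inv_norm (x - y) ^ (?n - 1) * wt y ^ (?n + 1)) + ennreal (wt x ^ (?n - 1)) * ennreal (wt y ^ (?n + 1))) \<partial>lborel)"
    proof (rule nn_integral_mono_AE, use f AE_lborel_neq[of x] in eventually_elim)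
      fix y assume fy: "norm (f y) \<le> C * wt y ^ (?n + 2)" and "y \<noteq> x"
      have Sn: "Suc (?n - 2) = ?n - 1" using n by simp
      have "norm (newton_kernel (x - y) - complex_of_real (wt x ^ (?n - 2))) = \<bar>inv_norm (x - y) ^ (?n - 2) - wt x ^ (?n - 2)\<bar>"
        unfolding newton_kernel_def of_real_diff[symmetric] norm_of_real ..
      also have "\<dots> \<le> ?m * (inv_norm (x - y) ^ (?n - 1) + wt x ^ (?n - 1)) / wt y"
        using inv_norm_power_minus_wt_power[of x y "?n - 2"] \<open>y \<noteq> x\<close> unfolding Sn by auto
      finally have "norm (?h y) \<le> (?m * (inv_norm (x - y) ^ (?n - 1) + wt x ^ (?n - 1)) / wt y) * (C * wt y ^ (?n + 2))"
        unfolding norm_mult by (intro mult_mono fy) (auto intro!: divide_nonneg_nonneg mult_nonneg_nonneg)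
      also have "\<dots> = ?m * C * (inv_norm (x - y) ^ (?n - 1) * wt y ^ (?n + 1) + wt x ^ (?n - 1) * wt y ^ (?n + 1))"
        by (simp add: field_simps)
      finally have "ennreal (norm (?h y)) \<le> ennreal (?m * C * (inv_norm (x - y) ^ (?n - 1) * wt y ^ (?n + 1) + wt x ^ (?n - 1) * wt y ^ (?n + 1)))"
        by (rule ennreal_leI)
      also have "\<dots> = ennreal (?m * C) * ennreal (inv_norm (x - y) ^ (?n - 1) * wt y ^ (?n + 1) + wt x ^ (?n - 1) * wt y ^ (?n + 1))"
        using C by (intro ennreal_mult') auto
      also have "ennreal (inv_norm (x - y) ^ (?n - 1) * wt y ^ (?n + 1) + wt x ^ (?n - 1) * wt y ^ (?n + 1))
        = ennreal (inv_norm (x - y) ^ (?n - 1) * wt y ^ (?n + 1)) + ennreal (wt x ^ (?n - 1)) * ennreal (wt y ^ (?n + 1))"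
        by (subst ennreal_plus) (auto simp: ennreal_mult'[symmetric])
      finally show "ennreal (norm (?h y)) \<le> ennreal (?m * C) * (ennreal (inv_norm (x - y) ^ (?n - 1) * wt y ^ (?n + 1)) + ennreal (wt x ^ (?n - 1)) * ennreal (wt y ^ (?n + 1)))" .
    qed
    also have "\<dots> = ennreal (?m * C) * ((\<integral>\<^sup>+y. ennreal (inv_norm (x - y) ^ (?n - 1) * wt y ^ (?n + 1)) \<partial>lborel) + ennreal (wt x ^ (?n - 1)) * (\<integral>\<^sup>+(y::real^'n). ennreal (wt y ^ (?n + 1)) \<partial>lborel))"
      by (subst nn_integral_cmult, measurable, subst nn_integral_add, measurable, subst nn_integral_cmult, measurable)
    also have "\<dots> \<le> ennreal (?m * C) * (ennreal (D * wt x ^ (?n - 1)) + ennreal (wt x ^ (?n - 1)) * ennreal J)"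
      unfolding J by (intro mult_left_mono add_right_mono D) auto
    also have "\<dots> = ennreal (?m * C * (D * wt x ^ (?n - 1) + wt x ^ (?n - 1) * J))"
      using C D(1) J0 by (simp add: ennreal_plus[symmetric] ennreal_mult'[symmetric] del: ennreal_plus)
    finally have "norm (newton f x) \<le> ?m * C * (D * wt x ^ (?n - 1) + wt x ^ (?n - 1) * J)"
      using C D(1) J0 by (subst (asm) ennreal_le_iff) auto
    then show ?thesis by (simp add: algebra_simps)
  qed
  then have "norm (newton f x) \<le> max 1 (?m * C * (D + J)) * wt x ^ (?n - 1)" for x
    by (rule order_trans) (intro mult_right_mono, auto)
  then show ?thesis by (intro exI[of _ "max 1 (?m * C * (D + J))"]) auto
qed

subsection \<open>Square integrability of the second derivatives\<close>

text \<open>With P the j-th derivative of the potential of g, integration by parts gives sum_i |d_i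
  P|^2 = - conj(P) Laplacian(P) under the integral. The Laplacian is -\<kappa> d_j g, and moving d_j
  back to P leaves \<kappa> |d_j P| |g|, half of whose square terms is absorbed. P and its
  derivatives are O(<x>^(1-n)), so no boundary terms arise.\<close>

lemma energy_estimate:
  fixes g :: "real ^ 'n \<Rightarrow> complex"
  assumes n: "CARD('n) \<ge> 3" and g: "test_function g"
  shows "integrable lborel (\<lambda>x. (norm (corr newton_kernel (partial i (partial j g)) x))\<^sup>2)"
    and "(LINT x|lborel. (norm (corr newton_kernel (partial i (partial j g)) x))\<^sup>2)
      \<le> (newton_const TYPE('n))\<^sup>2 * (LINT x|lborel. (norm (g x))\<^sup>2)"
proof -
  let ?n = "CARD('n)" let ?\<kappa> = "newton_const TYPE('n)"
  note kn = kernel_bound_newton_kernel[OF n]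
  have \<kappa>0: "?\<kappa> > 0" by (rule newton_const_pos[OF n])
  define P where "P = corr newton_kernel (partial j g)"
  note tj = test_function_partial[OF g, of j]
  have sP: "smooth P" unfolding P_def by (rule smooth_corr[OF kn tj])
  have pP: "partial i P = corr newton_kernel (partial i (partial j g))" for i
    unfolding P_def by (rule partial_corr[OF kn tj])
  have ppP: "partial i (partial i P) = corr newton_kernel (partial i (partial i (partial j g)))" for i
    unfolding pP by (rule partial_corr[OF kn test_function_partial[OF tj]])
  have lapP: "laplacian P x = - complex_of_real ?\<kappa> * partial j g x" for x
    unfolding P_def by (rule laplacian_corr_newton[OF n tj])
  have [measurable]: "P \<in> borel_measurable borel" "partial i P \<in> borel_measurable borel" "partial i (partial i P) \<in> borel_measurable borel"
    "g \<in> borel_measurable borel" "partial i g \<in> borel_measurable borel" "cnj \<in> borel_measurable borel" for i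
    by (intro smooth_borel smooth_partial sP test_function_smooth g borel_measurable_continuous_onI continuous_intros)+
  obtain D where D: "D > 0" "\<And>x. norm (P x) \<le> D * wt x ^ (?n - 1)"
    using corr_newton_partial_bound[OF n g] unfolding P_def by blast
  have "\<forall>i. \<exists>D>0. \<forall>x. norm (partial i P x) \<le> D * wt x ^ (?n - 1)"
    unfolding pP by (intro allI corr_newton_partial_bound[OF n tj])
  then obtain D1 where D1: "\<And>i. D1 i > 0" "\<And>i x. norm (partial i P x) \<le> D1 i * wt x ^ (?n - 1)" by metis
  have "\<forall>i. \<exists>D>0. \<forall>x. norm (partial i (partial i P) x) \<le> D * wt x ^ (?n - 1)"
    unfolding ppP by (intro allI corr_newton_partial_bound[OF n test_function_partial[OF tj]])
  then obtain D2 where D2: "\<And>i. D2 i > 0" "\<And>i x. norm (partial i (partial i P) x) \<le> D2 i * wt x ^ (?n - 1)" by metis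
  obtain G where G: "G > 0" "\<And>x. norm (g x) \<le> G * wt x ^ (?n - 1)" using test_function_bound[OF g] by blast
  obtain G1 where G1: "G1 > 0" "\<And>x. norm (partial j g x) \<le> G1 * wt x ^ (?n - 1)" using test_function_bound[OF tj] by blast
  have prod: "norm (a * b) \<le> A * B * wt x ^ (2 * (?n - 1))"
    if "norm a \<le> A * wt x ^ (?n - 1)" "norm b \<le> B * wt x ^ (?n - 1)" for a b :: complex and A B and x :: "real ^ 'n"
  proof -
    have "norm a * norm b \<le> (A * wt x ^ (?n - 1)) * (B * wt x ^ (?n - 1))"
      using that order_trans[OF norm_ge_zero that(1)] by (intro mult_mono) auto
    also have "\<dots> = A * B * wt x ^ (2 * (?n - 1))" by (simp only: mult_2 power_add mult_ac)
    finally show ?thesis by (simp add: norm_mult)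
  qed
  have k: "2 * (?n - 1) > ?n" using n by simp
  have int: "integrable lborel (\<lambda>x. a x * b x)"
    if [measurable]: "a \<in> borel_measurable borel" "b \<in> borel_measurable borel"
      and "\<And>x. norm (a x) \<le> A * wt x ^ (?n - 1)" "\<And>x. norm (b x) \<le> B * wt x ^ (?n - 1)"
    for a b :: "real ^ 'n \<Rightarrow> complex" and A B
    by (rule integrable_wt_bound[OF _ prod[OF that(3,4)] k]) measurable
  have cP: "(\<lambda>x. cnj (P x)) differentiable (at x)" for x
    using differentiableI[OF bounded_linear.has_derivative[OF bounded_linear_cnj has_derivative_partial[OF smooth_differentiable[OF sP]]]] .
  have pc: "partial i (\<lambda>x. cnj (P x)) x = cnj (partial i P x)" for i x
    by (intro partial_cnj smooth_differentiable sP)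
  have sq: "complex_of_real ((norm z)\<^sup>2) = cnj z * z" for z unfolding complex_norm_square by (rule mult.commute)
  have isq: "integrable lborel (\<lambda>x. (norm (partial i P x))\<^sup>2)" for i
  proof -
    have "integrable lborel (\<lambda>x. cnj (partial i P x) * partial i P x)"
      by (rule int[OF _ _ _ D1(2)]) (use D1(2) in auto)
    then have "integrable lborel (\<lambda>x. norm (cnj (partial i P x) * partial i P x))" by (rule integrable_norm)
    then show ?thesis by (simp add: norm_mult power2_eq_square)
  qed
  then show "integrable lborel (\<lambda>x. (norm (corr newton_kernel (partial i (partial j g)) x))\<^sup>2)" unfolding pP .
  have gsq: "integrable lborel (\<lambda>x. (norm (g x))\<^sup>2)"
  proof -
    have "integrable lborel (\<lambda>x. norm (g x * g x))" by (intro integrable_norm int[OF _ _ G(2) G(2)]) measurable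
    then show ?thesis by (simp add: norm_mult power2_eq_square)
  qed
  have e1: "complex_of_real (LINT x|lborel. (norm (partial i P x))\<^sup>2) = - (LINT x|lborel. cnj (P x) * partial i (partial i P) x)" for i
  proof -
    let ?A = "max (D * D1 i) (max (D * D2 i) (D1 i * D1 i))"
    have "(LINT x|lborel. cnj (P x) * partial i (partial i P) x) = - (LINT x|lborel. partial i (\<lambda>x. cnj (P x)) x * partial i P x)"
    proof (rule integral_by_parts[OF cP _ _ _ _ k])
      have le: "a \<le> ?A * wt x ^ (2 * (?n - 1))" if "a \<le> B * wt x ^ (2 * (?n - 1))" "B \<le> ?A" for a B and x :: "real ^ 'n"
        by (rule order_trans[OF that(1) mult_right_mono[OF that(2)]]) simp
      show "norm (cnj (P x) * partial i P x) \<le> ?A * wt x ^ (2 * (?n - 1))" for x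
        by (rule le[OF prod[OF _ D1(2)]]) (use D in auto)
      show "norm (cnj (P x) * partial i (partial i P) x) \<le> ?A * wt x ^ (2 * (?n - 1))" for x
        by (rule le[OF prod[OF _ D2(2)]]) (use D in auto)
      show "norm (partial i (\<lambda>x. cnj (P x)) x * partial i P x) \<le> ?A * wt x ^ (2 * (?n - 1))" for x
        unfolding pc by (rule le[OF prod[OF _ D1(2)]]) (use D1 in auto)
    qed (intro smooth_differentiable smooth_partial sP)
    then have "(LINT x|lborel. cnj (P x) * partial i (partial i P) x) = - (LINT x|lborel. complex_of_real ((norm (partial i P x))\<^sup>2))"
      unfolding pc sq .
    then show ?thesis by (simp only: integral_complex_of_real minus_minus)
  qed
  have e2: "complex_of_real (\<Sum>i\<in>UNIV. LINT x|lborel. (norm (partial i P x))\<^sup>2) = complex_of_real ?\<kappa> * (LINT x|lborel. cnj (P x) * partial j g x)"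
  proof -
    have ii: "integrable lborel (\<lambda>x. cnj (P x) * partial i (partial i P) x)" for i
      by (rule int[where A=D, OF _ _ _ D2(2)]) (use D(2) in auto)
    have "complex_of_real (\<Sum>i\<in>UNIV. LINT x|lborel. (norm (partial i P x))\<^sup>2) = - (\<Sum>i\<in>UNIV. LINT x|lborel. cnj (P x) * partial i (partial i P) x)"
      unfolding of_real_sum e1 by (simp add: sum_negf)
    also have "(\<Sum>i\<in>UNIV. LINT x|lborel. cnj (P x) * partial i (partial i P) x) = (LINT x|lborel. cnj (P x) * laplacian P x)"
      using ii by (simp add: laplacian_def sum_distrib_left Bochner_Integration.integral_sum)
    also have "\<dots> = (LINT x|lborel. - complex_of_real ?\<kappa> * (cnj (P x) * partial j g x))"
      unfolding lapP by (simp add: mult_ac)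
    finally show ?thesis by simp
  qed
  have e3: "(LINT x|lborel. cnj (P x) * partial j g x) = - (LINT x|lborel. cnj (partial j P x) * g x)"
  proof -
    have "(LINT x|lborel. cnj (P x) * partial j g x) = - (LINT x|lborel. partial j (\<lambda>x. cnj (P x)) x * g x)"
    proof (rule integral_by_parts_test[OF cP _ _ g])
      have w1: "wt x ^ (?n - 1) \<le> 1" for x :: "real ^ 'n" by (simp add: power_le_one)
      have le: "a \<le> max D (D1 j)" if "a \<le> B * wt x ^ (?n - 1)" "0 < B" "B \<le> max D (D1 j)" for a B and x :: "real ^ 'n"
        using that mult_left_mono[OF w1[of x], of B] by linarith
      show "norm (cnj (P x)) \<le> max D (D1 j)" for x using le[OF D(2)] D(1) by simp
      show "norm (partial j (\<lambda>x. cnj (P x)) x) \<le> max D (D1 j)" for x unfolding pc using le[OF D1(2)] D1(1) by simp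
    qed
    then show ?thesis unfolding pc .
  qed
  define S where "S i = (LINT x|lborel. (norm (partial i P x))\<^sup>2)" for i
  have S0: "S i \<ge> 0" for i unfolding S_def by (intro integral_nonneg_AE AE_I2) auto
  have igp: "integrable lborel (\<lambda>x. cnj (partial j P x) * g x)"
    by (rule int[where A="D1 j", OF _ _ _ G(2)]) (use D1(2) in auto)
  have "norm (complex_of_real (\<Sum>i\<in>UNIV. S i)) = ?\<kappa> * norm (LINT x|lborel. cnj (partial j P x) * g x)"
    unfolding S_def e2 e3 using \<kappa>0 by (simp add: norm_mult)
  moreover have "0 \<le> (\<Sum>i\<in>UNIV. S i)" by (intro sum_nonneg S0)
  ultimately have "(\<Sum>i\<in>UNIV. S i) = ?\<kappa> * norm (LINT x|lborel. cnj (partial j P x) * g x)"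
    by (simp only: norm_of_real abs_of_nonneg)
  also have "\<dots> \<le> ?\<kappa> * (LINT x|lborel. norm (cnj (partial j P x) * g x))"
    using \<kappa>0 by (intro mult_left_mono integral_norm_bound) auto
  also have "\<dots> = (LINT x|lborel. ?\<kappa> * norm (cnj (partial j P x) * g x))" by simp
  also have "\<dots> \<le> (LINT x|lborel. 1 / 2 * (norm (partial j P x))\<^sup>2 + ?\<kappa>\<^sup>2 / 2 * (norm (g x))\<^sup>2)"
  proof (rule integral_mono)
    show "integrable lborel (\<lambda>x. ?\<kappa> * norm (cnj (partial j P x) * g x))" by (intro integrable_mult_right integrable_norm igp)
    show "integrable lborel (\<lambda>x. 1 / 2 * (norm (partial j P x))\<^sup>2 + ?\<kappa>\<^sup>2 / 2 * (norm (g x))\<^sup>2)"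
      by (intro Bochner_Integration.integrable_add integrable_mult_right isq gsq)
    \<comment> \<open>2 a b \<le> a^2 + b^2 with a = |d_j P| and b = \<kappa> |g|; the coefficient
      1/2 lets the term S j be absorbed by the sum that contains it.\<close>
    show "?\<kappa> * norm (cnj (partial j P x) * g x) \<le> 1 / 2 * (norm (partial j P x))\<^sup>2 + ?\<kappa>\<^sup>2 / 2 * (norm (g x))\<^sup>2" for x
      using sum_squares_bound[of "norm (partial j P x)" "?\<kappa> * norm (g x)"] by (simp add: norm_mult power_mult_distrib mult_ac)
  qed
  also have "\<dots> = 1 / 2 * S j + ?\<kappa>\<^sup>2 / 2 * (LINT x|lborel. (norm (g x))\<^sup>2)"
    unfolding S_def using isq gsq by simp
  finally have le: "(\<Sum>i\<in>UNIV. S i) \<le> 1 / 2 * S j + ?\<kappa>\<^sup>2 / 2 * (LINT x|lborel. (norm (g x))\<^sup>2)" .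
  have Sle: "S i \<le> (\<Sum>i\<in>UNIV. S i)" for i using S0 by (intro member_le_sum) auto
  have "S i \<le> ?\<kappa>\<^sup>2 * (LINT x|lborel. (norm (g x))\<^sup>2)"
    using le Sle[of i] Sle[of j] by (simp add: field_simps)
  then show "(LINT x|lborel. (norm (corr newton_kernel (partial i (partial j g)) x))\<^sup>2) \<le> ?\<kappa>\<^sup>2 * (LINT x|lborel. (norm (g x))\<^sup>2)"
    unfolding S_def pP .
qed

text \<open>Completeness of L^2 in the form needed for Hessians: the limit must also be reached in
  pairings with test functions. The weights 2^k keep T = sum 2^k |h_(k+1) - h_k|^2 integrable while
  the squared distances decay like 4^(-k). Where T is finite, h_k converges and |h_k| \<le> |h_0| +
  2 + T is a common majorant; the square integrability of the limit is Fatou's lemma.\<close>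

lemma L2_fast_Cauchy_limit:
  fixes h :: "nat \<Rightarrow> 'a::euclidean_space \<Rightarrow> complex"
  assumes [measurable]: "\<And>k. h k \<in> borel_measurable borel"
    and hi: "\<And>k. integrable lborel (\<lambda>x. (norm (h k x))\<^sup>2)" and hQ: "\<And>k. (LINT x|lborel. (norm (h k x))\<^sup>2) \<le> Q"
    and di: "\<And>k. integrable lborel (\<lambda>x. (norm (h (Suc k) x - h k x))\<^sup>2)"
    and dc: "\<And>k. (LINT x|lborel. (norm (h (Suc k) x - h k x))\<^sup>2) \<le> c / 4 ^ k"
  shows "\<exists>H. H \<in> borel_measurable borel \<and> integrable lborel (\<lambda>x. (norm (H x))\<^sup>2) \<and>
    (\<forall>\<eta>. \<eta> \<in> borel_measurable borel \<longrightarrow> integrable lborel \<eta> \<longrightarrow> (\<exists>B. \<forall>x. norm (\<eta> x) \<le> B) \<longrightarrow>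
      integrable lborel (\<lambda>x. h 0 x * \<eta> x) \<longrightarrow>
      (\<lambda>k. LINT x|lborel. h k x * \<eta> x) \<longlonglongrightarrow> (LINT x|lborel. H x * \<eta> x))"
proof -
  define d where "d k x = 2 ^ k * (norm (h (Suc k) x - h k x))\<^sup>2" for k x
  have d0: "d k x \<ge> 0" for k x by (simp add: d_def)
  have [measurable]: "d k \<in> borel_measurable borel" for k unfolding d_def by measurable
  define T where "T x = (\<Sum>k. ennreal (d k x))" for x
  have [measurable]: "T \<in> borel_measurable borel" unfolding T_def by measurable
  have c0: "c \<ge> 0"
  proof -
    have "0 \<le> (LINT x|lborel. (norm (h (Suc 0) x - h 0 x))\<^sup>2)" by (intro integral_nonneg_AE AE_I2) auto
    also have "\<dots> \<le> c" using dc[of 0] by simp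
    finally show ?thesis .
  qed
  have dI: "(\<integral>\<^sup>+x. ennreal (d k x) \<partial>lborel) \<le> ennreal (c * (1 / 2) ^ k)" for k
  proof -
    have "(\<integral>\<^sup>+x. ennreal (d k x) \<partial>lborel) = ennreal (LINT x|lborel. d k x)"
      unfolding d_def by (intro nn_integral_eq_integral integrable_mult_right di) auto
    also have "(LINT x|lborel. d k x) \<le> 2 ^ k * (c / 4 ^ k)"
    proof -
      have "(LINT x|lborel. d k x) = 2 ^ k * (LINT x|lborel. (norm (h (Suc k) x - h k x))\<^sup>2)" by (simp add: d_def)
      also have "\<dots> \<le> 2 ^ k * (c / 4 ^ k)" by (intro mult_left_mono dc) simp
      finally show ?thesis .
    qed
    also have "2 ^ k * (c / 4 ^ k) = c * (1 / 2) ^ k"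
    proof -
      have "(4 :: real) ^ k = 2 ^ k * 2 ^ k" by (simp flip: power_mult_distrib)
      then show ?thesis by (simp add: power_one_over)
    qed
    finally show ?thesis by (simp add: ennreal_leI)
  qed
  have Tfin: "(\<integral>\<^sup>+x. T x \<partial>lborel) < \<infinity>"
  proof -
    have "(\<integral>\<^sup>+x. T x \<partial>lborel) = (\<Sum>k. \<integral>\<^sup>+x. ennreal (d k x) \<partial>lborel)"
      unfolding T_def by (intro nn_integral_suminf) measurable
    also have "\<dots> \<le> (\<Sum>k. ennreal (c * (1 / 2) ^ k))" by (intro suminf_le dI) auto
    also have "\<dots> = ennreal (\<Sum>k. c * (1 / 2) ^ k)"
      using c0 by (intro suminf_ennreal_eq[OF _ summable_sums]) (auto intro!: summable_mult summable_geometric)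
    finally show ?thesis by (simp add: le_less_trans)
  qed
  then have TAE: "AE x in lborel. T x \<noteq> \<infinity>"
    by (intro nn_integral_PInf_AE) auto
  define H where "H x = lim (\<lambda>k. h k x)" for x
  have [measurable]: "H \<in> borel_measurable borel" unfolding H_def by (rule borel_measurable_lim_metric) measurable
  have key: "(\<lambda>k. h k x) \<longlonglongrightarrow> H x" "\<And>k. norm (h k x) \<le> norm (h 0 x) + (2 + enn2real (T x))" if "T x \<noteq> \<infinity>" for x
  proof -
    have sd: "summable (\<lambda>k. d k x)" using that d0 unfolding T_def by (intro summable_suminf_not_top) auto
    have "T x = ennreal (\<Sum>k. d k x)" unfolding T_def by (rule suminf_ennreal2[OF d0 sd])
    then have Tx: "enn2real (T x) = (\<Sum>k. d k x)" using suminf_nonneg[OF sd d0] by simp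
    let ?g = "\<lambda>k. (1 / 2 :: real) ^ k"
    \<comment> \<open>From a \<le> 1 + a^2 with a = 2^k |h_(k+1) - h_k|: the difference is traded
      for its weighted square plus 2^(-k). The latter sum to the 2 in the majorant.\<close>
    have dle: "norm (h (Suc k) x - h k x) \<le> ?g k + d k x" for k
    proof -
      let ?a = "norm (h (Suc k) x - h k x)"
      have "0 \<le> (1 - 2 ^ k * ?a)\<^sup>2" by simp
      then have "2 * (2 ^ k * ?a) \<le> 1 + (2 ^ k * ?a)\<^sup>2" by (simp add: power2_diff)
      moreover have "0 \<le> 2 ^ k * ?a" by simp
      ultimately have "2 ^ k * ?a \<le> 1 + (2 ^ k * ?a)\<^sup>2" by linarith
      also have "\<dots> = 2 ^ k * (?g k + d k x)"
        by (simp add: d_def power_mult_distrib power2_eq_square distrib_left power_one_over)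
      finally show ?thesis by simp
    qed
    have sg: "summable ?g" by (rule summable_geometric) simp
    have sn: "summable (\<lambda>k. norm (h (Suc k) x - h k x))"
      by (rule summable_comparison_test[OF _ summable_add[OF sg sd]]) (use dle in auto)
    have tel: "(\<Sum>i<k. h (Suc i) x - h i x) = h k x - h 0 x" for k by (rule sum_lessThan_telescope)
    have "convergent (\<lambda>k. \<Sum>i<k. h (Suc i) x - h i x)"
      using summable_norm_cancel[OF sn] by (simp add: summable_iff_convergent)
    then have "convergent (\<lambda>k. (h k x - h 0 x) + h 0 x)" unfolding tel by (intro convergent_add convergent_const)
    then show "(\<lambda>k. h k x) \<longlonglongrightarrow> H x" unfolding H_def by (simp add: convergent_LIMSEQ_iff)
    fix k
    have "norm (h k x - h 0 x) \<le> (\<Sum>i<k. norm (h (Suc i) x - h i x))" unfolding tel[symmetric] by (rule norm_sum)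
    also have "\<dots> \<le> (\<Sum>i<k. ?g i + d i x)" by (intro sum_mono dle)
    also have "\<dots> \<le> (\<Sum>i. ?g i + d i x)"
      by (intro sum_le_suminf summable_add sg sd) (auto intro!: add_nonneg_nonneg d0)
    also have "\<dots> = 2 + enn2real (T x)" unfolding Tx by (subst suminf_add[OF sg sd, symmetric]) (simp add: suminf_geometric)
    finally show "norm (h k x) \<le> norm (h 0 x) + (2 + enn2real (T x))"
      using norm_triangle_sub[of "h k x" "h 0 x"] by linarith
  qed
  have "integrable lborel (\<lambda>x. (norm (H x))\<^sup>2)"
  proof (rule integrableI_bounded)
    have "(\<integral>\<^sup>+x. ennreal (norm ((norm (H x))\<^sup>2)) \<partial>lborel) = (\<integral>\<^sup>+x. liminf (\<lambda>k. ennreal ((norm (h k x))\<^sup>2)) \<partial>lborel)"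
    proof (rule nn_integral_cong_AE, use TAE in eventually_elim)
      fix x assume "T x \<noteq> \<infinity>"
      then have "(\<lambda>k. ennreal ((norm (h k x))\<^sup>2)) \<longlonglongrightarrow> ennreal ((norm (H x))\<^sup>2)"
        by (intro tendsto_ennrealI tendsto_intros key)
      then have "liminf (\<lambda>k. ennreal ((norm (h k x))\<^sup>2)) = ennreal ((norm (H x))\<^sup>2)"
        by (rule lim_imp_Liminf[OF sequentially_bot])
      then show "ennreal (norm ((norm (H x))\<^sup>2)) = liminf (\<lambda>k. ennreal ((norm (h k x))\<^sup>2))"
        by simp
    qed
    also have "\<dots> \<le> liminf (\<lambda>k. \<integral>\<^sup>+x. ennreal ((norm (h k x))\<^sup>2) \<partial>lborel)"
      by (rule nn_integral_liminf) measurable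
    also have "\<dots> \<le> ennreal Q"
    proof -
      have "(\<integral>\<^sup>+x. ennreal ((norm (h k x))\<^sup>2) \<partial>lborel) \<le> ennreal Q" for k
        using hQ[of k] by (subst nn_integral_eq_integral[OF hi]) (auto intro: ennreal_leI)
      then show ?thesis by (intro Liminf_le) (auto intro: always_eventually)
    qed
    finally show "(\<integral>\<^sup>+x. ennreal (norm ((norm (H x))\<^sup>2)) \<partial>lborel) < \<infinity>" by (simp add: le_less_trans)
  qed measurable
  moreover have "(\<lambda>k. LINT x|lborel. h k x * \<eta> x) \<longlonglongrightarrow> (LINT x|lborel. H x * \<eta> x)"
    if [measurable]: "\<eta> \<in> borel_measurable borel" and "integrable lborel \<eta>" and "\<And>x. norm (\<eta> x) \<le> B"
      and "integrable lborel (\<lambda>x. h 0 x * \<eta> x)" for \<eta> B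
  proof (rule integral_dominated_convergence[where w="\<lambda>x. norm (h 0 x * \<eta> x) + (2 * norm (\<eta> x) + B * enn2real (T x))"])
    have "integrable lborel (\<lambda>x. enn2real (T x))"
    proof (rule integrableI_bounded)
      have "(\<integral>\<^sup>+x. ennreal (norm (enn2real (T x))) \<partial>lborel) \<le> (\<integral>\<^sup>+x. T x \<partial>lborel)"
        by (intro nn_integral_mono) (simp add: ennreal_enn2real_if)
      then show "(\<integral>\<^sup>+x. ennreal (norm (enn2real (T x))) \<partial>lborel) < \<infinity>" using Tfin by (rule le_less_trans)
    qed measurable
    then show "integrable lborel (\<lambda>x. norm (h 0 x * \<eta> x) + (2 * norm (\<eta> x) + B * enn2real (T x)))"
      using that by (intro Bochner_Integration.integrable_add integrable_norm integrable_mult_right) auto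
    show "AE x in lborel. (\<lambda>k. h k x * \<eta> x) \<longlonglongrightarrow> H x * \<eta> x"
      using TAE by eventually_elim (intro tendsto_intros key)
    show "AE x in lborel. norm (h k x * \<eta> x) \<le> norm (h 0 x * \<eta> x) + (2 * norm (\<eta> x) + B * enn2real (T x))" for k
      using TAE
    proof eventually_elim
      case (elim x)
      have "norm (h k x * \<eta> x) \<le> (norm (h 0 x) + (2 + enn2real (T x))) * norm (\<eta> x)"
        unfolding norm_mult by (intro mult_right_mono key(2)[OF elim]) auto
      also have "\<dots> = norm (h 0 x * \<eta> x) + (2 * norm (\<eta> x) + norm (\<eta> x) * enn2real (T x))" by (simp add: norm_mult algebra_simps)
      also have "\<dots> \<le> norm (h 0 x * \<eta> x) + (2 * norm (\<eta> x) + B * enn2real (T x))"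
        by (intro add_left_mono mult_right_mono that(3)) auto
      finally show ?case .
    qed
  qed measurable
  ultimately show ?thesis using \<open>H \<in> borel_measurable borel\<close> by (intro exI[of _ H]) blast
qed

lemma newton_eq_corr:
  fixes f :: "real ^ 'n \<Rightarrow> complex"
  assumes [measurable]: "f \<in> borel_measurable borel"
  shows "newton f = corr newton_kernel f"
proof
  fix x :: "real ^ 'n"
  have "newton_kernel (x - y) = newton_kernel (y - x)" for y
    by (simp add: newton_kernel_def inv_norm_commute)
  then show "newton f x = corr newton_kernel f x" by (subst corr_eq) (simp_all add: pot_def)
qed

text \<open>The energy estimate is available for test functions, so f is approximated by test
  functions under the same weighted bound. Applied to their differences, the estimate makes the
  Hessians a fast Cauchy sequence in L^2, and the limit inherits the identity in the sense of
  distributions.\<close>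

lemma newton_second_derivative_L2:
  fixes f :: "real ^ 'n \<Rightarrow> complex"
  assumes n: "CARD('n) \<ge> 3" and [measurable]: "f \<in> borel_measurable borel" and C: "C > 0"
    and f: "\<And>x. norm (f x) \<le> C * wt x ^ (CARD('n) + 2)"
  shows "\<exists>H. H \<in> borel_measurable borel \<and> integrable lborel (\<lambda>x. (norm (H x))\<^sup>2) \<and>
    (\<forall>\<eta>. test_function \<eta> \<longrightarrow> (LINT x|lborel. newton f x * partial i (partial j \<eta>) x) = (LINT x|lborel. H x * \<eta> x))"
proof -
  let ?n = "CARD('n)" let ?\<kappa> = "newton_const TYPE('n)"
  note kn = kernel_bound_newton_kernel[OF n]
  have "f \<in> borel_measurable lebesgue" by (intro measurable_completion) simp
  moreover have "continuous_on UNIV (\<lambda>x::real^'n. C * wt x ^ (?n + 2))" by (intro continuous_intros)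
  moreover have "0 < C * wt x ^ (?n + 2)" for x :: "real ^ 'n" using C by simp
  ultimately obtain \<eta> where \<eta>: "\<And>k. test_function (\<eta> k)" "\<And>k x. norm (\<eta> k x) \<le> 2 * (C * wt x ^ (?n + 2))"
    "AE x in lborel. (\<lambda>k. \<eta> k x) \<longlonglongrightarrow> f x"
    using test_function_approximation[of f "\<lambda>x. C * wt x ^ (?n + 2)"] f by blast
  have [measurable]: "\<eta> k \<in> borel_measurable borel" for k by (intro smooth_borel test_function_smooth \<eta>)
  have wi: "integrable lborel (\<lambda>x::real^'n. B * wt x ^ (2 * (?n + 2)))" for B
    by (intro integrable_mult_right wt_power_integrable) simp
  have sqb: "(norm z)\<^sup>2 \<le> B\<^sup>2 * wt x ^ (2 * (?n + 2))" if "norm z \<le> B * wt x ^ (?n + 2)" for z :: complex and B and x :: "real ^ 'n"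
  proof -
    have "(norm z)\<^sup>2 \<le> (B * wt x ^ (?n + 2))\<^sup>2" using that by (intro power_mono) auto
    also have "\<dots> = B\<^sup>2 * wt x ^ (2 * (?n + 2))" by (simp only: power_mult_distrib power_mult[symmetric] mult.commute)
    finally show ?thesis .
  qed
  have sqi: "integrable lborel (\<lambda>x. (norm (g x))\<^sup>2)"
    if [measurable]: "g \<in> borel_measurable borel" and "\<And>x. norm (g x) \<le> B * wt x ^ (?n + 2)" for g :: "real ^ 'n \<Rightarrow> complex" and B
    by (rule Bochner_Integration.integrable_bound[OF wi[of "B\<^sup>2"]]) (use sqb[OF that(2)] in auto)
  have db: "norm (f x - \<eta> k x) \<le> (3 * C) * wt x ^ (?n + 2)" for k x
    using norm_triangle_ineq4[of "f x" "\<eta> k x"] f[of x] \<eta>(2)[of k x] by simp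
  have "(\<lambda>k. LINT x|lborel. (norm (f x - \<eta> k x))\<^sup>2) \<longlonglongrightarrow> (LINT x|(lborel :: (real ^ 'n) measure). (0::real))"
  proof (rule integral_dominated_convergence[OF _ _ wi[of "(3 * C)\<^sup>2"]])
    show "AE x in lborel. (\<lambda>k. (norm (f x - \<eta> k x))\<^sup>2) \<longlonglongrightarrow> 0"
      using \<eta>(3)
    proof eventually_elim
      case (elim x)
      have "(\<lambda>k. (norm (f x - \<eta> k x))\<^sup>2) \<longlonglongrightarrow> (norm (f x - f x))\<^sup>2" by (intro tendsto_intros elim)
      then show ?case by simp
    qed
    show "AE x in lborel. norm ((norm (f x - \<eta> k x))\<^sup>2) \<le> (3 * C)\<^sup>2 * wt x ^ (2 * (?n + 2))" for k
      using sqb[OF db] by (intro AE_I2) simp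
  qed measurable
  then have "\<forall>k::nat. \<exists>m. \<forall>l\<ge>m. (LINT x|lborel. (norm (f x - \<eta> l x))\<^sup>2) < 1 / 4 ^ k"
    by (intro allI) (auto simp: eventually_sequentially dest!: order_tendstoD(2)[where a="1 / 4 ^ k" for k])
  then obtain r0 where r0: "\<And>k l. l \<ge> r0 k \<Longrightarrow> (LINT x|lborel. (norm (f x - \<eta> l x))\<^sup>2) < 1 / 4 ^ k" by metis
  \<comment> \<open>The summand k forces the indices to infinity, so that almost everywhere
    convergence passes to the subsequence.\<close>
  define F where "F k = \<eta> (r0 k + k)" for k
  have F: "\<And>k. test_function (F k)" "\<And>k x. norm (F k x) \<le> (2 * C) * wt x ^ (?n + 2)"
    "\<And>k. (LINT x|lborel. (norm (f x - F k x))\<^sup>2) \<le> 1 / 4 ^ k"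
    using \<eta>(1,2) r0 by (auto simp: F_def mult.assoc intro: less_imp_le)
  have FAE: "AE x in lborel. (\<lambda>k. F k x) \<longlonglongrightarrow> f x"
    using \<eta>(3)
  proof eventually_elim
    case (elim x)
    have "filterlim (\<lambda>k. r0 k + k) sequentially sequentially"
      by (rule filterlim_at_top_mono[OF filterlim_ident]) simp
    from filterlim_compose[OF elim this] show ?case by (simp add: F_def)
  qed
  have [measurable]: "F k \<in> borel_measurable borel" for k by (simp add: F_def)
  have Fsq: "integrable lborel (\<lambda>x. (norm (F k x))\<^sup>2)" "integrable lborel (\<lambda>x. (norm (f x - F k x))\<^sup>2)" for k
    using sqi[OF _ F(2)[of k]] sqi[of "\<lambda>x. f x - F k x", OF _ db[of _ "r0 k + k", folded F_def]] by auto
  \<comment> \<open>The order of i and j is the one in which the two integrations by parts below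
    strip the derivatives off the test function.\<close>
  define h where "h k = corr newton_kernel (partial j (partial i (F k)))" for k
  have test_h: "test_function (partial j (partial i (F k)))" for k by (intro test_function_partial F)
  have hm [measurable]: "h k \<in> borel_measurable borel" for k
    unfolding h_def by (intro smooth_borel smooth_corr[OF kn] test_h)
  have hi: "integrable lborel (\<lambda>x. (norm (h k x))\<^sup>2)" for k
    unfolding h_def by (rule energy_estimate(1)[OF n F(1)])
  have hQ: "(LINT x|lborel. (norm (h k x))\<^sup>2) \<le> ?\<kappa>\<^sup>2 * (LINT x|lborel. (2 * C)\<^sup>2 * wt (x::real^'n) ^ (2 * (?n + 2)))" for k
  proof -
    have "(LINT x|lborel. (norm (F k x))\<^sup>2) \<le> (LINT x|lborel. (2 * C)\<^sup>2 * wt (x::real^'n) ^ (2 * (?n + 2)))"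
      by (intro integral_mono Fsq wi sqb F)
    then show ?thesis unfolding h_def
      by (intro order_trans[OF energy_estimate(2)[OF n F(1)]] mult_left_mono) auto
  qed
  define G where "G k x = F (Suc k) x - F k x" for k x
  have "test_function (\<lambda>x. F (Suc k) x + F k x * (- 1))" for k
    by (intro test_function_add test_function_mult F smooth_const)
  then have GT: "test_function (G k)" for k by (simp add: G_def[abs_def])
  have pG: "partial j (partial i (G k)) = (\<lambda>x. partial j (partial i (F (Suc k))) x - partial j (partial i (F k)) x)" for k
  proof -
    have p: "partial i (\<lambda>x. a x - b x) = (\<lambda>x. partial i a x - partial i b x)"
      if "smooth a" "smooth b" for a b :: "real ^ 'n \<Rightarrow> complex" and i
    proof
      fix x
      have "partial i (\<lambda>x. a x + (- 1) * b x) x = partial i a x + partial i (\<lambda>x. (- 1) * b x) x"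
        by (intro partial_add differentiable_mult differentiable_const smooth_differentiable that)
      also have "partial i (\<lambda>x. (- 1) * b x) x = (- 1) * partial i b x"
        by (intro partial_cmult smooth_differentiable that)
      finally have "partial i (\<lambda>x. a x + (- 1) * b x) x = partial i a x + (- 1) * partial i b x" .
      then show "partial i (\<lambda>x. a x - b x) x = partial i a x - partial i b x" by simp
    qed
    have s: "smooth (F k)" for k by (intro test_function_smooth F)
    have "partial i (G k) = (\<lambda>x. partial i (F (Suc k)) x - partial i (F k) x)"
      unfolding G_def[abs_def] by (rule p[OF s s])
    then show ?thesis by (simp only: p[OF smooth_partial[OF s] smooth_partial[OF s]])
  qed
  have cint: "integrable lborel (\<lambda>z. newton_kernel z * \<zeta> (y + z))" if "test_function \<zeta>" for \<zeta> :: "real ^ 'n \<Rightarrow> complex" and y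
    using test_function_bound_Suc[OF that] by (metis corr_integrable[OF kn])
  have hd: "h (Suc k) x - h k x = corr newton_kernel (partial j (partial i (G k))) x" for k x
    unfolding pG using cint[OF test_h, of "Suc k" x] cint[OF test_h, of k x]
    by (simp add: h_def corr_def right_diff_distrib)
  have di: "integrable lborel (\<lambda>x. (norm (h (Suc k) x - h k x))\<^sup>2)" for k
    unfolding hd by (rule energy_estimate(1)[OF n GT])
  \<comment> \<open>|F_(k+1) - F_k|^2 \<le> 2 |f - F_(k+1)|^2 + 2 |f - F_k|^2 integrates to at most
    (1/2 + 2) / 4^k, rounded up to 4 / 4^k.\<close>
  have dc: "(LINT x|lborel. (norm (h (Suc k) x - h k x))\<^sup>2) \<le> (4 * ?\<kappa>\<^sup>2) / 4 ^ k" for k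
  proof -
    have Gi: "integrable lborel (\<lambda>x. (norm (G k x))\<^sup>2)"
    proof (rule sqi)
      show "norm (G k x) \<le> (4 * C) * wt x ^ (?n + 2)" for x
        unfolding G_def using norm_triangle_ineq4[of "F (Suc k) x" "F k x"] F(2)[of "Suc k" x] F(2)[of k x] by simp
    qed (simp add: G_def[abs_def])
    have "(LINT x|lborel. (norm (G k x))\<^sup>2) \<le> (LINT x|lborel. 2 * (norm (f x - F (Suc k) x))\<^sup>2 + 2 * (norm (f x - F k x))\<^sup>2)"
    proof (intro integral_mono Gi Bochner_Integration.integrable_add integrable_mult_right Fsq)
      fix x
      let ?a = "norm (f x - F (Suc k) x)" and ?b = "norm (f x - F k x)"
      have "norm (G k x) \<le> ?a + ?b"
        using norm_triangle_ineq4[of "f x - F k x" "f x - F (Suc k) x"] by (simp add: G_def)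
      then have "(norm (G k x))\<^sup>2 \<le> (?a + ?b)\<^sup>2" by (intro power_mono) auto
      also have "\<dots> \<le> 2 * ?a\<^sup>2 + 2 * ?b\<^sup>2" using sum_squares_bound[of ?a ?b] by (simp add: power2_sum)
      finally show "(norm (G k x))\<^sup>2 \<le> 2 * ?a\<^sup>2 + 2 * ?b\<^sup>2" .
    qed
    also have "\<dots> = 2 * (LINT x|lborel. (norm (f x - F (Suc k) x))\<^sup>2) + 2 * (LINT x|lborel. (norm (f x - F k x))\<^sup>2)"
      using Fsq by simp
    also have "\<dots> \<le> 2 * (1 / 4 ^ Suc k) + 2 * (1 / 4 ^ k)" by (intro add_mono mult_left_mono F) auto
    also have "\<dots> \<le> 4 / 4 ^ k" by (simp add: field_simps)
    finally have "?\<kappa>\<^sup>2 * (LINT x|lborel. (norm (G k x))\<^sup>2) \<le> ?\<kappa>\<^sup>2 * (4 / 4 ^ k)" by (intro mult_left_mono) auto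
    then show ?thesis unfolding hd by (intro order_trans[OF energy_estimate(2)[OF n GT]]) (simp add: mult_ac)
  qed
  obtain H where H: "H \<in> borel_measurable borel" "integrable lborel (\<lambda>x. (norm (H x))\<^sup>2)"
    "\<And>\<zeta> B. \<zeta> \<in> borel_measurable borel \<Longrightarrow> integrable lborel \<zeta> \<Longrightarrow> (\<And>x. norm (\<zeta> x) \<le> B) \<Longrightarrow>
      integrable lborel (\<lambda>x. h 0 x * \<zeta> x) \<Longrightarrow> (\<lambda>k. LINT x|lborel. h k x * \<zeta> x) \<longlonglongrightarrow> (LINT x|lborel. H x * \<zeta> x)"
  proof -
    from L2_fast_Cauchy_limit[of h, OF hm hi hQ di dc]
    obtain H where "H \<in> borel_measurable borel" "integrable lborel (\<lambda>x. (norm (H x))\<^sup>2)"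
      and "\<forall>\<zeta>. \<zeta> \<in> borel_measurable borel \<longrightarrow> integrable lborel \<zeta> \<longrightarrow> (\<exists>B. \<forall>x. norm (\<zeta> x) \<le> B) \<longrightarrow>
        integrable lborel (\<lambda>x. h 0 x * \<zeta> x) \<longrightarrow> (\<lambda>k. LINT x|lborel. h k x * \<zeta> x) \<longlonglongrightarrow> (LINT x|lborel. H x * \<zeta> x)"
      by blast
    then show thesis by (intro that[of H]) blast+
  qed
  have "(LINT x|lborel. newton f x * partial i (partial j \<zeta>) x) = (LINT x|lborel. H x * \<zeta> x)" if \<zeta>: "test_function \<zeta>" for \<zeta>
  proof (rule LIMSEQ_unique)
    have [measurable]: "\<zeta> \<in> borel_measurable borel" by (intro smooth_borel test_function_smooth \<zeta>)
    have m: "partial i (partial j \<zeta>) \<in> borel_measurable borel"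
      by (intro smooth_borel smooth_partial test_function_smooth \<zeta>)
    obtain B where B: "\<And>x. norm (\<zeta> x) \<le> B" using test_function_bound[OF \<zeta>, of 0] by auto
    have bd: "\<exists>B. \<forall>x. norm (corr newton_kernel g x) \<le> B" if g: "test_function g" for g :: "real ^ 'n \<Rightarrow> complex"
    proof -
      obtain D where "D > 0" "\<And>x. norm (corr newton_kernel g x) \<le> D * wt x ^ (?n - 2)"
        using corr_test_bound[OF kn g] by blast
      then have "norm (corr newton_kernel g x) \<le> D * 1" for x
        by (meson order_trans mult_left_mono less_imp_le power_le_one wt_nonneg wt_le_1)
      then show ?thesis by blast
    qed
    obtain B0 where B0: "\<And>x. norm (h 0 x) \<le> B0" using bd[OF test_h] unfolding h_def by blast
    have "integrable lborel (\<lambda>x. h 0 x * \<zeta> x)"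
    proof (rule Bochner_Integration.integrable_bound)
      show "integrable lborel (\<lambda>x. B0 * norm (\<zeta> x))" using test_function_integrable[OF \<zeta>] by simp
      show "AE x in lborel. norm (h 0 x * \<zeta> x) \<le> norm (B0 * norm (\<zeta> x))"
        using B0 order_trans[OF norm_ge_zero B0] by (intro AE_I2) (auto simp: norm_mult intro!: mult_right_mono)
    qed measurable
    then have lim1: "(\<lambda>k. LINT x|lborel. h k x * \<zeta> x) \<longlonglongrightarrow> (LINT x|lborel. H x * \<zeta> x)"
      by (intro H(3)[OF _ test_function_integrable[OF \<zeta>] B]) simp_all
    have ibp: "(LINT x|lborel. h k x * \<zeta> x) = (LINT x|lborel. F k x * corr newton_kernel (partial i (partial j \<zeta>)) x)" for k
    proof -
      let ?U = "corr newton_kernel (F k)"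
      have sU: "smooth ?U" by (rule smooth_corr[OF kn F(1)])
      have pU: "partial i ?U = corr newton_kernel (partial i (F k))" by (rule partial_corr[OF kn F(1)])
      have ppU: "partial j (partial i ?U) = h k" unfolding pU h_def by (rule partial_corr[OF kn test_function_partial[OF F(1)]])
      obtain B1 B2 B3 where B: "\<And>x. norm (?U x) \<le> B1" "\<And>x. norm (partial i ?U x) \<le> B2" "\<And>x. norm (partial j (partial i ?U) x) \<le> B3"
        unfolding ppU unfolding h_def pU using bd[OF F(1)] bd[OF test_function_partial[OF F(1)]] bd[OF test_h] by metis
      have "(LINT x|lborel. ?U x * partial i (partial j \<zeta>) x) = - (LINT x|lborel. partial i ?U x * partial j \<zeta> x)"
        by (rule integral_by_parts_test[where B="max B1 B2", OF _ _ _ test_function_partial[OF \<zeta>]])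
           (use B in \<open>auto simp: le_max_iff_disj intro: smooth_differentiable sU\<close>)
      also have "(LINT x|lborel. partial i ?U x * partial j \<zeta> x) = - (LINT x|lborel. partial j (partial i ?U) x * \<zeta> x)"
        by (rule integral_by_parts_test[where B="max B2 B3", OF _ _ _ \<zeta>])
           (use B in \<open>auto simp: le_max_iff_disj intro: smooth_differentiable smooth_partial sU\<close>)
      finally have "(LINT x|lborel. h k x * \<zeta> x) = (LINT x|lborel. newton (F k) x * partial i (partial j \<zeta>) x)"
        unfolding ppU by (simp add: newton_eq_corr)
      also have "\<dots> = (LINT x|lborel. F k x * corr newton_kernel (partial i (partial j \<zeta>)) x)"
      proof -
        obtain D where D: "\<And>x. norm (partial i (partial j \<zeta>) x) \<le> D * wt x ^ Suc ?n"
          using test_function_bound[OF test_function_partial[OF test_function_partial[OF \<zeta>]]] by blast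
        have "integrable lborel (\<lambda>y. wt y ^ (?n - 2) * norm (F k y))"
          by (rule Bochner_Integration.integrable_bound[OF integrable_norm[OF test_function_integrable[OF F(1)]], of _ k])
             (auto intro!: AE_I2 mult_left_le_one_le power_le_one)
        then show ?thesis
          by (intro pot_duality(2)[OF kn _ m _ D]) simp_all
      qed
      finally show ?thesis .
    qed
    show "(\<lambda>k. LINT x|lborel. h k x * \<zeta> x) \<longlonglongrightarrow> (LINT x|lborel. H x * \<zeta> x)" by (rule lim1)
    obtain D where D: "D > 0" "\<And>x. norm (corr newton_kernel (partial i (partial j \<zeta>)) x) \<le> D * wt x ^ (?n - 2)"
      using corr_test_bound[OF kn test_function_partial[OF test_function_partial[OF \<zeta>]]] by blast
    have [measurable]: "corr newton_kernel (partial i (partial j \<zeta>)) \<in> borel_measurable borel"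
      by (intro smooth_borel smooth_corr[OF kn] test_function_partial \<zeta>)
    have "(\<lambda>k. LINT x|lborel. F k x * corr newton_kernel (partial i (partial j \<zeta>)) x) \<longlonglongrightarrow> (LINT x|lborel. f x * corr newton_kernel (partial i (partial j \<zeta>)) x)"
    proof (rule integral_dominated_convergence[where w="\<lambda>x. (2 * C * D) * wt x ^ (?n + 2)"])
      show "integrable lborel (\<lambda>x::real^'n. (2 * C * D) * wt x ^ (?n + 2))" by (intro integrable_mult_right wt_power_integrable) simp
      show "AE x in lborel. (\<lambda>k. F k x * corr newton_kernel (partial i (partial j \<zeta>)) x) \<longlonglongrightarrow> f x * corr newton_kernel (partial i (partial j \<zeta>)) x"
        using FAE by eventually_elim (intro tendsto_intros)
      show "AE x in lborel. norm (F k x * corr newton_kernel (partial i (partial j \<zeta>)) x) \<le> (2 * C * D) * wt x ^ (?n + 2)" for k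
      proof (intro AE_I2)
        fix x :: "real ^ 'n"
        have "D * wt x ^ (?n - 2) \<le> D * 1" using D(1) by (intro mult_left_mono power_le_one) auto
        then have "norm (corr newton_kernel (partial i (partial j \<zeta>)) x) \<le> D" using D(2)[of x] by simp
        then have "norm (F k x) * norm (corr newton_kernel (partial i (partial j \<zeta>)) x) \<le> (2 * C * wt x ^ (?n + 2)) * D"
          using C by (intro mult_mono F) auto
        then show "norm (F k x * corr newton_kernel (partial i (partial j \<zeta>)) x) \<le> (2 * C * D) * wt x ^ (?n + 2)"
          by (simp add: norm_mult mult_ac)
      qed
    qed measurable
    also have "(LINT x|lborel. f x * corr newton_kernel (partial i (partial j \<zeta>)) x) = (LINT x|lborel. newton f x * partial i (partial j \<zeta>) x)"
    proof -
      obtain D where D: "\<And>x. norm (partial i (partial j \<zeta>) x) \<le> D * wt x ^ Suc ?n"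
        using test_function_bound[OF test_function_partial[OF test_function_partial[OF \<zeta>]]] by blast
      have fi: "integrable lborel f" by (rule integrable_wt_bound[OF _ f]) simp_all
      have "integrable lborel (\<lambda>y. wt y ^ (?n - 2) * norm (f y))"
        by (rule Bochner_Integration.integrable_bound[OF integrable_norm[OF fi]])
           (auto intro!: AE_I2 mult_left_le_one_le power_le_one)
      then show ?thesis
        by (intro pot_duality(2)[OF kn _ m _ D, symmetric]) simp_all
    qed
    finally show "(\<lambda>k. LINT x|lborel. h k x * \<zeta> x) \<longlonglongrightarrow> (LINT x|lborel. newton f x * partial i (partial j \<zeta>) x)"
      unfolding ibp .
  qed
  with H(1,2) show ?thesis by blast
qed

subsection \<open>Borel representatives\<close>

lemma borel_representative:
  fixes f :: "real ^ 'n \<Rightarrow> complex"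
  assumes "f \<in> borel_measurable lebesgue"
  obtains g where "g \<in> borel_measurable borel" "AE x in lborel. f x = g x"
proof -
  have "(\<lambda>x. Re (f x)) \<in> borel_measurable lebesgue" "(\<lambda>x. Im (f x)) \<in> borel_measurable lebesgue"
    using assms by measurable
  from this[THEN completion_ex_borel_measurable_real]
  obtain a b where [measurable]: "a \<in> borel_measurable lborel" "b \<in> borel_measurable lborel"
    and ab: "AE x in lborel. Re (f x) = a x" "AE x in lborel. Im (f x) = b x"
    by blast
  show thesis
  proof (rule that[of "\<lambda>x. Complex (a x) (b x)"])
    have "(\<lambda>x. complex_of_real (a x) + \<i> * complex_of_real (b x)) \<in> borel_measurable lborel" by measurable
    then show "(\<lambda>x. Complex (a x) (b x)) \<in> borel_measurable borel" by (simp add: Complex_eq)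
    show "AE x in lborel. f x = Complex (a x) (b x)" using ab by eventually_elim (simp add: complex_eq_iff)
  qed
qed

lemma lebesgue_measurable_cong_AE:
  fixes f g :: "real ^ 'n \<Rightarrow> 'b::euclidean_space"
  assumes "g \<in> borel_measurable borel" and "AE x in lborel. f x = g x"
  shows "f \<in> borel_measurable lebesgue"
proof (rule borel_measurable_AE)
  show "g \<in> borel_measurable lebesgue" using assms(1) by (intro measurable_completion) simp
  show "AE x in lebesgue. g x = f x" using assms(2) by (auto simp: AE_completion_iff elim: eventually_mono)
qed

lemma lebesgue_integrable_cong_lborel:
  fixes f g :: "real ^ 'n \<Rightarrow> 'b::euclidean_space"
  assumes g: "g \<in> borel_measurable borel" and ae: "AE x in lborel. f x = g x"
  shows "integrable lebesgue f \<longleftrightarrow> integrable lborel g" and "(LINT x|lebesgue. f x) = (LINT x|lborel. g x)"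
proof -
  have g': "g \<in> borel_measurable lebesgue" using g by (intro measurable_completion) simp
  have ae': "AE x in lebesgue. f x = g x" using ae by (simp add: AE_completion_iff)
  note f = lebesgue_measurable_cong_AE[OF assms]
  show "integrable lebesgue f \<longleftrightarrow> integrable lborel g"
    using integrable_cong_AE[OF f g' ae'] g by (simp add: integrable_completion)
  show "(LINT x|lebesgue. f x) = (LINT x|lborel. g x)"
    using integral_cong_AE[OF f g' ae'] g by (simp add: integral_completion)
qed

section \<open>Identification of the Green function with the Newtonian kernel\<close>

lemma green0_eq:
  fixes x y :: "real ^ 'n"
  assumes "CARD('n) \<ge> 3"
  shows "complex_of_real (green0 x y) = newton_kernel (x - y) / complex_of_real (newton_const TYPE('n))"
proof -
  let ?n = "real CARD('n)"
  have G: "Gamma (?n / 2 + 1) = ?n / 2 * Gamma (?n / 2)" using assms by (intro Gamma_plus1) auto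
  have Gp: "Gamma (?n / 2) > 0" using assms by (intro Gamma_real_pos) auto
  have V: "unit_ball_vol ?n = pi powr (?n / 2) / (?n / 2 * Gamma (?n / 2))"
    by (simp only: unit_ball_vol_def G)
  \<comment> \<open>Amounts to area = n V for the unit sphere and ball, by the functional equation
    of the Gamma function at n / 2.\<close>
  have area: "(?n - 2) * unit_sphere_area CARD('n) = newton_const TYPE('n)"
  proof -
    have "?n * (?n - 2) * (pi powr (?n / 2) / (?n / 2 * Gamma (?n / 2))) = (?n - 2) * (2 * pi powr (?n / 2) / Gamma (?n / 2))"
    proof -
      have "N * (N - 2) * (p / (N / 2 * G)) = (N - 2) * (2 * p / G)" if "N \<noteq> 0" "G \<noteq> 0" for N p G :: real
        using that by (simp add: field_simps)
      then show ?thesis using assms Gp by simp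
    qed
    then show ?thesis unfolding unit_sphere_area_def newton_const_def V by (rule sym)
  qed
  have "norm (x - y) powr (2 - ?n) = inv_norm (x - y) ^ (CARD('n) - 2)"
  proof (cases "x = y")
    case True
    then show ?thesis using assms by (simp add: inv_norm_def)
  next
    case False
    then have "norm (x - y) powr (2 - ?n) = inverse (norm (x - y) powr real (CARD('n) - 2))"
      using assms by (simp add: powr_minus[symmetric] of_nat_diff)
    then show ?thesis using False by (simp add: powr_realpow inv_norm_def power_one_over inverse_eq_divide)
  qed
  then show ?thesis unfolding green0_def area by (simp add: newton_kernel_def)
qed

text \<open>The equality holds at every x and without integrability: the integrands agree almost
  everywhere, so both integrals have the default value 0 simultaneously if they diverge.\<close>

lemma zero_resolvent_eq:
  fixes f g :: "real ^ 'n \<Rightarrow> complex"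
  assumes n: "CARD('n) \<ge> 3" and [measurable]: "g \<in> borel_measurable borel" and ae: "AE x in lborel. f x = g x"
  shows "zero_resolvent f x = newton g x / complex_of_real (newton_const TYPE('n))"
proof -
  let ?\<kappa> = "complex_of_real (newton_const TYPE('n))"
  have "zero_resolvent f x = (LINT y|lborel. newton_kernel (x - y) * g y / ?\<kappa>)"
    unfolding zero_resolvent_def
    by (rule lebesgue_integrable_cong_lborel(2)) (measurable, use ae in eventually_elim, simp add: green0_eq[OF n])
  then show ?thesis by (simp add: pot_def)
qed

section \<open>Local integrability and membership in \<open>L_space\<close>, read off from Borel
  representatives\<close>

lemma locally_integrable_cong:
  fixes f g :: "real ^ 'n \<Rightarrow> complex"
  assumes [measurable]: "g \<in> borel_measurable borel" and ae: "AE x in lborel. f x = g x"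
    and g: "\<And>K. compact K \<Longrightarrow> set_integrable lborel K g"
  shows "locally_integrable f"
  unfolding locally_integrable_def
proof (intro allI impI)
  fix K :: "(real ^ 'n) set" assume K: "compact K"
  then have [measurable]: "K \<in> sets borel" by (simp add: borel_compact)
  have "integrable lebesgue (\<lambda>x. indicator K x *\<^sub>R f x) \<longleftrightarrow> integrable lborel (\<lambda>x. indicator K x *\<^sub>R g x)"
    by (rule lebesgue_integrable_cong_lborel(1)) (measurable, use ae in eventually_elim, simp)
  then show "set_integrable lebesgue K f" using g[OF K] by (simp add: set_integrable_def)
qed

lemma set_integrable_wt_bound:
  fixes g :: "real ^ 'n \<Rightarrow> complex"
  assumes [measurable]: "g \<in> borel_measurable borel" and g: "\<And>x. norm (g x) \<le> B * wt x ^ k" and K: "compact K"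
  shows "set_integrable lborel K g"
  unfolding set_integrable_def
proof (rule Bochner_Integration.integrable_bound)
  have [measurable]: "K \<in> sets borel" using K by (simp add: borel_compact)
  have "integrable lborel (indicator K :: real ^ 'n \<Rightarrow> real)"
    using emeasure_bounded_finite[OF compact_imp_bounded[OF K]] by (intro integrable_real_indicator) auto
  then show "integrable lborel (\<lambda>x. B * indicator K x)" by simp
  have "0 \<le> B * wt (0 :: real ^ 'n) ^ k" using order_trans[OF norm_ge_zero g] .
  then have B: "B \<ge> 0" using zero_less_power[OF wt_pos[of "0 :: real ^ 'n"], of k] by (simp add: zero_le_mult_iff)
  have "norm (g x) \<le> B" for x
    using order_trans[OF g mult_left_mono[OF power_le_one B]] by simp
  then show "AE x in lborel. norm (indicator K x *\<^sub>R g x) \<le> norm (B * indicator K x)"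
    using B by (intro AE_I2) (auto split: split_indicator)
  show "(\<lambda>x. indicator K x *\<^sub>R g x) \<in> borel_measurable lborel" by measurable
qed

lemma L_space_2_iff:
  fixes f g :: "real ^ 'n \<Rightarrow> complex"
  assumes [measurable]: "g \<in> borel_measurable borel" and ae: "AE x in lborel. f x = g x"
  shows "f \<in> L_space 2 \<longleftrightarrow> integrable lborel (\<lambda>x. (norm (g x))\<^sup>2)"
proof -
  have e: "norm z powr real_of_ereal 2 = (norm z)\<^sup>2" for z :: complex by simp
  have "integrable lebesgue (\<lambda>x. (norm (f x))\<^sup>2) \<longleftrightarrow> integrable lborel (\<lambda>x. (norm (g x))\<^sup>2)"
    by (rule lebesgue_integrable_cong_lborel(1)) (measurable, use ae in eventually_elim, simp)
  then show ?thesis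
    using lebesgue_measurable_cong_AE[OF assms] unfolding L_space_def mem_Collect_eq e by simp
qed

text \<open>k r > n is the integrability threshold for the r-th power of <x>^(-k); at q =
  \<infinity> boundedness of the weight suffices.\<close>

lemma L_space_if_wt_bound:
  fixes f g :: "real ^ 'n \<Rightarrow> complex"
  assumes [measurable]: "g \<in> borel_measurable borel" and ae: "AE x in lborel. f x = g x"
    and g: "\<And>x. norm (g x) \<le> B * wt x ^ k"
    and q: "q = \<infinity> \<or> (\<exists>r. q = ereal r \<and> r > 0 \<and> real k * r > real CARD('n))"
  shows "f \<in> L_space q"
proof -
  have "0 \<le> B * wt (0 :: real ^ 'n) ^ k" using order_trans[OF norm_ge_zero g] .
  then have B: "B \<ge> 0" using zero_less_power[OF wt_pos[of "0 :: real ^ 'n"], of k] by (simp add: zero_le_mult_iff)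
  note m = lebesgue_measurable_cong_AE[OF assms(1) ae]
  show ?thesis
  proof (cases "q = \<infinity>")
    case True
    have "norm (g x) \<le> B" for x
      using order_trans[OF g mult_left_mono[OF power_le_one B]] by simp
    then have "AE x in lebesgue. norm (f x) \<le> B"
      using ae unfolding AE_completion_iff by (auto elim: eventually_mono)
    then show ?thesis using m True by (auto simp: L_space_def)
  next
    case False
    then obtain r where r: "q = ereal r" "r > 0" "real k * r > real CARD('n)" using q by auto
    have "integrable lborel (\<lambda>x. norm (g x) powr r)"
    proof (rule Bochner_Integration.integrable_bound)
      show "integrable lborel (\<lambda>x::real^'n. B powr r * wt x powr (real k * r))"
        by (intro integrable_mult_right wt_powr_integrable r)
      show "AE x in lborel. norm (norm (g x) powr r) \<le> norm (B powr r * wt x powr (real k * r))"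
      proof (intro AE_I2)
        fix x
        have "norm (g x) powr r \<le> (B * wt x ^ k) powr r" using r by (intro powr_mono2 g) auto
        also have "\<dots> = B powr r * wt x powr (real k * r)"
          using B by (simp add: powr_mult powr_powr powr_realpow[symmetric])
        finally show "norm (norm (g x) powr r) \<le> norm (B powr r * wt x powr (real k * r))" by simp
      qed
    qed measurable
    moreover have "integrable lebesgue (\<lambda>x. norm (f x) powr r) \<longleftrightarrow> integrable lborel (\<lambda>x. norm (g x) powr r)"
      by (rule lebesgue_integrable_cong_lborel(1)) (measurable, use ae in eventually_elim, simp)
    ultimately show ?thesis using m r by (simp add: L_space_def)
  qed
qed

text \<open>For eigenfunctions in dimensions 3 and 4 the decay <x>^(2-n) alone does not reach the
  exponent 2, since then 2 (n - 2) \<le> n. Square integrability is given there, and boundedness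
  takes care of the larger exponents.\<close>

lemma L_space_interpolation:
  fixes f g :: "real ^ 'n \<Rightarrow> complex"
  assumes [measurable]: "g \<in> borel_measurable borel" and ae: "AE x in lborel. f x = g x"
    and B: "\<And>x. norm (g x) \<le> B" and L2: "f \<in> L_space 2" and r: "2 \<le> r"
  shows "f \<in> L_space (ereal r)"
proof -
  note m = lebesgue_measurable_cong_AE[OF assms(1) ae]
  have g2: "integrable lborel (\<lambda>x. (norm (g x))\<^sup>2)" using L2 L_space_2_iff[OF assms(1) ae] by simp
  have B0: "B \<ge> 0" using order_trans[OF norm_ge_zero B] .
  have "integrable lborel (\<lambda>x. norm (g x) powr r)"
  proof (rule Bochner_Integration.integrable_bound)
    show "integrable lborel (\<lambda>x. B powr (r - 2) * (norm (g x))\<^sup>2)" using g2 by simp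
    show "AE x in lborel. norm (norm (g x) powr r) \<le> norm (B powr (r - 2) * (norm (g x))\<^sup>2)"
    proof (intro AE_I2)
      fix x
      have "norm (g x) powr r = norm (g x) powr (r - 2) * norm (g x) powr 2" by (simp only: powr_add[symmetric]) simp
      also have "norm (g x) powr 2 = (norm (g x))\<^sup>2" by simp
      also have "norm (g x) powr (r - 2) * (norm (g x))\<^sup>2 \<le> B powr (r - 2) * (norm (g x))\<^sup>2"
        using r B by (intro mult_right_mono powr_mono2) auto
      finally show "norm (norm (g x) powr r) \<le> norm (B powr (r - 2) * (norm (g x))\<^sup>2)" by simp
    qed
  qed measurable
  moreover have "integrable lebesgue (\<lambda>x. norm (f x) powr r) \<longleftrightarrow> integrable lborel (\<lambda>x. norm (g x) powr r)"
    by (rule lebesgue_integrable_cong_lborel(1)) (measurable, use ae in eventually_elim, simp)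
  ultimately show ?thesis using m by (simp add: L_space_def)
qed

lemma test_integral_cong:
  fixes f g h :: "real ^ 'n \<Rightarrow> complex"
  assumes [measurable]: "g \<in> borel_measurable borel" "h \<in> borel_measurable borel" and ae: "AE x in lborel. f x = g x"
  shows "(LINT x|lebesgue. f x * h x) = (LINT x|lborel. g x * h x)"
  by (rule lebesgue_integrable_cong_lborel(2)) (measurable, use ae in eventually_elim, simp)

text \<open>Free of an integrability assumption because the integral of a non-integrable function is
  0; this permits estimates before convergence is established.\<close>

lemma ennreal_norm_integral_le:
  fixes f :: "'a \<Rightarrow> 'b::{banach, second_countable_topology}"
  shows "ennreal (norm (integral\<^sup>L M f)) \<le> (\<integral>\<^sup>+x. ennreal (norm (f x)) \<partial>M)"
  by (cases "integrable M f") (auto simp: integral_norm_bound_ennreal not_integrable_integral_eq)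

subsection \<open>Threshold solutions\<close>

locale decaying_potential =
  fixes v :: "real ^ 'n \<Rightarrow> complex" and C :: real
  assumes n3: "CARD('n) \<ge> 3" and v_meas: "v \<in> borel_measurable lebesgue"
    and v_real: "AE x in lebesgue. v x \<in> \<real>" and C_pos: "0 < C"
    and v_decay: "AE x in lebesgue. norm (v x) \<le> C * japanese_bracket x powr (- 4)"
begin

lemma newton_const_neq_0: "complex_of_real (newton_const TYPE('n)) \<noteq> 0" and norm_of_newton_const: "norm (complex_of_real (newton_const TYPE('n))) = newton_const TYPE('n)" and newton_const_pos': "newton_const TYPE('n) > 0"
  using newton_const_pos[OF n3] by auto

lemma abs_newton_const [simp]: "\<bar>newton_const TYPE('n)\<bar> = newton_const TYPE('n)"
  using newton_const_pos' by simp

text \<open>Reality and decay are made to hold at every point, by taking the real part and putting 0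
  where the bound fails; only a null set is affected.\<close>

lemma ex_borel_potential:
  "\<exists>w. w \<in> borel_measurable borel \<and> (AE x in lborel. v x = w x) \<and> (\<forall>x. w x \<in> \<real>) \<and> (\<forall>x. norm (w x) \<le> C * wt x ^ 4)"
proof -
  obtain u where [measurable]: "u \<in> borel_measurable borel" and u: "AE x in lborel. v x = u x"
    using borel_representative[OF v_meas] .
  have p: "japanese_bracket x powr (- 4) = wt x ^ 4" for x :: "real ^ 'n"
    using japanese_bracket_ge_1[of x] by (simp add: wt_def powr_minus powr_numeral power_one_over inverse_eq_divide)
  define w where "w x = (if norm (complex_of_real (Re (u x))) \<le> C * wt x ^ 4 then complex_of_real (Re (u x)) else 0)" for x
  have "w \<in> borel_measurable borel" unfolding w_def by measurable
  moreover have "AE x in lborel. v x = w x"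
    using u v_real[unfolded AE_completion_iff] v_decay[unfolded AE_completion_iff]
  proof eventually_elim
    case (elim x)
    then have "complex_of_real (Re (u x)) = u x" by (simp add: complex_is_Real_iff complex_eq_iff)
    then show ?case using elim by (simp add: w_def p)
  qed
  moreover have "norm (w x) \<le> C * wt x ^ 4" "w x \<in> \<real>" for x
    using C_pos by (auto simp: w_def)
  ultimately show ?thesis by blast
qed

definition pot_rep :: "real ^ 'n \<Rightarrow> complex" where
  "pot_rep = (SOME w. w \<in> borel_measurable borel \<and> (AE x in lborel. v x = w x) \<and> (\<forall>x. w x \<in> \<real>) \<and> (\<forall>x. norm (w x) \<le> C * wt x ^ 4))"

lemma pot_rep_measurable [measurable]: "pot_rep \<in> borel_measurable borel"
  and pot_rep: "AE x in lborel. v x = pot_rep x" "pot_rep x \<in> \<real>" "norm (pot_rep x) \<le> C * wt x ^ 4"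
  using someI_ex[OF ex_borel_potential] unfolding pot_rep_def[symmetric] by auto

text \<open>The common normal form of eigenfunctions and resonance functions. Demanding the equation
  and the decay at every point singles out one representative of the class, so that later arguments
  about solutions are pointwise.\<close>

definition threshold_solution :: "(real ^ 'n \<Rightarrow> complex) \<Rightarrow> bool" where
  "threshold_solution \<psi> \<longleftrightarrow> \<psi> \<in> borel_measurable borel \<and> (\<exists>B>0. \<forall>x. norm (\<psi> x) \<le> B * wt x ^ (CARD('n) - 2)) \<and>
    (\<forall>x. complex_of_real (newton_const TYPE('n)) * \<psi> x = - newton (\<lambda>y. pot_rep y * \<psi> y) x)"

text \<open>The assumption says that |v|^(1/2) \<psi> is in L^2, which covers eigenfunctions and
  elements of the kernel alike. The bootstrap runs for u = |v|^(1/2) |\<psi>|: of the factor v in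
  the source, one half is bounded by \<open>wt y ^ 2\<close> and the other half belongs to
  u.\<close>

lemma threshold_solution_exists:
  assumes [measurable]: "\<psi> \<in> borel_measurable borel"
    and int: "integrable lborel (\<lambda>x. norm (pot_rep x) * (norm (\<psi> x))\<^sup>2)"
    and eq: "AE x in lborel. complex_of_real (newton_const TYPE('n)) * \<psi> x = - newton (\<lambda>y. pot_rep y * \<psi> y) x"
  shows "\<exists>\<psi>0. threshold_solution \<psi>0 \<and> (AE x in lborel. \<psi> x = \<psi>0 x)"
proof -
  let ?n = "CARD('n)" let ?k = "newton_const TYPE('n)"
  define f where "f y = pot_rep y * \<psi> y" for y
  have [measurable]: "f \<in> borel_measurable borel" unfolding f_def by measurable
  define u where "u x = sqrt (norm (pot_rep x)) * norm (\<psi> x)" for x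
  have [measurable]: "u \<in> borel_measurable borel" unfolding u_def by measurable
  have sq: "sqrt (norm (pot_rep x)) \<le> sqrt C * wt x ^ 2" for x
  proof -
    have "sqrt (norm (pot_rep x)) \<le> sqrt (C * wt x ^ 4)" using pot_rep(3) by (rule real_sqrt_le_mono)
    also have "\<dots> = sqrt C * sqrt (wt x ^ 4)" by (rule real_sqrt_mult)
    also have "sqrt (wt x ^ 4) = wt x ^ 2" by (rule real_sqrt_unique) (simp_all flip: power_mult)
    finally show ?thesis .
  qed
  have f_u: "norm (f x) \<le> sqrt C * (wt x ^ 2 * u x)" for x
  proof -
    have "norm (f x) = sqrt (norm (pot_rep x)) * u x" by (simp add: f_def u_def norm_mult)
    also have "\<dots> \<le> (sqrt C * wt x ^ 2) * u x" by (intro mult_right_mono sq) (simp add: u_def)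
    finally show ?thesis by (simp add: mult.assoc)
  qed
  let ?P = "\<lambda>x. \<integral>\<^sup>+y. ennreal (inv_norm (x - y) ^ (?n - 2) * (wt y ^ 2 * u y)) \<partial>lborel"
  have newton_P: "ennreal (norm (newton f x)) \<le> ennreal (sqrt C) * ?P x" for x
  proof -
    have "ennreal (norm (newton f x)) \<le> (\<integral>\<^sup>+y. ennreal (norm (newton_kernel (x - y) * f y)) \<partial>lborel)"
      unfolding pot_def by (rule ennreal_norm_integral_le)
    also have "\<dots> \<le> (\<integral>\<^sup>+y. ennreal (sqrt C) * ennreal (inv_norm (x - y) ^ (?n - 2) * (wt y ^ 2 * u y)) \<partial>lborel)"
    proof (rule nn_integral_mono)
      fix y
      have "norm (newton_kernel (x - y) * f y) \<le> sqrt C * (inv_norm (x - y) ^ (?n - 2) * (wt y ^ 2 * u y))"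
        using mult_left_mono[OF f_u[of y], of "inv_norm (x - y) ^ (?n - 2)"] by (simp add: norm_mult norm_newton_kernel mult_ac)
      then show "ennreal (norm (newton_kernel (x - y) * f y)) \<le> ennreal (sqrt C) * ennreal (inv_norm (x - y) ^ (?n - 2) * (wt y ^ 2 * u y))"
        using C_pos by (simp add: ennreal_mult'[symmetric] ennreal_leI)
    qed
    also have "\<dots> = ennreal (sqrt C) * ?P x" by (intro nn_integral_cmult) measurable
    finally show ?thesis .
  qed
  \<comment> \<open>The constant A: one factor sqrt C bounds |v|^(1/2) outside the integral, the
    other comes from the half of v inside, and the division is by the constant of the
    equation.\<close>
  have "\<exists>B. \<forall>x. ?P x \<le> ennreal B"
  proof (rule newton_bootstrap_bounded[OF n3, where A="sqrt C * (sqrt C / ?k)"])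
    show "0 \<le> u x" for x by (simp add: u_def)
    show "integrable lborel (\<lambda>x. (u x)\<^sup>2)" using int by (simp add: u_def power_mult_distrib)
    show "0 \<le> sqrt C * (sqrt C / ?k)" using C_pos newton_const_pos' by simp
    show "AE x in lborel. ennreal (u x) \<le> ennreal (sqrt C * (sqrt C / ?k)) * ?P x"
      using eq
    proof eventually_elim
      case (elim x)
      have "u x \<le> (sqrt C * wt x ^ 2) * norm (\<psi> x)" unfolding u_def by (intro mult_right_mono sq) auto
      also have "\<dots> \<le> sqrt C * 1 * norm (\<psi> x)" using C_pos by (intro mult_right_mono mult_left_mono power_le_one) auto
      finally have 1: "u x \<le> sqrt C * norm (\<psi> x)" by simp
      have "norm (complex_of_real (newton_const TYPE('n)) * \<psi> x) = norm (newton f x)" using elim by (simp add: f_def[abs_def])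
      then have "?k * norm (\<psi> x) = norm (newton f x)" by (simp add: norm_mult norm_of_newton_const)
      then have "norm (\<psi> x) = norm (newton f x) / ?k" using newton_const_pos' by (simp add: field_simps)
      with 1 have "u x \<le> sqrt C / ?k * norm (newton f x)" by simp
      then have "ennreal (u x) \<le> ennreal (sqrt C / ?k) * ennreal (norm (newton f x))"
        using C_pos newton_const_pos' by (subst ennreal_mult'[symmetric]) (auto intro!: ennreal_leI)
      also have "\<dots> \<le> ennreal (sqrt C / ?k) * (ennreal (sqrt C) * ?P x)" by (intro mult_left_mono newton_P) auto
      also have "\<dots> = ennreal (sqrt C * (sqrt C / ?k)) * ?P x"
        using C_pos by (subst ennreal_mult') (auto simp: mult_ac)
      finally show ?case .
    qed
  qed measurable
  then obtain B where B: "\<And>x. ?P x \<le> ennreal B" by blast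
  have bdd: "norm (newton f x) \<le> sqrt C * max B 0" for x
  proof -
    have "ennreal (norm (newton f x)) \<le> ennreal (sqrt C) * ennreal (max B 0)"
      by (rule order_trans[OF newton_P mult_left_mono[OF order_trans[OF B]]]) (auto intro: ennreal_leI)
    then show ?thesis using C_pos by (simp add: ennreal_mult'[symmetric])
  qed
  have fb: "AE y in lborel. norm (f y) \<le> (C / ?k) * wt y ^ 4 * norm (newton f y)"
    using eq
  proof eventually_elim
    case (elim y)
    have "norm (complex_of_real (newton_const TYPE('n)) * \<psi> y) = norm (newton f y)" using elim by (simp add: f_def[abs_def])
    then have "?k * norm (\<psi> y) = norm (newton f y)" by (simp add: norm_mult norm_of_newton_const)
    then have "norm (\<psi> y) = norm (newton f y) / ?k" using newton_const_pos' by (simp add: field_simps)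
    then have "norm (f y) = norm (pot_rep y) * (norm (newton f y) / ?k)" by (simp add: f_def norm_mult)
    also have "\<dots> \<le> (C * wt y ^ 4) * (norm (newton f y) / ?k)"
      using newton_const_pos' by (intro mult_right_mono pot_rep(3)) auto
    finally show ?case by (simp add: mult_ac)
  qed
  obtain D where D: "D > 0" "\<And>x. norm (newton f x) \<le> D * wt x ^ (?n - 2)"
    using newton_decay[OF n3 _ bdd _ fb, of "?n - 2"] C_pos newton_const_pos' by auto
  \<comment> \<open>The right-hand side of the equation as the new representative: since changing
    \<psi> on a null set leaves the potential unchanged, the equation now holds everywhere.\<close>
  define \<psi>0 where "\<psi>0 x = - newton f x / complex_of_real (newton_const TYPE('n))" for x
  have m [measurable]: "\<psi>0 \<in> borel_measurable borel" unfolding \<psi>0_def by measurable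
  have ae: "AE x in lborel. \<psi> x = \<psi>0 x"
    using eq by eventually_elim (use newton_const_neq_0 in \<open>simp add: \<psi>0_def f_def[abs_def] field_simps\<close>)
  have "newton (\<lambda>y. pot_rep y * \<psi>0 y) = newton f"
  proof
    fix x
    show "newton (\<lambda>y. pot_rep y * \<psi>0 y) x = newton f x"
      unfolding pot_def by (rule integral_cong_AE) (measurable, use ae in eventually_elim, simp add: f_def)
  qed
  then have "complex_of_real (newton_const TYPE('n)) * \<psi>0 x = - newton (\<lambda>y. pot_rep y * \<psi>0 y) x" for x
    using newton_const_neq_0 by (simp add: \<psi>0_def)
  moreover have "norm (\<psi>0 x) \<le> (D / ?k) * wt x ^ (?n - 2)" for x
    using D(2)[of x] newton_const_pos' by (simp add: \<psi>0_def norm_divide norm_of_newton_const divide_right_mono)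
  moreover have "D / ?k > 0" using D newton_const_pos' by simp
  ultimately show ?thesis using ae m unfolding threshold_solution_def by blast
qed

lemma threshold_solution_props:
  assumes "threshold_solution \<psi>"
  shows "\<psi> \<in> borel_measurable borel"
    and "\<exists>B>0. \<forall>x. norm (\<psi> x) \<le> B * wt x ^ (CARD('n) - 2)"
    and "\<exists>B>0. \<forall>x. norm (pot_rep x * \<psi> x) \<le> B * wt x ^ (CARD('n) + 2)"
    and "complex_of_real (newton_const TYPE('n)) * \<psi> x = - newton (\<lambda>y. pot_rep y * \<psi> y) x"
    and "(\<lambda>y. pot_rep y * \<psi> y) \<in> borel_measurable borel"
proof -
  show m [measurable]: "\<psi> \<in> borel_measurable borel" and "complex_of_real (newton_const TYPE('n)) * \<psi> x = - newton (\<lambda>y. pot_rep y * \<psi> y) x"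
    and b: "\<exists>B>0. \<forall>x. norm (\<psi> x) \<le> B * wt x ^ (CARD('n) - 2)"
    using assms by (auto simp: threshold_solution_def)
  show "(\<lambda>y. pot_rep y * \<psi> y) \<in> borel_measurable borel" by measurable
  from b obtain B where B: "B > 0" "\<And>x. norm (\<psi> x) \<le> B * wt x ^ (CARD('n) - 2)" by blast
  have e: "4 + (CARD('n) - 2) = CARD('n) + 2" using n3 by simp
  have "norm (pot_rep x * \<psi> x) \<le> (C * B) * wt x ^ (CARD('n) + 2)" for x
  proof -
    have "norm (pot_rep x * \<psi> x) \<le> (C * wt x ^ 4) * (B * wt x ^ (CARD('n) - 2))"
      unfolding norm_mult using C_pos by (intro mult_mono pot_rep(3) B(2)) auto
    also have "\<dots> = (C * B) * (wt x ^ 4 * wt x ^ (CARD('n) - 2))" by simp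
    also have "wt x ^ 4 * wt x ^ (CARD('n) - 2) = wt x ^ (CARD('n) + 2)" by (simp only: power_add[symmetric] e)
    finally show ?thesis .
  qed
  then show "\<exists>B>0. \<forall>x. norm (pot_rep x * \<psi> x) \<le> B * wt x ^ (CARD('n) + 2)"
    using B(1) C_pos by (intro exI[of _ "C * B"]) auto
qed

section \<open>Weak derivatives, linear combinations and square integrability of threshold
  solutions\<close>

lemma threshold_solution_source_integrable:
  assumes "threshold_solution \<psi>"
  shows "integrable lborel (\<lambda>y. pot_rep y * \<psi> y)"
    and "integrable lborel (\<lambda>y. wt y ^ k * norm (pot_rep y * \<psi> y))"
    and "integrable lborel (\<lambda>y. newton_kernel (x - y) * (pot_rep y * \<psi> y))"
proof -
  obtain B where B: "B > 0" "\<And>x. norm (pot_rep x * \<psi> x) \<le> B * wt x ^ (CARD('n) + 2)"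
    using threshold_solution_props(3)[OF assms] by blast
  note [measurable] = threshold_solution_props(5)[OF assms]
  show i: "integrable lborel (\<lambda>y. pot_rep y * \<psi> y)" by (rule integrable_wt_bound[OF _ B(2)]) simp_all
  show "integrable lborel (\<lambda>y. wt y ^ k * norm (pot_rep y * \<psi> y))"
    by (rule Bochner_Integration.integrable_bound[OF integrable_norm[OF i]])
       (measurable, auto intro!: AE_I2 mult_left_le_one_le power_le_one)
  show "integrable lborel (\<lambda>y. newton_kernel (x - y) * (pot_rep y * \<psi> y))"
    using n3 by (intro pot_bound(1)[OF kernel_bound_newton_kernel[OF n3] _ AE_I2[OF B(2)], of 0]) auto
qed

lemma threshold_solution_laplacian:
  assumes ts: "threshold_solution \<psi>" and \<eta>: "test_function \<eta>"
  shows "(LINT x|lborel. \<psi> x * laplacian \<eta> x) = (LINT x|lborel. (pot_rep x * \<psi> x) * \<eta> x)"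
proof -
  let ?f = "\<lambda>y. pot_rep y * \<psi> y"
  have "complex_of_real (newton_const TYPE('n)) * (LINT x|lborel. \<psi> x * laplacian \<eta> x) = (LINT x|lborel. (complex_of_real (newton_const TYPE('n)) * \<psi> x) * laplacian \<eta> x)"
    by (simp add: mult.assoc)
  also have "\<dots> = - (LINT x|lborel. newton ?f x * laplacian \<eta> x)"
    unfolding threshold_solution_props(4)[OF ts] by simp
  also have "\<dots> = complex_of_real (newton_const TYPE('n)) * (LINT x|lborel. ?f x * \<eta> x)"
    using newton_distributional_laplacian[OF n3 threshold_solution_props(5)[OF ts] threshold_solution_source_integrable(2)[OF ts] \<eta>]
    by simp
  finally show ?thesis using newton_const_neq_0 by simp
qed

lemma threshold_solution_gradient:
  assumes ts: "threshold_solution \<psi>"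
  shows "\<exists>g. g \<in> borel_measurable borel \<and> (\<exists>B. \<forall>x. norm (g x) \<le> B * wt x ^ (CARD('n) - 1)) \<and>
    (\<forall>\<eta>. test_function \<eta> \<longrightarrow> (LINT x|lborel. \<psi> x * partial i \<eta> x) = - (LINT x|lborel. g x * \<eta> x))"
proof -
  let ?f = "\<lambda>y. pot_rep y * \<psi> y" let ?n = "CARD('n)"
  note [measurable] = threshold_solution_props(5)[OF ts]
  obtain B where B: "B > 0" "\<And>x. norm (?f x) \<le> B * wt x ^ (?n + 2)"
    using threshold_solution_props(3)[OF ts] by blast
  define g where "g x = - pot (newton_gradient i) ?f x / complex_of_real (newton_const TYPE('n))" for x
  have [measurable]: "g \<in> borel_measurable borel" unfolding g_def by measurable
  have "?n - 1 \<le> ?n - 1" "?n - 1 \<le> ?n + 2" "?n + (?n - 1) < (?n - 1) + (?n + 2)" by arith+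
  from pot_bound(2)[OF kernel_bound_newton_gradient[OF n3] _ AE_I2[OF B(2)] this]
  obtain D where D: "\<And>x. norm (pot (newton_gradient i) ?f x) \<le> D * wt x ^ (?n - 1)" by (auto simp del: One_nat_def)
  have gb: "norm (g x) \<le> (D / newton_const TYPE('n)) * wt x ^ (?n - 1)" for x
    using D[of x] newton_const_pos' by (simp add: g_def norm_divide norm_of_newton_const divide_right_mono)
  have "(LINT x|lborel. \<psi> x * partial i \<eta> x) = - (LINT x|lborel. g x * \<eta> x)" if \<eta>: "test_function \<eta>" for \<eta>
  proof -
    have "complex_of_real (newton_const TYPE('n)) * (LINT x|lborel. \<psi> x * partial i \<eta> x) = (LINT x|lborel. (complex_of_real (newton_const TYPE('n)) * \<psi> x) * partial i \<eta> x)"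
      by (simp add: mult.assoc)
    also have "\<dots> = - (LINT x|lborel. newton ?f x * partial i \<eta> x)"
      unfolding threshold_solution_props(4)[OF ts] by simp
    also have "\<dots> = (LINT x|lborel. pot (newton_gradient i) ?f x * \<eta> x)"
      using newton_weak_gradient[OF n3 threshold_solution_props(5)[OF ts] threshold_solution_source_integrable(2)[OF ts] \<eta>, of i]
      by simp
    also have "\<dots> = (LINT x|lborel. (- complex_of_real (newton_const TYPE('n))) * (g x * \<eta> x))" using newton_const_neq_0 by (simp add: g_def)
    also have "\<dots> = complex_of_real (newton_const TYPE('n)) * - (LINT x|lborel. g x * \<eta> x)" by simp
    finally show ?thesis using newton_const_neq_0 by (simp only: mult_cancel_left simp_thms)
  qed
  then show ?thesis using gb \<open>g \<in> borel_measurable borel\<close> by blast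
qed

lemma threshold_solution_hessian:
  assumes ts: "threshold_solution \<psi>"
  shows "\<exists>h. h \<in> borel_measurable borel \<and> integrable lborel (\<lambda>x. (norm (h x))\<^sup>2) \<and>
    (\<forall>\<eta>. test_function \<eta> \<longrightarrow> (LINT x|lborel. \<psi> x * partial i (partial j \<eta>) x) = (LINT x|lborel. h x * \<eta> x))"
proof -
  let ?f = "\<lambda>y. pot_rep y * \<psi> y"
  obtain B where B: "B > 0" "\<And>x. norm (?f x) \<le> B * wt x ^ (CARD('n) + 2)"
    using threshold_solution_props(3)[OF ts] by blast
  obtain H where H: "H \<in> borel_measurable borel" "integrable lborel (\<lambda>x. (norm (H x))\<^sup>2)"
    "\<And>\<eta>. test_function \<eta> \<Longrightarrow> (LINT x|lborel. newton ?f x * partial i (partial j \<eta>) x) = (LINT x|lborel. H x * \<eta> x)"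
    using newton_second_derivative_L2[OF n3 threshold_solution_props(5)[OF ts] B, of i j] by blast
  define h where "h x = - H x / complex_of_real (newton_const TYPE('n))" for x
  have "h \<in> borel_measurable borel" unfolding h_def using H(1) by measurable
  moreover have "integrable lborel (\<lambda>x. (norm (h x))\<^sup>2)"
    using H(2) by (simp add: h_def norm_divide power_divide)
  moreover have "(LINT x|lborel. \<psi> x * partial i (partial j \<eta>) x) = (LINT x|lborel. h x * \<eta> x)" if \<eta>: "test_function \<eta>" for \<eta>
  proof -
    have "complex_of_real (newton_const TYPE('n)) * (LINT x|lborel. \<psi> x * partial i (partial j \<eta>) x) = (LINT x|lborel. (complex_of_real (newton_const TYPE('n)) * \<psi> x) * partial i (partial j \<eta>) x)"
      by (simp add: mult.assoc)
    also have "\<dots> = - (LINT x|lborel. H x * \<eta> x)"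
      unfolding threshold_solution_props(4)[OF ts] using H(3)[OF \<eta>] by simp
    also have "\<dots> = (LINT x|lborel. complex_of_real (newton_const TYPE('n)) * (h x * \<eta> x))" using newton_const_neq_0 by (simp add: h_def)
    also have "\<dots> = complex_of_real (newton_const TYPE('n)) * (LINT x|lborel. h x * \<eta> x)" by simp
    finally show ?thesis using newton_const_neq_0 by (simp only: mult_cancel_left simp_thms)
  qed
  ultimately show ?thesis by blast
qed

lemma threshold_solution_linear:
  assumes "threshold_solution \<psi>" "threshold_solution \<phi>"
  shows "threshold_solution (\<lambda>x. a * \<psi> x - b * \<phi> x)"
  unfolding threshold_solution_def
proof (intro conjI allI)
  note [measurable] = threshold_solution_props(1)[OF assms(1)] threshold_solution_props(1)[OF assms(2)]
  show "(\<lambda>x. a * \<psi> x - b * \<phi> x) \<in> borel_measurable borel" by measurable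
  obtain A B where A: "A > 0" "\<And>x. norm (\<psi> x) \<le> A * wt x ^ (CARD('n) - 2)" and B: "B > 0" "\<And>x. norm (\<phi> x) \<le> B * wt x ^ (CARD('n) - 2)"
    using threshold_solution_props(2)[OF assms(1)] threshold_solution_props(2)[OF assms(2)] by metis
  have "norm (a * \<psi> x - b * \<phi> x) \<le> (norm a * A + norm b * B + 1) * wt x ^ (CARD('n) - 2)" for x
  proof -
    have "norm (a * \<psi> x - b * \<phi> x) \<le> norm a * norm (\<psi> x) + norm b * norm (\<phi> x)"
      using norm_triangle_ineq4[of "a * \<psi> x" "b * \<phi> x"] by (simp add: norm_mult)
    also have "\<dots> \<le> norm a * (A * wt x ^ (CARD('n) - 2)) + norm b * (B * wt x ^ (CARD('n) - 2))"
      by (intro add_mono mult_left_mono A B) auto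
    also have "\<dots> \<le> norm a * (A * wt x ^ (CARD('n) - 2)) + norm b * (B * wt x ^ (CARD('n) - 2)) + 1 * wt x ^ (CARD('n) - 2)" by simp
    finally show ?thesis by (simp only: distrib_right mult.assoc)
  qed
  moreover have "norm a * A + norm b * B + 1 > 0" using A B by (intro add_nonneg_pos add_nonneg_nonneg) auto
  ultimately show "\<exists>B>0. \<forall>x. norm (a * \<psi> x - b * \<phi> x) \<le> B * wt x ^ (CARD('n) - 2)" by blast
  fix x
  let ?I = "\<lambda>\<psi>. LINT y|lborel. newton_kernel (x - y) * (pot_rep y * \<psi> y)"
  have "newton (\<lambda>y. pot_rep y * (a * \<psi> y - b * \<phi> y)) x
      = (LINT y|lborel. a * (newton_kernel (x - y) * (pot_rep y * \<psi> y)) - b * (newton_kernel (x - y) * (pot_rep y * \<phi> y)))"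
    unfolding pot_def by (intro Bochner_Integration.integral_cong) (auto simp: algebra_simps)
  also have "\<dots> = a * ?I \<psi> - b * ?I \<phi>"
    using threshold_solution_source_integrable(3)[OF assms(1), of x] threshold_solution_source_integrable(3)[OF assms(2), of x]
    by simp
  finally have "newton (\<lambda>y. pot_rep y * (a * \<psi> y - b * \<phi> y)) x = a * newton (\<lambda>y. pot_rep y * \<psi> y) x - b * newton (\<lambda>y. pot_rep y * \<phi> y) x"
    by (simp add: pot_def)
  then show "complex_of_real (newton_const TYPE('n)) * (a * \<psi> x - b * \<phi> x) = - newton (\<lambda>y. pot_rep y * (a * \<psi> y - b * \<phi> y)) x"
    using threshold_solution_props(4)[OF assms(1), of x] threshold_solution_props(4)[OF assms(2), of x]
    by (simp add: algebra_simps)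
qed

lemma threshold_solution_mean_zero_decay:
  assumes ts: "threshold_solution \<psi>" and zero: "(LINT y|lborel. pot_rep y * \<psi> y) = 0"
  shows "\<exists>B. \<forall>x. norm (\<psi> x) \<le> B * wt x ^ (CARD('n) - 1)"
proof -
  obtain B where B: "B > 0" "\<And>x. norm (pot_rep x * \<psi> x) \<le> B * wt x ^ (CARD('n) + 2)"
    using threshold_solution_props(3)[OF ts] by blast
  obtain D where D: "\<And>x. norm (newton (\<lambda>y. pot_rep y * \<psi> y) x) \<le> D * wt x ^ (CARD('n) - 1)"
    using newton_decay_mean_zero[OF n3 threshold_solution_props(5)[OF ts] AE_I2[OF B(2)] _ zero] B(1) by auto
  have "norm (\<psi> x) \<le> (D / newton_const TYPE('n)) * wt x ^ (CARD('n) - 1)" for x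
  proof -
    have "norm (complex_of_real (newton_const TYPE('n)) * \<psi> x) \<le> D * wt x ^ (CARD('n) - 1)"
      unfolding threshold_solution_props(4)[OF ts] using D[of x] by simp
    then show ?thesis using newton_const_pos' by (simp add: norm_mult norm_of_newton_const field_simps)
  qed
  then show ?thesis by blast
qed

text \<open>Here the dimensions separate: the decay <x>^(2-n) is square integrable exactly when 2 (n
  - 2) > n, that is n >= 5, while the rate n - 1 obtained from mean zero suffices for all n >=
  3.\<close>

lemma threshold_solution_L2:
  assumes ts: "threshold_solution \<psi>" and "CARD('n) \<ge> 5 \<or> (LINT y|lborel. pot_rep y * \<psi> y) = 0"
  shows "integrable lborel (\<lambda>x. (norm (\<psi> x))\<^sup>2)"
proof -
  have "\<exists>B k. 2 * k > CARD('n) \<and> (\<forall>x. norm (\<psi> x) \<le> B * wt x ^ k)"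
  proof (cases "CARD('n) \<ge> 5")
    case True
    then have "2 * (CARD('n) - 2) > CARD('n)" by simp
    then show ?thesis using threshold_solution_props(2)[OF ts] by blast
  next
    case False
    have "2 * (CARD('n) - 1) > CARD('n)" using n3 by simp
    then show ?thesis using threshold_solution_mean_zero_decay[OF ts] assms(2) False by blast
  qed
  then obtain B k where k: "2 * k > CARD('n)" and B: "\<And>x. norm (\<psi> x) \<le> B * wt x ^ k" by blast
  note [measurable] = threshold_solution_props(1)[OF ts]
  show ?thesis
  proof (rule Bochner_Integration.integrable_bound)
    show "integrable lborel (\<lambda>x::real^'n. B\<^sup>2 * wt x ^ (2 * k))" by (intro integrable_mult_right wt_power_integrable k)
    show "AE x in lborel. norm ((norm (\<psi> x))\<^sup>2) \<le> norm (B\<^sup>2 * wt x ^ (2 * k))"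
    proof (intro AE_I2)
      fix x
      have "(norm (\<psi> x))\<^sup>2 \<le> (B * wt x ^ k)\<^sup>2" by (intro power_mono B) auto
      then show "norm ((norm (\<psi> x))\<^sup>2) \<le> norm (B\<^sup>2 * wt x ^ (2 * k))"
        by (simp add: power_mult_distrib mult.commute flip: power_mult)
    qed
  qed measurable
qed

end

context decaying_potential
begin

section \<open>Transfer to arbitrary functions that agree with a threshold solution almost
  everywhere\<close>

lemma threshold_solution_loc_int:
  assumes ts: "threshold_solution \<psi>0" and ae: "AE x in lborel. \<psi> x = \<psi>0 x"
  shows "locally_integrable \<psi>" "locally_integrable (\<lambda>x. v x * \<psi> x)" "locally_integrable (\<lambda>x. pot_rep x * \<psi>0 x)"
proof -
  obtain B where B: "\<And>x. norm (\<psi>0 x) \<le> B * wt x ^ (CARD('n) - 2)" using threshold_solution_props(2)[OF ts] by blast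
  obtain D where D: "\<And>x. norm (pot_rep x * \<psi>0 x) \<le> D * wt x ^ (CARD('n) + 2)" using threshold_solution_props(3)[OF ts] by blast
  show "locally_integrable \<psi>"
    by (rule locally_integrable_cong[OF threshold_solution_props(1)[OF ts] ae])
       (rule set_integrable_wt_bound[OF threshold_solution_props(1)[OF ts] B])
  have "AE x in lborel. v x * \<psi> x = pot_rep x * \<psi>0 x" using ae pot_rep(1) by eventually_elim simp
  then show "locally_integrable (\<lambda>x. v x * \<psi> x)"
    by (rule locally_integrable_cong[OF threshold_solution_props(5)[OF ts]])
       (rule set_integrable_wt_bound[OF threshold_solution_props(5)[OF ts] D])
  show "locally_integrable (\<lambda>x. pot_rep x * \<psi>0 x)"
    by (rule locally_integrable_cong[OF threshold_solution_props(5)[OF ts] AE_I2[OF refl]])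
       (rule set_integrable_wt_bound[OF threshold_solution_props(5)[OF ts] D])
qed

lemma threshold_solution_distributional:
  assumes ts: "threshold_solution \<psi>0" and ae: "AE x in lborel. \<psi> x = \<psi>0 x"
  shows "distributional_solution v \<psi>" and "weak_laplacian \<psi> (\<lambda>x. pot_rep x * \<psi>0 x)"
proof -
  have L: "(LINT x|lebesgue. \<psi> x * laplacian \<eta> x) = (LINT x|lborel. (pot_rep x * \<psi>0 x) * \<eta> x)" if "test_function \<eta>" for \<eta>
    using threshold_solution_laplacian[OF ts that]
      test_integral_cong[OF threshold_solution_props(1)[OF ts] smooth_borel[OF test_function_smooth[OF test_function_laplacian[OF that]]] ae]
    by simp
  have ae2: "AE x in lborel. v x * \<psi> x = pot_rep x * \<psi>0 x" using ae pot_rep(1) by eventually_elim simp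
  have R: "(LINT x|lebesgue. v x * \<psi> x * \<eta> x) = (LINT x|lborel. (pot_rep x * \<psi>0 x) * \<eta> x)"
    "(LINT x|lebesgue. pot_rep x * \<psi>0 x * \<eta> x) = (LINT x|lborel. (pot_rep x * \<psi>0 x) * \<eta> x)" if "test_function \<eta>" for \<eta>
    using test_integral_cong[OF threshold_solution_props(5)[OF ts] smooth_borel[OF test_function_smooth[OF that]] ae2]
      test_integral_cong[OF threshold_solution_props(5)[OF ts] smooth_borel[OF test_function_smooth[OF that]] AE_I2[OF refl]]
    by simp_all
  show "distributional_solution v \<psi>"
    unfolding distributional_solution_def using threshold_solution_loc_int[OF assms] L R by simp
  show "weak_laplacian \<psi> (\<lambda>x. pot_rep x * \<psi>0 x)"
    unfolding weak_laplacian_def using threshold_solution_loc_int[OF assms] L R by simp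
qed

lemma threshold_solution_L_space:
  assumes ts: "threshold_solution \<psi>0" and ae: "AE x in lborel. \<psi> x = \<psi>0 x"
    and q: "q = \<infinity> \<or> (\<exists>r. q = ereal r \<and> r > 0 \<and> real (CARD('n) - 2) * r > real CARD('n))"
  shows "\<psi> \<in> L_space q"
  using threshold_solution_props(2)[OF ts] L_space_if_wt_bound[OF threshold_solution_props(1)[OF ts] ae _ q] by blast

lemma threshold_solution_laplacian_in_L:
  assumes ts: "threshold_solution \<psi>0" and ae: "AE x in lborel. \<psi> x = \<psi>0 x"
    and q: "q = \<infinity> \<or> (\<exists>r. q = ereal r \<and> r > 0 \<and> real (CARD('n) + 2) * r > real CARD('n))"
  shows "laplacian_in_L q \<psi>"
proof -
  have "(\<lambda>x. pot_rep x * \<psi>0 x) \<in> L_space q"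
    using threshold_solution_props(3)[OF ts] L_space_if_wt_bound[OF threshold_solution_props(5)[OF ts] AE_I2[OF refl] _ q] by blast
  then show ?thesis unfolding laplacian_in_L_def using threshold_solution_distributional(2)[OF ts ae] by blast
qed

lemma threshold_solution_gradient_in_L:
  assumes ts: "threshold_solution \<psi>0" and ae: "AE x in lborel. \<psi> x = \<psi>0 x"
    and q: "q = \<infinity> \<or> (\<exists>r. q = ereal r \<and> r > 0 \<and> real (CARD('n) - 1) * r > real CARD('n))"
  shows "gradient_in_L q \<psi>"
  unfolding gradient_in_L_def
proof
  fix i
  obtain g B where g: "g \<in> borel_measurable borel" "\<And>x. norm (g x) \<le> B * wt x ^ (CARD('n) - 1)"
    "\<And>\<eta>. test_function \<eta> \<Longrightarrow> (LINT x|lborel. \<psi>0 x * partial i \<eta> x) = - (LINT x|lborel. g x * \<eta> x)"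
    using threshold_solution_gradient[OF ts, of i] by blast
  have "locally_integrable g"
    by (rule locally_integrable_cong[OF g(1) AE_I2[OF refl] set_integrable_wt_bound[OF g(1,2)]])
  moreover have "(LINT x|lebesgue. \<psi> x * partial i \<eta> x) = - (LINT x|lebesgue. g x * \<eta> x)" if t: "test_function \<eta>" for \<eta>
    using test_integral_cong[OF threshold_solution_props(1)[OF ts] smooth_borel[OF smooth_partial[OF test_function_smooth[OF t]]] ae]
      test_integral_cong[OF g(1) smooth_borel[OF test_function_smooth[OF t]] AE_I2[OF refl]] g(3)[OF t]
    by simp
  ultimately have "weak_derivative [i] \<psi> g"
    unfolding weak_derivative_def using threshold_solution_loc_int(1)[OF ts ae] by simp
  moreover have "g \<in> L_space q" by (rule L_space_if_wt_bound[OF g(1) AE_I2[OF refl] g(2) q])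
  ultimately show "\<exists>g\<in>L_space q. weak_derivative [i] \<psi> g" by blast
qed

lemma threshold_solution_gradient_in_L2:
  assumes ts: "threshold_solution \<psi>0" and ae: "AE x in lborel. \<psi> x = \<psi>0 x"
  shows "gradient_in_L 2 \<psi>"
proof (rule threshold_solution_gradient_in_L[OF ts ae])
  have "real (CARD('n) - 1) * 2 > real CARD('n)" using n3 by (simp add: of_nat_diff)
  then show "2 = \<infinity> \<or> (\<exists>r. 2 = ereal r \<and> r > 0 \<and> real (CARD('n) - 1) * r > real CARD('n))"
    by (intro disjI2 exI[of _ 2]) simp
qed

text \<open>Order zero is the assumption, order one follows from the decay <x>^(1-n) of the
  gradient, as 2 (n - 1) > n, and order two is the energy estimate.\<close>

lemma threshold_solution_in_domain:
  assumes ts: "threshold_solution \<psi>0" and ae: "AE x in lborel. \<psi> x = \<psi>0 x" and L2: "\<psi> \<in> L_space 2"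
  shows "\<psi> \<in> schroedinger_domain"
proof -
  have "\<exists>g\<in>L_space 2. weak_derivative is \<psi> g" if len: "length is \<le> 2" for "is"
  proof -
    consider "is = []" | i where "is = [i]" | i j where "is = [i, j]"
      using len by (auto simp: numeral_2_eq_2 le_Suc_eq length_Suc_conv)
    then show ?thesis
    proof cases
      case 1
      have "weak_derivative [] \<psi> \<psi>"
        unfolding weak_derivative_def using threshold_solution_loc_int(1)[OF ts ae] by simp
      then show ?thesis using 1 L2 by blast
    next
      case 2
      then show ?thesis using threshold_solution_gradient_in_L2[OF ts ae] unfolding gradient_in_L_def by blast
    next
      case 3
      obtain h where h [measurable]: "h \<in> borel_measurable borel" and h2: "integrable lborel (\<lambda>x. (norm (h x))\<^sup>2)"
        and hw: "\<And>\<eta>. test_function \<eta> \<Longrightarrow> (LINT x|lborel. \<psi>0 x * partial i (partial j \<eta>) x) = (LINT x|lborel. h x * \<eta> x)"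
        using threshold_solution_hessian[OF ts, of i j] by blast
      have "locally_integrable h"
      proof (rule locally_integrable_cong[OF h AE_I2[OF refl]])
        fix K :: "(real ^ 'n) set" assume K: "compact K"
        then have [measurable]: "K \<in> sets borel" by (simp add: borel_compact)
        show "set_integrable lborel K h" unfolding set_integrable_def
        proof (rule Bochner_Integration.integrable_bound)
          have "integrable lborel (indicator K :: real ^ 'n \<Rightarrow> real)"
            using emeasure_bounded_finite[OF compact_imp_bounded[OF K]] by (intro integrable_real_indicator) auto
          then show "integrable lborel (\<lambda>x. indicator K x + (norm (h x))\<^sup>2)" using h2 by simp
          have "norm (h x) \<le> 1 + (norm (h x))\<^sup>2" for x
          proof -
            have "2 * norm (h x) \<le> 1 + (norm (h x))\<^sup>2" using sum_squares_bound[of 1 "norm (h x)"] by simp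
            then show ?thesis using norm_ge_zero[of "h x"] by linarith
          qed
          then show "AE x in lborel. norm (indicator K x *\<^sub>R h x) \<le> norm (indicator K x + (norm (h x))\<^sup>2)"
            by (intro AE_I2) (auto split: split_indicator)
        qed measurable
      qed
      moreover have "(LINT x|lebesgue. \<psi> x * partial i (partial j \<eta>) x) = (LINT x|lebesgue. h x * \<eta> x)" if t: "test_function \<eta>" for \<eta>
        using test_integral_cong[OF threshold_solution_props(1)[OF ts] smooth_borel[OF smooth_partial[OF smooth_partial[OF test_function_smooth[OF t]]]] ae]
          test_integral_cong[OF h smooth_borel[OF test_function_smooth[OF t]] AE_I2[OF refl]] hw[OF t]
        by simp
      ultimately have "weak_derivative [i, j] \<psi> h"
        unfolding weak_derivative_def using threshold_solution_loc_int(1)[OF ts ae] by simp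
      moreover have "h \<in> L_space 2" using L_space_2_iff[OF h AE_I2[OF refl]] h2 by simp
      ultimately show ?thesis using 3 by blast
    qed
  qed
  then show ?thesis using L2 by (simp add: schroedinger_domain_def sobolev_space_def)
qed

text \<open>The distributional equation becomes the integral equation by
  \<open>L2_solution_eq_newton\<close>, and boundedness of the potential puts |v|^(1/2) \<psi> in
  L^2.\<close>

lemma eigenfunction_threshold_solution:
  assumes "\<psi> \<in> L_space 2" and ds: "distributional_solution v \<psi>"
  shows "\<exists>\<psi>0. threshold_solution \<psi>0 \<and> (AE x in lborel. \<psi> x = \<psi>0 x)"
proof -
  have "\<psi> \<in> borel_measurable lebesgue" using assms(1) by (simp add: L_space_def)
  then obtain \<psi>1 where m [measurable]: "\<psi>1 \<in> borel_measurable borel" and ae: "AE x in lborel. \<psi> x = \<psi>1 x"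
    by (rule borel_representative)
  have L2: "integrable lborel (\<lambda>x. (norm (\<psi>1 x))\<^sup>2)" using assms(1) L_space_2_iff[OF m ae] by simp
  let ?f = "\<lambda>x. pot_rep x * \<psi>1 x"
  have fm: "?f \<in> borel_measurable borel" by measurable
  have aef: "AE x in lborel. v x * \<psi> x = ?f x" using ae pot_rep(1) by eventually_elim simp
  have "AE x in lborel. complex_of_real (newton_const TYPE('n)) * \<psi>1 x = - newton ?f x"
  proof (rule L2_solution_eq_newton[OF n3 m fm L2])
    show "norm (?f x) \<le> C * wt x ^ 4 * norm (\<psi>1 x)" for x
      unfolding norm_mult by (intro mult_right_mono pot_rep(3)) auto
    show "(LINT x|lborel. \<psi>1 x * laplacian \<eta> x) = (LINT x|lborel. ?f x * \<eta> x)" if t: "test_function \<eta>" for \<eta>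
      using test_integral_cong[OF m smooth_borel[OF test_function_smooth[OF test_function_laplacian[OF t]]] ae]
        test_integral_cong[OF fm smooth_borel[OF test_function_smooth[OF t]] aef]
        ds t unfolding distributional_solution_def by simp
  qed
  moreover have "integrable lborel (\<lambda>x. norm (pot_rep x) * (norm (\<psi>1 x))\<^sup>2)"
  proof (rule Bochner_Integration.integrable_bound)
    show "integrable lborel (\<lambda>x. C * (norm (\<psi>1 x))\<^sup>2)" using L2 by simp
    have "norm (pot_rep x) \<le> C * 1" for x
      using C_pos by (intro order_trans[OF pot_rep(3)] mult_left_mono power_le_one) auto
    then show "AE x in lborel. norm (norm (pot_rep x) * (norm (\<psi>1 x))\<^sup>2) \<le> norm (C * (norm (\<psi>1 x))\<^sup>2)"
      using C_pos by (intro AE_I2) (auto intro!: mult_right_mono)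
  qed measurable
  ultimately obtain \<psi>0 where "threshold_solution \<psi>0" and "AE x in lborel. \<psi>1 x = \<psi>0 x"
    using threshold_solution_exists[OF m] by blast
  moreover have "AE x in lborel. \<psi> x = \<psi>0 x" using ae calculation(2) by eventually_elim simp
  ultimately show ?thesis by blast
qed

section \<open>The factorization of the potential and the Birman-Schwinger correspondence\<close>

lemma factor1_mult_factor2:
  assumes "v x \<in> \<real>" shows "factor1 v x * factor2 v x = v x"
proof -
  obtain r where r: "v x = complex_of_real r" using assms by (auto elim: Reals_cases)
  have "factor1 v x * factor2 v x = sgn_pot v x * complex_of_real (sqrt \<bar>r\<bar> * sqrt \<bar>r\<bar>)"
    by (simp only: factor1_def factor2_def r norm_of_real of_real_mult mult_ac)
  also have "sqrt \<bar>r\<bar> * sqrt \<bar>r\<bar> = \<bar>r\<bar>" by simp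
  finally show ?thesis
    by (cases "r \<ge> 0") (simp_all add: sgn_pot_def r complex_nonneg_Reals_iff)
qed

lemma norm_factor: "norm (factor1 v x) = sqrt (norm (v x))" "norm (factor2 v x) = sqrt (norm (v x))"
  by (simp_all add: factor1_def factor2_def sgn_pot_def norm_mult)

end

lemma borel_measurable_factor:
  fixes w :: "real ^ 'n \<Rightarrow> complex"
  assumes [measurable]: "w \<in> borel_measurable borel"
  shows "factor1 w \<in> borel_measurable borel" "factor2 w \<in> borel_measurable borel"
proof -
  have [measurable]: "\<real>\<^sub>\<ge>\<^sub>0 \<in> sets (borel :: complex measure)" by (intro borel_closed closed_nonneg_Reals_complex)
  show "factor1 w \<in> borel_measurable borel" unfolding factor1_def[abs_def] by measurable
  show "factor2 w \<in> borel_measurable borel" unfolding factor2_def[abs_def] sgn_pot_def[abs_def] by measurable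
qed

context decaying_potential
begin

lemma factor_cong: "v x = pot_rep x \<Longrightarrow> factor1 v x = factor1 pot_rep x \<and> factor2 v x = factor2 pot_rep x"
  by (simp add: factor1_def factor2_def sgn_pot_def)

lemma v_real_lborel: "AE x in lborel. v x \<in> \<real>"
  using v_real by (simp add: AE_completion_iff)

text \<open>Birman-Schwinger: for \<psi>1 = - G (v1 \<phi>) the kernel equation reads \<phi> = v2
  \<psi>1, whence v1 \<phi> = v \<psi>1 and \<psi>1 = - G (v \<psi>1). Moreover |\<phi>| = |v|^(1/2)
  |\<psi>1|, so \<phi> in L^2 is just the integrability that
  \<open>threshold_solution_exists\<close> asks for.\<close>

lemma ker_threshold_solution:
  assumes \<phi>: "\<phi> \<in> ker_sandwiched v"
  shows "\<exists>\<psi>0. threshold_solution \<psi>0 \<and> (AE x in lborel. - zero_resolvent (\<lambda>y. factor1 v y * \<phi> y) x = \<psi>0 x) \<and>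
    (AE x in lborel. \<phi> x = factor2 v x * \<psi>0 x)"
proof -
  have "\<phi> \<in> borel_measurable lebesgue" using \<phi> by (simp add: ker_sandwiched_def L_space_def)
  then obtain \<phi>1 where m [measurable]: "\<phi>1 \<in> borel_measurable borel" and ae: "AE x in lborel. \<phi> x = \<phi>1 x"
    by (rule borel_representative)
  note [measurable] = borel_measurable_factor[OF pot_rep_measurable]
  let ?k = "complex_of_real (newton_const TYPE('n))"
  define g where "g y = factor1 pot_rep y * \<phi>1 y" for y
  have gm [measurable]: "g \<in> borel_measurable borel" unfolding g_def by measurable
  define \<psi>1 where "\<psi>1 x = - newton g x / ?k" for x
  have m1 [measurable]: "\<psi>1 \<in> borel_measurable borel" unfolding \<psi>1_def by measurable
  have aeg: "AE y in lborel. factor1 v y * \<phi> y = g y"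
    using ae pot_rep(1) by eventually_elim (simp add: g_def factor_cong)
  have zr: "zero_resolvent (\<lambda>y. factor1 v y * \<phi> y) x = - \<psi>1 x" for x
    using zero_resolvent_eq[OF n3 gm aeg] by (simp add: \<psi>1_def)
  have "AE x in lborel. \<phi> x + sandwiched_resolvent v \<phi> x = 0"
    using \<phi> by (simp add: ker_sandwiched_def AE_completion_iff)
  then have ae2: "AE x in lborel. \<phi> x = factor2 v x * \<psi>1 x"
    by eventually_elim (simp add: sandwiched_resolvent_def zr)
  have ae3: "AE x in lborel. g x = pot_rep x * \<psi>1 x"
    using ae ae2 pot_rep(1) v_real_lborel
  proof eventually_elim
    case (elim x)
    then have "g x = (factor1 v x * factor2 v x) * \<psi>1 x" using factor_cong[of x] by (simp add: g_def)
    then show ?case using elim factor1_mult_factor2 by simp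
  qed
  have "integrable lborel (\<lambda>x. (norm (\<phi>1 x))\<^sup>2)"
    using \<phi> L_space_2_iff[OF m ae] by (simp add: ker_sandwiched_def)
  then have "integrable lborel (\<lambda>x. norm (pot_rep x) * (norm (\<psi>1 x))\<^sup>2)"
  proof (rule Bochner_Integration.integrable_bound)
    show "AE x in lborel. norm (norm (pot_rep x) * (norm (\<psi>1 x))\<^sup>2) \<le> norm ((norm (\<phi>1 x))\<^sup>2)"
      using ae ae2 pot_rep(1)
    proof eventually_elim
      case (elim x)
      then have "(norm (\<phi>1 x))\<^sup>2 = norm (pot_rep x) * (norm (\<psi>1 x))\<^sup>2"
        by (metis norm_factor(2) norm_mult norm_ge_zero power_mult_distrib real_sqrt_pow2)
      then show ?case by simp
    qed
  qed measurable
  moreover have "AE x in lborel. ?k * \<psi>1 x = - newton (\<lambda>y. pot_rep y * \<psi>1 y) x"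
  proof (intro AE_I2)
    fix x
    have "newton g x = newton (\<lambda>y. pot_rep y * \<psi>1 y) x"
      unfolding pot_def by (rule integral_cong_AE) (measurable, use ae3 in eventually_elim, simp)
    then show "?k * \<psi>1 x = - newton (\<lambda>y. pot_rep y * \<psi>1 y) x" using newton_const_neq_0 by (simp add: \<psi>1_def)
  qed
  ultimately obtain \<psi>0 where ts: "threshold_solution \<psi>0" and e: "AE x in lborel. \<psi>1 x = \<psi>0 x"
    using threshold_solution_exists[OF m1] by blast
  have "AE x in lborel. - zero_resolvent (\<lambda>y. factor1 v y * \<phi> y) x = \<psi>0 x" using e by (simp add: zr)
  moreover have "AE x in lborel. \<phi> x = factor2 v x * \<psi>0 x" using e ae2 by eventually_elim simp
  ultimately show ?thesis using ts by blast
qed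

text \<open>The converse with \<phi> = v2 \<psi>, based on v1 v2 = v almost everywhere. \<phi> is
  O(<x>^(-2-(n-2))) = O(<x>^(-n)), hence in L^2 even when \<psi> is not. If \<phi> vanishes almost
  everywhere, so does the source v \<psi>, and the integral equation makes \<psi> zero at every
  point.\<close>

lemma threshold_solution_ker:
  assumes ts: "threshold_solution \<psi>"
  shows "(\<lambda>x. factor2 v x * \<psi> x) \<in> ker_sandwiched v"
    and "\<psi> x = - zero_resolvent (\<lambda>y. factor1 v y * (factor2 v y * \<psi> y)) x"
    and "(\<lambda>x. factor2 v x * \<psi> x) \<in> L2_zero \<Longrightarrow> \<psi> x = 0"
proof -
  note [measurable] = borel_measurable_factor[OF pot_rep_measurable] threshold_solution_props(1)[OF ts]
  let ?k = "complex_of_real (newton_const TYPE('n))"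
  let ?f = "\<lambda>y. pot_rep y * \<psi> y"
  have aef: "AE y in lborel. factor1 v y * (factor2 v y * \<psi> y) = ?f y"
    using pot_rep(1) v_real_lborel
  proof eventually_elim
    case (elim y)
    have "factor1 v y * (factor2 v y * \<psi> y) = (factor1 v y * factor2 v y) * \<psi> y" by simp
    then show ?case using elim factor1_mult_factor2 by simp
  qed
  show zr: "\<psi> x = - zero_resolvent (\<lambda>y. factor1 v y * (factor2 v y * \<psi> y)) x" for x
  proof -
    have "newton ?f x = - (?k * \<psi> x)" using threshold_solution_props(4)[OF ts, of x] by simp
    then show ?thesis
      unfolding zero_resolvent_eq[OF n3 threshold_solution_props(5)[OF ts] aef] using newton_const_neq_0 by simp
  qed
  have ae: "AE x in lborel. factor2 v x * \<psi> x = factor2 pot_rep x * \<psi> x"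
    using pot_rep(1) by eventually_elim (simp add: factor_cong)
  have fm: "(\<lambda>x. factor2 pot_rep x * \<psi> x) \<in> borel_measurable borel" by measurable
  obtain B where B: "B > 0" "\<And>x. norm (\<psi> x) \<le> B * wt x ^ (CARD('n) - 2)" using threshold_solution_props(2)[OF ts] by blast
  have b: "norm (factor2 pot_rep x * \<psi> x) \<le> (sqrt C * B) * wt x ^ CARD('n)" for x
  proof -
    have "norm (factor2 pot_rep x) = sqrt (norm (pot_rep x))" by (simp add: factor2_def sgn_pot_def norm_mult)
    also have "\<dots> \<le> sqrt (C * wt x ^ 4)" by (intro real_sqrt_le_mono pot_rep(3))
    also have "\<dots> = sqrt C * sqrt (wt x ^ 4)" by (rule real_sqrt_mult)
    also have "sqrt (wt x ^ 4) = wt x ^ 2" by (rule real_sqrt_unique) (simp_all flip: power_mult)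
    finally have "norm (factor2 pot_rep x * \<psi> x) \<le> (sqrt C * wt x ^ 2) * (B * wt x ^ (CARD('n) - 2))"
      unfolding norm_mult using C_pos by (intro mult_mono B(2)) auto
    also have "\<dots> = (sqrt C * B) * (wt x ^ 2 * wt x ^ (CARD('n) - 2))" by simp
    also have "wt x ^ 2 * wt x ^ (CARD('n) - 2) = wt x ^ CARD('n)"
    proof -
      have "2 + (CARD('n) - 2) = CARD('n)" using n3 by simp
      then show ?thesis by (simp only: power_add[symmetric])
    qed
    finally show ?thesis .
  qed
  have "(\<lambda>x. factor2 v x * \<psi> x) \<in> L_space 2"
    by (rule L_space_if_wt_bound[OF fm ae b]) (intro disjI2 exI[of _ 2], simp)
  moreover have "AE x in lebesgue. factor2 v x * \<psi> x + sandwiched_resolvent v (\<lambda>x. factor2 v x * \<psi> x) x = 0"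
  proof (intro AE_I2)
    fix x
    have "zero_resolvent (\<lambda>y. factor1 v y * (factor2 v y * \<psi> y)) x = - \<psi> x" using zr[of x] by simp
    then show "factor2 v x * \<psi> x + sandwiched_resolvent v (\<lambda>x. factor2 v x * \<psi> x) x = 0"
      by (simp add: sandwiched_resolvent_def)
  qed
  ultimately show "(\<lambda>x. factor2 v x * \<psi> x) \<in> ker_sandwiched v" by (simp add: ker_sandwiched_def)
  assume "(\<lambda>x. factor2 v x * \<psi> x) \<in> L2_zero"
  then have "AE x in lborel. factor2 v x * \<psi> x = 0" by (simp add: L2_zero_def AE_completion_iff)
  then have z: "AE x in lborel. ?f x = 0" using aef by eventually_elim auto
  have "newton ?f x = (LINT y|(lborel :: (real ^ 'n) measure). 0)"
    unfolding pot_def by (rule integral_cong_AE) (measurable, use z in eventually_elim, simp)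
  then show "\<psi> x = 0" using threshold_solution_props(4)[OF ts, of x] newton_const_neq_0 by simp
qed

lemma L2_zero_subset_ker: "L2_zero \<subseteq> ker_sandwiched v"
proof
  fix \<phi> :: "real ^ 'n \<Rightarrow> complex" assume \<phi>: "\<phi> \<in> L2_zero"
  then have z: "AE x in lborel. \<phi> x = 0" by (simp add: L2_zero_def AE_completion_iff)
  have "zero_resolvent (\<lambda>y. factor1 v y * \<phi> y) x = newton (\<lambda>y. 0) x / complex_of_real (newton_const TYPE('n))" for x
    by (rule zero_resolvent_eq[OF n3]) (use z in \<open>auto elim: eventually_mono\<close>)
  then have "sandwiched_resolvent v \<phi> x = 0" for x by (simp add: sandwiched_resolvent_def pot_def)
  then show "\<phi> \<in> ker_sandwiched v" using \<phi> by (simp add: L2_zero_def ker_sandwiched_def)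
qed

text \<open>Reduces membership in the operator domain to membership in L^2, since threshold
  solutions in L^2 automatically have square integrable weak derivatives up to order two.\<close>

lemma zero_eigenfunction_iff:
  "zero_eigenfunction v \<psi> \<longleftrightarrow> \<psi> \<in> L_space 2 \<and> \<not> (AE x in lborel. \<psi> x = 0) \<and>
    (\<exists>\<psi>0. threshold_solution \<psi>0 \<and> (AE x in lborel. \<psi> x = \<psi>0 x))"
proof
  assume "zero_eigenfunction v \<psi>"
  then show "\<psi> \<in> L_space 2 \<and> \<not> (AE x in lborel. \<psi> x = 0) \<and> (\<exists>\<psi>0. threshold_solution \<psi>0 \<and> (AE x in lborel. \<psi> x = \<psi>0 x))"
    using eigenfunction_threshold_solution[of \<psi>]
    by (auto simp: zero_eigenfunction_def schroedinger_domain_def sobolev_space_def AE_completion_iff)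
next
  assume "\<psi> \<in> L_space 2 \<and> \<not> (AE x in lborel. \<psi> x = 0) \<and> (\<exists>\<psi>0. threshold_solution \<psi>0 \<and> (AE x in lborel. \<psi> x = \<psi>0 x))"
  then show "zero_eigenfunction v \<psi>"
    using threshold_solution_in_domain[of _ \<psi>] threshold_solution_distributional(1)[of _ \<psi>]
    by (auto simp: zero_eigenfunction_def AE_completion_iff)
qed

lemma resonance_function_threshold_solution:
  assumes "resonance_function v \<psi>"
  shows "\<exists>\<psi>0. threshold_solution \<psi>0 \<and> (AE x in lborel. \<psi> x = \<psi>0 x)"
proof -
  obtain \<phi> where "\<phi> \<in> ker_sandwiched v" and ae: "AE x in lborel. \<psi> x = - zero_resolvent (\<lambda>y. factor1 v y * \<phi> y) x"
    using assms by (auto simp: resonance_function_def AE_completion_iff)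
  then obtain \<psi>0 where "threshold_solution \<psi>0" and "AE x in lborel. - zero_resolvent (\<lambda>y. factor1 v y * \<phi> y) x = \<psi>0 x"
    using ker_threshold_solution by blast
  moreover have "AE x in lborel. \<psi> x = \<psi>0 x" using ae calculation(2) by eventually_elim simp
  ultimately show ?thesis by blast
qed

text \<open>The required \<phi> is v2 \<psi>; it is not a representative of zero, because otherwise
  \<psi> would vanish identically and lie in L^2.\<close>

lemma resonance_if_not_L2:
  assumes ts: "threshold_solution \<psi>" and "\<psi> \<notin> L_space 2"
  shows "resonance_function v \<psi>" and "zero_resonance v"
proof -
  have "(\<lambda>x. factor2 v x * \<psi> x) \<notin> L2_zero"
  proof
    assume "(\<lambda>x. factor2 v x * \<psi> x) \<in> L2_zero"
    then have "\<psi> = (\<lambda>x. 0)" using threshold_solution_ker(3)[OF ts] by blast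
    then have "\<psi> \<in> L_space 2" by (simp add: L_space_def)
    with assms(2) show False by simp
  qed
  then have k: "(\<lambda>x. factor2 v x * \<psi> x) \<in> ker_sandwiched v - L2_zero" using threshold_solution_ker(1)[OF ts] by blast
  then show r: "resonance_function v \<psi>"
    unfolding resonance_function_def
  proof (intro conjI bexI[OF _ k] AE_I2)
    show "\<psi> x = - zero_resolvent (\<lambda>y. factor1 v y * (factor2 v y * \<psi> y)) x" for x
      by (rule threshold_solution_ker(2)[OF ts])
    show "distributional_solution v \<psi>" by (rule threshold_solution_distributional(1)[OF ts AE_I2[OF refl]])
  qed (rule assms(2))
  show "zero_resonance v" unfolding zero_resonance_def using r k L2_zero_subset_ker by blast
qed

text \<open>Every kernel element comes from a threshold solution. If the solution is not in L^2 it
  is a resonance function; if it is in L^2 it is an eigenfunction or zero, and zero forces the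
  kernel element to vanish. Conversely an eigenfunction yields a nonzero kernel element.\<close>

lemma zero_regular_iff: "zero_regular v \<longleftrightarrow> ker_sandwiched v = L2_zero"
proof
  assume reg: "zero_regular v"
  have "\<phi> \<in> L2_zero" if \<phi>: "\<phi> \<in> ker_sandwiched v" for \<phi>
  proof -
    obtain \<psi> where ts: "threshold_solution \<psi>" and ae: "AE x in lborel. \<phi> x = factor2 v x * \<psi> x"
      using ker_threshold_solution[OF \<phi>] by blast
    have "\<psi> \<in> L_space 2" using resonance_if_not_L2(2)[OF ts] reg by (auto simp: zero_regular_def)
    then have "AE x in lborel. \<psi> x = 0"
      using ts reg zero_eigenfunction_iff[of \<psi>] by (auto simp: zero_regular_def zero_eigenvalue_def)
    then have "AE x in lborel. \<phi> x = 0" using ae by eventually_elim simp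
    then show ?thesis using \<phi> by (simp add: L2_zero_def ker_sandwiched_def AE_completion_iff)
  qed
  then show "ker_sandwiched v = L2_zero" using L2_zero_subset_ker by blast
next
  assume k: "ker_sandwiched v = L2_zero"
  have "\<not> zero_eigenfunction v \<psi>" for \<psi>
  proof
    assume "zero_eigenfunction v \<psi>"
    then obtain \<psi>0 where ts: "threshold_solution \<psi>0" and ae: "AE x in lborel. \<psi> x = \<psi>0 x" and nz: "\<not> (AE x in lborel. \<psi> x = 0)"
      unfolding zero_eigenfunction_iff by blast
    have "\<psi>0 x = 0" for x using threshold_solution_ker(1,3)[OF ts] k by blast
    then show False using ae nz by simp
  qed
  then show "zero_regular v" using k by (auto simp: zero_regular_def zero_eigenvalue_def zero_resonance_def)
qed

lemma no_resonance:
  assumes "CARD('n) \<ge> 5" shows "\<not> zero_resonance v"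
proof
  assume "zero_resonance v"
  then obtain \<psi> where r: "resonance_function v \<psi>" by (auto simp: zero_resonance_def)
  then obtain \<psi>0 where ts: "threshold_solution \<psi>0" and ae: "AE x in lborel. \<psi> x = \<psi>0 x"
    using resonance_function_threshold_solution by blast
  then have "\<psi> \<in> L_space 2"
    using threshold_solution_L2[OF ts] assms L_space_2_iff[OF threshold_solution_props(1)[OF ts] ae] by blast
  with r show False by (simp add: resonance_function_def)
qed

text \<open>The combination of two threshold solutions with \<open>\<integral> v \<psi> = 0\<close> loses the leading term
  \<open>\<bar>x\<bar>\<^bsup>2-n\<^esup>\<close> of its expansion at infinity and is therefore square integrable.\<close>

lemma resonance_simple:
  assumes ev: "\<not> zero_eigenvalue v" and r: "resonance_function v \<psi>" "resonance_function v \<psi>'"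
  shows "\<exists>c. AE x in lebesgue. \<psi>' x = c * \<psi> x"
proof -
  obtain \<psi>0 where ts: "threshold_solution \<psi>0" and ae: "AE x in lborel. \<psi> x = \<psi>0 x"
    using resonance_function_threshold_solution[OF r(1)] by blast
  obtain \<psi>1 where ts': "threshold_solution \<psi>1" and ae': "AE x in lborel. \<psi>' x = \<psi>1 x"
    using resonance_function_threshold_solution[OF r(2)] by blast
  define m where "m = (LINT y|lborel. pot_rep y * \<psi>0 y)"
  define m' where "m' = (LINT y|lborel. pot_rep y * \<psi>1 y)"
  \<comment> \<open>Otherwise the leading term at infinity of this solution would vanish already and
    it would be in L^2, contrary to being a resonance function.\<close>
  have m0: "m \<noteq> 0"
  proof
    assume "m = 0"
    then have "\<psi> \<in> L_space 2"
      using threshold_solution_L2[OF ts] L_space_2_iff[OF threshold_solution_props(1)[OF ts] ae] by (simp add: m_def)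
    with r(1) show False by (simp add: resonance_function_def)
  qed
  \<comment> \<open>The crosswise coefficients give mean m m' - m' m = 0, so \<theta> is in L^2. As
    0 is not an eigenvalue, \<theta> is zero almost everywhere, and m \<noteq> 0 permits solving for
    \<psi>'.\<close>
  define \<theta> where "\<theta> x = m * \<psi>1 x - m' * \<psi>0 x" for x
  have tc: "threshold_solution \<theta>" unfolding \<theta>_def by (rule threshold_solution_linear[OF ts' ts])
  have "(LINT y|lborel. pot_rep y * \<theta> y) = (LINT y|lborel. m * (pot_rep y * \<psi>1 y) - m' * (pot_rep y * \<psi>0 y))"
    by (intro Bochner_Integration.integral_cong) (auto simp: \<theta>_def algebra_simps)
  also have "\<dots> = m * m' - m' * m"
    using threshold_solution_source_integrable(1)[OF ts] threshold_solution_source_integrable(1)[OF ts']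
    by (simp add: m_def m'_def)
  finally have "\<theta> \<in> L_space 2"
    using threshold_solution_L2[OF tc] L_space_2_iff[OF threshold_solution_props(1)[OF tc] AE_I2[OF refl]] by simp
  then have "AE x in lborel. \<theta> x = 0"
    using ev tc zero_eigenfunction_iff[of \<theta>] by (auto simp: zero_eigenvalue_def)
  then have "AE x in lborel. \<psi>' x = (m' / m) * \<psi> x"
    using ae ae' by eventually_elim (use m0 in \<open>simp add: \<theta>_def field_simps\<close>)
  then show ?thesis by (intro exI[of _ "m' / m"]) (simp add: AE_completion_iff)
qed

end

section \<open>Exponent ranges and the assembly of the cases\<close>

lemma lower_bound_real_exponent:
  assumes "ereal a < q" "0 \<le> a" "k > 0" "m \<le> k * a"
  shows "q = \<infinity> \<or> (\<exists>r. q = ereal r \<and> r > 0 \<and> k * r > m)"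
proof (cases q)
  case (real r)
  then have "a < r" using assms(1) by simp
  then have "k * a < k * r" using assms(3) by (intro mult_strict_left_mono)
  then have "m < k * r" using assms(4) by linarith
  then show ?thesis using real \<open>a < r\<close> assms(2) by auto
qed (use assms in auto)

theorem theorem3p3:
  fixes v :: "real ^ 'n \<Rightarrow> complex" and C :: real and n :: nat
  defines "n \<equiv> CARD('n)"
  assumes n_ge_3: "n \<ge> 3"
    and v_bounded: "v \<in> L_space \<infinity>"
    and v_real: "AE x in lebesgue. v x \<in> \<real>"
    and C_pos: "0 < C"
    and v_decay: "AE x in lebesgue. norm (v x) \<le> C * japanese_bracket x powr (- 4)"
  shows
   "(n = 3 \<or> n = 4 \<longrightarrow>
       exactly_one
         [zero_regular v,
          zero_resonance v \<and> \<not> zero_eigenvalue v,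
          zero_eigenvalue v \<and> \<not> zero_resonance v,
          zero_resonance v \<and> zero_eigenvalue v] \<and>
       (zero_resonance v \<and> \<not> zero_eigenvalue v \<longrightarrow>
          (\<forall>\<psi> \<psi>'. resonance_function v \<psi> \<and> resonance_function v \<psi>' \<longrightarrow>
             (\<exists>c. AE x in lebesgue. \<psi>' x = c * \<psi> x)) \<and>
          (\<forall>\<psi>. resonance_function v \<psi> \<longrightarrow>
             (n = 3 \<longrightarrow> (\<forall>q \<in> {3<..<\<infinity>} \<union> {\<infinity>}. \<psi> \<in> L_space q)) \<and>
             (n = 4 \<longrightarrow> (\<forall>q \<in> {2<..<\<infinity>} \<union> {\<infinity>}. \<psi> \<in> L_space q)) \<and>
             gradient_in_L 2 \<psi> \<and>
             (\<forall>q \<in> {2..<\<infinity>} \<union> {\<infinity>}. laplacian_in_L q \<psi>) \<and>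
             \<psi> \<notin> L_space 2)) \<and>
       (zero_eigenvalue v \<and> \<not> zero_resonance v \<longrightarrow>
          (\<forall>\<psi>. zero_eigenfunction v \<psi> \<longrightarrow>
             (\<forall>q \<in> {2..<\<infinity>} \<union> {\<infinity>}. \<psi> \<in> L_space q \<and> laplacian_in_L q \<psi>) \<and>
             gradient_in_L 2 \<psi>)))
    \<and>
    (n \<ge> 5 \<longrightarrow>
       exactly_one [zero_regular v, zero_eigenvalue v] \<and>
       (zero_eigenvalue v \<longrightarrow>
          (\<forall>\<psi>. zero_eigenfunction v \<psi> \<longrightarrow>
             (\<forall>q \<in> (if n \<le> 7 then {ereal (real n / (real n - 2))<..<\<infinity>} \<union> {\<infinity>}
                    else {ereal (2 * real n / (real n + 4))<..<ereal (2 * real n / (real n - 4))}).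
                \<psi> \<in> L_space q \<and> laplacian_in_L q \<psi>) \<and>
             (\<forall>q \<in> (if n = 5 then {ereal (5 / 3)<..<\<infinity>}
                    else if n = 6 then {ereal (3 / 2)<..<\<infinity>}
                    else if n = 7 then {ereal (7 / 5)<..<14}
                    else {ereal (2 * real n / (real n + 4))<..<ereal (2 * real n / (real n - 6))}).
                gradient_in_L q \<psi>))) \<and>
       \<not> zero_resonance v)
    \<and>
    (zero_regular v \<longleftrightarrow> ker_sandwiched v = L2_zero)"
proof -
  have n: "n = CARD('n)" by (simp add: n_def)
  interpret decaying_potential v C
    using assms by unfold_locales (auto simp: L_space_def)
  have one4: "exactly_one [zero_regular v, zero_resonance v \<and> \<not> zero_eigenvalue v,
      zero_eigenvalue v \<and> \<not> zero_resonance v, zero_resonance v \<and> zero_eigenvalue v]"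
    by (auto simp: exactly_one_def zero_regular_def)
  have two: "q = \<infinity> \<or> (\<exists>r. q = ereal r \<and> r > 0 \<and> real (CARD('n) + 2) * r > real CARD('n))"
    if "q \<in> {2..<\<infinity>} \<union> {\<infinity>}" for q :: ereal
  proof (rule lower_bound_real_exponent)
    \<comment> \<open>The Laplacian v \<psi> decays like <x>^(-n-2), so it suffices that the
      exponent exceeds 1; in particular 2 is covered.\<close>
    have "ereal 1 < 2" by simp
    also have "2 \<le> q" using that by auto
    finally show "ereal 1 < q" .
  qed auto
  have low: "\<forall>\<psi>. resonance_function v \<psi> \<longrightarrow>
       (n = 3 \<longrightarrow> (\<forall>q \<in> {3<..<\<infinity>} \<union> {\<infinity>}. \<psi> \<in> L_space q)) \<and>
       (n = 4 \<longrightarrow> (\<forall>q \<in> {2<..<\<infinity>} \<union> {\<infinity>}. \<psi> \<in> L_space q)) \<and>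
       gradient_in_L 2 \<psi> \<and> (\<forall>q \<in> {2..<\<infinity>} \<union> {\<infinity>}. laplacian_in_L q \<psi>) \<and> \<psi> \<notin> L_space 2"
  proof (intro allI impI)
    fix \<psi> assume r: "resonance_function v \<psi>"
    then obtain \<psi>0 where ts: "threshold_solution \<psi>0" and ae: "AE x in lborel. \<psi> x = \<psi>0 x"
      using resonance_function_threshold_solution by blast
    \<comment> \<open>The lower endpoints, 3 here and 2 for n = 4, are the values of n / (n - 2), at
      which the decay <x>^(2-n) just fails to be integrable.\<close>
    have "\<psi> \<in> L_space q" if "n = 3" "q \<in> {3<..<\<infinity>} \<union> {\<infinity>}" for q
    proof (rule threshold_solution_L_space[OF ts ae], rule lower_bound_real_exponent[of 3])
      show "ereal 3 < q" using that(2) by auto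
    qed (use that n in auto)
    moreover have "\<psi> \<in> L_space q" if "n = 4" "q \<in> {2<..<\<infinity>} \<union> {\<infinity>}" for q
    proof (rule threshold_solution_L_space[OF ts ae], rule lower_bound_real_exponent[of 2])
      show "ereal 2 < q" using that(2) by auto
    qed (use that n in auto)
    moreover have "\<psi> \<notin> L_space 2" using r by (simp add: resonance_function_def)
    ultimately show "(n = 3 \<longrightarrow> (\<forall>q \<in> {3<..<\<infinity>} \<union> {\<infinity>}. \<psi> \<in> L_space q)) \<and>
       (n = 4 \<longrightarrow> (\<forall>q \<in> {2<..<\<infinity>} \<union> {\<infinity>}. \<psi> \<in> L_space q)) \<and>
       gradient_in_L 2 \<psi> \<and> (\<forall>q \<in> {2..<\<infinity>} \<union> {\<infinity>}. laplacian_in_L q \<psi>) \<and> \<psi> \<notin> L_space 2"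
      using threshold_solution_gradient_in_L2[OF ts ae] threshold_solution_laplacian_in_L[OF ts ae two] by blast
  qed
  have eig: "\<forall>\<psi>. zero_eigenfunction v \<psi> \<longrightarrow>
      (\<forall>q \<in> {2..<\<infinity>} \<union> {\<infinity>}. \<psi> \<in> L_space q \<and> laplacian_in_L q \<psi>) \<and> gradient_in_L 2 \<psi>"
  proof (intro allI impI)
    fix \<psi> assume "zero_eigenfunction v \<psi>"
    then obtain \<psi>0 where ts: "threshold_solution \<psi>0" and ae: "AE x in lborel. \<psi> x = \<psi>0 x" and L2: "\<psi> \<in> L_space 2"
      unfolding zero_eigenfunction_iff by blast
    obtain B where B: "B > 0" "\<And>x. norm (\<psi>0 x) \<le> B * wt x ^ (CARD('n) - 2)"
      using threshold_solution_props(2)[OF ts] by blast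
    have B': "norm (\<psi>0 x) \<le> B" for x
      using order_trans[OF B(2) mult_left_mono[OF power_le_one]] B(1) by simp
    have "\<psi> \<in> L_space q" if "q \<in> {2..<\<infinity>} \<union> {\<infinity>}" for q
    proof (cases q)
      case (real r)
      then have "ereal 2 \<le> ereal r" using that by auto
      then show ?thesis
        unfolding real by (intro L_space_interpolation[OF threshold_solution_props(1)[OF ts] ae B' L2]) simp
    next
      case PInf
      then show ?thesis by (intro threshold_solution_L_space[OF ts ae]) simp
    qed (use that in auto)
    then show "(\<forall>q \<in> {2..<\<infinity>} \<union> {\<infinity>}. \<psi> \<in> L_space q \<and> laplacian_in_L q \<psi>) \<and> gradient_in_L 2 \<psi>"
      using threshold_solution_gradient_in_L2[OF ts ae] threshold_solution_laplacian_in_L[OF ts ae two] by blast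
  qed
  have high: "\<forall>\<psi>. zero_eigenfunction v \<psi> \<longrightarrow>
             (\<forall>q \<in> (if n \<le> 7 then {ereal (real n / (real n - 2))<..<\<infinity>} \<union> {\<infinity>}
                    else {ereal (2 * real n / (real n + 4))<..<ereal (2 * real n / (real n - 4))}).
                \<psi> \<in> L_space q \<and> laplacian_in_L q \<psi>) \<and>
             (\<forall>q \<in> (if n = 5 then {ereal (5 / 3)<..<\<infinity>}
                    else if n = 6 then {ereal (3 / 2)<..<\<infinity>}
                    else if n = 7 then {ereal (7 / 5)<..<14}
                    else {ereal (2 * real n / (real n + 4))<..<ereal (2 * real n / (real n - 6))}).
                gradient_in_L q \<psi>)" if n5: "n \<ge> 5"
  proof (intro allI impI)
    fix \<psi> assume "zero_eigenfunction v \<psi>"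
    then obtain \<psi>0 where ts: "threshold_solution \<psi>0" and ae: "AE x in lborel. \<psi> x = \<psi>0 x"
      unfolding zero_eigenfunction_iff by blast
    \<comment> \<open>The critical exponent of the decay <x>^(2-n). All lower endpoints of the
      ranges below are at least this large.\<close>
    let ?a = "real n / (real n - 2)"
    \<comment> \<open>2 n / (n + 4) >= n / (n - 2) means 2 (n - 2) >= n + 4, which is n >= 8: the
      place where the ranges change form.\<close>
    have a8: "?a \<le> 2 * real n / (real n + 4)" if "n \<ge> 8"
    proof -
      have "real n * (real n + 4) \<le> 2 * real n * (real n - 2)"
        using that mult_left_mono[of "real n + 4" "2 * (real n - 2)" "real n"] by (simp add: mult.assoc)
      then show ?thesis using that by (simp add: divide_simps)
    qed
    have a0: "0 \<le> ?a" using n5 by simp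
    have p: "real (CARD('n) - 2) = real n - 2" "real (CARD('n) - 1) = real n - 1" "real (CARD('n) + 2) = real n + 2"
      using n5 by (simp_all add: n of_nat_diff)
    \<comment> \<open>Treats \<psi>, its gradient and its Laplacian together: their decay exponents
      n - 2, n - 1 and n + 2 are all at least n - 2.\<close>
    have cond: "q = \<infinity> \<or> (\<exists>r. q = ereal r \<and> r > 0 \<and> k * r > real CARD('n))"
      if "ereal ?a < q" "k \<ge> real n - 2" for q k
    proof (rule lower_bound_real_exponent[OF that(1) a0])
      show "k > 0" using that(2) n5 by simp
      have "real CARD('n) = (real n - 2) * ?a" using n5 by (simp add: n)
      also have "\<dots> \<le> k * ?a" using that(2) a0 by (intro mult_right_mono)
      finally show "real CARD('n) \<le> k * ?a" .
    qed
    have q1: "ereal ?a < q" if "q \<in> (if n \<le> 7 then {ereal (real n / (real n - 2))<..<\<infinity>} \<union> {\<infinity>}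
                    else {ereal (2 * real n / (real n + 4))<..<ereal (2 * real n / (real n - 4))})" for q
    proof (cases "n \<le> 7")
      case False
      then have "ereal ?a \<le> ereal (2 * real n / (real n + 4))" using a8 by simp
      also have "\<dots> < q" using that False by auto
      finally show ?thesis .
    qed (use that in auto)
    \<comment> \<open>5/3, 3/2 and 7/5 are the values of n / (n - 2) for n = 5, 6, 7.\<close>
    have q2: "ereal ?a < q" if "q \<in> (if n = 5 then {ereal (5 / 3)<..<\<infinity>}
                    else if n = 6 then {ereal (3 / 2)<..<\<infinity>}
                    else if n = 7 then {ereal (7 / 5)<..<14}
                    else {ereal (2 * real n / (real n + 4))<..<ereal (2 * real n / (real n - 6))})" for q
    proof -
      consider "n = 5" | "n = 6" | "n = 7" | "n \<ge> 8" using n5 by linarith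
      then show ?thesis
      proof cases
        case 4
        then have "ereal ?a \<le> ereal (2 * real n / (real n + 4))" using a8 by simp
        also have "\<dots> < q" using that 4 by auto
        finally show ?thesis .
      qed (use that in auto)
    qed
    show "(\<forall>q \<in> (if n \<le> 7 then {ereal (real n / (real n - 2))<..<\<infinity>} \<union> {\<infinity>}
                    else {ereal (2 * real n / (real n + 4))<..<ereal (2 * real n / (real n - 4))}).
                \<psi> \<in> L_space q \<and> laplacian_in_L q \<psi>) \<and>
             (\<forall>q \<in> (if n = 5 then {ereal (5 / 3)<..<\<infinity>}
                    else if n = 6 then {ereal (3 / 2)<..<\<infinity>}
                    else if n = 7 then {ereal (7 / 5)<..<14}
                    else {ereal (2 * real n / (real n + 4))<..<ereal (2 * real n / (real n - 6))}).
                gradient_in_L q \<psi>)"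
    proof (intro conjI ballI)
      fix q assume "q \<in> (if n \<le> 7 then {ereal (real n / (real n - 2))<..<\<infinity>} \<union> {\<infinity>}
                    else {ereal (2 * real n / (real n + 4))<..<ereal (2 * real n / (real n - 4))})"
      note q = q1[OF this]
      show "\<psi> \<in> L_space q" by (rule threshold_solution_L_space[OF ts ae cond[OF q]]) (simp only: p)
      show "laplacian_in_L q \<psi>" by (rule threshold_solution_laplacian_in_L[OF ts ae cond[OF q]]) (simp only: p; simp)
    next
      fix q assume "q \<in> (if n = 5 then {ereal (5 / 3)<..<\<infinity>}
                    else if n = 6 then {ereal (3 / 2)<..<\<infinity>}
                    else if n = 7 then {ereal (7 / 5)<..<14}
                    else {ereal (2 * real n / (real n + 4))<..<ereal (2 * real n / (real n - 6))})"
      note q = q2[OF this]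
      show "gradient_in_L q \<psi>" by (rule threshold_solution_gradient_in_L[OF ts ae cond[OF q]]) (simp only: p; simp)
    qed
  qed
  have no_res: "\<not> zero_resonance v" if "n \<ge> 5" using no_resonance that by (simp add: n)
  have one2: "exactly_one [zero_regular v, zero_eigenvalue v]" if "n \<ge> 5"
    using no_res[OF that] by (auto simp: exactly_one_def zero_regular_def)
  have simple: "\<exists>c. AE x in lebesgue. \<psi>' x = c * \<psi> x"
    if "\<not> zero_eigenvalue v" "resonance_function v \<psi>" "resonance_function v \<psi>'" for \<psi> \<psi>'
    by (rule resonance_simple[OF that])
  show ?thesis
    by (intro conjI impI one4 one2 no_res zero_regular_iff low eig high)
       (use simple in blast)+
qed

end
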